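(* Suppose one of the following holds. (i) The matrix $B_s$ has constant entries. (ii) There exist $\theta_1,\theta_2\in[0,\frac{\pi}{2})$, $\phi\in W^{2,\infty}(\mathbb{R}^d)$ (complex-valued) and a $d\times d$ matrix $\widetilde{C}$ with entries in $W^{2,\infty}(\mathbb{R}^d)$ such that $\theta=\theta_1+\theta_2$, $\phi(x)\in\Sigma_{\theta_1}$ for all $x\in\mathbb{R}^d$, $\widetilde{C}$ takes values in $\Sigma_{\theta_2}$ and $C=\phi\,\widetilde{C}$. Moreover, writing $\widetilde{C}=\widetilde{R}+i\widetilde{B}$ with $\widetilde{R},\widetilde{B}$ $d\times d$ matrix-valued functions with real-valued entries, $\widetilde{R}_s=\frac12(\widetilde{R}+\widetilde{R}^T)$ and $\operatorname{Re}\widetilde{C}=\frac12(\widetilde{C}+\widetilde{C}^* )$, there exists an $h>0$ such that $$\operatorname{tr}\big(U\,(\operatorname{Re}\widetilde{C})\,\overline{U}\big)\ge h\,\operatorname{tr}\big(U\,\widetilde{R}_s\,\overline{U}\big)$$ for all $u\in C_c^\infty(\mathbb{R}^d)$, where $U=(\partial_l\partial_k u)_{1\le k,l\le d}$. (iii) There exists an $M>0$ such that $\|(\partial_l B_a)\,U\|_{HS}^2\le M\,\operatorname{tr}(U\,R_s\,\overline{U})$ for all $l\in\{1,\dots,d\}$ and $u\in C_c^\infty(\mathbb{R}^d)$, where $U=(\partial_l\partial_k u)_{1\le k,l\le d}$. Then $A=B_2=Z$. Moreover, $C_c^\infty(\mathbb{R}^d)$ is a core for $A$.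
   Context: Let $d \in \mathbb{N}$, $\theta \in [0,\frac{\pi}{2})$ and $c_{kl} \in W^{2,\infty}(\mathbb{R}^d,\mathbb{C})$ for all $k,l\in\{1,\dots,d\}$. Set $C=(c_{kl})_{1\le k,l\le d}$ and, for $\psi_0\in[0,\frac\pi2)$, $\Sigma_{\psi_0}=\{re^{i\psi}: r\ge 0,\ |\psi|\le\psi_0\}$. A matrix-valued function $Q$ "takes values in $\Sigma_{\psi_0}$" if $(Q(x)\xi,\xi)\in\Sigma_{\psi_0}$ for all $x\in\mathbb{R}^d$, $\xi\in\mathbb{C}^d$, where $(\cdot,\cdot)$ is the standard inner product on $\mathbb{C}^d$, linear in the first variable. Assume $C$ takes values in $\Sigma_\theta$. Write $C=R+iB$ with $R,B$ $d\times d$ matrix-valued functions with real-valued entries, and set $R_s=\frac12(R+R^T)$, $B_s=\frac12(B+B^T)$, $B_a=\frac12(B-B^T)$. For a matrix $V$, $V^*$ is the conjugate transpose, $\overline V$ the entrywise conjugate and $\|V\|_{HS}=(\operatorname{tr}(V^*V))^{1/2}$. Derivatives of matrix functions are entrywise, and inequalities between functions are pointwise on $\mathbb{R}^d$. Function spaces are complex. The form $\mathfrak{a}_0(u,v)=\sum_{k,l=1}^d\int_{\mathbb{R}^d}c_{kl}\,(\partial_k u)\,\partial_l\overline{v}$ with domain $C_c^\infty(\mathbb{R}^d)$ is closable in $L_2(\mathbb{R}^d)$; $A$ is the ($m$-sectorial) operator in $L_2(\mathbb{R}^d)$ associated with its closure. Let $H_2u=-\sum_{k,l=1}^d\partial_k(\overline{c_{kl}}\,\partial_l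 u)$ with domain $D(H_2)=C_c^\infty(\mathbb{R}^d)$ in $L_2(\mathbb{R}^d)$, let $B_2=(H_2)^*$ be its adjoint in $L_2(\mathbb{R}^d)$, and let $Z=\overline{B_2|_{C_c^\infty(\mathbb{R}^d)}}$ be the closure of the restriction of $B_2$ to $C_c^\infty(\mathbb{R}^d)$. A core for a closed operator is a subspace of its domain that is dense in the domain for the graph norm. *)

theory Defs
  imports "HOL-Analysis.Analysis"
begin

section \<open>Partial derivatives, test functions, Sobolev functions\<close>

definition pd :: "'n::finite \<Rightarrow> (real^'n \<Rightarrow> 'b::real_normed_vector) \<Rightarrow> real^'n \<Rightarrow> 'b" where
  "pd k f x = frechet_derivative f (at x) (axis k 1)"

definition smooth :: "(real^'n::finite \<Rightarrow> complex) \<Rightarrow> bool" where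
  "smooth f \<longleftrightarrow> (\<forall>ks x. foldr pd ks f differentiable (at x))"

definition Cc_inf :: "(real^'n::finite \<Rightarrow> complex) set" where
  "Cc_inf = {f. smooth f \<and> compact (closure (support_on UNIV f))}"

definition Linf :: "(real^'n::finite \<Rightarrow> complex) set" where
  "Linf = {f \<in> borel_measurable lborel. \<exists>K. AE x in lborel. cmod (f x) \<le> K}"

definition weak_pd :: "'n::finite \<Rightarrow> (real^'n \<Rightarrow> complex) \<Rightarrow> (real^'n \<Rightarrow> complex) \<Rightarrow> bool" where
  "weak_pd k f g \<longleftrightarrow>
     (\<forall>\<phi>\<in>Cc_inf. (LINT x|lborel. f x * pd k \<phi> x) = - (LINT x|lborel. g x * \<phi> x))"

primrec Winf :: "nat \<Rightarrow> (real^'n::finite \<Rightarrow> complex) set" where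
  "Winf 0 = Linf"
| "Winf (Suc m) = {f \<in> Linf. \<forall>k. \<exists>g\<in>Winf m. weak_pd k f g}"

text \<open>Every element of the Sobolev space of order \<open>(2,\<infinity>)\<close> has a unique continuous
  representative, which is in fact continuously differentiable.  Since pointwise conditions are
  imposed on such functions, they are identified with that representative; their first-order
  derivatives \<^const>\<open>pd\<close> are then classical.\<close>

definition W2inf :: "(real^'n::finite \<Rightarrow> complex) set" where
  "W2inf = {f \<in> Winf 2. continuous_on UNIV f}"

section \<open>Matrices and sectors\<close>

definition sector :: "real \<Rightarrow> complex set" where
  "sector \<psi>0 = {of_real r * exp (\<i> * of_real \<psi>) |r \<psi>. r \<ge> 0 \<and> \<bar>\<psi>\<bar> \<le> \<psi>0}"

definition cinner_vec :: "complex^'n::finite \<Rightarrow> complex^'n \<Rightarrow> complex" where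
  "cinner_vec \<xi> \<eta> = (\<Sum>k\<in>UNIV. \<xi> $ k * cnj (\<eta> $ k))"

definition takes_values_in_sector ::
    "(real^'n::finite \<Rightarrow> complex^'n^'n) \<Rightarrow> real \<Rightarrow> bool" where
  "takes_values_in_sector Q \<psi>0 \<longleftrightarrow> (\<forall>x \<xi>. cinner_vec (Q x *v \<xi>) \<xi> \<in> sector \<psi>0)"

definition sym_part :: "real^'n::finite^'n \<Rightarrow> real^'n^'n" where
  "sym_part V = (1/2) *\<^sub>R (V + transpose V)"

definition skew_part :: "real^'n::finite^'n \<Rightarrow> real^'n^'n" where
  "skew_part V = (1/2) *\<^sub>R (V - transpose V)"

definition conj_transpose :: "complex^'n::finite^'n \<Rightarrow> complex^'n^'n" where
  "conj_transpose V = map_matrix cnj (transpose V)"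

definition hermitian_part :: "complex^'n::finite^'n \<Rightarrow> complex^'n^'n" where
  "hermitian_part V = (1/2) *\<^sub>R (V + conj_transpose V)"

text \<open>The trace below is a non-negative real number, so taking \<^const>\<open>Re\<close> is only a coercion.\<close>

definition hs_norm :: "complex^'n::finite^'n \<Rightarrow> real" where
  "hs_norm V = sqrt (Re (trace (conj_transpose V ** V)))"

definition pd_matrix ::
    "'n::finite \<Rightarrow> (real^'n \<Rightarrow> real^'n^'n) \<Rightarrow> real^'n \<Rightarrow> real^'n^'n" where
  "pd_matrix l V x = (\<chi> i j. pd l (\<lambda>y. V y $ i $ j) x)"

definition hessian :: "(real^'n::finite \<Rightarrow> complex) \<Rightarrow> real^'n \<Rightarrow> complex^'n^'n" where
  "hessian u x = (\<chi> k l. pd l (pd k u) x)"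

section \<open>Operators and forms in the complex Hilbert space of square-integrable functions\<close>

text \<open>Elements of the Hilbert space are handled through representatives, and an operator is
  given by its graph.  The graphs produced by \<open>l2_adjoint\<close>, by \<open>l2_closure\<close> and, for the
  closure of a form, by \<open>form_operator\<close> contain, with each pair, all pairs of functions in \<open>L2\<close> that agree with it almost everywhere,
  so that equality of such graphs is equality of operators.\<close>

definition L2 :: "(real^'n::finite \<Rightarrow> complex) set" where
  "L2 = {f \<in> borel_measurable lborel. integrable lborel (\<lambda>x. (cmod (f x))\<^sup>2)}"

definition l2_inner :: "(real^'n::finite \<Rightarrow> complex) \<Rightarrow> (real^'n \<Rightarrow> complex) \<Rightarrow> complex" where
  "l2_inner f g = (LINT x|lborel. f x * cnj (g x))"

definition l2_norm :: "(real^'n::finite \<Rightarrow> complex) \<Rightarrow> real" where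
  "l2_norm f = sqrt (LINT x|lborel. (cmod (f x))\<^sup>2)"

definition l2_tendsto ::
    "(nat \<Rightarrow> real^'n::finite \<Rightarrow> complex) \<Rightarrow> (real^'n \<Rightarrow> complex) \<Rightarrow> bool" where
  "l2_tendsto U u \<longleftrightarrow> (\<forall>n. U n \<in> L2) \<and> u \<in> L2 \<and> (\<lambda>n. l2_norm (\<lambda>x. U n x - u x)) \<longlonglongrightarrow> 0"

type_synonym 'n l2_graph = "((real^'n \<Rightarrow> complex) \<times> (real^'n \<Rightarrow> complex)) set"

definition l2_adjoint :: "'n::finite l2_graph \<Rightarrow> 'n l2_graph" where
  "l2_adjoint T = {(v, w). v \<in> L2 \<and> w \<in> L2 \<and> (\<forall>(u, f)\<in>T. l2_inner f v = l2_inner u w)}"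

definition l2_closure :: "'n::finite l2_graph \<Rightarrow> 'n l2_graph" where
  "l2_closure T = {(u, f). \<exists>U F. (\<forall>n. (U n, F n) \<in> T) \<and> l2_tendsto U u \<and> l2_tendsto F f}"

definition l2_restrict :: "'n::finite l2_graph \<Rightarrow> (real^'n \<Rightarrow> complex) set \<Rightarrow> 'n l2_graph" where
  "l2_restrict T D = {(u, f) \<in> T. u \<in> D}"

definition is_core :: "(real^'n::finite \<Rightarrow> complex) set \<Rightarrow> 'n l2_graph \<Rightarrow> bool" where
  "is_core D T \<longleftrightarrow>
     D \<subseteq> Domain T \<and> D \<noteq> {} \<and> (\<forall>u\<in>D. \<forall>v\<in>D. \<forall>c. (\<lambda>x. c * u x + v x) \<in> D) \<and>
     (\<forall>(u, f)\<in>T. \<forall>\<epsilon>>0. \<exists>(v, g)\<in>T. v \<in> D \<and>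
        l2_norm (\<lambda>x. u x - v x) + l2_norm (\<lambda>x. f x - g x) < \<epsilon>)"

text \<open>Closure, in the sense of Kato, of a closable sectorial form \<open>a\<close> with domain \<open>D\<close>, and the
  operator associated with a closed sectorial form.\<close>

definition form_tendsto ::
    "(real^'n::finite \<Rightarrow> complex) set \<Rightarrow> ((real^'n \<Rightarrow> complex) \<Rightarrow> (real^'n \<Rightarrow> complex) \<Rightarrow> complex)
     \<Rightarrow> (nat \<Rightarrow> real^'n \<Rightarrow> complex) \<Rightarrow> (real^'n \<Rightarrow> complex) \<Rightarrow> bool" where
  "form_tendsto D a U u \<longleftrightarrow> (\<forall>n. U n \<in> D) \<and> l2_tendsto U u \<and>
     (\<forall>\<epsilon>>0. \<exists>N. \<forall>m\<ge>N. \<forall>n\<ge>N. cmod (a (\<lambda>x. U m x - U n x) (\<lambda>x. U m x - U n x)) < \<epsilon>)"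

definition form_closure_dom ::
    "(real^'n::finite \<Rightarrow> complex) set \<Rightarrow> ((real^'n \<Rightarrow> complex) \<Rightarrow> (real^'n \<Rightarrow> complex) \<Rightarrow> complex)
     \<Rightarrow> (real^'n \<Rightarrow> complex) set" where
  "form_closure_dom D a = {u. \<exists>U. form_tendsto D a U u}"

definition form_closure ::
    "(real^'n::finite \<Rightarrow> complex) set \<Rightarrow> ((real^'n \<Rightarrow> complex) \<Rightarrow> (real^'n \<Rightarrow> complex) \<Rightarrow> complex)
     \<Rightarrow> (real^'n \<Rightarrow> complex) \<Rightarrow> (real^'n \<Rightarrow> complex) \<Rightarrow> complex" where
  "form_closure D a u v =
     (THE z. \<forall>U V. form_tendsto D a U u \<longrightarrow> form_tendsto D a V v \<longrightarrow> (\<lambda>n. a (U n) (V n)) \<longlonglongrightarrow> z)"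

definition form_operator ::
    "(real^'n::finite \<Rightarrow> complex) set \<Rightarrow> ((real^'n \<Rightarrow> complex) \<Rightarrow> (real^'n \<Rightarrow> complex) \<Rightarrow> complex)
     \<Rightarrow> 'n l2_graph" where
  "form_operator D a = {(u, f). u \<in> D \<and> f \<in> L2 \<and> (\<forall>v\<in>D. a u v = l2_inner f v)}"

section \<open>The elliptic operators\<close>

definition form_a0 :: "(real^'n::finite \<Rightarrow> complex^'n^'n)
     \<Rightarrow> (real^'n \<Rightarrow> complex) \<Rightarrow> (real^'n \<Rightarrow> complex) \<Rightarrow> complex" where
  "form_a0 C u v =
     (\<Sum>k\<in>UNIV. \<Sum>l\<in>UNIV. LINT x|lborel. C x $ k $ l * pd k u x * pd l (\<lambda>y. cnj (v y)) x)"

definition op_A :: "(real^'n::finite \<Rightarrow> complex^'n^'n) \<Rightarrow> 'n l2_graph" where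
  "op_A C = form_operator (form_closure_dom Cc_inf (form_a0 C)) (form_closure Cc_inf (form_a0 C))"

definition op_H2 :: "(real^'n::finite \<Rightarrow> complex^'n^'n) \<Rightarrow> 'n l2_graph" where
  "op_H2 C = {(u, \<lambda>x. - (\<Sum>k\<in>UNIV. \<Sum>l\<in>UNIV. pd k (\<lambda>y. cnj (C y $ k $ l) * pd l u y) x)) |u.
     u \<in> Cc_inf}"

definition op_B2 :: "(real^'n::finite \<Rightarrow> complex^'n^'n) \<Rightarrow> 'n l2_graph" where
  "op_B2 C = l2_adjoint (op_H2 C)"

definition op_Z :: "(real^'n::finite \<Rightarrow> complex^'n^'n) \<Rightarrow> 'n l2_graph" where
  "op_Z C = l2_closure (l2_restrict (op_B2 C) Cc_inf)"

section \<open>The three alternative hypotheses\<close>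

text \<open>Complex traces are compared through their real parts: each of them is real, because it has
  the form \<open>tr (U S U\<^sup>*)\<close> with \<open>S\<close> Hermitian (a Hessian \<open>U\<close> being symmetric).\<close>

definition hyp_i :: "(real^'n::finite \<Rightarrow> complex^'n^'n) \<Rightarrow> bool" where
  "hyp_i C \<longleftrightarrow> (\<exists>K. \<forall>x. sym_part (map_matrix Im (C x)) = K)"

definition hyp_ii :: "(real^'n::finite \<Rightarrow> complex^'n^'n) \<Rightarrow> real \<Rightarrow> bool" where
  "hyp_ii C \<theta> \<longleftrightarrow>
     (\<exists>\<theta>1 \<theta>2 \<phi> Ct.
        0 \<le> \<theta>1 \<and> \<theta>1 < pi/2 \<and> 0 \<le> \<theta>2 \<and> \<theta>2 < pi/2 \<and> \<theta> = \<theta>1 + \<theta>2 \<and>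
        \<phi> \<in> W2inf \<and> (\<forall>k l. (\<lambda>x. Ct x $ k $ l) \<in> W2inf) \<and>
        (\<forall>x. \<phi> x \<in> sector \<theta>1) \<and> takes_values_in_sector Ct \<theta>2 \<and>
        (\<forall>x k l. C x $ k $ l = \<phi> x * Ct x $ k $ l) \<and>
        (\<exists>h>0. \<forall>u\<in>Cc_inf. \<forall>x. let U = hessian u x in
           Re (trace (U ** hermitian_part (Ct x) ** map_matrix cnj U)) \<ge>
           h * Re (trace (U ** map_matrix of_real (sym_part (map_matrix Re (Ct x))) ** map_matrix cnj U))))"

definition hyp_iii :: "(real^'n::finite \<Rightarrow> complex^'n^'n) \<Rightarrow> bool" where
  "hyp_iii C \<longleftrightarrow>
     (\<exists>M>0. \<forall>l. \<forall>u\<in>Cc_inf. \<forall>x. let U = hessian u x in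
        (hs_norm (map_matrix of_real (pd_matrix l (\<lambda>y. skew_part (map_matrix Im (C y))) x) ** U))\<^sup>2 \<le>
        M * Re (trace (U ** map_matrix of_real (sym_part (map_matrix Re (C x))) ** map_matrix cnj U)))"

end

theory Submission
  imports Defs
begin

text \<open>Write \<open>L u = - \<Sum> \<partial>\<^sub>l(c\<^sub>k\<^sub>l \<partial>\<^sub>k u)\<close> on test functions.  The heart of the matter is that \<open>L\<close> is
  quasi-accretive for the inner product of the first-order Sobolev space:
  \<open>Re (L u, - \<Delta> u) \<ge> - \<kappa> \<parallel>\<nabla> u\<parallel>\<^sup>2\<close>.  After integrating by parts this is the sum of
  \<open>Re tr (U C U\<^sup>*)\<close>, \<open>U\<close> being the Hessian, and of terms containing first derivatives of \<open>C\<close>.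
  All of the latter are of lower order, except for those with the derivatives of \<open>B\<^sub>s\<close>, which
  Oleinik's inequality \<open>\<bar>tr (\<partial>\<^sub>j B\<^sub>s U)\<bar>\<^sup>2 \<le> K tr (U R\<^sub>s U\<^sup>*)\<close> bounds in terms of the symmetric part; under
  each of the three hypotheses either these terms vanish or the main term absorbs them.

  Since \<open>(1 - \<Delta>) C\<^sub>c\<^sup>\<infinity>\<close> is dense, testing with \<open>w - \<Delta> w\<close> shows that \<open>\<mu> + L\<close> has dense range on test
  functions for large \<open>\<mu>\<close>.  The hypotheses are invariant under \<open>C \<mapsto> C\<^sup>*\<close>, so the same holds for
  \<open>H\<^sub>2\<close>, and by duality \<open>\<mu> \<parallel>z\<parallel> \<le> \<parallel>(\<mu> + B\<^sub>2) z\<parallel>\<close> on the domain of \<open>B\<^sub>2\<close>.  Approximating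
  \<open>(\<mu> + B\<^sub>2) v\<close> by \<open>(\<mu> + L) u\<^sub>n\<close> therefore gives \<open>B\<^sub>2 \<subseteq> Z\<close>, whereas \<open>Z \<subseteq> A \<subseteq> B\<^sub>2\<close> is elementary.\<close>


section \<open>Partial derivatives and smooth functions\<close>

text \<open>A real symmetric coefficient contributes to the real part just half of a total
  derivative. In the remaining part of \<open>C\<close> the antisymmetric terms cancel against the
  symmetric Hessian after one further integration by parts, so that precisely
  \<open>\<partial>_j B_s\<close> survives, paired with the Hessian and the gradient. Sectoriality
  tames it: \<open>t R_s + B_s\<close> and \<open>t R_s - B_s\<close> are nonnegative everywhere,
  and a nonnegative function with a quadratic Taylor bound has its squared derivative controlled by
  its value; here two bounded derivatives of the coefficients are essential. The trace version
  follows by diagonalising the real and imaginary parts of the Hessian. Under (iii) the main term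
  contains \<open>B_a\<close> besides \<open>R_s\<close>; being antisymmetric, \<open>B_a\<close>
  acts as an operator of first order and can be absorbed as well. The density of the range of
  \<open>1 - \<Delta>\<close> on test functions comes from a finite-difference scheme whose iterates
  keep compact support.\<close>

lemma pd_eqI: "(f has_derivative f') (at x) \<Longrightarrow> pd k f x = f' (axis k 1)"
  unfolding pd_def by (metis frechet_derivative_at)

lemma frechet_eq_sum_pd:
  assumes "f differentiable (at x)"
  shows "frechet_derivative f (at x) h = (\<Sum>k\<in>UNIV. (h $ k) *\<^sub>R pd k f x)"
proof -
  interpret linear "frechet_derivative f (at x)"
    using assms by (rule linear_frechet_derivative)
  have "h = (\<Sum>k\<in>UNIV. (h $ k) *\<^sub>R axis k 1)"
    using basis_expansion[of h] by (simp add: scalar_mult_eq_scaleR)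
  then have "frechet_derivative f (at x) h
      = frechet_derivative f (at x) (\<Sum>k\<in>UNIV. (h $ k) *\<^sub>R axis k 1)"
    by simp
  then show ?thesis by (simp add: sum scale pd_def)
qed

lemma has_derivative_pd:
  assumes "f differentiable (at x)"
  shows "(f has_derivative (\<lambda>h. \<Sum>k\<in>UNIV. (h $ k) *\<^sub>R pd k f x)) (at x)"
  using assms frechet_eq_sum_pd[OF assms] by (metis (no_types, lifting) ext frechet_derivative_works)

lemma pd_const [simp]: "pd k (\<lambda>x. c) = (\<lambda>x. 0)"
  by (rule ext, rule pd_eqI[where f'="\<lambda>_. 0", simplified]) simp

lemma pd_add:
  assumes "f differentiable (at x)" "g differentiable (at x)"
  shows "pd k (\<lambda>x. f x + g x) x = pd k f x + pd k g x"
  using has_derivative_add[OF assms[unfolded frechet_derivative_works]]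
  by (auto simp: pd_def[symmetric] dest: pd_eqI)

lemma pd_sum:
  assumes "\<And>i. i \<in> I \<Longrightarrow> f i differentiable (at x)"
  shows "pd k (\<lambda>x. \<Sum>i\<in>I. f i x) x = (\<Sum>i\<in>I. pd k (f i) x)"
  by (rule pd_eqI[THEN trans, OF has_derivative_sum])
     (use assms in \<open>auto simp: frechet_derivative_works pd_def\<close>)

lemma pd_bounded_linear:
  assumes "bounded_linear L" "f differentiable (at x)"
  shows "pd k (\<lambda>x. L (f x)) x = L (pd k f x)"
  using bounded_linear.has_derivative[OF assms(1) assms(2)[unfolded frechet_derivative_works]]
  by (auto simp: pd_def[symmetric] dest: pd_eqI)

lemma differentiable_bounded_linear:
  assumes "bounded_linear L" "f differentiable F"
  shows "(\<lambda>x. L (f x)) differentiable F"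
  using assms bounded_linear.has_derivative unfolding differentiable_def by blast

lemma pd_mult:
  fixes f g :: "real^'n::finite \<Rightarrow> 'a::real_normed_algebra"
  assumes "f differentiable (at x)" "g differentiable (at x)"
  shows "pd k (\<lambda>x. f x * g x) x = f x * pd k g x + pd k f x * g x"
  using has_derivative_mult[OF assms[unfolded frechet_derivative_works]]
  by (auto simp: pd_def[symmetric] dest: pd_eqI)

lemma pd_shift:
  fixes f :: "real^'n::finite \<Rightarrow> 'a::real_normed_vector"
  assumes "f differentiable (at (x + a))"
  shows "pd k (\<lambda>x. f (x + a)) x = pd k f (x + a)" "(\<lambda>x. f (x + a)) differentiable (at x)"
proof -
  have "((\<lambda>x. x + a) has_derivative (\<lambda>h. h)) (at x)"
    by (auto intro!: derivative_eq_intros)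
  from diff_chain_at[OF this, of f "frechet_derivative f (at (x+a))"] assms
  have *: "((\<lambda>x. f (x + a)) has_derivative (\<lambda>h. frechet_derivative f (at (x+a)) h)) (at x)"
    by (auto simp: o_def frechet_derivative_works)
  from pd_eqI[OF *] show "pd k (\<lambda>x. f (x + a)) x = pd k f (x + a)" by (simp add: pd_def)
  from * show "(\<lambda>x. f (x + a)) differentiable (at x)" by (auto simp: differentiable_def)
qed

lemma line_derivative:
  fixes f :: "real^'n::finite \<Rightarrow> 'a::real_normed_vector"
  assumes "f differentiable (at (x + s *\<^sub>R v))"
  shows "((\<lambda>s. f (x + s *\<^sub>R v)) has_vector_derivative
           (\<Sum>k\<in>UNIV. (v $ k) *\<^sub>R pd k f (x + s *\<^sub>R v))) (at s within S)"
proof -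
  have "((\<lambda>s. x + s *\<^sub>R v) has_derivative (\<lambda>h. h *\<^sub>R v)) (at s within S)"
    by (auto intro!: derivative_eq_intros)
  from diff_chain_within[OF this, of f "\<lambda>h. \<Sum>k\<in>UNIV. (h $ k) *\<^sub>R pd k f (x + s *\<^sub>R v)"]
  show ?thesis
    using has_derivative_pd[OF assms]
    by (simp add: o_def has_vector_derivative_def has_derivative_at_withinI scaleR_sum_right)
qed

lemma axis_line_derivative:
  fixes f :: "real^'n::finite \<Rightarrow> 'a::real_normed_vector"
  assumes "f differentiable (at (x + s *\<^sub>R axis k 1))"
  shows "((\<lambda>s. f (x + s *\<^sub>R axis k 1)) has_vector_derivative pd k f (x + s *\<^sub>R axis k 1)) (at s within S)"
proof -
  have "(\<Sum>j\<in>UNIV. ((axis k 1 :: real^'n) $ j) *\<^sub>R pd j f (x + s *\<^sub>R axis k 1))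
      = pd k f (x + s *\<^sub>R axis k 1)"
    by (subst sum.remove[where x=k]) (auto simp: axis_def intro!: sum.neutral)
  then show ?thesis using line_derivative[OF assms, of S] by simp
qed

lemma pd_commute_real:
  fixes f :: "real^'n::finite \<Rightarrow> real"
  assumes d: "\<And>x. f differentiable (at x)" "\<And>x. pd k f differentiable (at x)"
      "\<And>x. pd l f differentiable (at x)"
    and c: "isCont (pd k (pd l f)) x" "isCont (pd l (pd k f)) x"
  shows "pd k (pd l f) x = pd l (pd k f) x"
proof -
  \<comment> \<open>Both orders of the mean value theorem represent the same mixed second difference.\<close>
  have mvt2: "\<exists>s t. 0 < s \<and> s < h \<and> 0 < t \<and> t < h \<and>
      f (x + h *\<^sub>R axis i 1 + h *\<^sub>R axis j 1) - f (x + h *\<^sub>R axis i 1) - f (x + h *\<^sub>R axis j 1) + f x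
      = h * h * pd j (pd i f) (x + s *\<^sub>R axis i 1 + t *\<^sub>R axis j 1)"
    if "h > 0" and di: "\<And>x. pd i f differentiable (at x)" for h and i j :: 'n
  proof -
    let ?F = "\<lambda>s. f (x + h *\<^sub>R axis j 1 + s *\<^sub>R axis i 1) - f (x + s *\<^sub>R axis i 1)"
    have "(?F has_real_derivative
        pd i f (x + h *\<^sub>R axis j 1 + s *\<^sub>R axis i 1) - pd i f (x + s *\<^sub>R axis i 1)) (at s)" for s
      unfolding has_real_derivative_iff_has_vector_derivative
      by (intro has_vector_derivative_diff axis_line_derivative d)
    from MVT2[OF \<open>h > 0\<close> this] obtain s where s: "0 < s" "s < h"
      "?F h - ?F 0 = h * (pd i f (x + h *\<^sub>R axis j 1 + s *\<^sub>R axis i 1) - pd i f (x + s *\<^sub>R axis i 1))"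
      by auto
    let ?G = "\<lambda>t. pd i f (x + s *\<^sub>R axis i 1 + t *\<^sub>R axis j 1)"
    have "(?G has_real_derivative pd j (pd i f) (x + s *\<^sub>R axis i 1 + t *\<^sub>R axis j 1)) (at t)" for t
      unfolding has_real_derivative_iff_has_vector_derivative
      by (intro axis_line_derivative di)
    from MVT2[OF \<open>h > 0\<close> this] obtain t where t: "0 < t" "t < h"
      "?G h - ?G 0 = h * pd j (pd i f) (x + s *\<^sub>R axis i 1 + t *\<^sub>R axis j 1)" by auto
    have "?F h - ?F 0 = h * (?G h - ?G 0)" using s(3) by (simp add: ac_simps)
    also have "\<dots> = h * h * pd j (pd i f) (x + s *\<^sub>R axis i 1 + t *\<^sub>R axis j 1)"
      by (simp only: t(3) mult.assoc)
    finally show ?thesis using s t by (auto simp: ac_simps algebra_simps)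
  qed
  show ?thesis
  proof (rule ccontr)
    let ?A = "pd k (pd l f)" and ?B = "pd l (pd k f)"
    assume "?A x \<noteq> ?B x"
    \<comment> \<open>The value of \<open>?B\<close> at one intermediate point equals that of
      \<open>?A\<close> at another, while each stays within \<open>e\<close> of its value at
      \<open>x\<close>; so the gap would be smaller than \<open>2 * e\<close>, which is the gap
      itself.\<close>
    define e where "e = \<bar>?A x - ?B x\<bar> / 2"
    have "e > 0" using \<open>?A x \<noteq> ?B x\<close> by (simp add: e_def)
    obtain d1 where d1: "d1 > 0" "\<And>y. dist y x < d1 \<Longrightarrow> dist (?A y) (?A x) < e"
      using c(1) \<open>e > 0\<close> unfolding continuous_at_eps_delta by blast
    obtain d2 where d2: "d2 > 0" "\<And>y. dist y x < d2 \<Longrightarrow> dist (?B y) (?B x) < e"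
      using c(2) \<open>e > 0\<close> unfolding continuous_at_eps_delta by blast
    define h where "h = min d1 d2 / 3"
    have h: "h > 0" "3 * h \<le> d1" "3 * h \<le> d2" using d1 d2 by (auto simp: h_def)
    have near: "dist (x + s *\<^sub>R axis i 1 + t *\<^sub>R axis j 1) x < 3 * h"
      if "0 < s" "s < h" "0 < t" "t < h" for s t and i j :: 'n
    proof -
      have "norm (s *\<^sub>R axis i (1::real) + t *\<^sub>R axis j 1) \<le> s + t"
        using norm_triangle_ineq[of "s *\<^sub>R axis i (1::real)" "t *\<^sub>R axis j 1"] that by simp
      then show ?thesis using that by (simp add: dist_norm add.assoc)
    qed
    obtain s t where st: "0 < s" "s < h" "0 < t" "t < h"
      "f (x + h *\<^sub>R axis k 1 + h *\<^sub>R axis l 1) - f (x + h *\<^sub>R axis k 1) - f (x + h *\<^sub>R axis l 1) + f x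
        = h * h * ?B (x + s *\<^sub>R axis k 1 + t *\<^sub>R axis l 1)"
      using mvt2[OF h(1) d(2), of l] by blast
    obtain s' t' where st': "0 < s'" "s' < h" "0 < t'" "t' < h"
      "f (x + h *\<^sub>R axis l 1 + h *\<^sub>R axis k 1) - f (x + h *\<^sub>R axis l 1) - f (x + h *\<^sub>R axis k 1) + f x
        = h * h * ?A (x + s' *\<^sub>R axis l 1 + t' *\<^sub>R axis k 1)"
      using mvt2[OF h(1) d(3), of k] by blast
    have "h * h * ?B (x + s *\<^sub>R axis k 1 + t *\<^sub>R axis l 1) = h * h * ?A (x + s' *\<^sub>R axis l 1 + t' *\<^sub>R axis k 1)"
      using st(5) st'(5) by (simp only: add.commute add.left_commute diff_right_commute add.assoc)
    then have "?B (x + s *\<^sub>R axis k 1 + t *\<^sub>R axis l 1) = ?A (x + s' *\<^sub>R axis l 1 + t' *\<^sub>R axis k 1)"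
      using h by simp
    moreover have "\<bar>?B (x + s *\<^sub>R axis k 1 + t *\<^sub>R axis l 1) - ?B x\<bar> < e"
      using d2(2)[of "x + s *\<^sub>R axis k 1 + t *\<^sub>R axis l 1"] near[OF st(1-4), of k l] h
      by (simp add: dist_real_def)
    moreover have "\<bar>?A (x + s' *\<^sub>R axis l 1 + t' *\<^sub>R axis k 1) - ?A x\<bar> < e"
      using d1(2)[of "x + s' *\<^sub>R axis l 1 + t' *\<^sub>R axis k 1"] near[OF st'(1-4), of l k] h
      by (simp add: dist_real_def)
    ultimately have "\<bar>?A x - ?B x\<bar> < e + e" by linarith
    then show False unfolding e_def by simp
  qed
qed

text \<open>The set \<open>S\<close> is an invariant: being closed under \<open>pd\<close>, it
  contains every iterated derivative of \<open>f\<close>. Exhibiting such a family replaces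
  inductions on lists of derivatives.\<close>

lemma smooth_coinduct:
  assumes "f \<in> S" and "\<And>g x. g \<in> S \<Longrightarrow> g differentiable (at x)"
    and "\<And>g k. g \<in> S \<Longrightarrow> pd k g \<in> S"
  shows "smooth f"
proof -
  have "foldr pd ks f \<in> S" for ks by (induction ks) (auto simp: assms)
  then show ?thesis using assms(2) by (auto simp: smooth_def)
qed

lemma smooth_differentiable: "smooth f \<Longrightarrow> f differentiable (at x)"
  unfolding smooth_def by (metis foldr_Nil id_apply)

lemma smooth_pd: "smooth f \<Longrightarrow> smooth (pd k f)"
  unfolding smooth_def
proof (intro allI)
  fix ks x assume "\<forall>ks x. foldr pd ks f differentiable (at x)"
  \<comment> \<open>\<open>foldr\<close> applies the last entry of the list innermost, so appending
    \<open>k\<close> puts \<open>pd k\<close> next to \<open>f\<close>.\<close>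
  then have "foldr pd (ks @ [k]) f differentiable (at x)" by blast
  then show "foldr pd ks (pd k f) differentiable (at x)" by simp
qed

lemma smooth_isCont: "smooth f \<Longrightarrow> isCont f x"
  by (simp add: differentiable_imp_continuous_within smooth_differentiable)

lemma smooth_continuous_on: "smooth f \<Longrightarrow> continuous_on S f"
  by (simp add: continuous_at_imp_continuous_on smooth_isCont)

text \<open>The algebra over the constants generated by \<open>G\<close>. For sums and products the
  generators are all smooth functions; for the bump functions the generators are flat functions
  whose smoothness is itself the point at issue.\<close>

inductive_set alg :: "(real^'n::finite \<Rightarrow> complex) set \<Rightarrow> (real^'n \<Rightarrow> complex) set"
  for G where
    base: "g \<in> G \<Longrightarrow> g \<in> alg G"
  | const: "(\<lambda>x. c) \<in> alg G"
  | add: "f \<in> alg G \<Longrightarrow> g \<in> alg G \<Longrightarrow> (\<lambda>x. f x + g x) \<in> alg G"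
  | mult: "f \<in> alg G \<Longrightarrow> g \<in> alg G \<Longrightarrow> (\<lambda>x. f x * g x) \<in> alg G"

text \<open>By the Leibniz rule the derivative of an element stays in the algebra as soon as this
  holds for the generators, so the algebra is a family to which \<open>smooth_coinduct\<close>
  applies.\<close>

lemma alg_smooth:
  assumes "f \<in> alg G" and d: "\<And>g x. g \<in> G \<Longrightarrow> g differentiable (at x)"
    and p: "\<And>g k. g \<in> G \<Longrightarrow> pd k g \<in> alg G"
  shows "smooth f"
proof (rule smooth_coinduct[OF assms(1)])
  fix g assume g: "g \<in> alg G"
  have gd: "g differentiable (at x)" if "g \<in> alg G" for g x
    using that by induction (auto intro: d)
  show "g differentiable (at x)" for x using gd[OF g] .
  show "pd k g \<in> alg G" for k using g
  proof induction
    case (add f g)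
    then have "pd k (\<lambda>x. f x + g x) = (\<lambda>x. pd k f x + pd k g x)"
      by (intro ext pd_add gd)
    with add show ?case by (auto intro: alg.intros)
  next
    case (mult f g)
    then have "pd k (\<lambda>x. f x * g x) = (\<lambda>x. f x * pd k g x + pd k f x * g x)"
      by (intro ext pd_mult gd)
    with mult show ?case by (auto intro: alg.intros)
  qed (auto intro: p alg.intros)
qed

lemma alg_smooth_smooth: "f \<in> alg {g. smooth g} \<Longrightarrow> smooth f"
  by (erule alg_smooth) (auto intro: smooth_differentiable smooth_pd alg.base)

section \<open>Closure properties of smooth functions\<close>

lemma smooth_const: "smooth (\<lambda>x. c)"
  by (rule alg_smooth_smooth, rule alg.const)

lemma smooth_add: "smooth f \<Longrightarrow> smooth g \<Longrightarrow> smooth (\<lambda>x. f x + g x)"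
  by (rule alg_smooth_smooth, rule alg.add) (simp_all add: alg.base)

lemma smooth_mult: "smooth f \<Longrightarrow> smooth g \<Longrightarrow> smooth (\<lambda>x. f x * g x)"
  by (rule alg_smooth_smooth, rule alg.mult) (simp_all add: alg.base)

lemma smooth_cmult: "smooth f \<Longrightarrow> smooth (\<lambda>x. c * f x)"
  by (intro smooth_mult smooth_const)

lemma smooth_minus: "smooth f \<Longrightarrow> smooth (\<lambda>x. - f x)"
  using smooth_cmult[of f "-1"] by simp

lemma smooth_diff: "smooth f \<Longrightarrow> smooth g \<Longrightarrow> smooth (\<lambda>x. f x - g x)"
  using smooth_add[of f "\<lambda>x. - g x"] smooth_minus[of g] by simp

lemma smooth_sum: "(\<And>i. i \<in> I \<Longrightarrow> smooth (f i)) \<Longrightarrow> smooth (\<lambda>x. \<Sum>i\<in>I. f i x)"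
  by (induction I rule: infinite_finite_induct) (auto intro: smooth_const smooth_add)

lemma smooth_cnj: 
  assumes "smooth f" shows "smooth (\<lambda>x. cnj (f x))"
proof (rule smooth_coinduct[where S="{\<lambda>x. cnj (g x) |g. smooth g}"])
  show "pd k g \<in> {\<lambda>x. cnj (g x) |g. smooth g}" if "g \<in> {\<lambda>x. cnj (g x) |g. smooth g}" for g k
  proof -
    from that obtain f where f: "smooth f" "g = (\<lambda>x. cnj (f x))" by auto
    have "pd k g = (\<lambda>x. cnj (pd k f x))" unfolding f(2)
      by (intro ext pd_bounded_linear[OF bounded_linear_cnj] smooth_differentiable f)
    then show ?thesis using smooth_pd[OF f(1)] by auto
  qed
qed (use assms in \<open>auto intro: differentiable_bounded_linear[OF bounded_linear_cnj] smooth_differentiable\<close>)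

lemma pd_cnj: "f differentiable (at x) \<Longrightarrow> pd k (\<lambda>x. cnj (f x)) x = cnj (pd k f x)"
  by (rule pd_bounded_linear[OF bounded_linear_cnj])

lemma smooth_shift: 
  assumes "smooth f" shows "smooth (\<lambda>x. f (x + a))"
proof (rule smooth_coinduct[where S="{\<lambda>x. g (x + a) |g. smooth g}"])
  show "pd k g \<in> {\<lambda>x. g (x + a) |g. smooth g}" if "g \<in> {\<lambda>x. g (x + a) |g. smooth g}" for g k
  proof -
    from that obtain f where f: "smooth f" "g = (\<lambda>x. f (x + a))" by auto
    have "pd k g = (\<lambda>x. pd k f (x + a))" unfolding f(2)
      by (intro ext pd_shift smooth_differentiable f)
    then show ?thesis using smooth_pd[OF f(1)] by auto
  qed
qed (use assms in \<open>auto intro: pd_shift(2) smooth_differentiable\<close>)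

lemma pd_commute:
  assumes "smooth f"
  shows "pd k (pd l f) = pd l (pd k f)"
proof
  fix x
  note D = smooth_differentiable
  have *: "pd k (pd l (\<lambda>x. L (f x))) x = pd l (pd k (\<lambda>x. L (f x))) x"
    "pd k (pd l (\<lambda>x. L (f x))) x = L (pd k (pd l f) x)"
    "pd l (pd k (\<lambda>x. L (f x))) x = L (pd l (pd k f) x)"
    if L: "bounded_linear L" for L :: "complex \<Rightarrow> real"
  proof -
    have 1: "pd i (\<lambda>x. L (g x)) = (\<lambda>x. L (pd i g x))" if "smooth g" for i g
      using that by (intro ext pd_bounded_linear L D)
    have cont: "isCont (\<lambda>x. L (g x)) x" if "smooth g" for g x
      using smooth_isCont[OF that] L by (rule bounded_linear.isCont[rotated])
    show "pd k (pd l (\<lambda>x. L (f x))) x = L (pd k (pd l f) x)"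
      "pd l (pd k (\<lambda>x. L (f x))) x = L (pd l (pd k f) x)"
      using assms by (simp_all add: 1 smooth_pd)
    show "pd k (pd l (\<lambda>x. L (f x))) x = pd l (pd k (\<lambda>x. L (f x))) x"
      by (rule pd_commute_real)
         (use assms in \<open>simp_all add: 1 smooth_pd cont differentiable_bounded_linear[OF L] D\<close>)
  qed
  show "pd k (pd l f) x = pd l (pd k f) x"
    using *[OF bounded_linear_Re] *[OF bounded_linear_Im] by (intro complex_eqI) metis+
qed

text \<open>Compact support in the form in which it is used: it passes through sums, products,
  derivatives and translations by adjusting a radius, and it makes sense for real-valued functions
  too. The next lemma relates it to the closed support.\<close>

definition csupp :: "(real^'n::finite \<Rightarrow> 'b::zero) \<Rightarrow> bool" where
  "csupp f \<longleftrightarrow> (\<exists>R. \<forall>x. norm x > R \<longrightarrow> f x = 0)"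

lemma csupp_iff:
  fixes f :: "real^'n::finite \<Rightarrow> complex"
  shows "csupp f \<longleftrightarrow> compact (closure (support_on UNIV f))"
proof -
  have "csupp f \<longleftrightarrow> bounded (support_on UNIV f)"
    unfolding csupp_def bounded_iff support_on_def by (auto simp: not_less[symmetric])
  then show ?thesis by simp
qed

lemma Cc_inf_iff: "f \<in> Cc_inf \<longleftrightarrow> smooth f \<and> csupp f"
  by (simp add: Cc_inf_def csupp_iff)

lemma Cc_inf_smooth: "f \<in> Cc_inf \<Longrightarrow> smooth f"
  and Cc_inf_csupp: "f \<in> Cc_inf \<Longrightarrow> csupp f"
  and Cc_inf_continuous: "f \<in> Cc_inf \<Longrightarrow> continuous_on S f"
  and Cc_inf_differentiable: "f \<in> Cc_inf \<Longrightarrow> f differentiable (at x)"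
  by (auto simp: Cc_inf_iff smooth_continuous_on smooth_differentiable)

lemma csupp_pd:
  assumes "csupp f" shows "csupp (pd k f)"
proof -
  obtain R where R: "\<And>x. norm x > R \<Longrightarrow> f x = 0" using assms by (auto simp: csupp_def)
  have "pd k f x = 0" if "norm x > R" for x
  proof -
    have "open {x::real^'n. norm x > R}" by (intro open_Collect_less continuous_intros)
    then have "(f has_derivative (\<lambda>_. 0)) (at x)"
      by (rule has_derivative_transform_within_open[of "\<lambda>_. 0", rotated 1]) (use R that in auto)
    from pd_eqI[OF this] show ?thesis .
  qed
  then show ?thesis by (auto simp: csupp_def)
qed

section \<open>Stability of compact support and of the test functions\<close>

lemma csupp_0 [simp]: "csupp (\<lambda>x. 0)" by (simp add: csupp_def)

lemma
  fixes f g :: "real^'n::finite \<Rightarrow> 'b::mult_zero"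
  shows csupp_mult1: "csupp f \<Longrightarrow> csupp (\<lambda>x. f x * g x)"
    and csupp_mult2: "csupp f \<Longrightarrow> csupp (\<lambda>x. g x * f x)"
  unfolding csupp_def by (metis mult_zero_left, metis mult_zero_right)

lemma csupp_cnj: "csupp f \<Longrightarrow> csupp (\<lambda>x. cnj (f x))"
  and csupp_minus: "csupp h \<Longrightarrow> csupp (\<lambda>x. - h x :: 'b::real_normed_vector)"
  by (auto simp: csupp_def)

lemma csupp_add: "csupp f \<Longrightarrow> csupp g \<Longrightarrow> csupp (\<lambda>x. f x + g x :: 'b::real_normed_vector)"
  unfolding csupp_def
proof (elim exE)
  fix R R' assume "\<forall>x. norm x > R \<longrightarrow> f x = 0" "\<forall>x. norm x > R' \<longrightarrow> g x = 0"
  then show "\<exists>R. \<forall>x. norm x > R \<longrightarrow> f x + g x = 0" by (intro exI[of _ "max R R'"]) auto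
qed

lemma csupp_diff: "csupp f \<Longrightarrow> csupp g \<Longrightarrow> csupp (\<lambda>x. f x - g x :: 'b::real_normed_vector)"
  using csupp_add[of f "\<lambda>x. - g x"] csupp_minus[of g] by simp

lemma csupp_sum: "(\<And>i. i \<in> I \<Longrightarrow> csupp (f i)) \<Longrightarrow> csupp (\<lambda>x. \<Sum>i\<in>I. f i x :: 'b::real_normed_vector)"
  by (induction I rule: infinite_finite_induct) (auto intro: csupp_add)

lemma csupp_shift: "csupp f \<Longrightarrow> csupp (\<lambda>x. f (x + a))"
  unfolding csupp_def
proof (elim exE)
  fix R assume R: "\<forall>x. norm x > R \<longrightarrow> f x = 0"
  have "norm (x + a) > R" if "norm x > R + norm a" for x
    using that norm_triangle_ineq4[of "x + a" a] by simp
  then show "\<exists>R. \<forall>x. norm x > R \<longrightarrow> f (x + a) = 0" using R by blast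
qed

lemma Cc_inf_0: "(\<lambda>x. 0) \<in> Cc_inf"
  and Cc_inf_pd: "f \<in> Cc_inf \<Longrightarrow> pd k f \<in> Cc_inf"
  and Cc_inf_add: "f \<in> Cc_inf \<Longrightarrow> g \<in> Cc_inf \<Longrightarrow> (\<lambda>x. f x + g x) \<in> Cc_inf"
  and Cc_inf_diff: "f \<in> Cc_inf \<Longrightarrow> g \<in> Cc_inf \<Longrightarrow> (\<lambda>x. f x - g x) \<in> Cc_inf"
  and Cc_inf_minus: "f \<in> Cc_inf \<Longrightarrow> (\<lambda>x. - f x) \<in> Cc_inf"
  and Cc_inf_cmult: "f \<in> Cc_inf \<Longrightarrow> (\<lambda>x. c * f x) \<in> Cc_inf"
  and Cc_inf_mult: "f \<in> Cc_inf \<Longrightarrow> g \<in> Cc_inf \<Longrightarrow> (\<lambda>x. f x * g x) \<in> Cc_inf"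
  and Cc_inf_cnj: "f \<in> Cc_inf \<Longrightarrow> (\<lambda>x. cnj (f x)) \<in> Cc_inf"
  and Cc_inf_shift: "f \<in> Cc_inf \<Longrightarrow> (\<lambda>x. f (x + a)) \<in> Cc_inf"
  by (auto simp: Cc_inf_iff intro: smooth_const smooth_pd csupp_pd smooth_add csupp_add smooth_diff
      csupp_diff smooth_minus csupp_minus smooth_cmult csupp_mult1 csupp_mult2 smooth_mult smooth_cnj
      csupp_cnj smooth_shift csupp_shift)

lemma Cc_inf_sum: "(\<And>i. i \<in> I \<Longrightarrow> f i \<in> Cc_inf) \<Longrightarrow> (\<lambda>x. \<Sum>i\<in>I. f i x) \<in> Cc_inf"
  by (auto simp: Cc_inf_iff intro: smooth_sum csupp_sum)

section \<open>Integration of compactly supported functions\<close>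

lemma integrable_csupp:
  fixes f :: "real^'n::finite \<Rightarrow> 'b::{banach,second_countable_topology}"
  assumes "continuous_on UNIV f" "csupp f"
  shows "integrable lborel f"
proof -
  obtain R where R: "\<And>x. norm x > R \<Longrightarrow> f x = 0" using assms(2) by (auto simp: csupp_def)
  have "integrable lborel (\<lambda>x. indicator (cball 0 R) x *\<^sub>R f x)"
    using assms(1) by (intro borel_integrable_compact) (auto intro: continuous_on_subset)
  moreover have "(\<lambda>x. indicator (cball 0 R) x *\<^sub>R f x) = f"
    using R by (auto simp: indicator_def fun_eq_iff)
  ultimately show ?thesis by simp
qed

lemma csupp_bounded:
  fixes f :: "real^'n::finite \<Rightarrow> 'b::real_normed_vector"
  assumes "continuous_on UNIV f" "csupp f"
  obtains K where "K \<ge> 0" "\<And>x. norm (f x) \<le> K"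
proof -
  obtain R where R: "\<And>x. norm x > R \<Longrightarrow> f x = 0" using assms(2) by (auto simp: csupp_def)
  have "bounded (f ` cball 0 R)"
    using assms(1) by (intro compact_imp_bounded compact_continuous_image) (auto intro: continuous_on_subset)
  then obtain B where B: "\<And>x. x \<in> cball 0 R \<Longrightarrow> norm (f x) \<le> B"
    unfolding bounded_iff by blast
  have "norm (f x) \<le> max B 0" for x
    using B[of x] R[of x] by (cases "norm x > R") auto
  then show ?thesis by (intro that[of "max B 0"]) auto
qed

lemma borel_measurable_continuous: "continuous_on UNIV f \<Longrightarrow> f \<in> borel_measurable lborel"
  by (simp add: borel_measurable_continuous_onI)

lemma borel_measurable_cnj [measurable]: "cnj \<in> borel_measurable borel"
  by (intro borel_measurable_continuous_onI continuous_intros)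

lemma csupp_cmod: "csupp f \<Longrightarrow> csupp (\<lambda>x. cmod (f x))"
  by (auto simp: csupp_def)

lemma integrable_mult_bounded:
  fixes g \<phi> :: "real^'n::finite \<Rightarrow> complex"
  assumes [measurable]: "g \<in> borel_measurable lborel" and K: "AE x in lborel. cmod (g x) \<le> K"
    and i: "integrable lborel \<phi>"
  shows "integrable lborel (\<lambda>x. g x * \<phi> x)"
    and "cmod (LINT x|lborel. g x * \<phi> x) \<le> K * (LINT x|lborel. cmod (\<phi> x))"
proof -
  have [measurable]: "\<phi> \<in> borel_measurable lborel" using i by auto
  have *: "AE x in lborel. cmod (g x * \<phi> x) \<le> K * cmod (\<phi> x)"
    using K by eventually_elim (auto simp: norm_mult intro: mult_right_mono)
  show 1: "integrable lborel (\<lambda>x. g x * \<phi> x)"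
  proof (rule Bochner_Integration.integrable_bound[where f="\<lambda>x. K * cmod (\<phi> x)"])
    show "AE x in lborel. norm (g x * \<phi> x) \<le> norm (K * cmod (\<phi> x))"
      using * by eventually_elim auto
  qed (use i in auto)
  have "cmod (LINT x|lborel. g x * \<phi> x) \<le> (LINT x|lborel. cmod (g x * \<phi> x))"
    by (rule integral_norm_bound)
  also have "\<dots> \<le> (LINT x|lborel. K * cmod (\<phi> x))"
    by (rule integral_mono_AE) (use 1 i * in \<open>auto intro: integrable_norm\<close>)
  finally show "cmod (LINT x|lborel. g x * \<phi> x) \<le> K * (LINT x|lborel. cmod (\<phi> x))" by simp
qed

section \<open>Translation invariance and integration by parts\<close>

lemma lborel_shift_eq: "distr lborel borel (\<lambda>x. x + a) = (lborel :: 'a::euclidean_space measure)"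
proof -
  have "(\<lambda>x. x + a) = (+) a" by (auto simp: add.commute)
  then show ?thesis using lborel_distr_plus[of a] by simp
qed

lemma
  fixes f :: "'a::euclidean_space \<Rightarrow> 'b::{banach,second_countable_topology}"
  assumes [measurable]: "f \<in> borel_measurable lborel"
  shows lborel_integral_shift: "(LINT x|lborel. f (x + a)) = (LINT x|lborel. f x)"
    and lborel_integrable_shift: "integrable lborel (\<lambda>x. f (x + a)) \<longleftrightarrow> integrable lborel f"
proof -
  have [measurable]: "f \<in> borel_measurable borel" using assms by simp
  have [measurable]: "(\<lambda>x. x + a) \<in> measurable lborel borel" by simp
  show "(LINT x|lborel. f (x + a)) = (LINT x|lborel. f x)"
    by (subst (2) lborel_shift_eq[symmetric, of a], subst integral_distr) auto
  show "integrable lborel (\<lambda>x. f (x + a)) \<longleftrightarrow> integrable lborel f"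
    by (subst (2) lborel_shift_eq[symmetric, of a], subst integrable_distr_eq) auto
qed

lemma increment_bound:
  fixes f :: "real^'n::finite \<Rightarrow> 'b::real_inner"
  assumes d: "\<And>x. f differentiable (at x)" and K: "\<And>x. norm (pd k f x) \<le> K"
  shows "norm (f (x + h *\<^sub>R axis k 1) - f x) \<le> K * \<bar>h\<bar>"
proof -
  have "norm ((\<lambda>s. f (x + s *\<^sub>R axis k 1)) h - (\<lambda>s. f (x + s *\<^sub>R axis k 1)) 0) \<le> K * norm (h - 0)"
    by (rule differentiable_bound[where S=UNIV and f'="\<lambda>s h. h *\<^sub>R pd k f (x + s *\<^sub>R axis k 1)"])
       (use axis_line_derivative[OF d] K in \<open>auto simp: has_vector_derivative_def intro!: onorm_le simp: mult.commute[of K] mult_left_mono\<close>)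
  then show ?thesis by simp
qed

text \<open>Translation invariance makes every difference quotient of \<open>f\<close> integrate to
  zero; the quotients converge to the derivative, dominated by its supremum on a ball.\<close>

lemma integral_pd_0:
  fixes f :: "real^'n::finite \<Rightarrow> complex"
  assumes d: "\<And>x. f differentiable (at x)" and f: "csupp f" and c: "continuous_on UNIV (pd k f)"
  shows "(LINT x|lborel. pd k f x) = 0"
proof -
  obtain R where R: "\<And>x. norm x > R \<Longrightarrow> f x = 0" using f by (auto simp: csupp_def)
  obtain K where K: "K \<ge> 0" "\<And>x. norm (pd k f x) \<le> K" using csupp_bounded[OF c csupp_pd[OF f]] by blast
  have cf: "continuous_on UNIV f"
    by (simp add: continuous_at_imp_continuous_on d differentiable_imp_continuous_within)
  note [measurable] = borel_measurable_continuous[OF cf] borel_measurable_continuous[OF c]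
  let ?e = "axis k 1 :: real^'n"
  define q where "q n x = (1 / (1 / real (Suc n))) *\<^sub>R (f (x + (1 / real (Suc n)) *\<^sub>R ?e) - f x)" for n x
  have fi: "integrable lborel f" by (rule integrable_csupp[OF cf f])
  have q0: "(LINT x|lborel. q n x) = 0" for n
    using fi unfolding q_def
    by (simp add: lborel_integral_shift lborel_integrable_shift)
  have "(\<lambda>n. LINT x|lborel. q n x) \<longlonglongrightarrow> (LINT x|lborel. pd k f x)"
  \<comment> \<open>The steps are at most \<open>1\<close>, so for \<open>x\<close> outside the ball
    of radius \<open>R + 1\<close> both points of the quotient lie where \<open>f\<close> vanishes;
    inside, the mean value bound \<open>K\<close> applies.\<close>
  proof (rule integral_dominated_convergence[where w="\<lambda>x. K * indicator (cball 0 (R+1)) x"])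
    show "AE x in lborel. (\<lambda>n. q n x) \<longlonglongrightarrow> pd k f x"
    proof (rule AE_I2)
      fix x
      have "((\<lambda>s. f (x + s *\<^sub>R ?e)) has_vector_derivative pd k f x) (at 0)"
        using axis_line_derivative[of f x 0 k UNIV] d by simp
      then have "((\<lambda>h. norm (f (x + h *\<^sub>R ?e) - f x - h *\<^sub>R pd k f x) / norm h) \<longlongrightarrow> 0) (at 0)"
        by (simp add: has_vector_derivative_def has_derivative_at)
      moreover have "filterlim (\<lambda>n. 1 / real (Suc n)) (at 0) sequentially"
        using LIMSEQ_inverse_real_of_nat by (simp add: filterlim_at inverse_eq_divide)
      ultimately have "(\<lambda>n. norm (f (x + (1 / real (Suc n)) *\<^sub>R ?e) - f x - (1 / real (Suc n)) *\<^sub>R pd k f x)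
          / norm (1 / real (Suc n))) \<longlonglongrightarrow> 0"
        by (rule filterlim_compose)
      moreover have "norm (f (x + (1 / real (Suc n)) *\<^sub>R ?e) - f x - (1 / real (Suc n)) *\<^sub>R pd k f x)
          / norm (1 / real (Suc n)) = norm (q n x - pd k f x)" for n
      proof -
        have "q n x - pd k f x = real (Suc n) *\<^sub>R (f (x + (1 / real (Suc n)) *\<^sub>R ?e) - f x - (1 / real (Suc n)) *\<^sub>R pd k f x)"
          by (simp add: q_def scaleR_diff_right del: of_nat_Suc)
        then show ?thesis by (simp del: of_nat_Suc)
      qed
      ultimately show "(\<lambda>n. q n x) \<longlonglongrightarrow> pd k f x"
        by (simp add: LIM_zero_cancel tendsto_norm_zero_iff)
    qed
    show "AE x in lborel. norm (q n x) \<le> K * indicator (cball 0 (R+1)) x" for n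
    proof (rule AE_I2)
      fix x
      let ?h = "1 / real (Suc n)"
      have h: "0 < ?h" "?h \<le> 1" by auto
      show "norm (q n x) \<le> K * indicator (cball 0 (R+1)) x"
      proof (cases "norm x \<le> R + 1")
        case True
        have "norm (q n x) \<le> (1 / ?h) * (K * \<bar>?h\<bar>)" unfolding q_def norm_scaleR
          by (intro mult_mono increment_bound d K) auto
        then show ?thesis using True h K by auto
      next
        case False
        have "norm x \<le> norm (x + ?h *\<^sub>R ?e) + norm (?h *\<^sub>R ?e)"
          using norm_triangle_ineq4[of "x + ?h *\<^sub>R ?e" "?h *\<^sub>R ?e"] by simp
        also have "norm (?h *\<^sub>R ?e) \<le> 1" using h by simp
        finally have "norm (x + ?h *\<^sub>R ?e) > R" using False by linarith
        then have "q n x = 0" unfolding q_def using R[of "x + ?h *\<^sub>R ?e"] R[of x] False by simp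
        then show ?thesis using K by simp
      qed
    qed
    show "integrable lborel (\<lambda>x. K * indicator (cball 0 (R + 1)) x :: real)"
      using emeasure_lborel_cball_finite[of 0 "R+1"] by (intro integrable_mult_right integrable_real_indicator) simp_all
    show "q n \<in> borel_measurable lborel" for n unfolding q_def by measurable
  qed simp
  then show ?thesis by (simp add: q0 LIMSEQ_const_iff)
qed

text \<open>The class shared by the coefficients and the test functions. It is closed under
  products, so \<open>c k l * pd k u\<close> can be integrated by parts although second derivatives
  of \<open>c k l\<close> exist only weakly.\<close>

definition C1 :: "(real^'n::finite \<Rightarrow> complex) \<Rightarrow> bool" where
  "C1 f \<longleftrightarrow> (\<forall>x. f differentiable (at x)) \<and> (\<forall>k. continuous_on UNIV (pd k f))"

lemma C1_differentiable: "C1 f \<Longrightarrow> f differentiable (at x)"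
  and C1_pd_continuous: "C1 f \<Longrightarrow> continuous_on S (pd k f)"
  by (auto simp: C1_def intro: continuous_on_subset)

lemma C1_continuous: "C1 f \<Longrightarrow> continuous_on S f"
  by (simp add: C1_def continuous_at_imp_continuous_on differentiable_imp_continuous_within)

lemma smooth_C1: "smooth f \<Longrightarrow> C1 f"
  by (simp add: C1_def smooth_differentiable smooth_continuous_on smooth_pd)

lemma C1_pd_mult: "C1 f \<Longrightarrow> C1 g \<Longrightarrow> pd k (\<lambda>x. f x * g x) = (\<lambda>x. f x * pd k g x + pd k f x * g x)"
  by (intro ext pd_mult C1_differentiable)

lemma C1_mult: "C1 f \<Longrightarrow> C1 g \<Longrightarrow> C1 (\<lambda>x. f x * g x)"
  by (subst C1_def)
     (auto simp: C1_pd_mult intro: C1_differentiable C1_continuous C1_pd_continuous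
       intro!: differentiable_mult continuous_on_add continuous_on_mult)

lemma C1_add: "C1 f \<Longrightarrow> C1 g \<Longrightarrow> C1 (\<lambda>x. f x + g x)"
  unfolding C1_def by (auto simp: pd_add[THEN ext] intro!: continuous_intros)

lemma C1_cnj: "C1 f \<Longrightarrow> C1 (\<lambda>x. cnj (f x))"
  unfolding C1_def
  by (auto simp: pd_cnj[THEN ext] intro!: continuous_intros differentiable_bounded_linear[OF bounded_linear_cnj])

text \<open>The disjunction allows the factor without compact support, typically containing a
  coefficient, to stand on either side.\<close>

lemma integration_by_parts:
  assumes f: "C1 f" and g: "C1 g" and s: "csupp f \<or> csupp g"
  shows "(LINT x|lborel. f x * pd k g x) = - (LINT x|lborel. pd k f x * g x)"
proof -
  note fg = C1_continuous[OF f] C1_pd_continuous[OF f] C1_continuous[OF g] C1_pd_continuous[OF g]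
  have "integrable lborel (\<lambda>x. f x * pd k g x)" "integrable lborel (\<lambda>x. pd k f x * g x)"
    using s by (auto intro!: integrable_csupp continuous_intros fg
      intro: csupp_mult1 csupp_mult2 csupp_mult1[OF csupp_pd] csupp_mult2[OF csupp_pd])
  moreover have "(LINT x|lborel. pd k (\<lambda>x. f x * g x) x) = 0"
    by (rule integral_pd_0)
       (use s C1_mult[OF f g] in \<open>auto simp: C1_def intro: csupp_mult1 csupp_mult2\<close>)
  ultimately show ?thesis by (simp add: C1_pd_mult[OF f g] add_eq_0_iff)
qed

section \<open>The space of square-integrable functions\<close>

lemma L2_measurable: "f \<in> L2 \<Longrightarrow> f \<in> borel_measurable lborel"
  and L2_integrable: "f \<in> L2 \<Longrightarrow> integrable lborel (\<lambda>x. (cmod (f x))\<^sup>2)"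
  by (auto simp: L2_def)

lemma L2_csupp:
  assumes "continuous_on UNIV f" "csupp f" shows "f \<in> L2"
  unfolding L2_def using assms
  by (auto intro!: integrable_csupp continuous_intros csupp_mult1 csupp_cmod simp: power2_eq_square
      borel_measurable_continuous_onI)

lemma Cc_inf_L2: "f \<in> Cc_inf \<Longrightarrow> f \<in> L2"
  by (intro L2_csupp Cc_inf_continuous Cc_inf_csupp)

text \<open>Two majorants at once, so that sums and differences fall under the same criterion as
  bounded multiples.\<close>

lemma L2_bound:
  assumes g: "g \<in> L2" "g' \<in> L2" and [measurable]: "f \<in> borel_measurable lborel"
    and b: "\<And>x. cmod (f x) \<le> K * (cmod (g x) + cmod (g' x))"
  shows "f \<in> L2"
proof -
  have "(cmod (f x))\<^sup>2 \<le> 2 * K\<^sup>2 * ((cmod (g x))\<^sup>2 + (cmod (g' x))\<^sup>2)" for x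
  proof -
    have "(cmod (f x))\<^sup>2 \<le> (K * (cmod (g x) + cmod (g' x)))\<^sup>2" by (intro power_mono b) auto
    also have "\<dots> = K\<^sup>2 * (cmod (g x) + cmod (g' x))\<^sup>2" by (simp add: power_mult_distrib)
    also have "\<dots> \<le> K\<^sup>2 * (2 * ((cmod (g x))\<^sup>2 + (cmod (g' x))\<^sup>2))"
      using sum_squares_bound[of "cmod (g x)" "cmod (g' x)"]
      by (intro mult_left_mono) (auto simp: power2_sum)
    finally show ?thesis by (simp add: algebra_simps)
  qed
  note le = this
  have "integrable lborel (\<lambda>x. (cmod (f x))\<^sup>2)"
  proof (rule Bochner_Integration.integrable_bound)
    show "integrable lborel (\<lambda>x. 2 * K\<^sup>2 * ((cmod (g x))\<^sup>2 + (cmod (g' x))\<^sup>2))"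
      using g by (intro integrable_mult_right Bochner_Integration.integrable_add L2_integrable)
    show "AE x in lborel. norm ((cmod (f x))\<^sup>2) \<le> norm (2 * K\<^sup>2 * ((cmod (g x))\<^sup>2 + (cmod (g' x))\<^sup>2))"
      using le by (intro AE_I2) (simp add: abs_mult)
  qed simp
  then show ?thesis by (simp add: L2_def)
qed

lemma L2_add: "f \<in> L2 \<Longrightarrow> g \<in> L2 \<Longrightarrow> (\<lambda>x. f x + g x) \<in> L2"
  by (rule L2_bound[of f g _ 1])
     (auto intro!: borel_measurable_add norm_triangle_ineq dest: L2_measurable)

lemma L2_diff: "f \<in> L2 \<Longrightarrow> g \<in> L2 \<Longrightarrow> (\<lambda>x. f x - g x) \<in> L2"
  by (rule L2_bound[of f g _ 1])
     (auto intro!: borel_measurable_diff norm_triangle_ineq4 dest: L2_measurable)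

lemma L2_mult_bounded:
  assumes "f \<in> L2" "m \<in> borel_measurable lborel" "\<And>x. cmod (m x) \<le> K"
  shows "(\<lambda>x. m x * f x) \<in> L2"
proof (rule L2_bound[of f f _ K])
  have [measurable]: "f \<in> borel_measurable borel" "m \<in> borel_measurable borel"
    using assms L2_measurable by auto
  show "(\<lambda>x. m x * f x) \<in> borel_measurable lborel" by measurable
  have K: "0 \<le> K" using order_trans[OF norm_ge_zero assms(3)] .
  show "cmod (m x * f x) \<le> K * (cmod (f x) + cmod (f x))" for x
    using mult_right_mono[OF assms(3), of "cmod (f x)" x] mult_nonneg_nonneg[OF K, of "cmod (f x)"]
    unfolding norm_mult distrib_left by auto
qed (use assms in auto)

lemma L2_cmult: "f \<in> L2 \<Longrightarrow> (\<lambda>x. c * f x) \<in> L2"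
  by (rule L2_mult_bounded[of f "\<lambda>_. c" "cmod c"]) auto

lemma L2_0: "(\<lambda>x. 0) \<in> L2" by (simp add: L2_def)

lemma L2_minus: "f \<in> L2 \<Longrightarrow> (\<lambda>x. - f x) \<in> L2"
  using L2_cmult[of f "-1"] by simp

lemma L2_sum: "(\<And>i. i \<in> I \<Longrightarrow> f i \<in> L2) \<Longrightarrow> (\<lambda>x. \<Sum>i\<in>I. f i x) \<in> L2"
  by (induction I rule: infinite_finite_induct) (auto intro: L2_0 L2_add)

lemma L2_inner_integrable:
  assumes "f \<in> L2" "g \<in> L2"
  shows "integrable lborel (\<lambda>x. f x * cnj (g x))"
proof (rule Bochner_Integration.integrable_bound[where f="\<lambda>x. (cmod (f x))\<^sup>2 + (cmod (g x))\<^sup>2"])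
  have "cmod (f x * cnj (g x)) \<le> (cmod (f x))\<^sup>2 + (cmod (g x))\<^sup>2" for x
    using sum_squares_bound[of "cmod (f x)" "cmod (g x)"] mult_nonneg_nonneg[OF norm_ge_zero norm_ge_zero, of "f x" "g x"]
    unfolding norm_mult complex_mod_cnj by linarith
  then show "AE x in lborel. norm (f x * cnj (g x)) \<le> norm ((cmod (f x))\<^sup>2 + (cmod (g x))\<^sup>2)"
    by auto
  have [measurable]: "f \<in> borel_measurable borel" "g \<in> borel_measurable borel"
    using assms L2_measurable by auto
  show "(\<lambda>x. f x * cnj (g x)) \<in> borel_measurable lborel" by measurable
qed (use assms in \<open>auto intro!: L2_integrable\<close>)

lemma l2_inner_add_left: "f \<in> L2 \<Longrightarrow> g \<in> L2 \<Longrightarrow> h \<in> L2 \<Longrightarrow>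
    l2_inner (\<lambda>x. f x + g x) h = l2_inner f h + l2_inner g h"
  and l2_inner_diff_left: "f \<in> L2 \<Longrightarrow> g \<in> L2 \<Longrightarrow> h \<in> L2 \<Longrightarrow>
    l2_inner (\<lambda>x. f x - g x) h = l2_inner f h - l2_inner g h"
  and l2_inner_add_right: "f \<in> L2 \<Longrightarrow> g \<in> L2 \<Longrightarrow> h \<in> L2 \<Longrightarrow>
    l2_inner h (\<lambda>x. f x + g x) = l2_inner h f + l2_inner h g"
  and l2_inner_diff_right: "f \<in> L2 \<Longrightarrow> g \<in> L2 \<Longrightarrow> h \<in> L2 \<Longrightarrow>
    l2_inner h (\<lambda>x. f x - g x) = l2_inner h f - l2_inner h g"
  by (simp_all add: l2_inner_def algebra_simps L2_inner_integrable)

lemma l2_inner_cmult_left: "l2_inner (\<lambda>x. c * f x) h = c * l2_inner f h"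
  and l2_inner_cmult_right: "l2_inner h (\<lambda>x. c * f x) = cnj c * l2_inner h f"
  by (simp_all add: l2_inner_def mult.assoc mult.left_commute[of _ "cnj c"])

lemma l2_inner_cnj: "l2_inner g f = cnj (l2_inner f g)"
proof -
  have "cnj (LINT x|lborel. f x * cnj (g x)) = (LINT x|lborel. cnj (f x * cnj (g x)))"
    by (rule Bochner_Integration.integral_cnj[symmetric])
  then show ?thesis by (simp add: l2_inner_def mult.commute del: Bochner_Integration.integral_cnj)
qed

lemma l2_inner_sum_left: "(\<And>i. i \<in> I \<Longrightarrow> f i \<in> L2) \<Longrightarrow> h \<in> L2 \<Longrightarrow>
    l2_inner (\<lambda>x. \<Sum>i\<in>I. f i x) h = (\<Sum>i\<in>I. l2_inner (f i) h)"
  by (simp add: l2_inner_def sum_distrib_right L2_inner_integrable)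

lemma l2_inner_sum_right: "(\<And>i. i \<in> I \<Longrightarrow> f i \<in> L2) \<Longrightarrow> h \<in> L2 \<Longrightarrow>
    l2_inner h (\<lambda>x. \<Sum>i\<in>I. f i x) = (\<Sum>i\<in>I. l2_inner h (f i))"
  by (simp add: l2_inner_def sum_distrib_left L2_inner_integrable)

lemma l2_norm_nonneg [simp]: "0 \<le> l2_norm f"
  by (simp add: l2_norm_def)

lemma l2_norm_sq: "(l2_norm f)\<^sup>2 = (LINT x|lborel. (cmod (f x))\<^sup>2)"
  by (simp add: l2_norm_def)

lemma l2_inner_self: "l2_inner f f = complex_of_real ((l2_norm f)\<^sup>2)"
  by (simp add: l2_inner_def l2_norm_sq complex_norm_square[symmetric] del: of_real_power)

lemma l2_norm_0 [simp]: "l2_norm (\<lambda>x. 0) = 0"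
  by (simp add: l2_norm_def)

text \<open>The optimal choice is \<open>s = b / a\<close>; shifting both numbers by a small
  \<open>d\<close> keeps \<open>s\<close> positive and finite when \<open>a\<close> or
  \<open>b\<close> vanishes. A family of additive bounds thus becomes a product bound, for the
  Cauchy-Schwarz inequality in \<open>L2\<close> and again for the sectorial form.\<close>

lemma le_mult_of_scaled_am_gm:
  fixes x a b :: real
  assumes a: "a \<ge> 0" and b: "b \<ge> 0" and le: "\<And>s. s > 0 \<Longrightarrow> x \<le> (s * a\<^sup>2 + b\<^sup>2 / s) / 2"
  shows "x \<le> a * b"
proof (rule field_le_epsilon)
  fix e :: real assume e: "e > 0"
  \<comment> \<open>Makes the total excess \<open>d * (a + b) / 2\<close> at most
    \<open>e\<close>.\<close>
  define d where "d = e / (a + b + 1)"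
  have d: "d > 0" using a b e by (simp add: d_def)
  have "x \<le> ((b + d) / (a + d) * a\<^sup>2 + b\<^sup>2 / ((b + d) / (a + d))) / 2"
    using d a b by (intro le) auto
  also have "(b + d) / (a + d) * a\<^sup>2 \<le> (b + d) * a"
  proof -
    have "(b + d) * (a * a / (a + d)) \<le> (b + d) * a"
      using a b d by (intro mult_left_mono) (auto simp: field_simps)
    then show ?thesis by (simp add: power2_eq_square ac_simps)
  qed
  also have "b\<^sup>2 / ((b + d) / (a + d)) \<le> b * (a + d)"
  proof -
    have "(b * b / (b + d)) * (a + d) \<le> b * (a + d)"
      using a b d by (intro mult_right_mono) (auto simp: field_simps)
    then show ?thesis by (simp add: power2_eq_square ac_simps)
  qed
  finally have "x \<le> ((b + d) * a + b * (a + d)) / 2" by simp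
  also have "\<dots> = a * b + d * (a + b) / 2" by (simp add: field_simps)
  also have "d * (a + b) / 2 \<le> e"
  proof -
    have "d * (a + b) \<le> d * (a + b + 1)" using d by simp
    also have "\<dots> = e" using a b by (simp add: d_def)
    finally show ?thesis using d a b e by simp
  qed
  finally show "x \<le> a * b + e" by simp
qed

text \<open>The product of the moduli is integrated, which is stronger than bounding the inner
  product; error terms carrying a bounded weight require it.\<close>

lemma l2_abs_inner_le:
  assumes "f \<in> L2" "g \<in> L2"
  shows "integrable lborel (\<lambda>x. cmod (f x) * cmod (g x))"
    and "(LINT x|lborel. cmod (f x) * cmod (g x)) \<le> l2_norm f * l2_norm g"
proof -
  have i: "integrable lborel (\<lambda>x. cmod (f x * cnj (g x)))"
    by (intro integrable_norm L2_inner_integrable assms)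
  then show i': "integrable lborel (\<lambda>x. cmod (f x) * cmod (g x))" by (simp add: norm_mult)
  show "(LINT x|lborel. cmod (f x) * cmod (g x)) \<le> l2_norm f * l2_norm g"
  proof (rule le_mult_of_scaled_am_gm)
    fix s :: real assume s: "s > 0"
    have "cmod (f x) * cmod (g x) \<le> (s * (cmod (f x))\<^sup>2 + (cmod (g x))\<^sup>2 / s) / 2" for x
    proof -
      have "0 \<le> (s * cmod (f x) - cmod (g x))\<^sup>2 / s" using s by simp
      then show ?thesis using s by (simp add: power2_eq_square field_simps)
    qed
    then have "(LINT x|lborel. cmod (f x) * cmod (g x))
        \<le> (LINT x|lborel. (s * (cmod (f x))\<^sup>2 + (cmod (g x))\<^sup>2 / s) / 2)"
      using assms i'
      by (intro integral_mono integrable_divide Bochner_Integration.integrable_add integrable_mult_right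
          L2_integrable)
    also have "\<dots> = (s * (l2_norm f)\<^sup>2 + (l2_norm g)\<^sup>2 / s) / 2"
      using assms by (simp add: l2_norm_sq L2_integrable)
    finally show "(LINT x|lborel. cmod (f x) * cmod (g x)) \<le> \<dots>" .
  qed auto
qed

lemma l2_cauchy_schwarz:
  assumes "f \<in> L2" "g \<in> L2"
  shows "cmod (l2_inner f g) \<le> l2_norm f * l2_norm g"
proof -
  have "cmod (l2_inner f g) \<le> (LINT x|lborel. cmod (f x * cnj (g x)))"
    unfolding l2_inner_def by (rule integral_norm_bound)
  also have "\<dots> = (LINT x|lborel. cmod (f x) * cmod (g x))" by (simp add: norm_mult)
  finally show ?thesis using l2_abs_inner_le(2)[OF assms] by simp
qed

lemma l2_norm_add_sq:
  assumes "f \<in> L2" "g \<in> L2"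
  shows "(l2_norm (\<lambda>x. f x + g x))\<^sup>2 = (l2_norm f)\<^sup>2 + 2 * Re (l2_inner f g) + (l2_norm g)\<^sup>2"
proof -
  have "complex_of_real ((l2_norm (\<lambda>x. f x + g x))\<^sup>2)
      = l2_inner f f + (l2_inner f g + cnj (l2_inner f g)) + l2_inner g g"
    using assms by (simp add: l2_inner_self[symmetric] l2_inner_add_left l2_inner_add_right L2_add
        l2_inner_cnj[of g f] del: of_real_power)
  also have "\<dots> = complex_of_real ((l2_norm f)\<^sup>2 + 2 * Re (l2_inner f g) + (l2_norm g)\<^sup>2)"
    by (simp add: l2_inner_self complex_add_cnj)
  finally show ?thesis by (simp only: of_real_eq_iff)
qed

lemma l2_norm_triangle:
  assumes "f \<in> L2" "g \<in> L2"
  shows "l2_norm (\<lambda>x. f x + g x) \<le> l2_norm f + l2_norm g"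
proof (rule power2_le_imp_le)
  have "Re (l2_inner f g) \<le> l2_norm f * l2_norm g"
    using l2_cauchy_schwarz[OF assms] complex_Re_le_cmod[of "l2_inner f g"] by linarith
  then show "(l2_norm (\<lambda>x. f x + g x))\<^sup>2 \<le> (l2_norm f + l2_norm g)\<^sup>2"
    by (simp add: l2_norm_add_sq[OF assms] power2_sum)
qed simp

lemma l2_norm_cmult: "l2_norm (\<lambda>x. c * f x) = cmod c * l2_norm f"
  by (simp add: l2_norm_def norm_mult power_mult_distrib real_sqrt_mult)

lemma l2_norm_minus: "l2_norm (\<lambda>x. - f x) = l2_norm f"
  by (simp add: l2_norm_def)

lemma l2_norm_diff_commute: "l2_norm (\<lambda>x. f x - g x) = l2_norm (\<lambda>x. g x - f x)"
  by (simp add: l2_norm_def norm_minus_commute)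

lemma l2_norm_triangle_diff:
  assumes "f \<in> L2" "g \<in> L2"
  shows "l2_norm (\<lambda>x. f x - g x) \<le> l2_norm f + l2_norm g"
  using l2_norm_triangle[OF assms(1) L2_minus[OF assms(2)]] by (simp add: l2_norm_minus)

lemma l2_norm_triangle_via:
  assumes "f \<in> L2" "g \<in> L2" "h \<in> L2"
  shows "l2_norm (\<lambda>x. f x - h x) \<le> l2_norm (\<lambda>x. f x - g x) + l2_norm (\<lambda>x. g x - h x)"
  using l2_norm_triangle[of "\<lambda>x. f x - g x" "\<lambda>x. g x - h x"] assms by (simp add: L2_diff)

lemma l2_norm_triangle_sub:
  assumes "f \<in> L2" "g \<in> L2"
  shows "l2_norm f \<le> l2_norm g + l2_norm (\<lambda>x. f x - g x)"
  using l2_norm_triangle[of g "\<lambda>x. f x - g x"] assms by (simp add: L2_diff)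

lemma l2_norm_sum:
  "(\<And>i. i \<in> I \<Longrightarrow> f i \<in> L2) \<Longrightarrow> l2_norm (\<lambda>x. \<Sum>i\<in>I. f i x) \<le> (\<Sum>i\<in>I. l2_norm (f i))"
proof (induction I rule: infinite_finite_induct)
  case (insert i I)
  then have "l2_norm (\<lambda>x. f i x + (\<Sum>i\<in>I. f i x)) \<le> l2_norm (f i) + l2_norm (\<lambda>x. \<Sum>i\<in>I. f i x)"
    by (intro l2_norm_triangle L2_sum) auto
  with insert show ?case by fastforce
qed auto

lemma l2_norm_mono:
  assumes "f \<in> L2" "g \<in> L2" "\<And>x. cmod (f x) \<le> K * cmod (g x)" "K \<ge> 0"
  shows "l2_norm f \<le> K * l2_norm g"
proof (rule power2_le_imp_le)
  have "(cmod (f x))\<^sup>2 \<le> K\<^sup>2 * (cmod (g x))\<^sup>2" for x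
    using power_mono[OF assms(3), of x 2] by (simp add: power_mult_distrib)
  then have "(LINT x|lborel. (cmod (f x))\<^sup>2) \<le> (LINT x|lborel. K\<^sup>2 * (cmod (g x))\<^sup>2)"
    using assms by (intro integral_mono) (auto intro!: L2_integrable)
  then show "(l2_norm f)\<^sup>2 \<le> (K * l2_norm g)\<^sup>2" by (simp add: l2_norm_sq power_mult_distrib)
qed (use assms in simp)

lemma l2_norm_shift: "f \<in> L2 \<Longrightarrow> l2_norm (\<lambda>x. f (x + a)) = l2_norm f"
  unfolding l2_norm_def using L2_measurable[of f]
  by (subst lborel_integral_shift[of "\<lambda>x. (cmod (f x))\<^sup>2"]) auto

lemma L2_shift: "f \<in> L2 \<Longrightarrow> (\<lambda>x. f (x + a)) \<in> L2"
  unfolding L2_def using lborel_integrable_shift[of "\<lambda>x. (cmod (f x))\<^sup>2" a]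
  by auto

lemma l2_tendsto_inner:
  assumes "l2_tendsto U u" "v \<in> L2"
  shows "(\<lambda>n. l2_inner (U n) v) \<longlonglongrightarrow> l2_inner u v"
proof (rule LIM_zero_cancel, rule Lim_null_comparison)
  have L: "U n \<in> L2" "u \<in> L2" for n using assms by (auto simp: l2_tendsto_def)
  show "\<forall>\<^sub>F n in sequentially. norm (l2_inner (U n) v - l2_inner u v) \<le> l2_norm (\<lambda>x. U n x - u x) * l2_norm v"
    using L assms(2) by (simp add: l2_inner_diff_left[symmetric] l2_cauchy_schwarz L2_diff)
  show "(\<lambda>n. l2_norm (\<lambda>x. U n x - u x) * l2_norm v) \<longlonglongrightarrow> 0"
    using assms(1) by (auto simp: l2_tendsto_def intro: tendsto_mult_left_zero)
qed

lemma l2_tendsto_norm: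
  assumes "l2_tendsto U u"
  shows "(\<lambda>n. l2_norm (U n)) \<longlonglongrightarrow> l2_norm u"
proof (rule LIM_zero_cancel, rule Lim_null_comparison)
  have L: "U n \<in> L2" "u \<in> L2" for n using assms by (auto simp: l2_tendsto_def)
  show "\<forall>\<^sub>F n in sequentially. norm (l2_norm (U n) - l2_norm u) \<le> l2_norm (\<lambda>x. U n x - u x)"
    using l2_norm_triangle_sub[OF L(1) L(2)] l2_norm_triangle_sub[OF L(2) L(1)]
    by (intro always_eventually allI) (auto simp: abs_le_iff l2_norm_diff_commute[of u] algebra_simps)
  show "(\<lambda>n. l2_norm (\<lambda>x. U n x - u x)) \<longlonglongrightarrow> 0"
    using assms(1) by (auto simp: l2_tendsto_def)
qed

lemma l2_tendsto_inner2:
  assumes U: "l2_tendsto U u" and V: "l2_tendsto V v"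
  shows "(\<lambda>n. l2_inner (U n) (V n)) \<longlonglongrightarrow> l2_inner u v"
proof (rule LIM_zero_cancel, rule Lim_null_comparison)
  have L: "U n \<in> L2" "u \<in> L2" "V n \<in> L2" "v \<in> L2" for n using assms by (auto simp: l2_tendsto_def)
  have "l2_inner (U n) (V n) - l2_inner u v
      = l2_inner (\<lambda>x. U n x - u x) (V n) + l2_inner u (\<lambda>x. V n x - v x)" for n
    using L by (simp add: l2_inner_diff_left l2_inner_diff_right)
  then have "norm (l2_inner (U n) (V n) - l2_inner u v) \<le>
     l2_norm (\<lambda>x. U n x - u x) * l2_norm (V n) + l2_norm u * l2_norm (\<lambda>x. V n x - v x)" for n
    using L by (simp add: L2_diff l2_cauchy_schwarz add_mono norm_triangle_mono)
  then show "\<forall>\<^sub>F n in sequentially. norm (l2_inner (U n) (V n) - l2_inner u v) \<le>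
     l2_norm (\<lambda>x. U n x - u x) * l2_norm (V n) + l2_norm u * l2_norm (\<lambda>x. V n x - v x)" by simp
  have "(\<lambda>n. l2_norm (\<lambda>x. U n x - u x) * l2_norm (V n) + l2_norm u * l2_norm (\<lambda>x. V n x - v x))
    \<longlonglongrightarrow> 0 * l2_norm v + l2_norm u * 0"
    using assms by (intro tendsto_intros l2_tendsto_norm) (auto simp: l2_tendsto_def)
  then show "(\<lambda>n. l2_norm (\<lambda>x. U n x - u x) * l2_norm (V n) + l2_norm u * l2_norm (\<lambda>x. V n x - v x)) \<longlonglongrightarrow> 0"
    by simp
qed

section \<open>Bump functions and density of the test functions\<close>

text \<open>The exponent \<open>n\<close> is carried along because differentiation stays within the
  linear span of this family, while it leaves the single function \<open>exp (- (1 / t))\<close> at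
  once.\<close>

definition flat :: "nat \<Rightarrow> real \<Rightarrow> real" where
  "flat n t = (if t \<le> 0 then 0 else exp (- (1 / t)) / t ^ n)"

lemma flat_tendsto_0: "(flat n \<longlongrightarrow> 0) (at_right 0)"
proof -
  have "((\<lambda>x. inverse x ^ n / exp (inverse x)) \<longlongrightarrow> (0::real)) (at_right 0)"
    by (rule filterlim_compose[OF tendsto_power_div_exp_0 filterlim_inverse_at_top_right])
  then show ?thesis
  proof (rule Lim_transform_eventually)
    show "\<forall>\<^sub>F x in at_right 0. inverse x ^ n / exp (inverse x) = flat n x"
      by (intro eventually_at_rightI[of 0 1])
         (auto simp: flat_def exp_minus field_simps power_inverse)
  qed
qed

lemma flat_deriv: "(flat n has_real_derivative (flat (n+2) t - real n * flat (n+1) t)) (at t)"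
proof (cases t "0::real" rule: linorder_cases)
  case less
  have "((\<lambda>_. 0) has_real_derivative 0) (at t)" by simp
  then have "(flat n has_real_derivative 0) (at t)"
    by (rule has_field_derivative_transform_within_open[of _ _ _ "{..<0}"])
       (use less in \<open>auto simp: flat_def\<close>)
  then show ?thesis using less by (simp add: flat_def)
next
  case greater
  have "((\<lambda>t. exp (- (1 / t)) / t ^ n) has_real_derivative
      ((exp (- (1/t)) * (1 / t^2)) * t ^ n - exp (- (1/t)) * (real n * t ^ (n - 1))) / (t ^ n * t ^ n)) (at t)"
    using greater by (auto intro!: derivative_eq_intros simp: power2_eq_square)
  then have "(flat n has_real_derivative
      ((exp (- (1/t)) * (1 / t^2)) * t ^ n - exp (- (1/t)) * (real n * t ^ (n - 1))) / (t ^ n * t ^ n)) (at t)"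
    by (rule has_field_derivative_transform_within_open[of _ _ _ "{0<..}"])
       (use greater in \<open>auto simp: flat_def\<close>)
  moreover have "((exp (- (1/t)) * (1 / t^2)) * t ^ n - exp (- (1/t)) * (real n * t ^ (n - 1))) / (t ^ n * t ^ n)
      = flat (n+2) t - real n * flat (n+1) t"
    using greater by (cases n) (auto simp: flat_def field_simps power2_eq_square)
  ultimately show ?thesis by simp
next
  case equal
  \<comment> \<open>The quotient at zero vanishes from the left and equals
    \<open>flat (Suc n)\<close> from the right, which tends to zero because the exponential beats
    every power.\<close>
  have "((\<lambda>h. (flat n (0 + h) - flat n 0) / h) \<longlongrightarrow> 0) (at 0)"
  proof (rule filterlim_split_at)
    show "((\<lambda>h. (flat n (0 + h) - flat n 0) / h) \<longlongrightarrow> 0) (at_left 0)"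
      by (rule Lim_transform_eventually[OF tendsto_const])
         (auto simp: flat_def eventually_at_filter)
    show "((\<lambda>h. (flat n (0 + h) - flat n 0) / h) \<longlongrightarrow> 0) (at_right 0)"
      by (rule Lim_transform_eventually[OF flat_tendsto_0[of "Suc n"]])
         (auto simp: flat_def eventually_at_filter)
  qed
  then show ?thesis using equal by (simp add: DERIV_def flat_def)
qed

lemma flat_bounds: "0 \<le> flat 0 t" "flat 0 t \<le> 1" "flat 0 t = 0 \<longleftrightarrow> t \<le> 0"
  by (auto simp: flat_def)

text \<open>The factor \<open>\<sigma>\<close> is \<open>1\<close> for the lower and
  \<open>-1\<close> for the upper faces of a box; as a parameter it keeps both within one family
  that generates an algebra closed under \<open>pd\<close>.\<close>

definition coord_flat :: "nat \<Rightarrow> real \<Rightarrow> 'n \<Rightarrow> real \<Rightarrow> real^'n::finite \<Rightarrow> complex" where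
  "coord_flat n \<sigma> k a x = complex_of_real (flat n (\<sigma> * x $ k - a))"

lemma coord_flat_has_derivative:
  "(coord_flat n \<sigma> k a has_derivative
    (\<lambda>h. complex_of_real ((flat (n+2) (\<sigma> * x $ k - a) - real n * flat (n+1) (\<sigma> * x $ k - a)) * (\<sigma> * h $ k)))) (at x)"
proof -
  have 1: "((\<lambda>x. \<sigma> * x $ k - a) has_derivative (\<lambda>h. \<sigma> * h $ k)) (at x)"
    using has_derivative_diff[OF has_derivative_mult_right[OF bounded_linear.has_derivative[OF bounded_linear_vec_nth has_derivative_ident]] has_derivative_const]
    by simp
  have 2: "(flat n has_derivative (*) (flat (n+2) (\<sigma> * x $ k - a) - real n * flat (n+1) (\<sigma> * x $ k - a)))
      (at (\<sigma> * x $ k - a))"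
    using flat_deriv by (simp add: has_field_derivative_def)
  from bounded_linear.has_derivative[OF bounded_linear_of_real[where 'a=complex] diff_chain_at[OF 1 2]]
  show ?thesis by (simp add: o_def coord_flat_def[abs_def])
qed

lemma coord_flat_smooth: "smooth (coord_flat n \<sigma> k a)"
proof -
  let ?G = "{coord_flat n \<sigma> k a |n \<sigma> k a. True} :: (real^'a \<Rightarrow> complex) set"
  show ?thesis
  proof (rule alg_smooth[of _ ?G])
    show "coord_flat n \<sigma> k a \<in> alg ?G" by (rule alg.base) auto
    show "g differentiable (at x)" if "g \<in> ?G" for g x
      using that differentiableI[OF coord_flat_has_derivative] by blast
    show "pd j g \<in> alg ?G" if g: "g \<in> ?G" for g j
    proof -
      obtain n \<sigma> k a where g: "g = coord_flat n \<sigma> k a" using g by auto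
      have "pd j g = (\<lambda>x. complex_of_real (if j = k then \<sigma> else 0) *
          (coord_flat (n+2) \<sigma> k a x + complex_of_real (- real n) * coord_flat (n+1) \<sigma> k a x))"
        unfolding g by (rule ext, rule pd_eqI[OF coord_flat_has_derivative, THEN trans])
          (simp add: coord_flat_def axis_def)
      also have "\<dots> \<in> alg ?G"
        by (rule alg.mult[OF alg.const], rule alg.add[OF _ alg.mult[OF alg.const]])
           (rule alg.base, blast)+
      finally show ?thesis .
    qed
  qed
qed

lemma smooth_prod: "(\<And>i. i \<in> I \<Longrightarrow> smooth (f i)) \<Longrightarrow> smooth (\<lambda>x. \<Prod>i\<in>I. f i x)"
  by (induction I rule: infinite_finite_induct) (simp_all add: smooth_const smooth_mult)

definition box_bump :: "real^'n::finite \<Rightarrow> real^'n \<Rightarrow> real^'n \<Rightarrow> real" where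
  "box_bump a b x = (\<Prod>k\<in>UNIV. flat 0 (x $ k - a $ k) * flat 0 (b $ k - x $ k))"

lemma box_bump_bounds: "0 \<le> box_bump a b x" "box_bump a b x \<le> 1"
  unfolding box_bump_def by (auto intro!: prod_nonneg prod_le_1 mult_le_one simp: flat_bounds)

lemma box_bump_eq_0_iff: "box_bump a b x = 0 \<longleftrightarrow> x \<notin> box a b"
  unfolding box_bump_def mem_box_cart by (auto simp: flat_bounds not_less)

lemma csupp_box:
  assumes "\<And>x. x \<notin> box a b \<Longrightarrow> f x = 0" shows "csupp f"
proof -
  obtain R where R: "\<And>x. x \<in> box a b \<Longrightarrow> norm x \<le> R"
    using bounded_box[of a b] unfolding bounded_iff by blast
  have "f x = 0" if "norm x > R" for x
    using R[of x] that assms[of x] by fastforce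
  then show ?thesis by (auto simp: csupp_def)
qed

lemma box_bump_Cc_inf: "(\<lambda>x. complex_of_real (box_bump a b x)) \<in> Cc_inf"
proof -
  have "(\<lambda>x. complex_of_real (box_bump a b x)) =
      (\<lambda>x. \<Prod>k\<in>UNIV. coord_flat 0 1 k (a $ k) x * coord_flat 0 (-1) k (- b $ k) x)"
    by (simp add: box_bump_def coord_flat_def fun_eq_iff)
  then have "smooth (\<lambda>x. complex_of_real (box_bump a b x))"
    using smooth_prod[of UNIV "\<lambda>k x. coord_flat 0 1 k (a $ k) x * coord_flat 0 (-1) k (- b $ k) x"]
    by (simp add: smooth_mult coord_flat_smooth)
  moreover have "csupp (\<lambda>x. complex_of_real (box_bump a b x))"
    by (rule csupp_box) (simp add: box_bump_eq_0_iff)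
  ultimately show ?thesis by (simp add: Cc_inf_iff)
qed

section \<open>The closure of the test functions in \<open>L2\<close>\<close>

definition L2_approx :: "(real^'n::finite \<Rightarrow> complex) set" where
  "L2_approx = {f \<in> L2. \<forall>\<epsilon>>0. \<exists>u\<in>Cc_inf. l2_norm (\<lambda>x. f x - u x) < \<epsilon>}"

lemma Cc_inf_L2_approx: "u \<in> Cc_inf \<Longrightarrow> u \<in> L2_approx"
  unfolding L2_approx_def by (auto simp: Cc_inf_L2 intro!: bexI[of _ u])

lemma L2_approx_add:
  assumes "f \<in> L2_approx" "g \<in> L2_approx" shows "(\<lambda>x. f x + g x) \<in> L2_approx"
proof -
  have L: "f \<in> L2" "g \<in> L2" using assms by (auto simp: L2_approx_def)
  have "\<exists>u\<in>Cc_inf. l2_norm (\<lambda>x. f x + g x - u x) < \<epsilon>" if e: "\<epsilon> > 0" for \<epsilon>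
  proof -
    obtain u v where u: "u \<in> Cc_inf" "l2_norm (\<lambda>x. f x - u x) < \<epsilon>/2"
      and v: "v \<in> Cc_inf" "l2_norm (\<lambda>x. g x - v x) < \<epsilon>/2"
      using assms half_gt_zero[OF e] unfolding L2_approx_def by blast
    have "l2_norm (\<lambda>x. (f x - u x) + (g x - v x)) \<le> l2_norm (\<lambda>x. f x - u x) + l2_norm (\<lambda>x. g x - v x)"
      by (intro l2_norm_triangle L2_diff L Cc_inf_L2 u v)
    then have "l2_norm (\<lambda>x. f x + g x - (u x + v x)) < \<epsilon>" using u v by (simp add: algebra_simps)
    then show ?thesis using Cc_inf_add[OF u(1) v(1)] by (rule bexI)
  qed
  then show ?thesis using L by (simp add: L2_approx_def L2_add)
qed

lemma L2_approx_cmult: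
  assumes "f \<in> L2_approx" shows "(\<lambda>x. c * f x) \<in> L2_approx"
proof (cases "c = 0")
  case True then show ?thesis using Cc_inf_L2_approx[OF Cc_inf_0] by simp
next
  case False
  have L: "f \<in> L2" using assms by (auto simp: L2_approx_def)
  have "\<exists>u\<in>Cc_inf. l2_norm (\<lambda>x. c * f x - u x) < \<epsilon>" if e: "\<epsilon> > 0" for \<epsilon>
  proof -
    have "\<epsilon> / cmod c > 0" using e False by simp
    then obtain u where u: "u \<in> Cc_inf" "l2_norm (\<lambda>x. f x - u x) < \<epsilon> / cmod c"
      using assms unfolding L2_approx_def by blast
    have "l2_norm (\<lambda>x. c * f x - c * u x) = cmod c * l2_norm (\<lambda>x. f x - u x)"
      by (simp add: l2_norm_cmult[symmetric] algebra_simps)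
    also have "\<dots> < \<epsilon>" using u(2) False by (simp add: field_simps)
    finally show ?thesis using Cc_inf_cmult[OF u(1)] by (rule bexI)
  qed
  then show ?thesis using L by (simp add: L2_approx_def L2_cmult)
qed

lemma L2_approx_sum: "(\<And>i. i \<in> I \<Longrightarrow> f i \<in> L2_approx) \<Longrightarrow> (\<lambda>x. \<Sum>i\<in>I. f i x) \<in> L2_approx"
  by (induction I rule: infinite_finite_induct)
     (auto intro: L2_approx_add Cc_inf_L2_approx[OF Cc_inf_0])

lemma L2_approx_diff:
  assumes "f \<in> L2_approx" "g \<in> L2_approx" shows "(\<lambda>x. f x - g x) \<in> L2_approx"
  using L2_approx_add[OF assms(1) L2_approx_cmult[OF assms(2), of "-1"]] by simp

text \<open>The majorant \<open>w\<close> turns pointwise convergence into convergence in norm.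
  Together with linearity this makes \<open>L2_approx\<close> closed under the limits of measure
  theory, so that indicators of boxes, indicators of Borel sets and general functions can be treated
  in succession.\<close>

lemma L2_approx_dominated:
  assumes F: "\<And>n. F n \<in> L2_approx" and lim: "\<And>x. (\<lambda>n. F n x) \<longlonglongrightarrow> f x"
    and w: "w \<in> L2" and b: "\<And>n x. cmod (F n x) \<le> cmod (w x)"
  shows "f \<in> L2_approx"
proof -
  have FL: "F n \<in> L2" for n using F by (simp add: L2_approx_def)
  have [measurable]: "F n \<in> borel_measurable borel" "w \<in> borel_measurable borel" for n
    using FL w L2_measurable by auto
  have fm: "f \<in> borel_measurable borel"
    by (rule borel_measurable_LIMSEQ_metric[of F]) (use lim in auto)
  note [measurable] = fm
  have fb: "cmod (f x) \<le> cmod (w x)" for x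
    by (rule Lim_bounded[OF tendsto_norm[OF lim]]) (use b in auto)
  have fL: "f \<in> L2" by (rule L2_bound[OF w w, of _ 1]) (simp_all add: order_trans[OF fb])
  have "(\<lambda>n. LINT x|lborel. (cmod (f x - F n x))\<^sup>2) \<longlonglongrightarrow> (LINT x|(lborel :: (real^'a) measure). 0)"
  proof (rule integral_dominated_convergence[where w="\<lambda>x. 4 * (cmod (w x))\<^sup>2"])
    show "integrable lborel (\<lambda>x. 4 * (cmod (w x))\<^sup>2)"
      by (intro integrable_mult_right L2_integrable w)
    show "AE x in lborel. (\<lambda>n. (cmod (f x - F n x))\<^sup>2) \<longlonglongrightarrow> 0"
    proof (rule AE_I2)
      fix x
      have "(\<lambda>n. (cmod (f x - F n x))\<^sup>2) \<longlonglongrightarrow> (cmod (f x - f x))\<^sup>2"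
        by (intro tendsto_intros lim)
      then show "(\<lambda>n. (cmod (f x - F n x))\<^sup>2) \<longlonglongrightarrow> 0" by simp
    qed
    show "AE x in lborel. norm ((cmod (f x - F n x))\<^sup>2) \<le> 4 * (cmod (w x))\<^sup>2" for n
    proof (rule AE_I2)
      fix x
      have "cmod (f x - F n x) \<le> 2 * cmod (w x)"
        using norm_triangle_ineq4[of "f x" "F n x"] fb[of x] b[of n x] by linarith
      then have "(cmod (f x - F n x))\<^sup>2 \<le> (2 * cmod (w x))\<^sup>2" by (intro power_mono) auto
      then show "norm ((cmod (f x - F n x))\<^sup>2) \<le> 4 * (cmod (w x))\<^sup>2" by (simp add: power_mult_distrib)
    qed
  qed auto
  then have "(\<lambda>n. sqrt (LINT x|lborel. (cmod (f x - F n x))\<^sup>2)) \<longlonglongrightarrow> sqrt 0"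
    by (intro tendsto_intros) simp
  then have lim0: "(\<lambda>n. l2_norm (\<lambda>x. f x - F n x)) \<longlonglongrightarrow> 0" by (simp add: l2_norm_def)
  have "\<exists>u\<in>Cc_inf. l2_norm (\<lambda>x. f x - u x) < \<epsilon>" if e: "\<epsilon> > 0" for \<epsilon>
  proof -
    have "\<forall>\<^sub>F n in sequentially. l2_norm (\<lambda>x. f x - F n x) < \<epsilon>/2"
      using order_tendstoD(2)[OF lim0, of "\<epsilon>/2"] e by simp
    then obtain n where n: "l2_norm (\<lambda>x. f x - F n x) < \<epsilon>/2" by (auto simp: eventually_sequentially)
    obtain u where u: "u \<in> Cc_inf" "l2_norm (\<lambda>x. F n x - u x) < \<epsilon>/2"
      using F half_gt_zero[OF e] unfolding L2_approx_def by blast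
    have "l2_norm (\<lambda>x. f x - u x) < \<epsilon>"
      using l2_norm_triangle_via[OF fL FL[of n] Cc_inf_L2[OF u(1)]] n u(2) by simp
    then show ?thesis using u(1) by blast
  qed
  then show ?thesis using fL by (simp add: L2_approx_def)
qed

lemma indicator_box_L2: "(\<lambda>x. complex_of_real (indicator (box a b) x)) \<in> L2"
proof -
  have "integrable lborel (indicator (box a b) :: real^'a \<Rightarrow> real)"
    by (intro integrable_real_indicator) (auto simp: emeasure_lborel_box_eq)
  moreover have "(\<lambda>x. (cmod (complex_of_real (indicator (box a b) x)))\<^sup>2) = (indicator (box a b) :: real^'a \<Rightarrow> real)"
    by (auto simp: indicator_def fun_eq_iff)
  ultimately show ?thesis by (simp add: L2_def)
qed

text \<open>The bump has values in \<open>(0, 1]\<close> on the box and vanishes elsewhere, so the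
  test functions \<open>1 - (1 - box_bump a b x) ^ n\<close> increase to the indicator.\<close>

lemma indicator_box_L2_approx: "(\<lambda>x. complex_of_real (indicator (box a b) x)) \<in> L2_approx"
proof (rule L2_approx_dominated[OF _ _ indicator_box_L2[of a b]])
  let ?F = "\<lambda>n x. complex_of_real (1 - (1 - box_bump a b x) ^ n)"
  show "?F n \<in> L2_approx" for n
  proof (rule Cc_inf_L2_approx)
    have r: "smooth (\<lambda>x. complex_of_real (box_bump a b x))"
      by (rule Cc_inf_smooth[OF box_bump_Cc_inf])
    have "smooth (\<lambda>x. (1 - complex_of_real (box_bump a b x)) ^ n)"
      by (induction n) (auto intro!: smooth_mult smooth_diff smooth_const r)
    then have "smooth (?F n)" by (auto intro: smooth_diff smooth_const)
    moreover have "csupp (?F n)"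
      by (rule csupp_box[of a b]) (simp add: box_bump_eq_0_iff[THEN iffD2])
    ultimately show "?F n \<in> Cc_inf" by (simp add: Cc_inf_iff)
  qed
  show "cmod (?F n x) \<le> cmod (complex_of_real (indicator (box a b) x))" for n x
  proof (cases "x \<in> box a b")
    case True
    have "0 \<le> (1 - box_bump a b x) ^ n" "(1 - box_bump a b x) ^ n \<le> 1"
      using box_bump_bounds[of a b x] by (auto intro: power_le_one)
    then show ?thesis using True by (simp del: of_real_diff of_real_power)
  next
    case False
    then have "box_bump a b x = 0" by (simp add: box_bump_eq_0_iff)
    then show ?thesis by simp
  qed
  show "(\<lambda>n. ?F n x) \<longlonglongrightarrow> complex_of_real (indicator (box a b) x)" for x
  proof (cases "x \<in> box a b")
    case True
    then have "0 < box_bump a b x" using box_bump_bounds[of a b x] box_bump_eq_0_iff[of a b x] by auto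
    then have "(\<lambda>n. (1 - box_bump a b x) ^ n) \<longlonglongrightarrow> 0"
      using box_bump_bounds[of a b x] by (intro LIMSEQ_realpow_zero) auto
    then have "(\<lambda>n. ?F n x) \<longlonglongrightarrow> complex_of_real (1 - 0)"
      by (intro tendsto_of_real tendsto_diff tendsto_const)
    moreover have "complex_of_real (1 - 0) = complex_of_real (indicator (box a b) x)" using True by simp
    ultimately show ?thesis by (simp only:)
  next
    case False
    then have "box_bump a b x = 0" by (simp add: box_bump_eq_0_iff)
    then show ?thesis using False by simp
  qed
qed

text \<open>A Dynkin-system argument: boxes form a generator stable under intersection. Cutting by a
  fixed box keeps complements in \<open>L2\<close> and supplies the majorant for countable disjoint
  unions.\<close>

lemma indicator_L2_approx:
  assumes A: "A \<in> sets borel"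
  shows "(\<lambda>x. complex_of_real (indicator (A \<inter> box c d) x)) \<in> L2_approx"
proof -
  let ?G = "range (\<lambda>(a, b). box a b) :: (real^'a) set set"
  have "Int_stable ?G" by (auto simp: Int_stable_def box_Int_box)
  moreover have "?G \<subseteq> Pow UNIV" by auto
  moreover have "A \<in> sigma_sets UNIV ?G" using A unfolding borel_eq_box by simp
  ultimately show ?thesis
  proof (induction rule: sigma_sets_induct_disjoint)
    case (basic A)
    then obtain a b where "A = box a b" by auto
    then show ?case using indicator_box_L2_approx by (auto simp: box_Int_box)
  next
    case empty
    show ?case using Cc_inf_L2_approx[OF Cc_inf_0] by simp
  next
    case (compl A)
    have "(\<lambda>x. complex_of_real (indicator ((UNIV - A) \<inter> box c d) x)) =
        (\<lambda>x. complex_of_real (indicator (box c d) x) - complex_of_real (indicator (A \<inter> box c d) x))"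
      by (auto simp: indicator_def fun_eq_iff)
    then show ?case using L2_approx_diff[OF indicator_box_L2_approx compl(2)] by simp
  next
    case (union A)
    show ?case
    proof (rule L2_approx_dominated[OF _ _ indicator_box_L2[of c d]])
      let ?F = "\<lambda>n x. \<Sum>i<n. complex_of_real (indicator (A i \<inter> box c d) x)"
      show "?F n \<in> L2_approx" for n by (intro L2_approx_sum union)
      have F: "?F n x = complex_of_real (indicator ((\<Union>i<n. A i) \<inter> box c d) x)" for n x
      proof -
        have "indicator (\<Union>i\<in>{..<n}. A i \<inter> box c d) x = (\<Sum>i<n. indicator (A i \<inter> box c d) x :: real)"
          using union(1) by (intro indicator_UN_disjoint)
            (auto simp: disjoint_family_on_def)
        then show ?thesis by simp
      qed
      show "cmod (?F n x) \<le> cmod (complex_of_real (indicator (box c d) x))" for n x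
        unfolding F by (auto simp: indicator_def)
      show "(\<lambda>n. ?F n x) \<longlonglongrightarrow> complex_of_real (indicator (\<Union> (range A) \<inter> box c d) x)" for x
        unfolding F
      proof (rule tendsto_eventually, cases "x \<in> \<Union> (range A)")
        case True
        then obtain i where "x \<in> A i" by auto
        then show "\<forall>\<^sub>F n in sequentially. complex_of_real (indicator ((\<Union>i<n. A i) \<inter> box c d) x)
            = complex_of_real (indicator (\<Union> (range A) \<inter> box c d) x)"
          by (intro eventually_sequentiallyI[of "Suc i"]) (auto simp: indicator_def)
      qed (auto simp: indicator_def)
    qed
  qed
qed

theorem Cc_inf_dense_L2:
  assumes f: "f \<in> L2" and e: "\<epsilon> > 0"
  obtains u where "u \<in> Cc_inf" "l2_norm (\<lambda>x. f x - u x) < \<epsilon>"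
proof -
  have [measurable]: "f \<in> borel_measurable lborel" using f by (rule L2_measurable)
  obtain F where F: "\<And>i. simple_function lborel (F i)" "\<And>x. (\<lambda>i. F i x) \<longlonglongrightarrow> f x"
      "\<And>i x. cmod (F i x) \<le> 2 * cmod (f x)"
    using borel_measurable_implies_sequence_metric[of f lborel 0] by (auto simp: dist_complex_def)
  \<comment> \<open>Boxes exhausting the space: simple functions cut by them are finite combinations
    of indicators of bounded Borel sets.\<close>
  let ?b = "\<lambda>i. box (- (\<chi> k. real i)) (\<chi> k. real i) :: (real^'a) set"
  let ?F = "\<lambda>i x. F i x * complex_of_real (indicator (?b i) x)"
  have "f \<in> L2_approx"
  proof (rule L2_approx_dominated[OF _ _ L2_cmult[OF f, of 2]])
    show "?F i \<in> L2_approx" for i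
    proof -
      have fin: "finite (range (F i))" using simple_functionD(1)[OF F(1)[of i]] by simp
      have "F i x * complex_of_real (indicator (?b i) x)
          = (\<Sum>y\<in>range (F i). y * complex_of_real (indicator (F i -` {y} \<inter> ?b i) x))" for x
      proof -
        have "(\<Sum>y\<in>range (F i). y * complex_of_real (indicator (F i -` {y} \<inter> ?b i) x))
          = (\<Sum>y\<in>{F i x}. y * complex_of_real (indicator (F i -` {y} \<inter> ?b i) x))"
          using fin by (intro sum.mono_neutral_right) (auto simp: indicator_def)
        then show ?thesis by (simp add: indicator_def)
      qed
      moreover have "F i -` {y} \<in> sets borel" for y
        using simple_functionD(2)[OF F(1)[of i], of "{y}"] by simp
      ultimately show ?thesis
        by (simp only:) (intro L2_approx_sum L2_approx_cmult indicator_L2_approx)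
    qed
    show "cmod (?F i x) \<le> cmod (2 * f x)" for i x
      using F(3)[of i x] by (auto simp: norm_mult indicator_def)
    show "(\<lambda>i. ?F i x) \<longlonglongrightarrow> f x" for x
    proof -
      obtain N where N: "norm x < real N" using reals_Archimedean2 by blast
      have "x \<in> ?b i" if "i \<ge> N" for i
        using component_le_norm_cart[of x] N that unfolding mem_box_cart
        by (auto simp: abs_le_iff) (smt (verit, ccfv_threshold) of_nat_mono)+
      then have "\<forall>\<^sub>F i in sequentially. F i x = ?F i x"
        by (intro eventually_sequentiallyI[of N]) auto
      then show ?thesis using F(2) by (rule Lim_transform_eventually[rotated])
    qed
  qed
  then show ?thesis using e that by (auto simp: L2_approx_def)
qed

section \<open>Regularity of Sobolev functions of order two\<close>

definition dird :: "real^'n::finite \<Rightarrow> (real^'n \<Rightarrow> complex) \<Rightarrow> real^'n \<Rightarrow> complex" where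
  "dird v f x = (\<Sum>k\<in>UNIV. complex_of_real (v $ k) * pd k f x)"

lemma dird_Cc_inf: "f \<in> Cc_inf \<Longrightarrow> dird v f \<in> Cc_inf"
  unfolding dird_def[abs_def] by (intro Cc_inf_sum Cc_inf_cmult Cc_inf_pd)

lemma dird_line_derivative:
  assumes "f \<in> Cc_inf"
  shows "((\<lambda>s. f (x + s *\<^sub>R v)) has_vector_derivative dird v f (x + s *\<^sub>R v)) (at s within S)"
  using line_derivative[OF Cc_inf_differentiable[OF assms], of x v s S] by (simp add: dird_def scaleR_conv_of_real)

text \<open>Two applications of the mean value inequality, to \<open>\<psi>'\<close> and to the
  linearisation of \<open>\<psi>\<close>; hence the constant \<open>L\<close>, twice the sharp
  one.\<close>

lemma taylor2_bound:
  fixes \<psi> :: "real \<Rightarrow> 'a::real_normed_vector"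
  assumes d: "\<And>t. (\<psi> has_vector_derivative \<psi>' t) (at t)"
    and d': "\<And>t. (\<psi>' has_vector_derivative \<psi>'' t) (at t)"
    and L: "\<And>t. norm (\<psi>'' t) \<le> L"
  shows "norm (\<psi> (s + h) - \<psi> s - h *\<^sub>R \<psi>' s) \<le> L * h\<^sup>2"
proof -
  have lip: "norm (\<psi>' t - \<psi>' s) \<le> L * \<bar>h\<bar>" if "t \<in> closed_segment s (s + h)" for t
  proof -
    have "norm (\<psi>' t - \<psi>' s) \<le> L * norm (t - s)"
    proof (rule differentiable_bound[where S=UNIV and f'="\<lambda>t h. h *\<^sub>R \<psi>'' t"])
      show "(\<psi>' has_derivative (\<lambda>h. h *\<^sub>R \<psi>'' t)) (at t within UNIV)" for t
        using d'[of t] by (simp add: has_vector_derivative_def)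
      show "onorm (\<lambda>h. h *\<^sub>R \<psi>'' t) \<le> L" for t
        by (rule onorm_le) (simp add: mult.commute[of L] mult_left_mono L)
    qed auto
    also have "\<bar>t - s\<bar> \<le> \<bar>h\<bar>" using that by (auto simp: closed_segment_eq_real_ivl split: if_splits)
    then have "L * norm (t - s) \<le> L * \<bar>h\<bar>"
      using order_trans[OF norm_ge_zero L] by (intro mult_left_mono) auto
    finally show ?thesis .
  qed
  have "norm (\<psi> (s + h) - \<psi> s - ((s + h) - s) *\<^sub>R \<psi>' s) \<le> norm ((s + h) - s) * (L * \<bar>h\<bar>)"
    by (rule vector_differentiable_bound_linearization[where S="closed_segment s (s + h)"])
       (use d lip in \<open>auto intro: has_vector_derivative_at_within\<close>)
  then show ?thesis by (simp add: power2_eq_square ac_simps)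
qed

section \<open>Mollification of bounded functions\<close>

definition mol :: "(real^'n::finite \<Rightarrow> complex) \<Rightarrow> (real^'n \<Rightarrow> complex) \<Rightarrow> real^'n \<Rightarrow> complex" where
  "mol f \<rho> x = (LINT z|lborel. f z * \<rho> (z - x))"

definition bdd_meas :: "real \<Rightarrow> (real^'n::finite \<Rightarrow> complex) \<Rightarrow> bool" where
  "bdd_meas K f \<longleftrightarrow> f \<in> borel_measurable lborel \<and> (AE x in lborel. cmod (f x) \<le> K)"

lemma Linf_bdd_meas: "f \<in> Linf \<Longrightarrow> \<exists>K. bdd_meas K f"
  by (auto simp: Linf_def bdd_meas_def)

lemma bdd_meas_mono: "bdd_meas K f \<Longrightarrow> K \<le> K' \<Longrightarrow> bdd_meas K' f"
  unfolding bdd_meas_def by (auto elim!: AE_mp)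

lemma bdd_meas_integrable:
  assumes "bdd_meas K f" "integrable lborel \<phi>"
  shows "integrable lborel (\<lambda>x. f x * \<phi> x)"
    and "cmod (LINT x|lborel. f x * \<phi> x) \<le> K * (LINT x|lborel. cmod (\<phi> x))"
  using integrable_mult_bounded[of f K \<phi>] assms by (auto simp: bdd_meas_def)

lemma bdd_meas_Cc_inf_integrable: "bdd_meas K f \<Longrightarrow> \<phi> \<in> Cc_inf \<Longrightarrow> integrable lborel (\<lambda>x. f x * \<phi> x)"
  by (intro bdd_meas_integrable integrable_csupp Cc_inf_continuous Cc_inf_csupp)

lemma Cc_inf_shift_diff: "\<phi> \<in> Cc_inf \<Longrightarrow> (\<lambda>z. \<phi> (z - x)) \<in> Cc_inf"
  using Cc_inf_shift[of \<phi> "- x"] by simp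

lemma mol_bound:
  assumes "bdd_meas K f" "\<rho> \<in> Cc_inf"
  shows "cmod (mol f \<rho> x) \<le> K * (LINT z|lborel. cmod (\<rho> z))"
proof -
  have r: "(\<lambda>z. \<rho> (z - x)) \<in> Cc_inf" by (rule Cc_inf_shift_diff[OF assms(2)])
  have "cmod (mol f \<rho> x) \<le> K * (LINT z|lborel. cmod (\<rho> (z - x)))"
    unfolding mol_def by (intro bdd_meas_integrable assms integrable_csupp Cc_inf_continuous Cc_inf_csupp r)
  also have "(LINT z|lborel. cmod (\<rho> (z - x))) = (LINT z|lborel. cmod (\<rho> z))"
    using lborel_integral_shift[of "\<lambda>z. cmod (\<rho> z)" "- x"]
      borel_measurable_continuous[OF Cc_inf_continuous[OF assms(2)]] by simp
  finally show ?thesis .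
qed

lemma mol_linear:
  assumes "bdd_meas K f" "\<And>i. i \<in> I \<Longrightarrow> \<rho> i \<in> Cc_inf"
  shows "mol f (\<lambda>z. \<Sum>i\<in>I. c i * \<rho> i z) x = (\<Sum>i\<in>I. c i * mol f (\<rho> i) x)"
proof -
  have "integrable lborel (\<lambda>z. f z * (c i * \<rho> i (z - x)))" if "i \<in> I" for i
    by (rule bdd_meas_Cc_inf_integrable[OF assms(1)], rule Cc_inf_cmult, rule Cc_inf_shift_diff) (use that assms(2) in auto)
  then have "mol f (\<lambda>z. \<Sum>i\<in>I. c i * \<rho> i z) x = (\<Sum>i\<in>I. LINT z|lborel. f z * (c i * \<rho> i (z - x)))"
    unfolding mol_def sum_distrib_left by (intro Bochner_Integration.integral_sum)
  also have "\<dots> = (\<Sum>i\<in>I. c i * mol f (\<rho> i) x)"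
    by (simp add: mol_def mult.left_commute)
  finally show ?thesis .
qed

text \<open>The Taylor remainder of the translated kernel is of size \<open>h\<^sup>2\<close> on a
  ball independent of \<open>h\<close>, so its integral against a merely bounded \<open>f\<close> is
  of that size too. Only the kernel is differentiated.\<close>

lemma mol_line_derivative:
  assumes f: "bdd_meas K f" and r: "\<rho> \<in> Cc_inf"
  shows "((\<lambda>s. mol f \<rho> (x + s *\<^sub>R v)) has_vector_derivative - mol f (dird v \<rho>) (x + s *\<^sub>R v)) (at s)"
proof -
  let ?d = "dird v \<rho>" and ?dd = "dird v (dird v \<rho>)"
  have dC: "?d \<in> Cc_inf" "?dd \<in> Cc_inf" by (intro dird_Cc_inf r)+
  obtain L where L: "L \<ge> 0" "\<And>y. cmod (?dd y) \<le> L"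
    using csupp_bounded[OF Cc_inf_continuous[OF dC(2)] Cc_inf_csupp[OF dC(2)]] by blast
  obtain R1 where R1: "\<And>y. norm y > R1 \<Longrightarrow> \<rho> y = 0" using Cc_inf_csupp[OF r] by (auto simp: csupp_def)
  obtain R2 where R2: "\<And>y. norm y > R2 \<Longrightarrow> ?d y = 0" using Cc_inf_csupp[OF dC(1)] by (auto simp: csupp_def)
  \<comment> \<open>Enlarging by \<open>norm v\<close> accounts for a translation by
    \<open>h\<close> times \<open>v\<close> with \<open>\<bar>h\<bar> \<le> 1\<close>: outside this
    ball around \<open>?x\<close> the remainder vanishes for all such \<open>h\<close>.\<close>
  define R where "R = max R1 R2 + norm v"
  let ?x = "x + s *\<^sub>R v"
  let ?V = "measure lborel (cball ?x R)"
  have dline: "((\<lambda>t. \<phi> (z - (x + t *\<^sub>R v))) has_vector_derivative - dird v \<phi> (z - (x + t *\<^sub>R v))) (at t)"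
    if "\<phi> \<in> Cc_inf" for \<phi> z t
    using dird_line_derivative[OF that, of "z - x" "-v" t UNIV] by (simp add: dird_def sum_negf algebra_simps)
  define e where "e h z = \<rho> (z - (x + (s + h) *\<^sub>R v)) - \<rho> (z - ?x) - h *\<^sub>R (- ?d (z - ?x))" for h z
  have e1: "cmod (e h z) \<le> L * h\<^sup>2 * indicator (cball ?x R) z" if "\<bar>h\<bar> \<le> 1" for h z
  proof (cases "z \<in> cball ?x R")
    case True
    have "((\<lambda>t. - ?d (z - (x + t *\<^sub>R v))) has_vector_derivative - (- ?dd (z - (x + t *\<^sub>R v)))) (at t)" for t
      by (intro has_vector_derivative_minus dline dC)
    from taylor2_bound[OF dline[OF r, of z] this, of L s h] show ?thesis
      using L(2) True by (simp add: e_def)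
  next
    case False
    then have z: "norm (z - ?x) > R" by (simp add: dist_norm norm_minus_commute)
    have "norm (z - (x + (s + h) *\<^sub>R v)) \<ge> norm (z - ?x) - norm (h *\<^sub>R v)"
      using norm_triangle_ineq2[of "z - ?x" "h *\<^sub>R v"] by (simp add: algebra_simps)
    moreover have "norm (h *\<^sub>R v) \<le> norm v" using that by (simp add: mult_left_le_one_le)
    ultimately have "norm (z - (x + (s + h) *\<^sub>R v)) > R1" using z by (simp add: R_def)
    moreover have "norm (z - ?x) > R1" "norm (z - ?x) > R2" using z norm_ge_zero[of v] unfolding R_def by linarith+
    ultimately have "e h z = 0" unfolding e_def using R1 R2 by simp
    then show ?thesis using False by simp
  qed
  have eC: "e h \<in> Cc_inf" for h
    unfolding e_def[abs_def] scaleR_conv_of_real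
    by (intro Cc_inf_diff Cc_inf_cmult Cc_inf_minus Cc_inf_shift_diff r dC)
  have e2: "(LINT z|lborel. cmod (e h z)) \<le> L * h\<^sup>2 * ?V" if "\<bar>h\<bar> \<le> 1" for h
  proof -
    have "(LINT z|lborel. cmod (e h z)) \<le> (LINT z|lborel. L * h\<^sup>2 * indicator (cball ?x R) z)"
      using e1[OF that] emeasure_lborel_cball_finite[of ?x R]
      by (intro integral_mono integrable_norm integrable_csupp Cc_inf_continuous Cc_inf_csupp eC
          integrable_mult_right integrable_real_indicator) auto
    then show ?thesis by simp
  qed
  obtain K' where f': "bdd_meas K' f" "K' \<ge> 0" using bdd_meas_mono[OF f, of "max K 0"] by auto
  have e3: "cmod (mol f \<rho> (x + (s + h) *\<^sub>R v) - mol f \<rho> ?x - h *\<^sub>R (- mol f ?d ?x)) \<le> K' * (L * h\<^sup>2 * ?V)"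
    if "\<bar>h\<bar> \<le> 1" for h
  proof -
    have i: "integrable lborel (\<lambda>z. f z * \<phi> (z - y))" if "\<phi> \<in> Cc_inf" for \<phi> y
      by (rule bdd_meas_Cc_inf_integrable[OF f Cc_inf_shift_diff[OF that]])
    have "mol f \<rho> (x + (s + h) *\<^sub>R v) - mol f \<rho> ?x - h *\<^sub>R (- mol f ?d ?x) =
        (LINT z|lborel. f z * \<rho> (z - (x + (s + h) *\<^sub>R v)) - f z * \<rho> (z - ?x) - h *\<^sub>R (- (f z * ?d (z - ?x))))"
      unfolding mol_def
      by (subst Bochner_Integration.integral_diff Bochner_Integration.integral_scaleR_right Bochner_Integration.integral_minus;
          (intro Bochner_Integration.integrable_diff integrable_scaleR_right Bochner_Integration.integrable_minus i r dC)?)+ simp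
    also have "\<dots> = (LINT z|lborel. f z * e h z)"
      by (simp add: e_def algebra_simps)
    also have "cmod \<dots> \<le> K' * (LINT z|lborel. cmod (e h z))"
      by (intro bdd_meas_integrable f' integrable_csupp Cc_inf_continuous Cc_inf_csupp eC)
    also have "\<dots> \<le> K' * (L * h\<^sup>2 * ?V)" by (intro mult_left_mono e2 that f')
    finally show ?thesis .
  qed
  have "((\<lambda>h. norm (mol f \<rho> (x + (s + h) *\<^sub>R v) - mol f \<rho> ?x - h *\<^sub>R (- mol f ?d ?x)) / norm h) \<longlongrightarrow> 0) (at 0)"
  proof (rule Lim_null_comparison)
    show "\<forall>\<^sub>F h in at 0. norm (norm (mol f \<rho> (x + (s + h) *\<^sub>R v) - mol f \<rho> ?x - h *\<^sub>R (- mol f ?d ?x)) / norm h)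
        \<le> K' * L * ?V * \<bar>h\<bar>"
      unfolding eventually_at
    proof (intro exI[of _ 1] conjI ballI impI)
      fix h :: real assume h: "h \<noteq> 0 \<and> dist h 0 < 1"
      then have "cmod (mol f \<rho> (x + (s + h) *\<^sub>R v) - mol f \<rho> ?x - h *\<^sub>R (- mol f ?d ?x)) \<le> (K' * L * ?V * \<bar>h\<bar>) * \<bar>h\<bar>"
        using e3[of h] by (simp add: ac_simps power2_eq_square abs_mult[symmetric])
      then show "norm (norm (mol f \<rho> (x + (s + h) *\<^sub>R v) - mol f \<rho> ?x - h *\<^sub>R (- mol f ?d ?x)) / norm h)
        \<le> K' * L * ?V * \<bar>h\<bar>"
        using h by (simp add: divide_le_eq)
    qed simp
    show "((\<lambda>h. K' * L * ?V * \<bar>h\<bar>) \<longlongrightarrow> 0) (at 0)"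
      by (intro tendsto_eq_intros) auto
  qed
  moreover have "bounded_linear (\<lambda>h. h *\<^sub>R (- mol f ?d ?x))" by (rule bounded_linear_scaleR_left)
  ultimately show ?thesis unfolding has_vector_derivative_def has_derivative_at by blast
qed

text \<open>The kernel enters as \<open>\<rho> (z - x)\<close>, so a derivative in \<open>x\<close>
  costs a sign; the definition of the weak derivative costs another. Altogether the derivatives of
  \<open>mol f \<rho>\<close> are the mollified weak derivatives of \<open>f\<close>.\<close>

lemma mol_weak_pd:
  assumes "weak_pd k f g" "\<rho> \<in> Cc_inf"
  shows "mol f (pd k \<rho>) x = - mol g \<rho> x"
proof -
  have "pd k (\<lambda>z. \<rho> (z - x)) = (\<lambda>z. pd k \<rho> (z - x))"
    using pd_shift(1)[of \<rho> _ "- x"] Cc_inf_differentiable[OF assms(2)] by (auto simp: fun_eq_iff)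
  then show ?thesis
    using assms(1)[unfolded weak_pd_def, rule_format, OF Cc_inf_shift_diff[OF assms(2)], of x]
    by (simp add: mol_def)
qed

lemma mollifier_exists:
  assumes d: "\<delta> > 0"
  obtains \<rho> :: "real^'n::finite \<Rightarrow> complex"
  where "\<rho> \<in> Cc_inf" "(LINT z|lborel. cmod (\<rho> z)) = 1" "(LINT z|lborel. \<rho> z) = 1"
    "\<And>z. \<rho> z \<noteq> 0 \<Longrightarrow> norm z < \<delta>"
proof -
  \<comment> \<open>The euclidean norm is at most the sum of the moduli of the coordinates, so a
    cube of this half-side fits into the ball of radius \<open>\<delta>\<close>.\<close>
  define c where "c = \<delta> / real CARD('n)"
  have c: "c > 0" using d by (simp add: c_def)
  let ?b = "box_bump (- (\<chi> k. c)) (\<chi> k. c) :: real^'n \<Rightarrow> real"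
  let ?B = "box (- (\<chi> k. c)) (\<chi> k. c) :: (real^'n) set"
  define I where "I = (LINT z|lborel. ?b z)"
  have C: "(\<lambda>z. complex_of_real (?b z)) \<in> Cc_inf" by (rule box_bump_Cc_inf)
  have "integrable lborel (\<lambda>z. complex_of_real (?b z))"
    by (intro integrable_csupp Cc_inf_continuous Cc_inf_csupp C)
  then have i: "integrable lborel ?b" using integrable_Re by fastforce
  have "I \<noteq> 0"
  proof
    assume "I = 0"
    then have "AE z in lborel. ?b z = 0"
      using integral_nonneg_eq_0_iff_AE[OF i] by (simp add: I_def box_bump_bounds)
    then have "AE z in lborel. z \<notin> ?B" by (simp add: box_bump_eq_0_iff)
    then have "emeasure lborel ?B = 0"
      by (subst (asm) AE_iff_measurable[OF _ refl]) auto
    moreover have "emeasure lborel ?B \<noteq> 0"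
    proof -
      have "0 < (\<Prod>b\<in>Basis. ((\<chi> k. c) - (- (\<chi> k. c)) :: real^'n) \<bullet> b)"
        using c by (intro prod_pos) (auto simp: Basis_vec_def inner_axis)
      moreover have "\<forall>b\<in>Basis. (- (\<chi> k. c) :: real^'n) \<bullet> b \<le> (\<chi> k. c) \<bullet> b"
        using c by (auto simp: Basis_vec_def inner_axis)
      ultimately show ?thesis by (simp add: emeasure_lborel_box_eq del: prod_zero_iff)
    qed
    ultimately show False by simp
  qed
  moreover have "I \<ge> 0" unfolding I_def by (intro integral_nonneg_AE) (auto simp: box_bump_bounds)
  ultimately have I: "I > 0" by simp
  let ?\<rho> = "\<lambda>z. complex_of_real (1 / I) * complex_of_real (?b z)"
  show ?thesis
  proof (rule that[of ?\<rho>])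
    show "?\<rho> \<in> Cc_inf" by (rule Cc_inf_cmult[OF C])
    have "(LINT z|lborel. ?\<rho> z) = complex_of_real (1 / I) * complex_of_real I"
      unfolding I_def integral_complex_of_real[symmetric] by (rule integral_mult_right_zero)
    then show "(LINT z|lborel. ?\<rho> z) = 1" using I by simp
    have "(LINT z|lborel. cmod (?\<rho> z)) = (LINT z|lborel. (1 / I) * ?b z)"
      using I by (intro Bochner_Integration.integral_cong) (auto simp: norm_mult norm_divide box_bump_bounds)
    also have "\<dots> = 1 / I * I" unfolding I_def by (rule integral_mult_right_zero)
    finally show "(LINT z|lborel. cmod (?\<rho> z)) = 1" using I by simp
    show "norm z < \<delta>" if "?\<rho> z \<noteq> 0" for z
    proof -
      have "?b z \<noteq> 0" using that by auto
      then have "\<bar>z $ k\<bar> < c" for k by (simp add: box_bump_eq_0_iff mem_box_cart abs_less_iff minus_less_iff)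
      then have "(\<Sum>k\<in>UNIV. \<bar>z $ k\<bar>) < (\<Sum>k\<in>(UNIV::'n set). c)" by (intro sum_strict_mono) auto
      then show ?thesis using norm_le_l1_cart[of z] by (simp add: c_def)
    qed
  qed
qed

lemma mol_tendsto:
  assumes f: "continuous_on UNIV f" and b: "bdd_meas K f" and r: "\<And>n. \<rho> n \<in> Cc_inf"
    and r1: "\<And>n. (LINT z|lborel. cmod (\<rho> n z)) = 1" "\<And>n. (LINT z|lborel. \<rho> n z) = 1"
    and rs: "\<And>n z. \<rho> n z \<noteq> 0 \<Longrightarrow> norm z < 1 / real (Suc n)"
  shows "(\<lambda>n. mol f (\<rho> n) x) \<longlonglongrightarrow> f x"
proof (rule LIMSEQ_I)
  fix e :: real assume e: "e > 0"
  have "isCont f x" using f by (simp add: continuous_on_eq_continuous_at)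
  then obtain d where d: "d > 0" "\<And>z. dist z x < d \<Longrightarrow> dist (f z) (f x) < e/2"
    using half_gt_zero[OF e] unfolding continuous_at_eps_delta by blast
  obtain N where N: "1 / real (Suc N) < d" using nat_approx_posE[OF d(1)] .
  have "norm (mol f (\<rho> n) x - f x) < e" if n: "n \<ge> N" for n
  proof -
    let ?r = "\<lambda>z. \<rho> n (z - x)"
    have rC: "?r \<in> Cc_inf" by (rule Cc_inf_shift_diff[OF r])
    have ri: "integrable lborel ?r" "integrable lborel (\<lambda>z. f z * ?r z)"
      by (intro integrable_csupp Cc_inf_continuous Cc_inf_csupp rC) (rule bdd_meas_Cc_inf_integrable[OF b rC])
    have cont: "continuous_on UNIV (\<rho> n)" by (rule Cc_inf_continuous[OF r])
    have "(LINT z|lborel. ?r z) = 1"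
      using lborel_integral_shift[of "\<rho> n" "- x"] cont r1 by (simp add: borel_measurable_continuous_onI)
    then have "mol f (\<rho> n) x - f x = (LINT z|lborel. f z * ?r z) - (LINT z|lborel. f x * ?r z)"
      by (simp add: mol_def)
    also have "\<dots> = (LINT z|lborel. f z * ?r z - f x * ?r z)"
      by (rule Bochner_Integration.integral_diff[symmetric]) (use ri in auto)
    finally have "norm (mol f (\<rho> n) x - f x) \<le> (LINT z|lborel. cmod (f z * ?r z - f x * ?r z))"
      by (simp only: integral_norm_bound)
    also have "\<dots> \<le> (LINT z|lborel. e/2 * cmod (?r z))"
    proof (rule integral_mono)
      show "integrable lborel (\<lambda>z. cmod (f z * ?r z - f x * ?r z))" using ri by auto
      show "integrable lborel (\<lambda>z. e/2 * cmod (?r z))" using ri by auto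
      show "cmod (f z * ?r z - f x * ?r z) \<le> e/2 * cmod (?r z)" for z
      proof (cases "?r z = 0")
        case False
        then have "norm (z - x) < 1 / real (Suc n)" by (rule rs)
        also have "\<dots> \<le> 1 / real (Suc N)" using n by (simp add: frac_le)
        finally have "dist z x < d" using N by (simp add: dist_norm)
        then have "cmod (f z - f x) \<le> e/2" using d(2)[of z] by (simp add: dist_norm)
        then show ?thesis
          unfolding left_diff_distrib[symmetric] norm_mult by (rule mult_right_mono) simp
      qed simp
    qed
    also have "\<dots> = e/2 * (LINT z|lborel. cmod (\<rho> n z))"
      using lborel_integral_shift[of "\<lambda>z. cmod (\<rho> n z)" "- x"] borel_measurable_continuous[OF cont] by simp
    also have "\<dots> < e" using e by (simp add: r1)
    finally show ?thesis .
  qed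
  then show "\<exists>no. \<forall>n\<ge>no. norm (mol f (\<rho> n) x - f x) < e" by blast
qed

text \<open>What later proofs use about a coefficient, under one constant. The quadratic Taylor
  bound is the pointwise counterpart of bounded second derivatives and feeds Oleinik's inequality;
  the bounded weak derivatives of \<open>pd k f\<close> serve the integrations by parts.\<close>

definition reg :: "real \<Rightarrow> (real^'n::finite \<Rightarrow> complex) \<Rightarrow> bool" where
  "reg K f \<longleftrightarrow> C1 f \<and> (\<forall>x. cmod (f x) \<le> K) \<and> (\<forall>k x. cmod (pd k f x) \<le> K) \<and>
    (\<forall>x v. cmod (f (x + v) - f x - (\<Sum>k\<in>UNIV. complex_of_real (v $ k) * pd k f x)) \<le> K * (norm v)\<^sup>2) \<and>
    (\<forall>j k. \<exists>g. bdd_meas K g \<and> weak_pd j (pd k f) g)"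

section \<open>From mollified functions to a classical Lipschitz gradient\<close>

lemma norm_triangle_three:
  fixes a b c :: "'a::real_normed_vector"
  shows "norm (a - b - c) \<le> norm a + norm b + norm c"
    and "norm (a - b + c) \<le> norm a + norm b + norm c"
  using norm_triangle_ineq4[of "a - b" c] norm_triangle_ineq[of "a - b" c] norm_triangle_ineq4[of a b]
  by linarith+

lemma weak_pdD:
  "weak_pd k f g \<Longrightarrow> \<phi> \<in> Cc_inf \<Longrightarrow> (LINT x|lborel. f x * pd k \<phi> x) = - (LINT x|lborel. g x * \<phi> x)"
  by (simp add: weak_pd_def)

lemma has_derivative_of_quadratic_bound:
  fixes f :: "real^'n::finite \<Rightarrow> complex"
  assumes "\<And>v. cmod (f (x + v) - f x - (\<Sum>k\<in>UNIV. complex_of_real (v $ k) * G k)) \<le> K * (norm v)\<^sup>2"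
  shows "(f has_derivative (\<lambda>v. \<Sum>k\<in>UNIV. complex_of_real (v $ k) * G k)) (at x)"
  unfolding has_derivative_at
proof
  have "linear (\<lambda>v::real^'n. \<Sum>k\<in>UNIV. complex_of_real (v $ k) * G k)"
    by (rule linearI) (simp_all add: sum.distrib algebra_simps scaleR_conv_of_real[where 'a=complex] sum_distrib_left)
  then show "bounded_linear (\<lambda>v::real^'n. \<Sum>k\<in>UNIV. complex_of_real (v $ k) * G k)"
    by (rule linear_conv_bounded_linear[THEN iffD1])
  show "((\<lambda>h. norm (f (x + h) - f x - (\<Sum>k\<in>UNIV. complex_of_real (h $ k) * G k)) / norm h) \<longlongrightarrow> 0) (at 0)"
  proof (rule Lim_null_comparison)
    show "\<forall>\<^sub>F h in at 0. norm (norm (f (x + h) - f x - (\<Sum>k\<in>UNIV. complex_of_real (h $ k) * G k)) / norm h) \<le> K * norm h"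
    proof (rule always_eventually, rule allI)
      fix h :: "real^'n"
      have "cmod (f (x + h) - f x - (\<Sum>k\<in>UNIV. complex_of_real (h $ k) * G k)) \<le> (K * norm h) * norm h"
        using assms[of h] by (simp add: power2_eq_square mult.assoc)
      moreover have "h = 0 \<or> norm h > 0" by auto
      ultimately show "norm (norm (f (x + h) - f x - (\<Sum>k\<in>UNIV. complex_of_real (h $ k) * G k)) / norm h) \<le> K * norm h"
        by (auto simp: divide_le_eq)
    qed
    show "((\<lambda>h::real^'n. K * norm h) \<longlongrightarrow> 0) (at 0)" by (intro tendsto_eq_intros) auto
  qed
qed

text \<open>Expansions at \<open>x\<close> and at \<open>x + v\<close> are compared on increments
  along the axis \<open>k\<close> of length \<open>norm v\<close>. The three remainders are
  \<open>4\<close>, \<open>1\<close> and \<open>1\<close> times \<open>K * (norm v)\<^sup>2\<close>;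
  dividing by the length gives the constant \<open>6\<close>.\<close>

lemma gradient_lipschitz_of_quadratic_bound:
  fixes f :: "real^'n::finite \<Rightarrow> complex"
  assumes T: "\<And>x v. cmod (f (x + v) - f x - (\<Sum>k\<in>UNIV. complex_of_real (v $ k) * G k x)) \<le> K * (norm v)\<^sup>2"
  shows "cmod (G k (x + v) - G k x) \<le> 6 * K * norm v"
proof (cases "v = 0")
  case False
  define t where "t = norm v"
  have t: "t > 0" using False by (simp add: t_def)
  let ?e = "t *\<^sub>R axis k 1 :: real^'n"
  let ?L = "\<lambda>v x. \<Sum>k\<in>UNIV. complex_of_real (v $ k) * G k x"
  have Le: "?L ?e x = complex_of_real t * G k x" for x
    by (subst sum.remove[of _ k]) (auto simp: axis_def intro!: sum.neutral)
  have Ladd: "?L (v + ?e) x = ?L v x + ?L ?e x" by (simp add: sum.distrib algebra_simps)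
  let ?T1 = "f (x + v + ?e) - f (x + v) - ?L ?e (x + v)"
  let ?T2 = "f (x + (v + ?e)) - f x - ?L (v + ?e) x"
  let ?T3 = "f (x + v) - f x - ?L v x"
  have "K * (norm v)\<^sup>2 \<ge> 0" using order_trans[OF norm_ge_zero T] .
  then have K: "K \<ge> 0" using t by (simp add: t_def zero_le_mult_iff)
  have "norm (v + ?e) \<le> 2 * t" using norm_triangle_ineq[of v ?e] t by (simp add: t_def)
  then have "K * (norm (v + ?e))\<^sup>2 \<le> K * (2 * t)\<^sup>2" using K by (intro mult_left_mono power_mono) auto
  then have 2: "cmod ?T2 \<le> K * (2 * t)\<^sup>2" using T[of x "v + ?e"] by linarith
  have 1: "cmod ?T1 \<le> K * t\<^sup>2" using T[of "x + v" ?e] t by simp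
  have 3: "cmod ?T3 \<le> K * t\<^sup>2" using T[of x v] by (simp add: t_def)
  have "complex_of_real t * (G k (x + v) - G k x) = ?T2 - ?T1 - ?T3"
    unfolding Ladd Le by (simp add: algebra_simps)
  then have "cmod (complex_of_real t * (G k (x + v) - G k x)) \<le> cmod ?T2 + cmod ?T1 + cmod ?T3"
    by (simp only: norm_triangle_three)
  also have "\<dots> \<le> K * (2 * t)\<^sup>2 + K * t\<^sup>2 + K * t\<^sup>2" using 1 2 3 by linarith
  also have "\<dots> = t * (6 * K * t)" by (simp add: power2_eq_square)
  finally have "t * cmod (G k (x + v) - G k x) \<le> t * (6 * K * t)"
    using t by (simp only: norm_mult norm_of_real abs_of_pos)
  then show ?thesis using t unfolding t_def[symmetric] by simp
qed simp

lemma regI: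
  fixes f :: "real^'n::finite \<Rightarrow> complex"
  assumes K: "K \<ge> 0" and f: "\<And>x. cmod (f x) \<le> K"
    and G: "\<And>k x. cmod (G k x) \<le> K"
    and T: "\<And>x v. cmod (f (x + v) - f x - (\<Sum>k\<in>UNIV. complex_of_real (v $ k) * G k x)) \<le> K * (norm v)\<^sup>2"
    and w: "\<And>k. weak_pd k f (g k)" "\<And>k j. weak_pd j (g k) (gg k j)" "\<And>k j. bdd_meas K (gg k j)"
  shows "reg K f"
proof -
  have der: "(f has_derivative (\<lambda>v. \<Sum>k\<in>UNIV. complex_of_real (v $ k) * G k x)) (at x)" for x
    by (rule has_derivative_of_quadratic_bound[OF T])
  have pd: "pd k f x = G k x" for k x
    by (rule pd_eqI[OF der, THEN trans], subst sum.remove[of _ k]) (auto simp: axis_def intro!: sum.neutral)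
  have "continuous_on UNIV (G k)" for k
  proof -
    have "isCont (G k) x" for x
      unfolding isCont_def
    proof (rule LIM_offset_zero_cancel, rule LIM_zero_cancel, rule Lim_null_comparison)
      show "\<forall>\<^sub>F v in at 0. norm (G k (x + v) - G k x) \<le> 6 * K * norm v"
        using gradient_lipschitz_of_quadratic_bound[OF T] by simp
      show "((\<lambda>v::real^'n. 6 * K * norm v) \<longlongrightarrow> 0) (at 0)" by (intro tendsto_eq_intros) auto
    qed
    then show ?thesis by (simp add: continuous_at_imp_continuous_on)
  qed
  then have C1: "C1 f" using der pd by (auto simp: C1_def differentiable_def fun_eq_iff[symmetric])
  \<comment> \<open>The classical derivative \<open>pd k f\<close> and the weak one
    \<open>g k\<close> have the same pairing with test functions, so the weak derivatives of
    \<open>g k\<close> are weak derivatives of \<open>pd k f\<close>.\<close>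
  have "weak_pd j (pd k f) (gg k j)" for j k
    unfolding weak_pd_def
  proof
    fix \<phi> :: "real^'n \<Rightarrow> complex" assume p: "\<phi> \<in> Cc_inf"
    have "(LINT x|lborel. f x * pd k (pd j \<phi>) x) = - (LINT x|lborel. pd k f x * pd j \<phi> x)"
      using p by (intro integration_by_parts C1 smooth_C1 Cc_inf_smooth Cc_inf_pd disjI2 Cc_inf_csupp)
    moreover have "(LINT x|lborel. f x * pd k (pd j \<phi>) x) = - (LINT x|lborel. g k x * pd j \<phi> x)"
      by (rule weak_pdD[OF w(1) Cc_inf_pd[OF p]])
    ultimately show "(LINT x|lborel. pd k f x * pd j \<phi> x) = - (LINT x|lborel. gg k j x * \<phi> x)"
      using weak_pdD[OF w(2) p] by simp
  qed
  then have "\<exists>g. bdd_meas K g \<and> weak_pd j (pd k f) g" for j k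
    using w(3)[of k j] by (intro exI[of _ "gg k j"] conjI)
  then show ?thesis unfolding reg_def using C1 f G T by (simp add: pd)
qed

text \<open>The mollified functions satisfy a quadratic Taylor bound uniformly in \<open>n\<close>,
  because their second derivatives are averages of the bounded weak ones. Combined with pointwise
  convergence of the functions, this forces the mollified gradients to converge, and the bound
  survives in the limit.\<close>

theorem W2inf_reg:
  fixes f :: "real^'n::finite \<Rightarrow> complex"
  assumes f: "f \<in> W2inf"
  shows "\<exists>K. reg K f"
proof -
  have cont: "continuous_on UNIV f" and fL: "f \<in> Linf" and "\<forall>k. \<exists>g. g \<in> Linf \<and> weak_pd k f g \<and> (\<forall>j. \<exists>h\<in>Linf. weak_pd j g h)"
    using f by (auto simp: W2inf_def numeral_2_eq_2)
  then obtain g where g: "\<And>k. g k \<in> Linf" "\<And>k. weak_pd k f (g k)"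
      "\<And>k. \<forall>j. \<exists>h\<in>Linf. weak_pd j (g k) h"
    by metis
  then obtain gg where gg: "\<And>k j. gg k j \<in> Linf" "\<And>k j. weak_pd j (g k) (gg k j)" by metis
  obtain Kf where Kf: "bdd_meas Kf f" using Linf_bdd_meas[OF fL] by blast
  obtain Kg where Kg: "\<And>k. bdd_meas (Kg k) (g k)" using Linf_bdd_meas[OF g(1)] by metis
  obtain Kh where Kh: "\<And>k j. bdd_meas (Kh k j) (gg k j)" using Linf_bdd_meas[OF gg(1)] by metis
  define K where "K = \<bar>Kf\<bar> + (\<Sum>k\<in>UNIV. \<bar>Kg k\<bar>) + (\<Sum>k\<in>UNIV. \<Sum>j\<in>UNIV. \<bar>Kh k j\<bar>)"
  have s1: "Kg k \<le> (\<Sum>k\<in>UNIV. \<bar>Kg k\<bar>)" for k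
    by (rule order_trans[OF abs_ge_self member_le_sum[of k UNIV "\<lambda>k. \<bar>Kg k\<bar>"]]) auto
  have s2: "Kh k j \<le> (\<Sum>k\<in>UNIV. \<Sum>j\<in>UNIV. \<bar>Kh k j\<bar>)" for k j
  proof -
    have "\<bar>Kh k j\<bar> \<le> (\<Sum>j\<in>UNIV. \<bar>Kh k j\<bar>)" by (rule member_le_sum) auto
    also have "\<dots> \<le> (\<Sum>k\<in>UNIV. \<Sum>j\<in>UNIV. \<bar>Kh k j\<bar>)"
      by (rule member_le_sum) (auto intro: sum_nonneg)
    finally show ?thesis by simp
  qed
  have s3: "0 \<le> (\<Sum>k\<in>UNIV. \<bar>Kg k\<bar>)" "0 \<le> (\<Sum>k\<in>UNIV. \<Sum>j\<in>UNIV. \<bar>Kh k j\<bar>)" by (intro sum_nonneg; simp)+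
  have K: "K \<ge> 0" using s3 unfolding K_def by linarith
  have Kle: "Kf \<le> K" "Kg k \<le> K" "Kh k j \<le> K" for k j
    using s3 s1[of k] s2[of k j] unfolding K_def by linarith+
  note B = bdd_meas_mono[OF Kf Kle(1)] bdd_meas_mono[OF Kg Kle(2)] bdd_meas_mono[OF Kh Kle(3)]
  have "\<exists>\<rho> :: real^'n \<Rightarrow> complex. \<rho> \<in> Cc_inf \<and> (LINT z|lborel. cmod (\<rho> z)) = 1 \<and> (LINT z|lborel. \<rho> z) = 1 \<and>
      (\<forall>z. \<rho> z \<noteq> 0 \<longrightarrow> norm z < 1 / real (Suc n))" for n
    using mollifier_exists[of "1 / real (Suc n)"] by (metis of_nat_0_less_iff zero_less_Suc zero_less_divide_1_iff)
  then obtain \<rho> :: "nat \<Rightarrow> real^'n \<Rightarrow> complex" where r: "\<And>n. \<rho> n \<in> Cc_inf"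
    "\<And>n. (LINT z|lborel. cmod (\<rho> n z)) = 1" "\<And>n. (LINT z|lborel. \<rho> n z) = 1"
    "\<And>n z. \<rho> n z \<noteq> 0 \<Longrightarrow> norm z < 1 / real (Suc n)" by metis
  have lim: "(\<lambda>n. mol f (\<rho> n) x) \<longlonglongrightarrow> f x" for x
    by (rule mol_tendsto[OF cont Kf r]) assumption
  have mb: "cmod (mol h (\<rho> n) x) \<le> K" if "bdd_meas K h" for h n x
    using mol_bound[OF that r(1), of n x] r(2) by simp
  define d where "d = real CARD('n)"
  \<comment> \<open>The second derivative along \<open>v\<close> is a double sum of
    \<open>d\<^sup>2\<close> terms, each at most \<open>K * (norm v)\<^sup>2\<close>.\<close>
  define K1 where "K1 = K * d\<^sup>2"
  have "d \<ge> 1" by (simp add: d_def Suc_le_eq)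
  then have K1: "K \<le> K1" "K1 \<ge> 0" using K by (auto simp: K1_def mult_le_cancel_left1 one_le_power)
  have Tn: "cmod (mol f (\<rho> n) (x + v) - mol f (\<rho> n) x - (\<Sum>k\<in>UNIV. complex_of_real (v $ k) * mol (g k) (\<rho> n) x))
      \<le> K1 * (norm v)\<^sup>2" for n x v
  proof -
    have 1: "mol h (dird v \<phi>) y = - (\<Sum>k\<in>UNIV. complex_of_real (v $ k) * mol (h' k) \<phi> y)"
      if "bdd_meas K h" "\<phi> \<in> Cc_inf" "\<And>k. weak_pd k h (h' k)" for h h' \<phi> y
      unfolding dird_def
      by (subst mol_linear[OF that(1)]) (auto simp: mol_weak_pd[OF that(3,2)] sum_negf intro: Cc_inf_pd that)
    let ?\<psi>'' = "\<lambda>s. mol f (dird v (dird v (\<rho> n))) (x + s *\<^sub>R v)"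
    have d1: "((\<lambda>s. mol f (\<rho> n) (x + s *\<^sub>R v)) has_vector_derivative - mol f (dird v (\<rho> n)) (x + s *\<^sub>R v)) (at s)" for s
      by (rule mol_line_derivative[OF Kf r(1)])
    have d2: "((\<lambda>s. - mol f (dird v (\<rho> n)) (x + s *\<^sub>R v)) has_vector_derivative - (- ?\<psi>'' s)) (at s)" for s
      by (intro has_vector_derivative_minus mol_line_derivative[OF Kf] dird_Cc_inf r)
    have d3: "norm (- (- ?\<psi>'' s)) \<le> K1 * (norm v)\<^sup>2" for s
    proof -
      let ?y = "x + s *\<^sub>R v"
      have "?\<psi>'' s = - (\<Sum>k\<in>UNIV. complex_of_real (v $ k) * mol (g k) (dird v (\<rho> n)) ?y)"
        by (rule 1[OF B(1) dird_Cc_inf[OF r(1)] g(2)])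
      also have "\<dots> = (\<Sum>k\<in>UNIV. \<Sum>j\<in>UNIV. complex_of_real (v $ k * v $ j) * mol (gg k j) (\<rho> n) ?y)"
      proof -
        have "mol (g k) (dird v (\<rho> n)) ?y = - (\<Sum>j\<in>UNIV. complex_of_real (v $ j) * mol (gg k j) (\<rho> n) ?y)" for k
          by (rule 1[OF B(2) r(1) gg(2)])
        then show ?thesis by (simp add: sum_negf sum_distrib_left mult.assoc)
      qed
      also have "cmod \<dots> \<le> (\<Sum>k\<in>UNIV. \<Sum>j\<in>UNIV. cmod (complex_of_real (v $ k * v $ j) * mol (gg k j) (\<rho> n) ?y))"
        by (intro order_trans[OF norm_sum] sum_mono norm_sum)
      also have "\<dots> \<le> (\<Sum>k\<in>(UNIV::'n set). \<Sum>j\<in>(UNIV::'n set). (norm v * norm v) * K)"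
        unfolding norm_mult norm_of_real abs_mult
        by (intro sum_mono mult_mono mb B component_le_norm_cart) (auto simp: K)
      finally show ?thesis by (simp add: K1_def d_def power2_eq_square ac_simps)
    qed
    have "cmod (mol f (\<rho> n) (x + (0 + 1) *\<^sub>R v) - mol f (\<rho> n) (x + 0 *\<^sub>R v) - 1 *\<^sub>R (- mol f (dird v (\<rho> n)) (x + 0 *\<^sub>R v)))
      \<le> K1 * (norm v)\<^sup>2 * 1\<^sup>2"
      by (rule taylor2_bound[OF d1 d2 d3])
    moreover have "mol f (dird v (\<rho> n)) x = - (\<Sum>k\<in>UNIV. complex_of_real (v $ k) * mol (g k) (\<rho> n) x)"
      by (rule 1[OF B(1) r(1) g(2)])
    ultimately show ?thesis by simp
  qed
  have "\<exists>l. (\<lambda>n. mol (g k) (\<rho> n) x) \<longlonglongrightarrow> l" for k x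
  proof -
    let ?a = "\<lambda>n. mol (g k) (\<rho> n) x" and ?F = "\<lambda>n. mol f (\<rho> n)"
    have "Cauchy ?a"
    proof (rule metric_CauchyI)
      fix e :: real assume e: "e > 0"
      \<comment> \<open>The increments over a step \<open>t\<close> converge, and the Taylor errors
        contribute \<open>2 * K1 * t\<close> to the difference of two gradients; this choice keeps
        that below half of \<open>e\<close>.\<close>
      define t where "t = e / (4 * (K1 + 1))"
      have t: "t > 0" "4 * K1 * t < e" using e K1 by (auto simp: t_def field_simps)
      let ?e = "t *\<^sub>R axis k 1 :: real^'n"
      have L: "(\<Sum>j\<in>UNIV. complex_of_real (?e $ j) * mol (g j) (\<rho> n) x) = complex_of_real t * ?a n" for n
        by (subst sum.remove[of _ k]) (auto simp: axis_def intro!: sum.neutral)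
      have Te: "cmod (?F n (x + ?e) - ?F n x - complex_of_real t * ?a n) \<le> K1 * t\<^sup>2" for n
        using Tn[of n x ?e] t unfolding L by simp
      have "Cauchy (\<lambda>n. ?F n (x + ?e) - ?F n x)"
        using tendsto_diff[OF lim lim] by (rule LIMSEQ_imp_Cauchy)
      moreover have "e * t / 2 > 0" using e t by simp
      ultimately obtain N where N: "\<And>m n. m \<ge> N \<Longrightarrow> n \<ge> N \<Longrightarrow>
          cmod ((?F m (x + ?e) - ?F m x) - (?F n (x + ?e) - ?F n x)) < e * t / 2"
        unfolding Cauchy_iff by blast
      have "dist (?a m) (?a n) < e" if "m \<ge> N" "n \<ge> N" for m n
      proof -
        let ?D = "\<lambda>n. ?F n (x + ?e) - ?F n x"
        have "complex_of_real t * (?a m - ?a n) =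
            (?D m - ?D n) - (?D m - complex_of_real t * ?a m) + (?D n - complex_of_real t * ?a n)"
          by (simp add: algebra_simps)
        then have "cmod (complex_of_real t * (?a m - ?a n)) \<le> cmod (?D m - ?D n)
            + cmod (?D m - complex_of_real t * ?a m) + cmod (?D n - complex_of_real t * ?a n)"
          by (simp only: norm_triangle_three)
        also have "\<dots> < e * t / 2 + K1 * t\<^sup>2 + K1 * t\<^sup>2"
          using N[OF that] Te[of m] Te[of n] by linarith
        also have "\<dots> = t * (e / 2 + 2 * K1 * t)" by (simp add: power2_eq_square algebra_simps)
        finally have "t * cmod (?a m - ?a n) < t * (e / 2 + 2 * K1 * t)"
          using t by (simp only: norm_mult norm_of_real abs_of_pos)
        then have "cmod (?a m - ?a n) < e / 2 + 2 * K1 * t" using t by simp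
        then show ?thesis using t by (simp add: dist_norm)
      qed
      then show "\<exists>M. \<forall>m\<ge>M. \<forall>n\<ge>M. dist (?a m) (?a n) < e" by blast
    qed
    then show ?thesis using Cauchy_convergent_iff convergent_def by blast
  qed
  then obtain G where G: "\<And>k x. (\<lambda>n. mol (g k) (\<rho> n) x) \<longlonglongrightarrow> G k x" by metis
  have "reg K1 f"
  proof (rule regI[OF K1(2) _ _ _ g(2) gg(2)])
    show "cmod (f x) \<le> K1" for x
      by (rule Lim_bounded[OF tendsto_norm[OF lim]]) (use mb[OF B(1)] K1 in \<open>auto intro: order_trans\<close>)
    show "cmod (G k x) \<le> K1" for k x
      by (rule Lim_bounded[OF tendsto_norm[OF G]]) (use mb[OF B(2)] K1 in \<open>auto intro: order_trans\<close>)
    show "cmod (f (x + v) - f x - (\<Sum>k\<in>UNIV. complex_of_real (v $ k) * G k x)) \<le> K1 * (norm v)\<^sup>2" for x v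
      by (rule Lim_bounded[where f="\<lambda>n. cmod (mol f (\<rho> n) (x + v) - mol f (\<rho> n) x
            - (\<Sum>k\<in>UNIV. complex_of_real (v $ k) * mol (g k) (\<rho> n) x))" and M=0])
         (auto intro!: tendsto_intros lim G Tn)
    show "bdd_meas K1 (gg k j)" for k j by (rule bdd_meas_mono[OF B(3) K1(1)])
  qed
  then show ?thesis by blast
qed

section \<open>Algebraic operations on regular coefficients\<close>

lemma regD:
  assumes "reg K f"
  shows "C1 f" "cmod (f x) \<le> K" "cmod (pd k f x) \<le> K"
    "cmod (f (x + v) - f x - (\<Sum>k\<in>UNIV. complex_of_real (v $ k) * pd k f x)) \<le> K * (norm v)\<^sup>2"
    "\<exists>g. bdd_meas K g \<and> weak_pd j (pd k f) g" "bdd_meas K f" "bdd_meas K (pd k f)" "K \<ge> 0"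
  using assms order_trans[OF norm_ge_zero, of "f x" K]
  by (auto simp: reg_def bdd_meas_def intro!: borel_measurable_continuous_onI C1_continuous C1_pd_continuous)

lemma reg_mono:
  assumes f: "reg K f" and "K \<le> K'" shows "reg K' f"
proof -
  note r = regD[OF f]
  have "K * (norm v)\<^sup>2 \<le> K' * (norm v)\<^sup>2" for v :: "real^'a"
    using assms(2) by (intro mult_right_mono) auto
  then have "cmod (f (x + v) - f x - (\<Sum>k\<in>UNIV. complex_of_real (v $ k) * pd k f x)) \<le> K' * (norm v)\<^sup>2" for x v
    using order_trans r(4) by blast
  moreover have "cmod (f x) \<le> K'" "cmod (pd k f x) \<le> K'" for k x
    using order_trans[OF r(2) assms(2)] order_trans[OF r(3) assms(2)] by auto
  moreover have "\<exists>g. bdd_meas K' g \<and> weak_pd j (pd k f) g" for j k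
    using r(5)[of j k] bdd_meas_mono[OF _ assms(2)] by blast
  ultimately show ?thesis unfolding reg_def using r(1) by blast
qed

lemma bdd_meas_add: "bdd_meas K f \<Longrightarrow> bdd_meas K' g \<Longrightarrow> bdd_meas (K + K') (\<lambda>x. f x + g x)"
  unfolding bdd_meas_def by (auto intro: norm_triangle_mono)

lemma bdd_meas_cmult: "bdd_meas K f \<Longrightarrow> bdd_meas (cmod c * K) (\<lambda>x. c * f x)"
  unfolding bdd_meas_def by (auto simp: norm_mult mult_left_mono)

lemma bdd_meas_cnj: "bdd_meas K f \<Longrightarrow> bdd_meas K (\<lambda>x. cnj (f x))"
  unfolding bdd_meas_def by auto

lemma reg_add:
  assumes f: "reg K f" and g: "reg K' g" shows "reg (K + K') (\<lambda>x. f x + g x)"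
proof -
  note F = regD[OF f] and G = regD[OF g]
  have pd: "pd k (\<lambda>x. f x + g x) = (\<lambda>x. pd k f x + pd k g x)" for k
    by (intro ext pd_add C1_differentiable F G)
  have "cmod (f (x + v) + g (x + v) - (f x + g x) - (\<Sum>k\<in>UNIV. complex_of_real (v $ k) * (pd k f x + pd k g x)))
      \<le> (K + K') * (norm v)\<^sup>2" for x v
    using norm_triangle_mono[OF F(4)[of x v] G(4)[of x v]]
    by (simp add: algebra_simps sum.distrib)
  moreover have "\<exists>h. bdd_meas (K + K') h \<and> weak_pd j (\<lambda>x. pd k f x + pd k g x) h" for j k
  proof -
    obtain h1 h2 where h: "bdd_meas K h1" "weak_pd j (pd k f) h1" "bdd_meas K' h2" "weak_pd j (pd k g) h2"
      using F(5) G(5) by metis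
    have "weak_pd j (\<lambda>x. pd k f x + pd k g x) (\<lambda>x. h1 x + h2 x)"
      unfolding weak_pd_def
      using h weak_pdD[OF h(2)] weak_pdD[OF h(4)]
      by (simp add: distrib_right bdd_meas_Cc_inf_integrable[OF h(1)] bdd_meas_Cc_inf_integrable[OF h(3)]
          bdd_meas_Cc_inf_integrable[OF F(7) Cc_inf_pd] bdd_meas_Cc_inf_integrable[OF G(7) Cc_inf_pd])
    then show ?thesis using bdd_meas_add[OF h(1,3)] by blast
  qed
  ultimately show ?thesis
    unfolding reg_def pd using F G by (auto intro!: C1_add norm_triangle_mono)
qed

lemma reg_cmult:
  assumes f: "reg K f" shows "reg (cmod c * K) (\<lambda>x. c * f x)"
proof -
  note F = regD[OF f]
  have pd: "pd k (\<lambda>x. c * f x) = (\<lambda>x. c * pd k f x)" for k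
    using C1_pd_mult[OF smooth_C1[OF smooth_const] F(1), of k c] by simp
  have "cmod (c * f (x + v) - c * f x - (\<Sum>k\<in>UNIV. complex_of_real (v $ k) * (c * pd k f x)))
      \<le> cmod c * K * (norm v)\<^sup>2" for x v
  proof -
    have "c * f (x + v) - c * f x - (\<Sum>k\<in>UNIV. complex_of_real (v $ k) * (c * pd k f x))
      = c * (f (x + v) - f x - (\<Sum>k\<in>UNIV. complex_of_real (v $ k) * pd k f x))"
      by (simp add: right_diff_distrib sum_distrib_left mult.left_commute)
    then show ?thesis using F(4)[of x v] by (simp add: norm_mult mult.assoc mult_left_mono)
  qed
  moreover have "\<exists>h. bdd_meas (cmod c * K) h \<and> weak_pd j (\<lambda>x. c * pd k f x) h" for j k
  proof -
    obtain h where h: "bdd_meas K h" "weak_pd j (pd k f) h" using F(5) by metis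
    have "weak_pd j (\<lambda>x. c * pd k f x) (\<lambda>x. c * h x)"
      unfolding weak_pd_def using weak_pdD[OF h(2)] by (simp add: mult.assoc)
    then show ?thesis using bdd_meas_cmult[OF h(1)] by blast
  qed
  ultimately show ?thesis
    unfolding reg_def pd using F C1_mult[OF smooth_C1[OF smooth_const] F(1)]
    by (auto intro!: mult_left_mono simp: norm_mult)
qed

lemma reg_cnj:
  assumes f: "reg K f" shows "reg K (\<lambda>x. cnj (f x))"
proof -
  note F = regD[OF f]
  have pd: "pd k (\<lambda>x. cnj (f x)) = (\<lambda>x. cnj (pd k f x))" for k
    by (intro ext pd_cnj C1_differentiable F)
  have "cmod (cnj (f (x + v)) - cnj (f x) - (\<Sum>k\<in>UNIV. complex_of_real (v $ k) * cnj (pd k f x)))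
      \<le> K * (norm v)\<^sup>2" for x v
  proof -
    have "cnj (f (x + v)) - cnj (f x) - (\<Sum>k\<in>UNIV. complex_of_real (v $ k) * cnj (pd k f x))
      = cnj (f (x + v) - f x - (\<Sum>k\<in>UNIV. complex_of_real (v $ k) * pd k f x))"
      by (simp add: cnj_sum)
    then show ?thesis using F(4)[of x v] by (simp only: complex_mod_cnj)
  qed
  moreover have "\<exists>h. bdd_meas K h \<and> weak_pd j (\<lambda>x. cnj (pd k f x)) h" for j k
  proof -
    obtain h where h: "bdd_meas K h" "weak_pd j (pd k f) h" using F(5) by metis
    have "weak_pd j (\<lambda>x. cnj (pd k f x)) (\<lambda>x. cnj (h x))"
      unfolding weak_pd_def
    proof
      fix \<phi> :: "real^'a \<Rightarrow> complex" assume p: "\<phi> \<in> Cc_inf"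
      have "pd j (\<lambda>x. cnj (\<phi> x)) = (\<lambda>x. cnj (pd j \<phi> x))"
        by (intro ext pd_cnj Cc_inf_differentiable p)
      then have "(LINT x|lborel. pd k f x * cnj (pd j \<phi> x)) = - (LINT x|lborel. h x * cnj (\<phi> x))"
        using weak_pdD[OF h(2) Cc_inf_cnj[OF p]] by simp
      then have "cnj (LINT x|lborel. pd k f x * cnj (pd j \<phi> x)) = cnj (- (LINT x|lborel. h x * cnj (\<phi> x)))"
        by (rule arg_cong)
      then show "(LINT x|lborel. cnj (pd k f x) * pd j \<phi> x) = - (LINT x|lborel. cnj (h x) * \<phi> x)"
        by (simp add: Bochner_Integration.integral_cnj[symmetric] del: Bochner_Integration.integral_cnj)
    qed
    then show ?thesis using bdd_meas_cnj[OF h(1)] by blast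
  qed
  ultimately show ?thesis
    unfolding reg_def pd using F by (auto intro!: C1_cnj)
qed

section \<open>The range of \<open>1 - \<Delta>\<close> on test functions\<close>

lemma interval_square_bound:
  fixes F G :: "real \<Rightarrow> complex"
  assumes h: "h > 0" and c: "continuous_on {0..h} G" and F0: "F 0 = 0"
    and d: "\<And>s. 0 \<le> s \<Longrightarrow> s \<le> h \<Longrightarrow> (F has_vector_derivative G s) (at s within {0..h})"
  shows "(cmod (F h))\<^sup>2 \<le> h * (LINT s|lborel. indicator {0..h} s * (cmod (G s))\<^sup>2)"
    and "integrable lborel (\<lambda>s. indicator {0..h} s * (cmod (G s))\<^sup>2)"
proof -
  let ?i = "indicator {0..h} :: real \<Rightarrow> real"
  have i: "integrable lborel (\<lambda>s. ?i s * g s)" if "continuous_on {0..h} g" for g :: "real \<Rightarrow> real"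
    using borel_integrable_atLeastAtMost'[OF that] by (simp add: set_integrable_def)
  show i2: "integrable lborel (\<lambda>s. ?i s * (cmod (G s))\<^sup>2)"
    by (intro i continuous_intros c)
  have i1: "integrable lborel (\<lambda>s. ?i s * cmod (G s))" and i0: "integrable lborel (\<lambda>s. ?i s * a)" for a
    by (intro i continuous_intros c)+
  \<comment> \<open>The mean slope. Integrating
    \<open>2 * a * cmod (G s) \<le> (cmod (G s))\<^sup>2 + a\<^sup>2\<close> over the interval
    yields the Cauchy-Schwarz bound with the optimal constant, since equality holds for constant
    \<open>G\<close>.\<close>
  define a where "a = cmod (F h) / h"
  let ?I = "LINT s|lborel. ?i s * (cmod (G s))\<^sup>2"
  have "(LINT s|lborel. ?i s *\<^sub>R G s) = F h - F 0"
    using h by (intro integral_FTC_Icc c d) auto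
  then have "cmod (F h) = cmod (LINT s|lborel. ?i s *\<^sub>R G s)" by (simp add: F0)
  also have "\<dots> \<le> (LINT s|lborel. cmod (?i s *\<^sub>R G s))" by (rule integral_norm_bound)
  also have "\<dots> = (LINT s|lborel. ?i s * cmod (G s))" by simp
  finally have "2 * a * cmod (F h) \<le> 2 * a * (LINT s|lborel. ?i s * cmod (G s))"
    using h by (intro mult_left_mono) (auto simp: a_def)
  also have "\<dots> = (LINT s|lborel. 2 * a * (?i s * cmod (G s)))" by simp
  also have "\<dots> \<le> (LINT s|lborel. ?i s * (cmod (G s))\<^sup>2 + ?i s * a\<^sup>2)"
  proof (rule integral_mono)
    show "2 * a * (?i s * cmod (G s)) \<le> ?i s * (cmod (G s))\<^sup>2 + ?i s * a\<^sup>2" for s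
      using sum_squares_bound[of a "cmod (G s)"] by (simp add: indicator_def)
  qed (intro integrable_mult_right Bochner_Integration.integrable_add i0 i1 i2)+
  also have "\<dots> = ?I + a\<^sup>2 * h"
    using h by (simp add: i2 i0)
  finally have "2 * (cmod (F h))\<^sup>2 / h \<le> ?I + (cmod (F h))\<^sup>2 / h"
    using h by (simp add: a_def power2_eq_square)
  then have "(cmod (F h))\<^sup>2 / h \<le> ?I" by (simp add: field_simps)
  then show "(cmod (F h))\<^sup>2 \<le> h * ?I" using h by (simp add: divide_le_eq mult.commute)
qed

text \<open>An integral form of Minkowski's inequality: the Cauchy-Schwarz bound in \<open>s\<close>
  is integrated over \<open>x\<close>, and exchanging the two integrals of nonnegative functions
  leaves only the norms of the slices \<open>G s\<close>.\<close>

lemma l2_norm_le_of_derivative: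
  fixes F G :: "real \<Rightarrow> real^'n::finite \<Rightarrow> complex"
  assumes h: "h > 0" and c: "continuous_on UNIV (\<lambda>p. G (snd p) (fst p))" and F0: "\<And>x. F 0 x = 0"
    and d: "\<And>s x. 0 \<le> s \<Longrightarrow> s \<le> h \<Longrightarrow> ((\<lambda>s. F s x) has_vector_derivative G s x) (at s within {0..h})"
    and FL: "F h \<in> L2" and GL: "\<And>s. 0 \<le> s \<Longrightarrow> s \<le> h \<Longrightarrow> G s \<in> L2"
    and M: "\<And>s. 0 \<le> s \<Longrightarrow> s \<le> h \<Longrightarrow> l2_norm (G s) \<le> M"
  shows "l2_norm (F h) \<le> h * M"
proof -
  have M0: "M \<ge> 0" using M[of 0] h l2_norm_nonneg[of "G 0"] by linarith
  let ?i = "indicator {0..h} :: real \<Rightarrow> real"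
  have Gm: "(\<lambda>p. G (snd p) (fst p)) \<in> borel_measurable (lborel \<Otimes>\<^sub>M lborel)"
    using c by (simp add: lborel_prod borel_measurable_continuous_onI)
  then have m: "case_prod (\<lambda>x s. ennreal (h * (?i s * (cmod (G s x))\<^sup>2))) \<in> borel_measurable (lborel \<Otimes>\<^sub>M lborel)"
    by (simp add: split_beta')
  have cs: "continuous_on S (\<lambda>s. G s x)" for x S
    using continuous_on_compose2[OF c, of S "\<lambda>s. (x, s)"]
      continuous_on_Pair[OF continuous_on_const continuous_on_id, of S x] by simp
  have sq: "ennreal ((l2_norm f)\<^sup>2) = (\<integral>\<^sup>+x. ennreal ((cmod (f x))\<^sup>2) \<partial>lborel)" if "f \<in> L2" for f :: "real^'n \<Rightarrow> complex"
    unfolding l2_norm_sq using L2_integrable[OF that] by (simp add: nn_integral_eq_integral)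
  have "ennreal ((l2_norm (F h))\<^sup>2) = (\<integral>\<^sup>+x. ennreal ((cmod (F h x))\<^sup>2) \<partial>lborel)" by (rule sq[OF FL])
  also have "\<dots> \<le> (\<integral>\<^sup>+x. \<integral>\<^sup>+s. ennreal (h * (?i s * (cmod (G s x))\<^sup>2)) \<partial>lborel \<partial>lborel)"
  proof (rule nn_integral_mono)
    fix x
    note b = interval_square_bound[OF h cs F0 d, of x]
    have "ennreal ((cmod (F h x))\<^sup>2) \<le> ennreal (LINT s|lborel. h * (?i s * (cmod (G s x))\<^sup>2))"
      using b(1) by (intro ennreal_leI) simp
    also have "\<dots> = (\<integral>\<^sup>+s. ennreal (h * (?i s * (cmod (G s x))\<^sup>2)) \<partial>lborel)"
      using h by (intro nn_integral_eq_integral[symmetric] integrable_mult_right b(2)) auto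
    finally show "ennreal ((cmod (F h x))\<^sup>2) \<le> (\<integral>\<^sup>+s. ennreal (h * (?i s * (cmod (G s x))\<^sup>2)) \<partial>lborel)" .
  qed
  also have "\<dots> = (\<integral>\<^sup>+s. \<integral>\<^sup>+x. ennreal (h * (?i s * (cmod (G s x))\<^sup>2)) \<partial>lborel \<partial>lborel)"
    by (rule lborel_pair.Fubini'[OF m, symmetric])
  also have "\<dots> \<le> (\<integral>\<^sup>+s. ennreal (h * M\<^sup>2) * indicator {0..h} s \<partial>lborel)"
  proof (rule nn_integral_mono)
    fix s :: real
    show "(\<integral>\<^sup>+x. ennreal (h * (?i s * (cmod (G s x))\<^sup>2)) \<partial>lborel) \<le> ennreal (h * M\<^sup>2) * indicator {0..h} s"
    proof (cases "s \<in> {0..h}")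
      case True
      then have "(\<integral>\<^sup>+x. ennreal (h * (?i s * (cmod (G s x))\<^sup>2)) \<partial>lborel) = ennreal h * ennreal ((l2_norm (G s))\<^sup>2)"
        using h L2_measurable[OF GL, of s] by (subst sq[OF GL]) (auto simp: ennreal_mult nn_integral_cmult)
      also have "\<dots> \<le> ennreal h * ennreal (M\<^sup>2)"
        using True by (intro mult_left_mono ennreal_leI power_mono M) auto
      finally show ?thesis using True h by (simp add: ennreal_mult)
    qed simp
  qed
  also have "\<dots> = ennreal (h * M\<^sup>2) * ennreal h" using h by (simp add: nn_integral_cmult)
  also have "\<dots> = ennreal (h * M\<^sup>2 * h)" using h by (intro ennreal_mult[symmetric]) auto
  also have "h * M\<^sup>2 * h = (h * M)\<^sup>2" by (simp add: power2_eq_square)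
  finally have "(l2_norm (F h))\<^sup>2 \<le> (h * M)\<^sup>2" by (simp add: ennreal_le_iff)
  then show ?thesis by (rule power2_le_imp_le) (use h M0 in simp)
qed

text \<open>As a function of the step, the second difference minus its leading term vanishes at zero
  together with its first two derivatives. The bound is integrated up from the third derivative of
  \<open>u\<close>: each integration costs a factor \<open>h\<close>, and the factor
  \<open>2\<close> counts the two translates.\<close>

lemma second_difference_l2:
  fixes u :: "real^'n::finite \<Rightarrow> complex" and k :: 'n
  assumes u: "u \<in> Cc_inf" and h: "h > 0"
  defines "e \<equiv> axis k 1"
  shows "l2_norm (\<lambda>x. u (x + h *\<^sub>R e) + u (x + (- h) *\<^sub>R e) - 2 * u x - complex_of_real (h\<^sup>2) * pd k (pd k u) x)
    \<le> 2 * h ^ 3 * l2_norm (pd k (pd k (pd k u)))"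
proof -
  define u1 where "u1 = pd k u"
  define u2 where "u2 = pd k u1"
  define u3 where "u3 = pd k u2"
  have C: "u1 \<in> Cc_inf" "u2 \<in> Cc_inf" "u3 \<in> Cc_inf"
    unfolding u1_def u2_def u3_def by (intro Cc_inf_pd u)+
  have T: "(\<lambda>x. w (x + s *\<^sub>R e)) \<in> L2" "l2_norm (\<lambda>x. w (x + s *\<^sub>R e)) = l2_norm w" if "w \<in> Cc_inf" for w s
    by (intro L2_shift l2_norm_shift Cc_inf_L2 that)+
  have cont: "continuous_on UNIV (\<lambda>p. w (fst p + (c * snd p) *\<^sub>R e))" if "w \<in> Cc_inf" for w c
    by (rule continuous_on_compose2[OF Cc_inf_continuous[OF that, of UNIV]]) (auto intro!: continuous_intros)
  have cont1: "continuous_on UNIV (\<lambda>p. w (fst p))" if "w \<in> Cc_inf" for w :: "real^'n \<Rightarrow> complex"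
    by (rule continuous_on_compose2[OF Cc_inf_continuous[OF that, of UNIV]]) (auto intro!: continuous_intros)
  have dp: "((\<lambda>s. w (x + s *\<^sub>R e)) has_vector_derivative pd k w (x + s *\<^sub>R e)) (at s within S)"
    if "w \<in> Cc_inf" for w x s S
    unfolding e_def by (intro axis_line_derivative Cc_inf_differentiable that)
  have dm: "((\<lambda>s. w (x + (- s) *\<^sub>R e)) has_vector_derivative - pd k w (x + (- s) *\<^sub>R e)) (at s within S)"
    if "w \<in> Cc_inf" for w x s S
  proof -
    have "((\<lambda>s. w (x + s *\<^sub>R e)) has_vector_derivative pd k w (x + (- s) *\<^sub>R e)) (at (- s) within uminus ` S)"
      by (rule dp[OF that])
    moreover have "((\<lambda>s. - s) has_vector_derivative - 1) (at s within S)" by (auto intro!: derivative_eq_intros)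
    ultimately show ?thesis
      using vector_diff_chain_within[of uminus "-1" s S "\<lambda>s. w (x + s *\<^sub>R e)"] by (simp add: o_def)
  qed
  have d1: "((\<lambda>s. complex_of_real s * c) has_vector_derivative c) (at s within S)" for c s S
    by (auto intro!: derivative_eq_intros simp: has_vector_derivative_def scaleR_conv_of_real)
  have d2: "((\<lambda>s. complex_of_real (s\<^sup>2) * c) has_vector_derivative complex_of_real (2 * s) * c) (at s within S)" for c s S
    by (auto intro!: derivative_eq_intros simp: has_vector_derivative_def scaleR_conv_of_real algebra_simps)
  have L: "w \<in> Cc_inf \<Longrightarrow> w \<in> L2" for w :: "real^'n \<Rightarrow> complex" by (rule Cc_inf_L2)
  define D2 where "D2 s x = u2 (x + s *\<^sub>R e) + u2 (x + (- s) *\<^sub>R e) - 2 * u2 x" for s x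
  define D1 where "D1 s x = u1 (x + s *\<^sub>R e) - u1 (x + (- s) *\<^sub>R e) - complex_of_real s * (2 * u2 x)" for s x
  define D0 where "D0 s x = u (x + s *\<^sub>R e) + u (x + (- s) *\<^sub>R e) - 2 * u x - complex_of_real (s\<^sup>2) * u2 x" for s x
  have D_L2: "D2 s \<in> L2" "D1 s \<in> L2" "D0 s \<in> L2" for s
    unfolding D2_def[abs_def] D1_def[abs_def] D0_def[abs_def]
    by (intro L2_diff L2_add L2_cmult T L C u)+
  have D_zero: "D2 0 x = 0" "D1 0 x = 0" "D0 0 x = 0" for x
    by (simp_all add: D2_def D1_def D0_def)
  have D2b: "l2_norm (D2 s) \<le> s * (2 * l2_norm u3)" if s: "s > 0" for s
  proof (rule l2_norm_le_of_derivative[OF s, of "\<lambda>t x. u3 (x + t *\<^sub>R e) - u3 (x + (- t) *\<^sub>R e)"])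
    show "continuous_on UNIV (\<lambda>p. u3 (fst p + snd p *\<^sub>R e) - u3 (fst p + (- snd p) *\<^sub>R e))"
      using cont[OF C(3), of 1] cont[OF C(3), of "-1"] by (auto intro: continuous_on_diff)
    show "((\<lambda>s. D2 s x) has_vector_derivative u3 (x + t *\<^sub>R e) - u3 (x + (- t) *\<^sub>R e)) (at t within {0..s})" for t x
      unfolding D2_def u3_def using dp[OF C(2)] dm[OF C(2)]
      by (auto intro!: derivative_eq_intros)
    show "l2_norm (\<lambda>x. u3 (x + t *\<^sub>R e) - u3 (x + (- t) *\<^sub>R e)) \<le> 2 * l2_norm u3" for t
      using l2_norm_triangle_diff[OF T(1)[OF C(3), of t] T(1)[OF C(3), of "- t"]]
      by (simp only: T(2)[OF C(3)])
    show "(\<lambda>x. u3 (x + t *\<^sub>R e) - u3 (x + (- t) *\<^sub>R e)) \<in> L2" for t by (intro L2_diff T C)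
  qed (simp_all add: D_zero D_L2)
  have D1b: "l2_norm (D1 s) \<le> s * (s * (2 * l2_norm u3))" if s: "s > 0" for s
  proof (rule l2_norm_le_of_derivative[OF s, of D2])
    show "continuous_on UNIV (\<lambda>p. D2 (snd p) (fst p))"
      unfolding D2_def using cont[OF C(2), of 1] cont[OF C(2), of "-1"] cont1[OF C(2)]
      by (auto intro!: continuous_intros)
    show "((\<lambda>s. D1 s x) has_vector_derivative D2 t x) (at t within {0..s})" for t x
    proof -
      have "((\<lambda>s. D1 s x) has_vector_derivative pd k u1 (x + t *\<^sub>R e) - (- pd k u1 (x + (- t) *\<^sub>R e)) - 2 * u2 x) (at t within {0..s})"
        unfolding D1_def by (intro has_vector_derivative_diff dp dm d1 C)
      then show ?thesis by (simp add: D2_def u2_def)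
    qed
    show "l2_norm (D2 t) \<le> s * (2 * l2_norm u3)" if "0 \<le> t" "t \<le> s" for t
    proof (cases "t = 0")
      case True
      then have "D2 t = (\<lambda>x. 0)" by (auto simp: D_zero)
      then show ?thesis using s by simp
    next
      case False
      then have "l2_norm (D2 t) \<le> t * (2 * l2_norm u3)" using that by (intro D2b) auto
      also have "\<dots> \<le> s * (2 * l2_norm u3)" using that by (intro mult_right_mono) auto
      finally show ?thesis .
    qed
  qed (auto simp: D_zero intro!: D_L2)
  have "l2_norm (D0 h) \<le> h * (h * (h * (2 * l2_norm u3)))"
  proof (rule l2_norm_le_of_derivative[OF h, of D1])
    show "continuous_on UNIV (\<lambda>p. D1 (snd p) (fst p))"
      unfolding D1_def using cont[OF C(1), of 1] cont[OF C(1), of "-1"] cont1[OF C(2)]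
      by (auto intro!: continuous_intros)
    show "((\<lambda>s. D0 s x) has_vector_derivative D1 t x) (at t within {0..h})" for t x
    proof -
      have "((\<lambda>s. D0 s x) has_vector_derivative pd k u (x + t *\<^sub>R e) + (- pd k u (x + (- t) *\<^sub>R e)) - 0 - complex_of_real (2 * t) * u2 x) (at t within {0..h})"
        unfolding D0_def by (intro has_vector_derivative_diff has_vector_derivative_add has_vector_derivative_const dp dm d2 u)
      then show ?thesis by (simp add: D1_def u1_def ac_simps)
    qed
    show "l2_norm (D1 t) \<le> h * (h * (2 * l2_norm u3))" if "0 \<le> t" "t \<le> h" for t
    proof (cases "t = 0")
      case True
      then have "D1 t = (\<lambda>x. 0)" by (auto simp: D_zero)
      then show ?thesis using h by simp
    next
      case False
      then have "l2_norm (D1 t) \<le> t * (t * (2 * l2_norm u3))" using that by (intro D1b) auto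
      also have "\<dots> \<le> h * (h * (2 * l2_norm u3))" using that by (intro mult_mono) auto
      finally show ?thesis .
    qed
  qed (auto simp: D_zero intro!: D_L2)
  then show ?thesis
    unfolding D0_def u3_def u2_def u1_def by (simp add: power3_eq_cube ac_simps)
qed

section \<open>A finite-difference approximation of the resolvent of the Laplacian\<close>

definition lap :: "(real^'n::finite \<Rightarrow> complex) \<Rightarrow> real^'n \<Rightarrow> complex" where
  "lap u x = (\<Sum>k\<in>UNIV. pd k (pd k u) x)"

lemma lap_Cc_inf: "u \<in> Cc_inf \<Longrightarrow> lap u \<in> Cc_inf"
  unfolding lap_def[abs_def] by (intro Cc_inf_sum Cc_inf_pd)

definition nbr_sum :: "real \<Rightarrow> (real^'n::finite \<Rightarrow> complex) \<Rightarrow> real^'n \<Rightarrow> complex" where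
  "nbr_sum h u x = (\<Sum>k\<in>UNIV. u (x + h *\<^sub>R axis k 1) + u (x + (- h) *\<^sub>R axis k 1))"

lemma nbr_sum_Cc_inf: "u \<in> Cc_inf \<Longrightarrow> nbr_sum h u \<in> Cc_inf"
  unfolding nbr_sum_def[abs_def] by (intro Cc_inf_sum Cc_inf_add Cc_inf_shift)

lemma nbr_sum_L2: "u \<in> L2 \<Longrightarrow> nbr_sum h u \<in> L2"
  unfolding nbr_sum_def[abs_def] by (intro L2_sum L2_add L2_shift)

lemma nbr_sum_norm:
  fixes u :: "real^'n::finite \<Rightarrow> complex"
  assumes "u \<in> L2" shows "l2_norm (nbr_sum h u) \<le> 2 * real CARD('n) * l2_norm u"
proof -
  have "l2_norm (nbr_sum h u) \<le> (\<Sum>k\<in>(UNIV::'n set). l2_norm (\<lambda>x. u (x + h *\<^sub>R axis k 1) + u (x + (- h) *\<^sub>R axis k 1)))"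
    unfolding nbr_sum_def[abs_def] by (intro l2_norm_sum L2_add L2_shift assms)
  also have "\<dots> \<le> (\<Sum>k\<in>(UNIV::'n set). l2_norm u + l2_norm u)"
  proof (rule sum_mono)
    fix k :: 'n
    show "l2_norm (\<lambda>x. u (x + h *\<^sub>R axis k 1) + u (x + (- h) *\<^sub>R axis k 1)) \<le> l2_norm u + l2_norm u"
      using l2_norm_triangle[OF L2_shift[OF assms] L2_shift[OF assms], of "h *\<^sub>R axis k 1" "(- h) *\<^sub>R axis k 1"]
      by (simp only: l2_norm_shift[OF assms])
  qed
  also have "\<dots> = 2 * real CARD('n) * l2_norm u" by simp
  finally show ?thesis .
qed

lemma nbr_sum_pd: "u \<in> Cc_inf \<Longrightarrow> pd j (nbr_sum h u) = nbr_sum h (pd j u)"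
proof
  fix x assume u: "u \<in> Cc_inf"
  have "pd j (nbr_sum h u) x = (\<Sum>k\<in>UNIV. pd j (\<lambda>x. u (x + h *\<^sub>R axis k 1) + u (x + (- h) *\<^sub>R axis k 1)) x)"
    unfolding nbr_sum_def[abs_def] by (intro pd_sum Cc_inf_differentiable Cc_inf_add Cc_inf_shift u)
  also have "\<dots> = (\<Sum>k\<in>UNIV. pd j (\<lambda>x. u (x + h *\<^sub>R axis k 1)) x + pd j (\<lambda>x. u (x + (- h) *\<^sub>R axis k 1)) x)"
    by (intro sum.cong refl pd_add Cc_inf_differentiable Cc_inf_shift u)
  also have "\<dots> = nbr_sum h (pd j u) x"
    unfolding nbr_sum_def by (simp only: pd_shift(1)[OF Cc_inf_differentiable[OF u]])
  finally show "pd j (nbr_sum h u) x = nbr_sum h (pd j u) x" .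
qed

lemma nbr_sum_diff: "nbr_sum h (\<lambda>x. u x - v x) = (\<lambda>x. nbr_sum h u x - nbr_sum h v x)"
  by (simp add: nbr_sum_def fun_eq_iff sum_subtractf[symmetric] algebra_simps)

text \<open>Picard iteration for the finite-difference equation
  \<open>u - h\<^sup>-\<^sup>2 (nbr_sum h u - 2 d u) = f\<close>; it commutes with partial derivatives and does not increase
  the norm, so that derivatives of the iterates are bounded uniformly in \<open>h\<close>.\<close>

primrec fd_iter :: "real \<Rightarrow> (real^'n::finite \<Rightarrow> complex) \<Rightarrow> nat \<Rightarrow> real^'n \<Rightarrow> complex" where
  "fd_iter h f 0 = (\<lambda>x. 0)"
| "fd_iter h f (Suc n) = (\<lambda>x. complex_of_real (1 / (h\<^sup>2 + 2 * real CARD('n))) *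
      (complex_of_real (h\<^sup>2) * f x + nbr_sum h (fd_iter h f n) x))"

lemma fd_iter_Cc_inf: "f \<in> Cc_inf \<Longrightarrow> fd_iter h f n \<in> Cc_inf"
proof (induction n)
  case (Suc n)
  then show ?case unfolding fd_iter.simps by (intro Cc_inf_cmult Cc_inf_add nbr_sum_Cc_inf)
qed (simp add: Cc_inf_0)

lemma pd_cmult: "f differentiable (at x) \<Longrightarrow> pd k (\<lambda>x. c * f x :: complex) x = c * pd k f x"
  by (rule pd_bounded_linear[OF bounded_linear_mult_right])

lemma fd_iter_pd: "f \<in> Cc_inf \<Longrightarrow> pd k (fd_iter h f n) = fd_iter h (pd k f) n"
proof (induction n)
  case (Suc n)
  note C = fd_iter_Cc_inf[OF Suc(2)]
  have "pd k (fd_iter h f (Suc n)) = (\<lambda>x. complex_of_real (1 / (h\<^sup>2 + 2 * real CARD('a))) *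
      (complex_of_real (h\<^sup>2) * pd k f x + pd k (nbr_sum h (fd_iter h f n)) x))"
  proof
    fix x
    have "pd k (fd_iter h f (Suc n)) x = complex_of_real (1 / (h\<^sup>2 + 2 * real CARD('a))) *
      pd k (\<lambda>x. complex_of_real (h\<^sup>2) * f x + nbr_sum h (fd_iter h f n) x) x"
      unfolding fd_iter.simps
      by (intro pd_cmult Cc_inf_differentiable Cc_inf_add Cc_inf_cmult nbr_sum_Cc_inf C Suc)
    also have "pd k (\<lambda>x. complex_of_real (h\<^sup>2) * f x + nbr_sum h (fd_iter h f n) x) x =
       pd k (\<lambda>x. complex_of_real (h\<^sup>2) * f x) x + pd k (nbr_sum h (fd_iter h f n)) x"
      by (intro pd_add Cc_inf_differentiable Cc_inf_cmult nbr_sum_Cc_inf C Suc)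
    also have "pd k (\<lambda>x. complex_of_real (h\<^sup>2) * f x) x = complex_of_real (h\<^sup>2) * pd k f x"
      by (intro pd_cmult Cc_inf_differentiable Suc)
    finally show "pd k (fd_iter h f (Suc n)) x = complex_of_real (1 / (h\<^sup>2 + 2 * real CARD('a))) *
      (complex_of_real (h\<^sup>2) * pd k f x + pd k (nbr_sum h (fd_iter h f n)) x)" .
  qed
  then show ?case using Suc by (simp add: nbr_sum_pd[OF C])
qed simp

text \<open>The iteration is an average: the weight \<open>h\<^sup>2\<close> of \<open>f\<close> and
  the weights \<open>1\<close> of the \<open>2 * CARD('n)\<close> neighbours add up to the
  denominator, and translations preserve the norm.\<close>

lemma fd_iter_norm:
  fixes f :: "real^'n::finite \<Rightarrow> complex"
  assumes f: "f \<in> Cc_inf" shows "l2_norm (fd_iter h f n) \<le> l2_norm f"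
proof (induction n)
  case (Suc n)
  let ?d = "real CARD('n)"
  have d: "?d > 0" by simp
  have D: "h\<^sup>2 + 2 * ?d > 0" by (rule add_nonneg_pos) auto
  have L: "fd_iter h f n \<in> L2" "f \<in> L2" using f by (auto intro: Cc_inf_L2 fd_iter_Cc_inf)
  have "l2_norm (fd_iter h f (Suc n)) = 1 / (h\<^sup>2 + 2 * ?d) *
      l2_norm (\<lambda>x. complex_of_real (h\<^sup>2) * f x + nbr_sum h (fd_iter h f n) x)"
    unfolding fd_iter.simps l2_norm_cmult norm_of_real using D by simp
  also have "\<dots> \<le> 1 / (h\<^sup>2 + 2 * ?d) * (h\<^sup>2 * l2_norm f + 2 * ?d * l2_norm f)"
  proof (rule mult_left_mono)
    have "l2_norm (\<lambda>x. complex_of_real (h\<^sup>2) * f x + nbr_sum h (fd_iter h f n) x)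
      \<le> l2_norm (\<lambda>x. complex_of_real (h\<^sup>2) * f x) + l2_norm (nbr_sum h (fd_iter h f n))"
      by (intro l2_norm_triangle L2_cmult nbr_sum_L2 L)
    also have "l2_norm (\<lambda>x. complex_of_real (h\<^sup>2) * f x) = h\<^sup>2 * l2_norm f"
      unfolding l2_norm_cmult norm_of_real by simp
    also have "l2_norm (nbr_sum h (fd_iter h f n)) \<le> 2 * ?d * l2_norm (fd_iter h f n)"
      by (rule nbr_sum_norm[OF L(1)])
    also have "\<dots> \<le> 2 * ?d * l2_norm f" by (intro mult_left_mono Suc) auto
    finally show "l2_norm (\<lambda>x. complex_of_real (h\<^sup>2) * f x + nbr_sum h (fd_iter h f n) x)
      \<le> h\<^sup>2 * l2_norm f + 2 * ?d * l2_norm f" by simp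
  qed (use D in simp)
  also have "\<dots> = l2_norm f"
    using D unfolding distrib_right[symmetric] by simp
  finally show ?case .
qed simp

text \<open>The contribution of \<open>f\<close> cancels in the difference of two iterates; the
  neighbour sum divided by the denominator has norm at most \<open>q\<close>, which is below
  \<open>1\<close> for \<open>h \<noteq> 0\<close>.\<close>

lemma fd_iter_step_norm:
  fixes f :: "real^'n::finite \<Rightarrow> complex" and h :: real
  assumes f: "f \<in> Cc_inf"
  defines "q \<equiv> 2 * real CARD('n) / (h\<^sup>2 + 2 * real CARD('n))"
  shows "l2_norm (\<lambda>x. fd_iter h f (Suc n) x - fd_iter h f n x) \<le> q ^ n * l2_norm f"
proof (induction n)
  case 0
  then show ?case using fd_iter_norm[OF f, of h "Suc 0"] by simp
next
  case (Suc n)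
  let ?d = "real CARD('n)" and ?U = "fd_iter h f"
  have D: "h\<^sup>2 + 2 * ?d > 0" by (rule add_nonneg_pos) auto
  have L: "(\<lambda>x. ?U (Suc n) x - ?U n x) \<in> L2" by (intro L2_diff Cc_inf_L2 fd_iter_Cc_inf f)
  have "(\<lambda>x. ?U (Suc (Suc n)) x - ?U (Suc n) x) =
      (\<lambda>x. complex_of_real (1 / (h\<^sup>2 + 2 * ?d)) * nbr_sum h (\<lambda>x. ?U (Suc n) x - ?U n x) x)"
    unfolding nbr_sum_diff fd_iter.simps(2)[of h f "Suc n"] fd_iter.simps(2)[of h f n]
    by (simp only: right_diff_distrib distrib_left fun_eq_iff) simp
  then have "l2_norm (\<lambda>x. ?U (Suc (Suc n)) x - ?U (Suc n) x) =
      1 / (h\<^sup>2 + 2 * ?d) * l2_norm (nbr_sum h (\<lambda>x. ?U (Suc n) x - ?U n x))"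
    using D by (simp only: l2_norm_cmult norm_of_real) simp
  also have "\<dots> \<le> 1 / (h\<^sup>2 + 2 * ?d) * (2 * ?d * l2_norm (\<lambda>x. ?U (Suc n) x - ?U n x))"
    using D by (intro mult_left_mono nbr_sum_norm L) auto
  also have "\<dots> = q * l2_norm (\<lambda>x. ?U (Suc n) x - ?U n x)" by (simp add: q_def)
  also have "\<dots> \<le> q * (q ^ n * l2_norm f)" using D by (intro mult_left_mono Suc) (auto simp: q_def)
  finally show ?case by simp
qed

text \<open>An iterate is still a test function, a property that the exact solution of the
  difference equation need not have. Two errors arise: the iteration defect, of order
  \<open>q ^ n / h\<^sup>2\<close>, and the discretisation error, at most \<open>2 * h * M\<close>
  with \<open>M\<close> depending only on \<open>f\<close>.\<close>

lemma one_minus_lap_approx: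
  fixes f :: "real^'n::finite \<Rightarrow> complex"
  assumes f: "f \<in> Cc_inf" and e: "\<epsilon> > 0"
  shows "\<exists>u\<in>Cc_inf. l2_norm (\<lambda>x. f x - (u x - lap u x)) < \<epsilon>"
proof -
  let ?d = "real CARD('n)"
  define M where "M = (\<Sum>k\<in>(UNIV::'n set). l2_norm (pd k (pd k (pd k f))))"
  have M: "M \<ge> 0" unfolding M_def by (intro sum_nonneg) auto
  \<comment> \<open>Fixed before \<open>n\<close>: the discretisation error stays below three
    quarters of \<open>\<epsilon>\<close>, and the number of iterations may then depend on
    \<open>h\<close>, whose inverse square multiplies the iteration defect.\<close>
  define h where "h = \<epsilon> / (4 * (M + 1))"
  have h: "h > 0" "2 * h * M < \<epsilon> / 2 + \<epsilon> / 4" using e M by (auto simp: h_def field_simps add_strict_increasing)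
  define q where "q = 2 * ?d / (h\<^sup>2 + 2 * ?d)"
  have q: "0 \<le> q" "q < 1" using h by (auto simp: q_def field_simps add_pos_pos)
  let ?U = "fd_iter h f"
  have "(\<lambda>n. 2 * ?d / h\<^sup>2 * (q ^ n * l2_norm f)) \<longlonglongrightarrow> 2 * ?d / h\<^sup>2 * (0 * l2_norm f)"
    using q by (intro tendsto_mult tendsto_const LIMSEQ_realpow_zero)
  then have "\<forall>\<^sub>F n in sequentially. 2 * ?d / h\<^sup>2 * (q ^ n * l2_norm f) < \<epsilon> / 4"
    by (rule order_tendstoD(2)) (use e in simp)
  then obtain n where n: "2 * ?d / h\<^sup>2 * (q ^ n * l2_norm f) < \<epsilon> / 4" by (auto simp: eventually_sequentially)
  define u where "u = ?U (Suc n)"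
  define w where "w x = u x - ?U n x" for x
  have uC: "u \<in> Cc_inf" unfolding u_def by (rule fd_iter_Cc_inf[OF f])
  have wL: "w \<in> L2" unfolding w_def[abs_def] u_def by (intro L2_diff Cc_inf_L2 fd_iter_Cc_inf f)
  define D where "D k x = u (x + h *\<^sub>R axis k 1) + u (x + (- h) *\<^sub>R axis k 1) - 2 * u x - complex_of_real (h\<^sup>2) * pd k (pd k u) x" for k x
  have DL: "D k \<in> L2" for k unfolding D_def[abs_def]
    by (intro L2_diff L2_add L2_cmult L2_shift Cc_inf_L2 Cc_inf_pd uC)
  have sumD: "(\<Sum>k\<in>UNIV. D k x) = nbr_sum h u x - 2 * complex_of_real ?d * u x - complex_of_real (h\<^sup>2) * lap u x" for x
    by (simp add: D_def nbr_sum_def lap_def sum_subtractf sum.distrib sum_distrib_left)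
  have c0: "complex_of_real (h\<^sup>2) \<noteq> 0" using h by simp
  \<comment> \<open>The recursion multiplied by its denominator shows that the residual consists of
    the failure \<open>w\<close> of the iterate to be a fixed point, spread over the neighbours, and
    of the consistency errors \<open>D k\<close>.\<close>
  have eq: "f x - (u x - lap u x) = complex_of_real (1 / h\<^sup>2) * (nbr_sum h w x - (\<Sum>k\<in>UNIV. D k x))" for x
  proof -
    have "complex_of_real (h\<^sup>2 + 2 * ?d) \<noteq> 0"
      using h by (simp only: of_real_eq_0_iff) (metis add_nonneg_pos less_numeral_extra(3) mult_pos_pos of_nat_0_less_iff zero_le_power2 zero_less_card_finite zero_less_numeral)
    then have "complex_of_real (h\<^sup>2 + 2 * ?d) * u x = complex_of_real (h\<^sup>2) * f x + nbr_sum h (?U n) x"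
      unfolding u_def by (simp del: of_real_add of_real_power of_real_mult)
    moreover have "nbr_sum h w x = nbr_sum h u x - nbr_sum h (?U n) x"
      unfolding w_def[abs_def] nbr_sum_diff by simp
    ultimately have "complex_of_real (h\<^sup>2) * (f x - (u x - lap u x)) = nbr_sum h w x - (\<Sum>k\<in>UNIV. D k x)"
      unfolding sumD by (simp add: algebra_simps)
    then show ?thesis using c0 by (simp add: field_simps)
  qed
  have "l2_norm (\<lambda>x. f x - (u x - lap u x)) = 1 / h\<^sup>2 * l2_norm (\<lambda>x. nbr_sum h w x - (\<Sum>k\<in>UNIV. D k x))"
    unfolding eq l2_norm_cmult norm_of_real by simp
  also have "\<dots> \<le> 1 / h\<^sup>2 * (2 * ?d * (q ^ n * l2_norm f) + 2 * h ^ 3 * M)"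
  proof (rule mult_left_mono)
    have "l2_norm (\<lambda>x. nbr_sum h w x - (\<Sum>k\<in>UNIV. D k x)) \<le> l2_norm (nbr_sum h w) + l2_norm (\<lambda>x. \<Sum>k\<in>UNIV. D k x)"
      by (intro l2_norm_triangle_diff nbr_sum_L2 wL L2_sum DL)
    also have "l2_norm (nbr_sum h w) \<le> 2 * ?d * l2_norm w" by (rule nbr_sum_norm[OF wL])
    also have "l2_norm w \<le> q ^ n * l2_norm f"
      unfolding w_def[abs_def] u_def q_def by (rule fd_iter_step_norm[OF f])
    also have "l2_norm (\<lambda>x. \<Sum>k\<in>UNIV. D k x) \<le> (\<Sum>k\<in>UNIV. l2_norm (D k))" by (intro l2_norm_sum DL)
    also have "\<dots> \<le> (\<Sum>k\<in>UNIV. 2 * h ^ 3 * l2_norm (pd k (pd k (pd k f))))"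
    proof (rule sum_mono)
      fix k :: 'n
      have "l2_norm (D k) \<le> 2 * h ^ 3 * l2_norm (pd k (pd k (pd k u)))"
        unfolding D_def by (rule second_difference_l2[OF uC h(1)])
      also have "pd k (pd k (pd k u)) = fd_iter h (pd k (pd k (pd k f))) (Suc n)"
        unfolding u_def by (simp only: fd_iter_pd f Cc_inf_pd)
      also have "l2_norm \<dots> \<le> l2_norm (pd k (pd k (pd k f)))" by (intro fd_iter_norm Cc_inf_pd f)
      finally show "l2_norm (D k) \<le> 2 * h ^ 3 * l2_norm (pd k (pd k (pd k f)))" using h by simp
    qed
    also have "\<dots> = 2 * h ^ 3 * M" by (simp add: M_def sum_distrib_left)
    finally show "l2_norm (\<lambda>x. nbr_sum h w x - (\<Sum>k\<in>UNIV. D k x)) \<le> 2 * ?d * (q ^ n * l2_norm f) + 2 * h ^ 3 * M"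
      by simp
  qed simp
  also have "\<dots> = 2 * ?d / h\<^sup>2 * (q ^ n * l2_norm f) + 2 * h * M"
    using h by (simp add: field_simps power2_eq_square power3_eq_cube)
  also have "\<dots> < \<epsilon>" using n h by linarith
  finally show ?thesis using uC by blast
qed

theorem one_minus_lap_dense:
  assumes f: "f \<in> L2" and e: "\<epsilon> > 0"
  obtains u where "u \<in> Cc_inf" "l2_norm (\<lambda>x. f x - (u x - lap u x)) < \<epsilon>"
proof -
  obtain v where v: "v \<in> Cc_inf" "l2_norm (\<lambda>x. f x - v x) < \<epsilon> / 2"
    using Cc_inf_dense_L2[OF f half_gt_zero[OF e]] .
  obtain u where u: "u \<in> Cc_inf" "l2_norm (\<lambda>x. v x - (u x - lap u x)) < \<epsilon> / 2"
    using one_minus_lap_approx[OF v(1) half_gt_zero[OF e]] by blast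
  have "l2_norm (\<lambda>x. f x - (u x - lap u x)) \<le> l2_norm (\<lambda>x. f x - v x) + l2_norm (\<lambda>x. v x - (u x - lap u x))"
    by (intro l2_norm_triangle_via f Cc_inf_L2 v L2_diff lap_Cc_inf u)
  then show ?thesis using u v that by fastforce
qed

section \<open>Symmetric matrices and the inequality of Oleinik\<close>

text \<open>Induction on the dimension: a maximiser of \<open>f x \<bullet> x\<close> on the unit
  sphere of \<open>S\<close> is an eigenvector, and its orthogonal complement in \<open>S\<close> is
  again invariant.\<close>

lemma self_adjoint_orthonormal_eigenbasis:
  fixes f :: "'a::euclidean_space \<Rightarrow> 'a"
  assumes f: "linear f" and sym: "\<And>x y. f x \<bullet> y = x \<bullet> f y"
    and S: "subspace S" "f ` S \<subseteq> S"
  shows "\<exists>B. B \<subseteq> S \<and> pairwise orthogonal B \<and> (\<forall>b\<in>B. norm b = 1 \<and> f b = (f b \<bullet> b) *\<^sub>R b) \<and> span B = S"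
  using S
proof (induction "dim S" arbitrary: S rule: less_induct)
  case less
  interpret f: linear f by (rule f)
  show ?case
  proof (cases "S \<subseteq> {0}")
    case True
    then have "S = {0}" using less(2) subspace_0 by fastforce
    then show ?thesis by (intro exI[of _ "{}"]) auto
  next
    case False
    let ?C = "S \<inter> sphere 0 1"
    obtain z where z: "z \<in> S" "z \<noteq> 0" using False by auto
    have "(1 / norm z) *\<^sub>R z \<in> ?C" using z less(2) by (simp add: subspace_scale)
    then have ne: "?C \<noteq> {}" by blast
    have "compact ?C" 
      using closed_Int_compact[OF closed_subspace[OF less(2)] compact_sphere] .
    moreover have "continuous_on ?C f"
      using f by (intro linear_continuous_on) (simp add: linear_conv_bounded_linear)
    then have "continuous_on ?C (\<lambda>x. f x \<bullet> x)" by (rule continuous_on_inner[OF _ continuous_on_id])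
    ultimately obtain b where b: "b \<in> ?C" "\<And>y. y \<in> ?C \<Longrightarrow> f y \<bullet> y \<le> f b \<bullet> b"
      using continuous_attains_sup[OF _ ne, of "\<lambda>x. f x \<bullet> x"] by blast
    have bS: "b \<in> S" and b1: "norm b = 1" "b \<bullet> b = 1" using b(1) by (auto simp: norm_eq_1)
    define m where "m = f b \<bullet> b"
    have max: "f y \<bullet> y \<le> m * (norm y)\<^sup>2" if "y \<in> S" for y
    proof (cases "y = 0")
      case False
      have "(1 / norm y) *\<^sub>R y \<in> ?C" using that False less(2) by (simp add: subspace_scale)
      from b(2)[OF this] have "(f y \<bullet> y) / (norm y)\<^sup>2 \<le> m"
        by (simp add: f.scale m_def power2_eq_square)
      then show ?thesis using False by (simp add: divide_le_eq)
    qed (simp add: f.zero)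
    have orth: "f b \<bullet> y = 0" if y: "y \<in> S" "y \<bullet> b = 0" for y
    proof (rule ccontr)
      define c where "c = f b \<bullet> y"
      assume "f b \<bullet> y \<noteq> 0"
      then have c: "c \<noteq> 0" by (simp add: c_def)
      \<comment> \<open>A positive majorant of the coefficient of \<open>t\<^sup>2\<close> below; at
        \<open>t = c / D\<close> the linear term outweighs the quadratic one, which is impossible at
        a maximiser unless \<open>c = 0\<close>.\<close>
      define D where "D = \<bar>m * (norm y)\<^sup>2 - f y \<bullet> y\<bar> + 1"
      have D: "D > 0" by (simp add: D_def)
      have le: "2 * t * c \<le> t\<^sup>2 * (m * (norm y)\<^sup>2 - f y \<bullet> y)" for t
      proof -
        have "b + t *\<^sub>R y \<in> S" using bS y less(2) by (simp add: subspace_add subspace_scale)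
        from max[OF this] have "f (b + t *\<^sub>R y) \<bullet> (b + t *\<^sub>R y) \<le> m * ((b + t *\<^sub>R y) \<bullet> (b + t *\<^sub>R y))"
          by (simp add: power2_norm_eq_inner)
        moreover have "f y \<bullet> b = c" using sym[of y b] by (simp add: c_def inner_commute)
        ultimately show ?thesis unfolding power2_norm_eq_inner[of y]
          using y(2) b1 by (simp add: f.add f.scale inner_simps inner_commute[of b y] m_def[symmetric] c_def[symmetric]
              power2_eq_square algebra_simps)
      qed
      have "2 * (c / D) * c \<le> (c / D)\<^sup>2 * (m * (norm y)\<^sup>2 - f y \<bullet> y)" by (rule le)
      also have "\<dots> \<le> (c / D)\<^sup>2 * D" by (intro mult_left_mono) (auto simp: D_def)
      finally have "2 * c\<^sup>2 / D \<le> c\<^sup>2 / D" using D by (simp add: power2_eq_square)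
      then show False using D c by (simp add: divide_le_cancel)
    qed
    have eig: "f b = m *\<^sub>R b"
    proof -
      let ?y = "f b - m *\<^sub>R b"
      have "?y \<in> S" using less(2,3) bS by (auto intro: subspace_diff subspace_scale)
      moreover have yb: "?y \<bullet> b = 0" using b1 by (simp add: inner_simps m_def)
      ultimately have "f b \<bullet> ?y = 0" by (rule orth)
      then have "?y \<bullet> ?y = 0" using yb by (simp add: inner_diff_left inner_commute)
      then show ?thesis by simp
    qed
    let ?S = "{x \<in> S. x \<bullet> b = 0}"
    have sub: "subspace ?S" using less(2) unfolding subspace_def by (auto simp: inner_simps)
    have inv: "f ` ?S \<subseteq> ?S"
    proof
      fix y assume "y \<in> f ` ?S"
      then obtain x where x: "x \<in> S" "x \<bullet> b = 0" "y = f x" by auto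
      have "f x \<bullet> b = x \<bullet> (m *\<^sub>R b)" by (simp only: sym eig)
      then show "y \<in> ?S" using x less(3) by auto
    qed
    have "dim ?S < dim S"
    proof (rule dim_psubset)
      have "b \<notin> ?S" using b1 by simp
      then have "?S \<subset> S" using bS by blast
      then show "span ?S \<subset> span S" using less(2) sub by (simp only: span_eq_iff[THEN iffD2])
    qed
    from less(1)[OF this sub inv] obtain B where B: "B \<subseteq> ?S" "pairwise orthogonal B"
      "\<forall>b\<in>B. norm b = 1 \<and> f b = (f b \<bullet> b) *\<^sub>R b" "span B = ?S" by blast
    show ?thesis
    proof (intro exI[of _ "insert b B"] conjI)
      show "insert b B \<subseteq> S" using B(1) bS by auto
      show "pairwise orthogonal (insert b B)"
        using B(1,2) by (auto simp: pairwise_insert orthogonal_def inner_commute)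
      show "\<forall>b\<in>insert b B. norm b = 1 \<and> f b = (f b \<bullet> b) *\<^sub>R b" using B(3) b1 eig m_def by auto
      show "span (insert b B) = S"
      proof
        show "span (insert b B) \<subseteq> S" using B(1) bS less(2) by (intro span_minimal) auto
        show "S \<subseteq> span (insert b B)"
        proof
          fix x assume x: "x \<in> S"
          have "x - (x \<bullet> b) *\<^sub>R b \<in> ?S"
            using x bS b1 less(2) by (auto intro: subspace_diff subspace_scale simp: inner_simps)
          then have "x - (x \<bullet> b) *\<^sub>R b \<in> span (insert b B)" using B(4) span_mono[of B "insert b B"] by auto
          moreover have "(x \<bullet> b) *\<^sub>R b \<in> span (insert b B)" by (simp add: span_base span_scale)
          ultimately show "x \<in> span (insert b B)" using span_add by fastforce
        qed
      qed
    qed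
  qed
qed

lemma symmetric_matrix_spectral:
  fixes U :: "real^'n::finite^'n"
  assumes sym: "\<And>k l. U $ k $ l = U $ l $ k"
  obtains B \<mu> where "finite B" "card B \<le> CARD('n)" "\<And>v w. v \<in> B \<Longrightarrow> w \<in> B \<Longrightarrow> v \<bullet> w = (if v = w then 1 else 0)"
    "\<And>k l. U $ k $ l = (\<Sum>v\<in>B. \<mu> v * v $ k * v $ l)"
proof -
  have s: "(U *v x) \<bullet> y = x \<bullet> (U *v y)" for x y
    using sym by (simp add: dot_lmul_matrix[symmetric] matrix_vector_mult_def vector_matrix_mult_def vec_eq_iff inner_vec_def
      sum_distrib_left sum_distrib_right) (subst sum.swap, simp add: ac_simps)
  obtain B where B: "pairwise orthogonal B" "\<forall>b\<in>B. norm b = 1 \<and> U *v b = ((U *v b) \<bullet> b) *\<^sub>R b" "span B = UNIV"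
    using self_adjoint_orthonormal_eigenbasis[OF matrix_vector_mul_linear[of U] s, of UNIV] by auto
  have "0 \<notin> B" using B(2) by auto
  then have ind: "independent B" by (rule pairwise_orthogonal_independent[OF B(1)])
  have fin: "finite B" "card B \<le> CARD('n)" using independent_bound[OF ind] by auto
  have on: "v \<bullet> w = (if v = w then 1 else 0)" if "v \<in> B" "w \<in> B" for v w
    using B(1,2) that by (auto simp: pairwise_def orthogonal_def norm_eq_1)
  define \<mu> where "\<mu> v = (U *v v) \<bullet> v" for v
  have ex: "x = (\<Sum>v\<in>B. (x \<bullet> v) *\<^sub>R v)" for x
  proof -
    have "x \<in> span B" using B(3) by simp
    then obtain c where c: "x = (\<Sum>v\<in>B. c v *\<^sub>R v)" using span_finite[OF fin(1)] by auto
    have "x \<bullet> w = c w" if "w \<in> B" for w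
    proof -
      have "x \<bullet> w = (\<Sum>v\<in>B. c v * (v \<bullet> w))" unfolding c by (simp add: inner_sum_left)
      also have "\<dots> = (\<Sum>v\<in>B. if v = w then c v else 0)" using that by (intro sum.cong) (auto simp: on)
      finally show ?thesis using fin that by simp
    qed
    then show ?thesis using c by simp
  qed
  have "U $ k $ l = (\<Sum>v\<in>B. \<mu> v * v $ k * v $ l)" for k l
  proof -
    have "U $ k $ l = (U *v axis l 1) $ k"
      by (simp add: matrix_vector_mult_def axis_def if_distrib[of "\<lambda>z. _ * z"] sum.delta cong: if_cong)
    also have "axis l 1 = (\<Sum>v\<in>B. (v $ l) *\<^sub>R v)"
      using ex[of "axis l 1"] by (simp add: inner_axis')
    also have "U *v \<dots> = (\<Sum>v\<in>B. (v $ l) *\<^sub>R (\<mu> v *\<^sub>R v))"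
      using B(2) by (simp add: linear_sum[OF matrix_vector_mul_linear] matrix_vector_mult_scaleR \<mu>_def)
    finally show ?thesis by (simp add: sum_component ac_simps)
  qed
  then show ?thesis using that fin on by blast
qed

section \<open>Quadratic forms and traces against a symmetric matrix\<close>

definition rqf :: "('n::finite \<Rightarrow> 'n \<Rightarrow> real) \<Rightarrow> ('n \<Rightarrow> real) \<Rightarrow> real" where
  "rqf r \<xi> = (\<Sum>k\<in>UNIV. \<Sum>l\<in>UNIV. r k l * \<xi> k * \<xi> l)"

text \<open>In an orthonormal eigenbasis of \<open>U\<close> the trace against \<open>b\<close> is
  the sum of \<open>\<mu> v * rqf b v\<close>, and the sum on the right is that of
  \<open>(\<mu> v)\<^sup>2 * rqf r v\<close>. At unit eigenvectors the hypothesis compares the two,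
  and Cauchy-Schwarz over at most \<open>CARD('n)\<close> of them gives the factor.\<close>

lemma real_trace_square_bound:
  fixes U :: "'n::finite \<Rightarrow> 'n \<Rightarrow> real"
  assumes sym: "\<And>k l. U k l = U l k" and K: "K \<ge> 0"
    and b: "\<And>\<xi>. (rqf b \<xi>)\<^sup>2 \<le> K * (\<Sum>k\<in>UNIV. (\<xi> k)\<^sup>2) * rqf r \<xi>"
  shows "(\<Sum>k\<in>UNIV. \<Sum>l\<in>UNIV. b k l * U k l)\<^sup>2 \<le> real CARD('n) * K * (\<Sum>j\<in>UNIV. rqf r (U j))"
proof -
  obtain B :: "(real^'n) set" and \<mu> where B: "finite B" "card B \<le> CARD('n)"
    "\<And>v w. v \<in> B \<Longrightarrow> w \<in> B \<Longrightarrow> v \<bullet> w = (if v = w then 1 else 0)"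
    and BV: "\<And>k l. (\<chi> k l. U k l) $ k $ l = (\<Sum>v\<in>B. \<mu> v * v $ k * v $ l)"
    by (rule symmetric_matrix_spectral[of "\<chi> k l. U k l"]) (simp_all add: sym)
  have BU: "U k l = (\<Sum>v\<in>B. \<mu> v * v $ k * v $ l)" for k l using BV[of k l] by simp
  have "(\<Sum>k\<in>UNIV. \<Sum>l\<in>UNIV. b k l * U k l) = (\<Sum>k\<in>UNIV. \<Sum>l\<in>UNIV. \<Sum>v\<in>B. \<mu> v * (b k l * v $ k * v $ l))"
    by (simp add: BU sum_distrib_left ac_simps)
  also have "\<dots> = (\<Sum>k\<in>UNIV. \<Sum>v\<in>B. \<Sum>l\<in>UNIV. \<mu> v * (b k l * v $ k * v $ l))"
    by (rule sum.cong[OF refl sum.swap])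
  also have "\<dots> = (\<Sum>v\<in>B. \<mu> v * rqf b (($) v))"
    by (subst sum.swap) (simp add: rqf_def sum_distrib_left)
  finally have 1: "(\<Sum>k\<in>UNIV. \<Sum>l\<in>UNIV. b k l * U k l) = (\<Sum>v\<in>B. \<mu> v * rqf b (($) v))" .
  have UU: "(\<Sum>j\<in>UNIV. U j k * U j l) = (\<Sum>v\<in>B. (\<mu> v)\<^sup>2 * v $ k * v $ l)" for k l
  proof -
    have "(\<Sum>j\<in>UNIV. U j k * U j l) = (\<Sum>j\<in>UNIV. \<Sum>v\<in>B. \<Sum>w\<in>B. (\<mu> v * v $ k * \<mu> w * w $ l) * (v $ j * w $ j))"
      unfolding BU sum_product by (simp add: ac_simps)
    also have "\<dots> = (\<Sum>v\<in>B. \<Sum>j\<in>UNIV. \<Sum>w\<in>B. (\<mu> v * v $ k * \<mu> w * w $ l) * (v $ j * w $ j))"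
      by (rule sum.swap)
    also have "\<dots> = (\<Sum>v\<in>B. \<Sum>w\<in>B. \<Sum>j\<in>UNIV. (\<mu> v * v $ k * \<mu> w * w $ l) * (v $ j * w $ j))"
      by (rule sum.cong[OF refl sum.swap])
    also have "\<dots> = (\<Sum>v\<in>B. \<Sum>w\<in>B. (\<mu> v * v $ k * \<mu> w * w $ l) * (v \<bullet> w))"
      by (simp add: inner_vec_def sum_distrib_left)
    also have "\<dots> = (\<Sum>v\<in>B. \<Sum>w\<in>B. if v = w then \<mu> v * v $ k * \<mu> w * w $ l else 0)"
      by (intro sum.cong refl) (simp add: B(3))
    also have "\<dots> = (\<Sum>v\<in>B. (\<mu> v)\<^sup>2 * v $ k * v $ l)"
      using B(1) by (simp add: power2_eq_square ac_simps)
    finally show ?thesis .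
  qed
  have "(\<Sum>j\<in>UNIV. rqf r (U j)) = (\<Sum>k\<in>UNIV. \<Sum>l\<in>UNIV. r k l * (\<Sum>j\<in>UNIV. U j k * U j l))"
  proof -
    have "(\<Sum>j\<in>UNIV. rqf r (U j)) = (\<Sum>k\<in>UNIV. \<Sum>j\<in>UNIV. \<Sum>l\<in>UNIV. r k l * (U j k * U j l))"
      unfolding rqf_def by (subst sum.swap) (simp add: mult.assoc)
    also have "\<dots> = (\<Sum>k\<in>UNIV. \<Sum>l\<in>UNIV. \<Sum>j\<in>UNIV. r k l * (U j k * U j l))"
      by (rule sum.cong[OF refl sum.swap])
    finally show ?thesis by (simp add: sum_distrib_left)
  qed
  also have "\<dots> = (\<Sum>k\<in>UNIV. \<Sum>l\<in>UNIV. \<Sum>v\<in>B. (\<mu> v)\<^sup>2 * (r k l * v $ k * v $ l))"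
    by (simp add: UU sum_distrib_left ac_simps)
  also have "\<dots> = (\<Sum>k\<in>UNIV. \<Sum>v\<in>B. \<Sum>l\<in>UNIV. (\<mu> v)\<^sup>2 * (r k l * v $ k * v $ l))"
    by (rule sum.cong[OF refl sum.swap])
  also have "\<dots> = (\<Sum>v\<in>B. (\<mu> v)\<^sup>2 * rqf r (($) v))"
    by (subst sum.swap) (simp add: rqf_def sum_distrib_left)
  finally have 2: "(\<Sum>j\<in>UNIV. rqf r (U j)) = (\<Sum>v\<in>B. (\<mu> v)\<^sup>2 * rqf r (($) v))" .
  have v1: "(\<Sum>k\<in>UNIV. (v $ k)\<^sup>2) = 1" if "v \<in> B" for v
    using B(3)[OF that that] by (simp add: inner_vec_def power2_eq_square)
  have "(\<Sum>v\<in>B. \<mu> v * rqf b (($) v))\<^sup>2 \<le> (\<Sum>v\<in>B. (\<mu> v * rqf b (($) v))\<^sup>2) * real (card B)"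
    by (rule sum_squared_le_sum_of_squares)
  also have "\<dots> \<le> (\<Sum>v\<in>B. (\<mu> v * rqf b (($) v))\<^sup>2) * real CARD('n)"
    using B(2) by (intro mult_left_mono sum_nonneg) auto
  also have "\<dots> \<le> (\<Sum>v\<in>B. (\<mu> v)\<^sup>2 * (K * rqf r (($) v))) * real CARD('n)"
  proof (intro mult_right_mono sum_mono)
    fix v assume v: "v \<in> B"
    have "(rqf b (($) v))\<^sup>2 \<le> K * rqf r (($) v)" using b[of "($) v"] v1[OF v] by simp
    then show "(\<mu> v * rqf b (($) v))\<^sup>2 \<le> (\<mu> v)\<^sup>2 * (K * rqf r (($) v))"
      by (simp add: power_mult_distrib mult_left_mono)
  qed simp
  also have "\<dots> = real CARD('n) * K * (\<Sum>v\<in>B. (\<mu> v)\<^sup>2 * rqf r (($) v))"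
    by (simp add: sum_distrib_left sum_distrib_right ac_simps)
  finally show ?thesis unfolding 1 2 .
qed

definition cqf :: "('n::finite \<Rightarrow> 'n \<Rightarrow> complex) \<Rightarrow> ('n \<Rightarrow> complex) \<Rightarrow> complex" where
  "cqf c \<xi> = (\<Sum>k\<in>UNIV. \<Sum>l\<in>UNIV. c k l * \<xi> k * cnj (\<xi> l))"

lemma Re_cqf_of_real:
  "Re (cqf (\<lambda>k l. complex_of_real (r k l)) \<xi>) = rqf r (\<lambda>k. Re (\<xi> k)) + rqf r (\<lambda>k. Im (\<xi> k))"
  unfolding cqf_def rqf_def sum.distrib[symmetric] Re_sum
  by (intro sum.cong refl) (simp add: algebra_simps)

text \<open>A complex symmetric matrix need not be diagonalisable, but its real and imaginary parts
  are real symmetric, and both sides of the inequality split accordingly.\<close>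

lemma trace_square_bound:
  fixes U :: "'n::finite \<Rightarrow> 'n \<Rightarrow> complex"
  assumes sym: "\<And>k l. U k l = U l k" and K: "K \<ge> 0"
    and b: "\<And>\<xi>. (rqf b \<xi>)\<^sup>2 \<le> K * (\<Sum>k\<in>UNIV. (\<xi> k)\<^sup>2) * rqf r \<xi>"
  shows "(cmod (\<Sum>k\<in>UNIV. \<Sum>l\<in>UNIV. complex_of_real (b k l) * U k l))\<^sup>2
    \<le> real CARD('n) * K * (\<Sum>j\<in>UNIV. Re (cqf (\<lambda>k l. complex_of_real (r k l)) (U j)))"
proof -
  let ?Z = "\<Sum>k\<in>UNIV. \<Sum>l\<in>UNIV. complex_of_real (b k l) * U k l"
  have "Re ?Z = (\<Sum>k\<in>UNIV. \<Sum>l\<in>UNIV. b k l * Re (U k l))" "Im ?Z = (\<Sum>k\<in>UNIV. \<Sum>l\<in>UNIV. b k l * Im (U k l))"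
    by (simp_all add: Re_sum Im_sum)
  then have "(cmod ?Z)\<^sup>2 = (\<Sum>k\<in>UNIV. \<Sum>l\<in>UNIV. b k l * Re (U k l))\<^sup>2 + (\<Sum>k\<in>UNIV. \<Sum>l\<in>UNIV. b k l * Im (U k l))\<^sup>2"
    by (simp add: cmod_power2)
  also have "\<dots> \<le> real CARD('n) * K * (\<Sum>j\<in>UNIV. rqf r (\<lambda>k. Re (U j k))) + real CARD('n) * K * (\<Sum>j\<in>UNIV. rqf r (\<lambda>k. Im (U j k)))"
    by (intro add_mono real_trace_square_bound K b) (simp_all add: sym)
  finally show ?thesis by (simp add: Re_cqf_of_real sum.distrib algebra_simps)
qed

text \<open>Serves twice: for the derivative of a nonnegative function with quadratic Taylor bound,
  and for the first variation at a near-minimiser. For \<open>M = 0\<close> it says that an affine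
  function bounded below is constant.\<close>

lemma nonneg_quadratic_discriminant:
  fixes a c M :: real
  assumes M: "M \<ge> 0" and q: "\<And>s. 0 \<le> a + s * c + M * s\<^sup>2"
  shows "c\<^sup>2 \<le> 4 * M * a"
proof (cases "M = 0")
  case True
  have "c = 0"
  proof (rule ccontr)
    assume "c \<noteq> 0"
    then show False using q[of "- (a + 1) / c"] True by simp
  qed
  then show ?thesis using True by simp
next
  case False
  then have "M > 0" using M by simp
  then show ?thesis using q[of "- c / (2 * M)"] by (simp add: field_simps power2_eq_square)
qed

lemma oleinik:
  fixes R B :: "'n::finite \<Rightarrow> 'n \<Rightarrow> real^'n \<Rightarrow> complex"
  assumes R: "\<And>k l. reg K (R k l)" and B: "\<And>k l. reg K (B k l)" and t: "t \<ge> 0"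
    and le: "\<And>x \<xi>. \<bar>rqf (\<lambda>k l. Re (B k l x)) \<xi>\<bar> \<le> t * rqf (\<lambda>k l. Re (R k l x)) \<xi>"
    and sym: "\<And>k l. U k l = U l k"
  shows "(cmod (\<Sum>k\<in>UNIV. \<Sum>l\<in>UNIV. complex_of_real (Re (pd j (B k l) x)) * U k l))\<^sup>2
    \<le> 4 * real CARD('n) ^ 3 * K * (t + 1) * t *
      (\<Sum>m\<in>UNIV. Re (cqf (\<lambda>k l. complex_of_real (Re (R k l x))) (U m)))"
proof -
  have K: "K \<ge> 0" using regD(8)[OF R] .
  let ?d = "real CARD('n)"
  have taylor: "\<bar>Re (f (x + s *\<^sub>R axis j 1)) - Re (f x) - s * Re (pd j f x)\<bar> \<le> K * s\<^sup>2"
    if "reg K f" for f s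
  proof -
    have "(\<Sum>k\<in>UNIV. complex_of_real ((s *\<^sub>R axis j 1 :: real^'n) $ k) * pd k f x) = complex_of_real s * pd j f x"
      by (subst sum.remove[of _ j]) (auto simp: axis_def intro!: sum.neutral)
    then have "cmod (f (x + s *\<^sub>R axis j 1) - f x - complex_of_real s * pd j f x) \<le> K * s\<^sup>2"
      using regD(4)[OF that, of x "s *\<^sub>R axis j 1"] by simp
    then show ?thesis
      using abs_Re_le_cmod[of "f (x + s *\<^sub>R axis j 1) - f x - complex_of_real s * pd j f x"] by simp
  qed
  have qtaylor: "\<bar>rqf (\<lambda>k l. Re (f k l (x + s *\<^sub>R axis j 1))) \<xi> - rqf (\<lambda>k l. Re (f k l x)) \<xi>
      - s * rqf (\<lambda>k l. Re (pd j (f k l) x)) \<xi>\<bar> \<le> ?d\<^sup>2 * K * (\<Sum>k\<in>UNIV. (\<xi> k)\<^sup>2) * s\<^sup>2"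
    if f: "\<And>k l. reg K (f k l)" for f :: "'n \<Rightarrow> 'n \<Rightarrow> real^'n \<Rightarrow> complex" and \<xi> s
  proof -
    let ?n = "\<Sum>k\<in>UNIV. (\<xi> k)\<^sup>2"
    have xi: "\<bar>\<xi> k * \<xi> l\<bar> \<le> ?n" for k l
    proof -
      have "(\<xi> i)\<^sup>2 \<le> ?n" for i by (rule member_le_sum) auto
      moreover have "2 * \<bar>\<xi> k * \<xi> l\<bar> \<le> (\<xi> k)\<^sup>2 + (\<xi> l)\<^sup>2"
        using sum_squares_bound[of "\<bar>\<xi> k\<bar>" "\<bar>\<xi> l\<bar>"] by (simp add: abs_mult mult.assoc)
      ultimately show ?thesis by (smt (verit))
    qed
    let ?e = "\<lambda>k l. Re (f k l (x + s *\<^sub>R axis j 1)) - Re (f k l x) - s * Re (pd j (f k l) x)"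
    have "rqf (\<lambda>k l. Re (f k l (x + s *\<^sub>R axis j 1))) \<xi> - rqf (\<lambda>k l. Re (f k l x)) \<xi>
      - s * rqf (\<lambda>k l. Re (pd j (f k l) x)) \<xi> = (\<Sum>k\<in>UNIV. \<Sum>l\<in>UNIV. ?e k l * (\<xi> k * \<xi> l))"
      unfolding rqf_def by (simp add: sum_distrib_left sum_subtractf[symmetric] algebra_simps)
    also have "\<bar>\<dots>\<bar> \<le> (\<Sum>k\<in>UNIV. \<Sum>l\<in>UNIV. \<bar>?e k l * (\<xi> k * \<xi> l)\<bar>)"
      by (rule order_trans[OF sum_abs]) (intro sum_mono sum_abs)
    also have "\<dots> \<le> (\<Sum>k\<in>(UNIV::'n set). \<Sum>l\<in>(UNIV::'n set). (K * s\<^sup>2) * ?n)"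
    proof (intro sum_mono)
      fix k l
      show "\<bar>?e k l * (\<xi> k * \<xi> l)\<bar> \<le> (K * s\<^sup>2) * ?n"
        unfolding abs_mult[of "?e k l"] by (rule mult_mono[OF taylor[OF f] xi]) (simp_all add: K)
    qed
    finally show ?thesis by (simp add: power2_eq_square ac_simps)
  qed
  \<comment> \<open>The Taylor constant of \<open>t * R \<plusminus> B\<close> per unit of the
    squared norm of \<open>\<xi>\<close>: \<open>K\<close> for each of the \<open>?d\<^sup>2\<close>
    entries, with weights \<open>t\<close> and \<open>1\<close>.\<close>
  define M where "M = ?d\<^sup>2 * K * (t + 1)"
  have M: "M \<ge> 0" using K t by (simp add: M_def)
  let ?r = "\<lambda>\<xi>. rqf (\<lambda>k l. Re (R k l x)) \<xi>" and ?b = "\<lambda>\<xi>. rqf (\<lambda>k l. Re (B k l x)) \<xi>"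
  let ?r' = "\<lambda>\<xi>. rqf (\<lambda>k l. Re (pd j (R k l) x)) \<xi>" and ?b' = "\<lambda>\<xi>. rqf (\<lambda>k l. Re (pd j (B k l) x)) \<xi>"
  have main: "(?b' \<xi>)\<^sup>2 \<le> (4 * M * t) * (\<Sum>k\<in>UNIV. (\<xi> k)\<^sup>2) * ?r \<xi>" for \<xi>
  proof -
    let ?n = "\<Sum>k\<in>UNIV. (\<xi> k)\<^sup>2"
    have n: "?n \<ge> 0" by (intro sum_nonneg) auto
    have step: "(t * ?r' \<xi> + \<sigma> * ?b' \<xi>)\<^sup>2 \<le> 4 * (M * ?n) * (t * ?r \<xi> + \<sigma> * ?b \<xi>)"
      if \<sigma>: "\<sigma> = 1 \<or> \<sigma> = -1" for \<sigma> :: real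
    proof (rule nonneg_quadratic_discriminant)
      fix s
      let ?y = "x + s *\<^sub>R axis j 1"
      have 0: "0 \<le> t * rqf (\<lambda>k l. Re (R k l ?y)) \<xi> + \<sigma> * rqf (\<lambda>k l. Re (B k l ?y)) \<xi>"
        using le[of ?y \<xi>] \<sigma> by auto
      have 1: "t * (rqf (\<lambda>k l. Re (R k l ?y)) \<xi> - ?r \<xi> - s * ?r' \<xi>) \<le> t * (?d\<^sup>2 * K * ?n * s\<^sup>2)"
        using qtaylor[of R s \<xi>, OF R] t by (intro mult_left_mono) auto
      have 2: "\<sigma> * (rqf (\<lambda>k l. Re (B k l ?y)) \<xi> - ?b \<xi> - s * ?b' \<xi>) \<le> ?d\<^sup>2 * K * ?n * s\<^sup>2"
        using qtaylor[of B s \<xi>, OF B] \<sigma> by auto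
      show "0 \<le> t * ?r \<xi> + \<sigma> * ?b \<xi> + s * (t * ?r' \<xi> + \<sigma> * ?b' \<xi>) + M * ?n * s\<^sup>2"
        using 0 1 2 unfolding M_def by (simp add: algebra_simps)
    qed (use M n in simp)
    have "4 * (?b' \<xi>)\<^sup>2 \<le> 2 * ((t * ?r' \<xi> + 1 * ?b' \<xi>)\<^sup>2 + (t * ?r' \<xi> + (-1) * ?b' \<xi>)\<^sup>2)"
      using zero_le_power2[of "t * ?r' \<xi>"] by (simp add: power2_eq_square algebra_simps)
    also have "\<dots> \<le> 2 * (4 * (M * ?n) * (t * ?r \<xi> + 1 * ?b \<xi>) + 4 * (M * ?n) * (t * ?r \<xi> + (-1) * ?b \<xi>))"
      by (intro mult_left_mono add_mono step) auto
    also have "\<dots> = 4 * ((4 * M * t) * ?n * ?r \<xi>)" by (simp add: algebra_simps)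
    finally show ?thesis by simp
  qed
  have "(cmod (\<Sum>k\<in>UNIV. \<Sum>l\<in>UNIV. complex_of_real (Re (pd j (B k l) x)) * U k l))\<^sup>2
    \<le> ?d * (4 * M * t) * (\<Sum>m\<in>UNIV. Re (cqf (\<lambda>k l. complex_of_real (Re (R k l x))) (U m)))"
    by (rule trace_square_bound[OF sym _ main]) (use M t in simp)
  then show ?thesis by (simp add: M_def power3_eq_cube power2_eq_square ac_simps)
qed

section \<open>The elliptic operator on test functions\<close>

text \<open>With this order of the indices \<open>ell c\<close> is the formal operator of
  \<open>aform c\<close>, and the expression defining \<open>op_H2\<close> becomes
  \<open>ell (adj c)\<close>.\<close>

definition ell :: "('n::finite \<Rightarrow> 'n \<Rightarrow> real^'n \<Rightarrow> complex) \<Rightarrow> (real^'n \<Rightarrow> complex) \<Rightarrow> real^'n \<Rightarrow> complex" where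
  "ell c u x = - (\<Sum>k\<in>UNIV. \<Sum>l\<in>UNIV. pd l (\<lambda>y. c k l y * pd k u y) x)"

definition aform :: "('n::finite \<Rightarrow> 'n \<Rightarrow> real^'n \<Rightarrow> complex) \<Rightarrow> (real^'n \<Rightarrow> complex) \<Rightarrow> (real^'n \<Rightarrow> complex) \<Rightarrow> complex" where
  "aform c u v = (\<Sum>k\<in>UNIV. \<Sum>l\<in>UNIV. LINT x|lborel. c k l x * pd k u x * pd l (\<lambda>y. cnj (v y)) x)"

definition adj :: "('n::finite \<Rightarrow> 'n \<Rightarrow> real^'n \<Rightarrow> complex) \<Rightarrow> 'n \<Rightarrow> 'n \<Rightarrow> real^'n \<Rightarrow> complex" where
  "adj c k l x = cnj (c l k x)"

lemma adj_adj: "adj (adj c) = c"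
  by (simp add: adj_def fun_eq_iff)

lemma reg_adj: "(\<And>k l. reg K (c k l)) \<Longrightarrow> reg K (adj c k l)"
  unfolding adj_def[abs_def] by (rule reg_cnj)

lemma C1_Cc_inf: "u \<in> Cc_inf \<Longrightarrow> C1 u"
  by (intro smooth_C1 Cc_inf_smooth)

lemma pd_cnj_Cc_inf: "v \<in> Cc_inf \<Longrightarrow> pd l (\<lambda>y. cnj (v y)) = (\<lambda>x. cnj (pd l v x))"
  by (intro ext pd_cnj Cc_inf_differentiable)

lemma aform_alt:
  assumes "v \<in> Cc_inf"
  shows "aform c u v = (\<Sum>k\<in>UNIV. \<Sum>l\<in>UNIV. LINT x|lborel. c k l x * pd k u x * cnj (pd l v x))"
  unfolding aform_def pd_cnj_Cc_inf[OF assms] ..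

lemma C1_integrable:
  assumes "continuous_on UNIV f" "w \<in> Cc_inf"
  shows "integrable lborel (\<lambda>x. f x * w x)"
  by (intro integrable_csupp continuous_intros assms Cc_inf_continuous csupp_mult2 Cc_inf_csupp)

lemma
  assumes c: "\<And>k l. C1 (c k l)" and u: "u \<in> Cc_inf"
  shows ell_expand: "ell c u x = - (\<Sum>k\<in>UNIV. \<Sum>l\<in>UNIV. c k l x * pd l (pd k u) x + pd l (c k l) x * pd k u x)"
    and ell_L2: "ell c u \<in> L2"
proof -
  have 1: "pd l (\<lambda>y. c k l y * pd k u y) = (\<lambda>x. c k l x * pd l (pd k u) x + pd l (c k l) x * pd k u x)" for k l
    by (rule C1_pd_mult[OF c C1_Cc_inf[OF Cc_inf_pd[OF u]]])
  then show "ell c u x = - (\<Sum>k\<in>UNIV. \<Sum>l\<in>UNIV. c k l x * pd l (pd k u) x + pd l (c k l) x * pd k u x)"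
    unfolding ell_def by simp
  have "(\<lambda>x. c k l x * pd l (pd k u) x + pd l (c k l) x * pd k u x) \<in> L2" for k l
    by (intro L2_add L2_csupp continuous_intros C1_continuous C1_pd_continuous c Cc_inf_continuous Cc_inf_pd u
        csupp_mult2 Cc_inf_csupp)
  then show "ell c u \<in> L2"
    unfolding ell_def[abs_def] 1 by (intro L2_minus L2_sum)
qed

lemma ell_inner:
  assumes c: "\<And>k l. C1 (c k l)" and u: "u \<in> Cc_inf" and v: "v \<in> Cc_inf"
  shows "l2_inner (ell c u) v = aform c u v"
proof -
  have C: "C1 (\<lambda>y. c k l y * pd k u y)" for k l
    by (intro C1_mult c C1_Cc_inf Cc_inf_pd u)
  have i: "integrable lborel (\<lambda>x. pd l (\<lambda>y. c k l y * pd k u y) x * cnj (v x))" for k l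
    by (rule C1_integrable[OF C1_pd_continuous[OF C] Cc_inf_cnj[OF v]])
  have "l2_inner (ell c u) v = (LINT x|lborel. - (\<Sum>k\<in>UNIV. \<Sum>l\<in>UNIV. pd l (\<lambda>y. c k l y * pd k u y) x * cnj (v x)))"
    unfolding l2_inner_def ell_def by (simp add: sum_distrib_right)
  also have "\<dots> = - (\<Sum>k\<in>UNIV. \<Sum>l\<in>UNIV. LINT x|lborel. pd l (\<lambda>y. c k l y * pd k u y) x * cnj (v x))"
    by (simp add: i)
  also have "\<dots> = aform c u v"
    unfolding aform_def
    by (simp add: integration_by_parts[OF C C1_Cc_inf[OF Cc_inf_cnj[OF v]] disjI2[OF Cc_inf_csupp[OF Cc_inf_cnj[OF v]]]]
        sum_negf)
  finally show ?thesis .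
qed

lemma aform_adj:
  assumes u: "u \<in> Cc_inf" and v: "v \<in> Cc_inf"
  shows "aform (adj c) v u = cnj (aform c u v)"
proof -
  have "cnj (aform c u v) = (\<Sum>k\<in>UNIV. \<Sum>l\<in>UNIV. LINT x|lborel. cnj (c k l x) * pd l v x * cnj (pd k u x))"
    unfolding aform_alt[OF v] cnj_sum Bochner_Integration.integral_cnj[symmetric]
    by (simp add: ac_simps del: Bochner_Integration.integral_cnj)
  also have "\<dots> = aform (adj c) v u"
    unfolding aform_alt[OF u] adj_def by (rule sum.swap)
  finally show ?thesis ..
qed

text \<open>All derivatives are moved onto \<open>v\<close>. In this form \<open>u\<close> can be
  replaced by limits in \<open>L2\<close> without any control of its derivatives.\<close>

lemma inner_ell_adj:
  assumes c: "\<And>k l. C1 (c k l)" and u: "u \<in> Cc_inf" and v: "v \<in> Cc_inf"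
  shows "l2_inner u (ell (adj c) v) = aform c u v"
proof -
  have "C1 (adj c k l)" for k l unfolding adj_def[abs_def] by (intro C1_cnj c)
  then have "l2_inner (ell (adj c) v) u = aform (adj c) v u" by (intro ell_inner u v)
  then show ?thesis using l2_inner_cnj[of u "ell (adj c) v"] aform_adj[OF u v] by simp
qed

section \<open>The Laplacian and second-order norms on test functions\<close>

lemma l2_inner_pd:
  assumes "f \<in> Cc_inf" "g \<in> Cc_inf"
  shows "l2_inner (pd k f) g = - l2_inner f (pd k g)"
  unfolding l2_inner_def
  using integration_by_parts[OF C1_Cc_inf[OF assms(1)] C1_Cc_inf[OF Cc_inf_cnj[OF assms(2)]] disjI1[OF Cc_inf_csupp[OF assms(1)]], of k]
  by (simp add: pd_cnj_Cc_inf[OF assms(2)])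

definition grad_sq :: "(real^'n::finite \<Rightarrow> complex) \<Rightarrow> real" where
  "grad_sq u = (\<Sum>k\<in>UNIV. (l2_norm (pd k u))\<^sup>2)"

lemma grad_sq_nonneg: "0 \<le> grad_sq u"
  unfolding grad_sq_def by (intro sum_nonneg) auto

lemma inner_lap:
  assumes u: "u \<in> Cc_inf"
  shows "l2_inner u (lap u) = - complex_of_real (grad_sq u)"
proof -
  have "l2_inner u (lap u) = (\<Sum>k\<in>UNIV. l2_inner u (pd k (pd k u)))"
    unfolding lap_def[abs_def] by (intro l2_inner_sum_right Cc_inf_L2 Cc_inf_pd u)
  also have "\<dots> = - complex_of_real (grad_sq u)"
    using l2_inner_pd[OF u Cc_inf_pd[OF u]]
    by (simp add: grad_sq_def sum_negf[symmetric] l2_inner_self[symmetric] of_real_power[symmetric] del: of_real_power)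
  finally show ?thesis .
qed

text \<open>Two integrations by parts turn products of pure second derivatives into squares of mixed
  ones; hence the Laplacian alone controls the whole Hessian.\<close>

lemma lap_norm_sq:
  assumes u: "u \<in> Cc_inf"
  shows "(l2_norm (lap u))\<^sup>2 = (\<Sum>k\<in>UNIV. \<Sum>l\<in>UNIV. (l2_norm (pd l (pd k u)))\<^sup>2)"
proof -
  have "complex_of_real ((l2_norm (lap u))\<^sup>2) = l2_inner (lap u) (lap u)" by (simp only: l2_inner_self)
  also have "\<dots> = (\<Sum>k\<in>UNIV. l2_inner (pd k (pd k u)) (lap u))"
    unfolding lap_def[abs_def] by (intro l2_inner_sum_left L2_sum Cc_inf_L2 Cc_inf_pd u)
  also have "\<dots> = (\<Sum>k\<in>UNIV. \<Sum>l\<in>UNIV. l2_inner (pd k (pd k u)) (pd l (pd l u)))"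
    unfolding lap_def[abs_def] by (intro sum.cong refl l2_inner_sum_right L2_sum Cc_inf_L2 Cc_inf_pd u)
  also have "\<dots> = (\<Sum>k\<in>UNIV. \<Sum>l\<in>UNIV. complex_of_real ((l2_norm (pd l (pd k u)))\<^sup>2))"
  proof (intro sum.cong refl)
    fix k l :: 'a
    have "l2_inner (pd k (pd k u)) (pd l (pd l u)) = - l2_inner (pd k u) (pd l (pd k (pd l u)))"
      by (simp add: l2_inner_pd Cc_inf_pd u pd_commute[of "pd l u" k l] smooth_pd Cc_inf_smooth)
    also have "\<dots> = l2_inner (pd l (pd k u)) (pd k (pd l u))"
      by (simp add: l2_inner_pd[of "pd k u"] Cc_inf_pd u)
    finally show "l2_inner (pd k (pd k u)) (pd l (pd l u)) = complex_of_real ((l2_norm (pd l (pd k u)))\<^sup>2)"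
      by (simp only: pd_commute[OF Cc_inf_smooth[OF u], of k l] l2_inner_self)
  qed
  finally show ?thesis by (simp only: of_real_sum[symmetric] of_real_eq_iff)
qed

lemma one_minus_lap_norm_sq:
  assumes u: "u \<in> Cc_inf"
  shows "(l2_norm (\<lambda>x. u x - lap u x))\<^sup>2 =
    (l2_norm u)\<^sup>2 + 2 * grad_sq u + (\<Sum>k\<in>UNIV. \<Sum>l\<in>UNIV. (l2_norm (pd l (pd k u)))\<^sup>2)"
proof -
  have L: "u \<in> L2" "lap u \<in> L2" using u by (auto intro: Cc_inf_L2 lap_Cc_inf)
  have "l2_inner u (\<lambda>x. - lap u x) = complex_of_real (grad_sq u)"
    using inner_lap[OF u] l2_inner_cmult_right[of u "-1" "lap u"] by simp
  then show ?thesis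
    using l2_norm_add_sq[OF L(1) L2_minus[OF L(2)]] by (simp add: l2_norm_minus lap_norm_sq[OF u])
qed

text \<open>All summands in \<open>one_minus_lap_norm_sq\<close> are nonnegative. Derivatives up to
  order two are thereby bounded by the very quantity that \<open>one_minus_lap_dense\<close> can
  prescribe approximately.\<close>

lemma
  assumes u: "u \<in> Cc_inf"
  shows norm_le_one_minus_lap: "l2_norm u \<le> l2_norm (\<lambda>x. u x - lap u x)"
    and pd_le_one_minus_lap: "l2_norm (pd k u) \<le> l2_norm (\<lambda>x. u x - lap u x)"
    and pd2_le_one_minus_lap: "l2_norm (pd l (pd k u)) \<le> l2_norm (\<lambda>x. u x - lap u x)"
proof -
  let ?N = "(l2_norm (\<lambda>x. u x - lap u x))\<^sup>2"
  let ?H = "\<Sum>k\<in>UNIV. \<Sum>l\<in>UNIV. (l2_norm (pd l (pd k u)))\<^sup>2"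
  note eq = one_minus_lap_norm_sq[OF u]
  have H: "0 \<le> ?H" by (intro sum_nonneg) auto
  have p: "(l2_norm (pd k u))\<^sup>2 \<le> grad_sq u" unfolding grad_sq_def by (rule member_le_sum) auto
  have "(l2_norm (pd l (pd k u)))\<^sup>2 \<le> (\<Sum>l\<in>UNIV. (l2_norm (pd l (pd k u)))\<^sup>2)"
    by (rule member_le_sum) auto
  also have "\<dots> \<le> ?H" by (rule member_le_sum) (auto intro: sum_nonneg)
  finally have h: "(l2_norm (pd l (pd k u)))\<^sup>2 \<le> ?H" .
  note nn = grad_sq_nonneg[of u] zero_le_power2[of "l2_norm u"]
  show "l2_norm u \<le> l2_norm (\<lambda>x. u x - lap u x)"
    by (rule power2_le_imp_le) (use eq H nn in \<open>auto intro: order_trans\<close>)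
  have "(l2_norm (pd k u))\<^sup>2 \<le> ?N" using eq H nn p by linarith
  then show "l2_norm (pd k u) \<le> l2_norm (\<lambda>x. u x - lap u x)" by (rule power2_le_imp_le) simp
  have "(l2_norm (pd l (pd k u)))\<^sup>2 \<le> ?N" using eq h nn by linarith
  then show "l2_norm (pd l (pd k u)) \<le> l2_norm (\<lambda>x. u x - lap u x)" by (rule power2_le_imp_le) simp
qed

text \<open>In the density argument \<open>w\<close> is known only through \<open>w - lap w\<close>;
  this is the bound for the operator applied to such a \<open>w\<close>.\<close>

lemma ell_norm_bound:
  fixes c :: "'n::finite \<Rightarrow> 'n \<Rightarrow> real^'n \<Rightarrow> complex"
  assumes c: "\<And>k l. reg K (c k l)" and u: "u \<in> Cc_inf"
  shows "l2_norm (ell c u) \<le> 2 * K * (real CARD('n))\<^sup>2 * l2_norm (\<lambda>x. u x - lap u x)"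
proof -
  let ?N = "l2_norm (\<lambda>x. u x - lap u x)"
  note r = regD[OF c]
  have L: "(\<lambda>x. c k l x * w x) \<in> L2" "(\<lambda>x. pd j (c k l) x * w x) \<in> L2" if "w \<in> Cc_inf" for k l j w
    by (intro L2_csupp continuous_intros C1_continuous C1_pd_continuous r Cc_inf_continuous that csupp_mult2 Cc_inf_csupp)+
  have "l2_norm (ell c u) = l2_norm (\<lambda>x. \<Sum>k\<in>UNIV. \<Sum>l\<in>UNIV. c k l x * pd l (pd k u) x + pd l (c k l) x * pd k u x)"
    by (subst ell_expand[OF r(1) u, THEN ext]) (rule l2_norm_minus)
  also have "\<dots> \<le> (\<Sum>k\<in>UNIV. l2_norm (\<lambda>x. \<Sum>l\<in>UNIV. c k l x * pd l (pd k u) x + pd l (c k l) x * pd k u x))"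
    by (intro l2_norm_sum L2_sum L2_add L Cc_inf_pd u)
  also have "\<dots> \<le> (\<Sum>k\<in>UNIV. \<Sum>l\<in>UNIV. l2_norm (\<lambda>x. c k l x * pd l (pd k u) x + pd l (c k l) x * pd k u x))"
    by (intro sum_mono l2_norm_sum L2_add L Cc_inf_pd u)
  also have "\<dots> \<le> (\<Sum>k\<in>(UNIV::'n set). \<Sum>l\<in>(UNIV::'n set). K * ?N + K * ?N)"
  proof (intro sum_mono)
    fix k l :: 'n
    have "l2_norm (\<lambda>x. c k l x * pd l (pd k u) x + pd l (c k l) x * pd k u x)
       \<le> l2_norm (\<lambda>x. c k l x * pd l (pd k u) x) + l2_norm (\<lambda>x. pd l (c k l) x * pd k u x)"
      by (intro l2_norm_triangle L Cc_inf_pd u)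
    also have "\<dots> \<le> K * l2_norm (pd l (pd k u)) + K * l2_norm (pd k u)"
      by (intro add_mono l2_norm_mono L Cc_inf_L2 Cc_inf_pd u r(8)) (auto simp: norm_mult intro!: mult_right_mono r)
    also have "\<dots> \<le> K * ?N + K * ?N"
      by (intro add_mono mult_left_mono pd_le_one_minus_lap pd2_le_one_minus_lap u r(8))
    finally show "l2_norm (\<lambda>x. c k l x * pd l (pd k u) x + pd l (c k l) x * pd k u x) \<le> K * ?N + K * ?N" .
  qed
  also have "\<dots> = 2 * K * (real CARD('n))\<^sup>2 * ?N" by (simp add: power2_eq_square)
  finally show ?thesis .
qed

section \<open>Accretivity with respect to the gradient\<close>

text \<open>The error term of the energy identity, in which the derivative
  \<open>\<partial>_j\<close> has fallen on the coefficient.\<close>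

definition tform :: "('n::finite \<Rightarrow> 'n \<Rightarrow> real^'n \<Rightarrow> complex) \<Rightarrow> 'n \<Rightarrow> (real^'n \<Rightarrow> complex) \<Rightarrow> complex" where
  "tform c j u = (\<Sum>k\<in>UNIV. \<Sum>l\<in>UNIV. LINT x|lborel. pd j (c k l) x * (pd k u x * cnj (pd j (pd l u) x)))"

text \<open>One of the two derivatives \<open>\<partial>_j\<close> in each term of
  \<open>- lap u\<close> is moved to the factor \<open>c k l * pd k u\<close>; the Leibniz rule
  separates the form at \<open>pd j u\<close> from \<open>tform\<close>.\<close>

lemma energy_identity:
  assumes c: "\<And>k l. C1 (c k l)" and u: "u \<in> Cc_inf"
  shows "l2_inner (ell c u) (\<lambda>x. - lap u x) = (\<Sum>j\<in>UNIV. aform c (pd j u) (pd j u) + tform c j u)"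
proof -
  have C: "C1 (\<lambda>y. c k l y * pd k u y)" for k l
    by (intro C1_mult c C1_Cc_inf Cc_inf_pd u)
  have j: "- l2_inner (ell c u) (pd j (pd j u)) = aform c (pd j u) (pd j u) + tform c j u" for j
  proof -
    note ju = Cc_inf_pd[OF u, of j] Cc_inf_pd[OF Cc_inf_pd[OF u], of j j]
    have "- l2_inner (ell c u) (pd j (pd j u)) = - aform c u (pd j (pd j u))"
      by (simp add: ell_inner[OF c u ju(2)])
    also have "\<dots> = (\<Sum>k\<in>UNIV. \<Sum>l\<in>UNIV. - (LINT x|lborel. (c k l x * pd k u x) * cnj (pd l (pd j (pd j u)) x)))"
      by (simp add: aform_alt[OF ju(2)] sum_negf)
    also have "\<dots> = (\<Sum>k\<in>UNIV. \<Sum>l\<in>UNIV. (LINT x|lborel. c k l x * pd k (pd j u) x * cnj (pd l (pd j u) x))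
        + (LINT x|lborel. pd j (c k l) x * (pd k u x * cnj (pd j (pd l u) x))))"
    proof (intro sum.cong refl)
      fix k l :: 'a
      let ?w = "\<lambda>x. cnj (pd l (pd j u) x)"
      have w: "?w \<in> Cc_inf" by (intro Cc_inf_cnj Cc_inf_pd u)
      have "pd j ?w = (\<lambda>x. cnj (pd j (pd l (pd j u)) x))" by (intro pd_cnj_Cc_inf Cc_inf_pd u)
      also have "pd j (pd l (pd j u)) = pd l (pd j (pd j u))"
        by (rule pd_commute[OF Cc_inf_smooth[OF ju(1)]])
      finally have "- (LINT x|lborel. (c k l x * pd k u x) * cnj (pd l (pd j (pd j u)) x))
          = (LINT x|lborel. pd j (\<lambda>x. c k l x * pd k u x) x * ?w x)"
        using integration_by_parts[OF C C1_Cc_inf[OF w] disjI2[OF Cc_inf_csupp[OF w]], of k l j] by simp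
      also have "pd j (\<lambda>x. c k l x * pd k u x) = (\<lambda>x. c k l x * pd j (pd k u) x + pd j (c k l) x * pd k u x)"
        by (rule C1_pd_mult[OF c C1_Cc_inf[OF Cc_inf_pd[OF u]]])
      also have "(LINT x|lborel. (c k l x * pd j (pd k u) x + pd j (c k l) x * pd k u x) * ?w x) =
         (LINT x|lborel. c k l x * (pd j (pd k u) x * ?w x) + pd j (c k l) x * (pd k u x * ?w x))"
        by (simp add: algebra_simps)
      also have "\<dots> = (LINT x|lborel. c k l x * (pd j (pd k u) x * ?w x)) + (LINT x|lborel. pd j (c k l) x * (pd k u x * ?w x))"
        by (intro Bochner_Integration.integral_add C1_integrable C1_continuous C1_pd_continuous c Cc_inf_mult w Cc_inf_pd u)
      finally show "- (LINT x|lborel. (c k l x * pd k u x) * cnj (pd l (pd j (pd j u)) x)) =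
        (LINT x|lborel. c k l x * pd k (pd j u) x * cnj (pd l (pd j u) x))
        + (LINT x|lborel. pd j (c k l) x * (pd k u x * cnj (pd j (pd l u) x)))"
        by (simp only: pd_commute[OF Cc_inf_smooth[OF u], of k j] pd_commute[OF Cc_inf_smooth[OF u], of l j] mult.assoc)
    qed
    also have "\<dots> = aform c (pd j u) (pd j u) + tform c j u"
      unfolding aform_alt[OF ju(1)] tform_def by (simp add: sum.distrib)
    finally show ?thesis .
  qed
  have "l2_inner (ell c u) (\<lambda>x. - lap u x) = - l2_inner (ell c u) (lap u)"
    using l2_inner_cmult_right[of "ell c u" "-1" "lap u"] by simp
  also have "l2_inner (ell c u) (lap u) = (\<Sum>j\<in>UNIV. l2_inner (ell c u) (pd j (pd j u)))"
    unfolding lap_def[abs_def] by (intro l2_inner_sum_right ell_L2 c Cc_inf_L2 Cc_inf_pd u)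
  also have "- \<dots> = (\<Sum>j\<in>UNIV. aform c (pd j u) (pd j u) + tform c j u)"
    by (simp add: sum_negf[symmetric] j)
  finally show ?thesis .
qed

lemma weighted_product_bound:
  assumes g: "bdd_meas K g" and u: "u \<in> Cc_inf"
  shows "cmod (LINT x|lborel. g x * (pd k u x * cnj (pd l u x))) \<le> K * (((l2_norm (pd k u))\<^sup>2 + (l2_norm (pd l u))\<^sup>2) / 2)"
proof -
  note L = Cc_inf_L2[OF Cc_inf_pd[OF u]]
  \<comment> \<open>The bound on \<open>g\<close> holds almost everywhere, and a negative
    \<open>K\<close> would make the whole space a null set.\<close>
  have K: "0 \<le> K"
  proof (rule ccontr)
    assume "\<not> 0 \<le> K"
    have "AE x in lborel. cmod (g x) \<le> K" using g by (simp add: bdd_meas_def)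
    then have "AE x in (lborel::(real^'a) measure). False"
      by eventually_elim (use \<open>\<not> 0 \<le> K\<close> norm_ge_zero order_trans in blast)
    then have "emeasure lborel (UNIV::(real^'a) set) = 0" by (simp add: AE_iff_null null_sets_def)
    then show False by simp
  qed
  have "cmod (LINT x|lborel. g x * (pd k u x * cnj (pd l u x))) \<le> K * (LINT x|lborel. cmod (pd k u x * cnj (pd l u x)))"
    by (intro bdd_meas_integrable g L2_inner_integrable L)
  also have "(LINT x|lborel. cmod (pd k u x * cnj (pd l u x))) = (LINT x|lborel. cmod (pd k u x) * cmod (pd l u x))"
    by (simp add: norm_mult)
  also have "K * \<dots> \<le> K * (l2_norm (pd k u) * l2_norm (pd l u))"
    by (intro mult_left_mono l2_abs_inner_le L K)
  also have "\<dots> \<le> K * (((l2_norm (pd k u))\<^sup>2 + (l2_norm (pd l u))\<^sup>2) / 2)"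
    using sum_squares_bound[of "l2_norm (pd k u)" "l2_norm (pd l u)"] by (intro mult_left_mono K) auto
  finally show ?thesis .
qed

lemma sum_pairs_grad_sq:
  fixes u :: "real^'n::finite \<Rightarrow> complex"
  shows "(\<Sum>k\<in>UNIV. \<Sum>l\<in>UNIV. K * (((l2_norm (pd k u))\<^sup>2 + (l2_norm (pd l u))\<^sup>2) / 2)) = K * real CARD('n) * grad_sq u"
proof -
  define a where "a k = (l2_norm (pd k u))\<^sup>2" for k
  have "(\<Sum>k\<in>(UNIV::'n set). \<Sum>l\<in>(UNIV::'n set). K * ((a k + a l) / 2)) = (\<Sum>k\<in>(UNIV::'n set). \<Sum>l\<in>(UNIV::'n set). (K / 2) * (a k + a l))"
    by simp
  also have "\<dots> = (K / 2) * (\<Sum>k\<in>(UNIV::'n set). \<Sum>l\<in>(UNIV::'n set). a k + a l)"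
    by (simp only: sum_distrib_left)
  also have "(\<Sum>k\<in>(UNIV::'n set). \<Sum>l\<in>(UNIV::'n set). a k + a l) = 2 * real CARD('n) * (\<Sum>k\<in>UNIV. a k)"
    by (simp add: sum.distrib sum_distrib_left mult.assoc)
  also have "(K / 2) * (2 * real CARD('n) * (\<Sum>k\<in>UNIV. a k)) = K * real CARD('n) * (\<Sum>k\<in>UNIV. a k)"
    by simp
  finally show ?thesis unfolding a_def grad_sq_def .
qed

text \<open>For a real symmetric coefficient the integrand of \<open>tform\<close> has the real part of
  \<open>(\<Sum> \<partial>\<^sub>j r\<^sub>k\<^sub>l \<partial>\<^sub>j(\<partial>\<^sub>k u cnj (\<partial>\<^sub>l u))) / 2\<close>, and no ellipticity is needed.\<close>

lemma tform_real_symmetric: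
  fixes r :: "'n::finite \<Rightarrow> 'n \<Rightarrow> real^'n \<Rightarrow> complex"
  assumes r: "\<And>k l. reg K (r k l)" and sym: "\<And>k l. r k l = r l k" and real: "\<And>k l x. cnj (r k l x) = r k l x"
    and u: "u \<in> Cc_inf"
  shows "\<bar>Re (tform r j u)\<bar> \<le> K * real CARD('n) * grad_sq u"
proof -
  note R = regD[OF r]
  have pr: "cnj (pd j (r k l) x) = pd j (r k l) x" for k l x
    using pd_cnj[OF C1_differentiable[OF R(1)], of j k l x] unfolding real by (rule HOL.sym)
  have "cnj (tform r j u) = (\<Sum>k\<in>UNIV. \<Sum>l\<in>UNIV. LINT x|lborel. pd j (r k l) x * (cnj (pd k u x) * pd j (pd l u) x))"
    unfolding tform_def cnj_sum Bochner_Integration.integral_cnj[symmetric] by (simp add: pr)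
  also have "\<dots> = (\<Sum>k\<in>UNIV. \<Sum>l\<in>UNIV. LINT x|lborel. pd j (r k l) x * (pd j (pd k u) x * cnj (pd l u x)))"
  proof (subst sum.swap, intro sum.cong refl)
    fix k l :: 'n
    show "(LINT x|lborel. pd j (r l k) x * (cnj (pd l u x) * pd j (pd k u) x))
        = (LINT x|lborel. pd j (r k l) x * (pd j (pd k u) x * cnj (pd l u x)))"
      unfolding sym[of l k] by (simp add: mult.commute)
  qed
  finally have cnj: "cnj (tform r j u) = (\<Sum>k\<in>UNIV. \<Sum>l\<in>UNIV. LINT x|lborel. pd j (r k l) x * (pd j (pd k u) x * cnj (pd l u x)))" .
  have "\<forall>k l. \<exists>g. bdd_meas K g \<and> weak_pd j (pd j (r k l)) g" using R(5) by blast
  then obtain g where g: "\<And>k l. bdd_meas K (g k l)" "\<And>k l. weak_pd j (pd j (r k l)) (g k l)" by metis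
  \<comment> \<open>The two integrands are \<open>\<partial>_j r_kl\<close> times the two summands
    of the derivative of \<open>pd k u * cnj (pd l u)\<close>. Integrating by parts leaves only
    first derivatives of \<open>u\<close>, weighted by bounded functions.\<close>
  have "tform r j u + cnj (tform r j u) = (\<Sum>k\<in>UNIV. \<Sum>l\<in>UNIV. - (LINT x|lborel. g k l x * (pd k u x * cnj (pd l u x))))"
    unfolding cnj unfolding tform_def sum.distrib[symmetric]
  proof (intro sum.cong refl)
    fix k l
    let ?w = "\<lambda>x. pd k u x * cnj (pd l u x)"
    have w: "?w \<in> Cc_inf" by (intro Cc_inf_mult Cc_inf_cnj Cc_inf_pd u)
    have "pd j ?w = (\<lambda>x. pd k u x * cnj (pd j (pd l u) x) + pd j (pd k u) x * cnj (pd l u x))"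
      using C1_pd_mult[OF C1_Cc_inf[OF Cc_inf_pd[OF u]] C1_Cc_inf[OF Cc_inf_cnj[OF Cc_inf_pd[OF u]]], of j k l]
      by (simp add: pd_cnj_Cc_inf Cc_inf_pd u)
    then have "(LINT x|lborel. pd j (r k l) x * (pd k u x * cnj (pd j (pd l u) x)) + pd j (r k l) x * (pd j (pd k u) x * cnj (pd l u x)))
        = - (LINT x|lborel. g k l x * ?w x)"
      using weak_pdD[OF g(2) w, of k l] by (simp add: distrib_left)
    then show "(LINT x|lborel. pd j (r k l) x * (pd k u x * cnj (pd j (pd l u) x))) + (LINT x|lborel. pd j (r k l) x * (pd j (pd k u) x * cnj (pd l u x)))
        = - (LINT x|lborel. g k l x * ?w x)"
      by (subst (asm) Bochner_Integration.integral_add)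
         (auto intro!: C1_integrable C1_pd_continuous R Cc_inf_mult Cc_inf_cnj Cc_inf_pd u)
  qed
  also have "cmod \<dots> \<le> (\<Sum>k\<in>UNIV. \<Sum>l\<in>UNIV. cmod (LINT x|lborel. g k l x * (pd k u x * cnj (pd l u x))))"
    by (rule order_trans[OF norm_sum], intro sum_mono, rule order_trans[OF norm_sum]) simp
  also have "\<dots> \<le> (\<Sum>k\<in>UNIV. \<Sum>l\<in>UNIV. K * (((l2_norm (pd k u))\<^sup>2 + (l2_norm (pd l u))\<^sup>2) / 2))"
    by (intro sum_mono weighted_product_bound g u)
  also have "\<dots> = K * real CARD('n) * grad_sq u" by (rule sum_pairs_grad_sq)
  finally have "2 * \<bar>Re (tform r j u)\<bar> \<le> K * real CARD('n) * grad_sq u"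
    by (simp add: complex_add_cnj)
  then show ?thesis using abs_ge_zero[of "Re (tform r j u)"] by linarith
qed

text \<open>The derivative \<open>\<partial>_l\<close> is taken off the conjugated factor. On the
  coefficient it produces a bounded weak second derivative, hence a gradient term. On
  \<open>pd k u\<close> it produces \<open>V\<close>, where both indices of
  \<open>\<partial>_j e\<close> are contracted with the Hessian, so that only the symmetric part of
  \<open>e\<close> can contribute.\<close>

lemma tform_bound:
  fixes e :: "'n::finite \<Rightarrow> 'n \<Rightarrow> real^'n \<Rightarrow> complex" and j :: 'n
  assumes e: "\<And>k l. reg K (e k l)" and u: "u \<in> Cc_inf"
  defines "V \<equiv> \<lambda>x. \<Sum>k\<in>UNIV. \<Sum>l\<in>UNIV. pd j (e k l) x * pd l (pd k u) x"
  shows "cmod (tform e j u) \<le> K * (real CARD('n))\<^sup>2 * grad_sq u + (LINT x|lborel. cmod (V x) * cmod (pd j u x))"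
proof -
  let ?d = "real CARD('n)"
  note R = regD[OF e]
  have "\<forall>k l. \<exists>g. bdd_meas K g \<and> weak_pd l (pd j (e k l)) g" using R(5) by blast
  then obtain g where g: "\<And>k l. bdd_meas K (g k l)" "\<And>k l. weak_pd l (pd j (e k l)) (g k l)" by metis
  have Vint: "integrable lborel (\<lambda>x. pd j (e k l) x * (pd l (pd k u) x * cnj (pd j u x)))" for k l
    by (intro C1_integrable C1_pd_continuous R Cc_inf_mult Cc_inf_cnj Cc_inf_pd u)
  have VL: "V \<in> L2"
    unfolding V_def by (intro L2_sum L2_csupp continuous_intros C1_pd_continuous R Cc_inf_continuous csupp_mult2 Cc_inf_csupp Cc_inf_pd u)
  have "tform e j u = (\<Sum>k\<in>UNIV. \<Sum>l\<in>UNIV. - (LINT x|lborel. g k l x * (pd k u x * cnj (pd j u x)))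
      - (LINT x|lborel. pd j (e k l) x * (pd l (pd k u) x * cnj (pd j u x))))"
    unfolding tform_def
  proof (intro sum.cong refl)
    fix k l
    let ?w = "\<lambda>x. pd k u x * cnj (pd j u x)"
    have w: "?w \<in> Cc_inf" by (intro Cc_inf_mult Cc_inf_cnj Cc_inf_pd u)
    have "pd l ?w = (\<lambda>x. pd k u x * cnj (pd l (pd j u) x) + pd l (pd k u) x * cnj (pd j u x))"
      using C1_pd_mult[OF C1_Cc_inf[OF Cc_inf_pd[OF u]] C1_Cc_inf[OF Cc_inf_cnj[OF Cc_inf_pd[OF u]]], of l k j]
      by (simp add: pd_cnj_Cc_inf Cc_inf_pd u)
    also have "pd l (pd j u) = pd j (pd l u)" by (rule pd_commute[OF Cc_inf_smooth[OF u]])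
    finally have "(LINT x|lborel. pd j (e k l) x * (pd k u x * cnj (pd j (pd l u) x)) + pd j (e k l) x * (pd l (pd k u) x * cnj (pd j u x)))
        = - (LINT x|lborel. g k l x * ?w x)"
      using weak_pdD[OF g(2) w, of k l] by (simp add: distrib_left)
    then have "(LINT x|lborel. pd j (e k l) x * (pd k u x * cnj (pd j (pd l u) x))) + (LINT x|lborel. pd j (e k l) x * (pd l (pd k u) x * cnj (pd j u x)))
        = - (LINT x|lborel. g k l x * ?w x)"
      by (subst (asm) Bochner_Integration.integral_add)
         (auto intro!: C1_integrable C1_pd_continuous R Cc_inf_mult Cc_inf_cnj Cc_inf_pd u)
    then show "(LINT x|lborel. pd j (e k l) x * (pd k u x * cnj (pd j (pd l u) x))) = - (LINT x|lborel. g k l x * ?w x)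
      - (LINT x|lborel. pd j (e k l) x * (pd l (pd k u) x * cnj (pd j u x)))" by (simp add: eq_diff_eq)
  qed
  also have "\<dots> = - (\<Sum>k\<in>UNIV. \<Sum>l\<in>UNIV. LINT x|lborel. g k l x * (pd k u x * cnj (pd j u x))) - l2_inner V (pd j u)"
    unfolding V_def l2_inner_def by (simp add: sum_distrib_right sum_subtractf sum_negf Vint mult.assoc)
  finally have "cmod (tform e j u) \<le> cmod (\<Sum>k\<in>UNIV. \<Sum>l\<in>UNIV. LINT x|lborel. g k l x * (pd k u x * cnj (pd j u x))) + cmod (l2_inner V (pd j u))"
    using norm_triangle_ineq4[of "- (\<Sum>k\<in>UNIV. \<Sum>l\<in>UNIV. LINT x|lborel. g k l x * (pd k u x * cnj (pd j u x)))" "l2_inner V (pd j u)"]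
    by simp
  moreover have "cmod (\<Sum>k\<in>UNIV. \<Sum>l\<in>UNIV. LINT x|lborel. g k l x * (pd k u x * cnj (pd j u x))) \<le> K * ?d\<^sup>2 * grad_sq u"
  proof -
    have "cmod (\<Sum>k\<in>UNIV. \<Sum>l\<in>UNIV. LINT x|lborel. g k l x * (pd k u x * cnj (pd j u x)))
      \<le> (\<Sum>k\<in>UNIV. \<Sum>l\<in>UNIV. cmod (LINT x|lborel. g k l x * (pd k u x * cnj (pd j u x))))"
      by (rule order_trans[OF norm_sum], intro sum_mono norm_sum)
    also have "\<dots> \<le> (\<Sum>k\<in>(UNIV::'n set). \<Sum>l\<in>(UNIV::'n set). K * grad_sq u)"
    proof (intro sum_mono)
      fix k l :: 'n
      have p: "(l2_norm (pd i u))\<^sup>2 \<le> grad_sq u" for i unfolding grad_sq_def by (rule member_le_sum) auto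
      have "cmod (LINT x|lborel. g k l x * (pd k u x * cnj (pd j u x))) \<le> K * (((l2_norm (pd k u))\<^sup>2 + (l2_norm (pd j u))\<^sup>2) / 2)"
        by (rule weighted_product_bound[OF g(1) u])
      also have "\<dots> \<le> K * grad_sq u" using p[of k] p[of j] by (intro mult_left_mono R(8)) auto
      finally show "cmod (LINT x|lborel. g k l x * (pd k u x * cnj (pd j u x))) \<le> K * grad_sq u" .
    qed
    finally show ?thesis by (simp add: power2_eq_square ac_simps)
  qed
  moreover have "cmod (l2_inner V (pd j u)) \<le> (LINT x|lborel. cmod (V x) * cmod (pd j u x))"
    unfolding l2_inner_def
    using integral_norm_bound[of lborel "\<lambda>x. V x * cnj (pd j u x)"] by (simp add: norm_mult)
  ultimately show ?thesis by linarith
qed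

text \<open>The entries of \<open>R_s\<close> and, next, of \<open>B_s\<close>, stored as complex
  functions so that \<open>reg\<close> and the rules for complex-valued test functions
  apply.\<close>

definition symR :: "('n::finite \<Rightarrow> 'n \<Rightarrow> real^'n \<Rightarrow> complex) \<Rightarrow> 'n \<Rightarrow> 'n \<Rightarrow> real^'n \<Rightarrow> complex" where
  "symR c k l x = complex_of_real ((Re (c k l x) + Re (c l k x)) / 2)"

definition symB :: "('n::finite \<Rightarrow> 'n \<Rightarrow> real^'n \<Rightarrow> complex) \<Rightarrow> 'n \<Rightarrow> 'n \<Rightarrow> real^'n \<Rightarrow> complex" where
  "symB c k l x = complex_of_real ((Im (c k l x) + Im (c l k x)) / 2)"

lemma reg_Re:
  assumes "reg K f" shows "reg K (\<lambda>x. complex_of_real (Re (f x)))"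
proof -
  have "reg (cmod (1/2) * (K + K)) (\<lambda>x. (1/2) * (f x + cnj (f x)))"
    by (intro reg_cmult reg_add reg_cnj assms)
  moreover have "(\<lambda>x. (1/2) * (f x + cnj (f x))) = (\<lambda>x. complex_of_real (Re (f x)))"
    by (simp add: fun_eq_iff complex_add_cnj)
  ultimately show ?thesis by simp
qed

lemma reg_Im:
  assumes "reg K f" shows "reg K (\<lambda>x. complex_of_real (Im (f x)))"
proof -
  have "reg (cmod (- \<i>) * K) (\<lambda>x. - \<i> * f x)" by (intro reg_cmult assms)
  then have "reg K (\<lambda>x. complex_of_real (Re (- \<i> * f x)))" by (intro reg_Re) simp
  then show ?thesis by simp
qed

lemma reg_average:
  assumes "reg K (\<lambda>x. complex_of_real (f x))" "reg K (\<lambda>x. complex_of_real (g x))"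
  shows "reg K (\<lambda>x. complex_of_real ((f x + g x) / 2))"
proof -
  have "reg (cmod (1/2) * (K + K)) (\<lambda>x. (1/2) * (complex_of_real (f x) + complex_of_real (g x)))"
    by (intro reg_cmult reg_add assms)
  then show ?thesis by simp
qed

lemma reg_symR: "(\<And>k l. reg K (c k l)) \<Longrightarrow> reg K (symR c k l)"
  unfolding symR_def[abs_def] by (intro reg_average reg_Re)

lemma reg_symB: "(\<And>k l. reg K (c k l)) \<Longrightarrow> reg K (symB c k l)"
  unfolding symB_def[abs_def] by (intro reg_average reg_Im)

text \<open>The common outcome of the three hypotheses: the main term dominates \<open>h\<close>
  times the integral of \<open>W\<close>, and \<open>W\<close> dominates the squares of the
  dangerous terms \<open>tr (\<partial>_j B_s U)\<close>. A constant \<open>B_s\<close> allows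
  \<open>W = 0\<close>; otherwise \<open>W\<close> is \<open>tr (U R_s cnj U)\<close>. The constants
  are uniform in \<open>u\<close>, and only \<open>W\<close> depends on it.\<close>

definition grad_coercive :: "('n::finite \<Rightarrow> 'n \<Rightarrow> real^'n \<Rightarrow> complex) \<Rightarrow> bool" where
  "grad_coercive c \<longleftrightarrow> (\<exists>h>0. \<exists>M\<ge>0. \<exists>\<kappa>\<ge>0. \<forall>u\<in>Cc_inf. \<exists>W.
     integrable lborel W \<and> (\<forall>x. 0 \<le> W x) \<and>
     (\<forall>j x. (cmod (\<Sum>k\<in>UNIV. \<Sum>l\<in>UNIV. pd j (symB c k l) x * pd l (pd k u) x))\<^sup>2 \<le> M * W x) \<and>
     h * (LINT x|lborel. W x) - \<kappa> * grad_sq u \<le> Re (\<Sum>j\<in>UNIV. aform c (pd j u) (pd j u)))"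

text \<open>Young's inequality with a free parameter: a small \<open>\<eta>\<close> lets the main
  term absorb the first summand, at the price of a large multiple of the gradient.\<close>

lemma young_integral:
  assumes Z: "Z \<in> L2" and p: "p \<in> L2" and W: "integrable lborel W"
    and b: "\<And>x. (cmod (Z x))\<^sup>2 \<le> M * W x" and e: "\<eta> > 0"
  shows "(LINT x|lborel. cmod (Z x) * cmod (p x)) \<le> \<eta> * M * (LINT x|lborel. W x) + (l2_norm p)\<^sup>2 / (4 * \<eta>)"
proof -
  have "cmod (Z x) * cmod (p x) \<le> \<eta> * M * W x + (cmod (p x))\<^sup>2 / (4 * \<eta>)" for x
  proof -
    have "0 \<le> (2 * \<eta> * cmod (Z x) - cmod (p x))\<^sup>2 / (4 * \<eta>)" using e by simp
    also have "\<dots> = \<eta> * (cmod (Z x))\<^sup>2 - cmod (Z x) * cmod (p x) + (cmod (p x))\<^sup>2 / (4 * \<eta>)"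
      using e by (simp add: power2_eq_square field_simps)
    finally have "cmod (Z x) * cmod (p x) \<le> \<eta> * (cmod (Z x))\<^sup>2 + (cmod (p x))\<^sup>2 / (4 * \<eta>)" by simp
    also have "\<eta> * (cmod (Z x))\<^sup>2 \<le> \<eta> * (M * W x)" using e b by (intro mult_left_mono) auto
    finally show ?thesis by (simp add: mult.assoc)
  qed
  then have "(LINT x|lborel. cmod (Z x) * cmod (p x)) \<le> (LINT x|lborel. \<eta> * M * W x + (cmod (p x))\<^sup>2 / (4 * \<eta>))"
    using Z p W by (intro integral_mono l2_abs_inner_le Bochner_Integration.integrable_add integrable_mult_right
        integrable_divide L2_integrable)
  also have "\<dots> = \<eta> * M * (LINT x|lborel. W x) + (l2_norm p)\<^sup>2 / (4 * \<eta>)"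
    using W L2_integrable[OF p] by (simp add: l2_norm_sq)
  finally show ?thesis .
qed

theorem gradient_accretive:
  fixes c :: "'n::finite \<Rightarrow> 'n \<Rightarrow> real^'n \<Rightarrow> complex"
  assumes c: "\<And>k l. reg K (c k l)" and gc: "grad_coercive c"
  shows "\<exists>\<kappa>\<ge>0. \<forall>u\<in>Cc_inf. - \<kappa> * grad_sq u \<le> Re (l2_inner (ell c u) (\<lambda>x. - lap u x))"
proof -
  let ?d = "real CARD('n)"
  obtain h M \<kappa> where h: "h > 0" and M: "M \<ge> 0" and \<kappa>: "\<kappa> \<ge> 0"
    and H: "\<And>u. u \<in> Cc_inf \<Longrightarrow> \<exists>W. integrable lborel W \<and> (\<forall>x. 0 \<le> W x) \<and>
     (\<forall>j x. (cmod (\<Sum>k\<in>UNIV. \<Sum>l\<in>UNIV. pd j (symB c k l) x * pd l (pd k u) x))\<^sup>2 \<le> M * W x) \<and>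
     h * (LINT x|lborel. W x) - \<kappa> * grad_sq u \<le> Re (\<Sum>j\<in>UNIV. aform c (pd j u) (pd j u))"
    using gc unfolding grad_coercive_def by blast
  have K: "K \<ge> 0" using regD(8)[OF c] .
  \<comment> \<open>The coefficients with \<open>R_s\<close> removed. The symmetric part is
    \<open>\<i> * symB\<close>, and the antisymmetric part cancels against the Hessian in
    \<open>V\<close>.\<close>
  define e where "e k l x = c k l x + (-1) * symR c k l x" for k l x
  have re: "reg (K + K) (e k l)" for k l
  proof -
    have "reg (K + cmod (-1) * K) (e k l)"
      unfolding e_def[abs_def] by (intro reg_add c reg_cmult reg_symR)
    then show ?thesis by simp
  qed
  have C: "C1 (c k l)" and R: "C1 (symR c k l)" and B: "C1 (symB c k l)" and E: "C1 (e k l)" for k l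
    by (rule regD(1)[OF c], rule regD(1)[OF reg_symR[OF c]], rule regD(1)[OF reg_symB[OF c]], rule regD(1)[OF re])
  \<comment> \<open>Summation over \<open>j\<close> produces \<open>?d * \<eta> * M\<close> times
    the integral of \<open>W\<close>, which must not exceed \<open>h\<close>; the added
    \<open>1\<close> covers \<open>M = 0\<close>.\<close>
  define \<eta> where "\<eta> = h / (?d * M + 1)"
  have dM: "?d * M + 1 > 0" using M by (simp add: add_nonneg_pos)
  have \<eta>: "\<eta> > 0" "?d * \<eta> * M \<le> h" using h dM M by (auto simp: \<eta>_def field_simps)
  define \<kappa>' where "\<kappa>' = \<kappa> + ?d * (K * ?d) + ?d * ((K + K) * ?d\<^sup>2) + 1 / (4 * \<eta>)"
  have "\<kappa>' \<ge> 0" using \<kappa> K \<eta> by (simp add: \<kappa>'_def)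
  moreover have "- \<kappa>' * grad_sq u \<le> Re (l2_inner (ell c u) (\<lambda>x. - lap u x))" if u: "u \<in> Cc_inf" for u
  proof -
    obtain W where W: "integrable lborel W" "\<And>x. 0 \<le> W x"
      "\<And>j x. (cmod (\<Sum>k\<in>UNIV. \<Sum>l\<in>UNIV. pd j (symB c k l) x * pd l (pd k u) x))\<^sup>2 \<le> M * W x"
      "h * (LINT x|lborel. W x) - \<kappa> * grad_sq u \<le> Re (\<Sum>j\<in>UNIV. aform c (pd j u) (pd j u))"
      using H[OF u] by blast
    define V where "V j x = (\<Sum>k\<in>UNIV. \<Sum>l\<in>UNIV. pd j (e k l) x * pd l (pd k u) x)" for j x
    have VL: "V j \<in> L2" for j
      unfolding V_def[abs_def] by (intro L2_sum L2_csupp continuous_intros C1_pd_continuous E Cc_inf_continuous csupp_mult2 Cc_inf_csupp Cc_inf_pd u)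
    have Vb: "(cmod (V j x))\<^sup>2 \<le> M * W x" for j x
    proof -
      have pe: "pd j (e k l) x + pd j (e l k) x = 2 * \<i> * pd j (symB c k l) x" for k l
      proof -
        have "(\<lambda>x. e k l x + e l k x) = (\<lambda>x. (2 * \<i>) * symB c k l x)"
          by (auto simp: fun_eq_iff e_def symR_def symB_def complex_eq_iff field_simps)
        then have "pd j (\<lambda>x. e k l x + e l k x) x = pd j (\<lambda>x. (2 * \<i>) * symB c k l x) x" by simp
        then show ?thesis
          by (simp only: pd_add[OF C1_differentiable[OF E] C1_differentiable[OF E]] pd_cmult[OF C1_differentiable[OF B]])
      qed
      \<comment> \<open>Interchanging the indices and using the symmetry of the Hessian replaces
        \<open>e k l\<close> by \<open>e l k\<close>; averaging the two expressions leaves the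
        symmetric part.\<close>
      have "V j x = (\<Sum>k\<in>UNIV. \<Sum>l\<in>UNIV. pd j (e l k) x * pd l (pd k u) x)"
        unfolding V_def by (subst sum.swap) (simp only: pd_commute[OF Cc_inf_smooth[OF u]])
      then have "2 * V j x = (\<Sum>k\<in>UNIV. \<Sum>l\<in>UNIV. pd j (e k l) x * pd l (pd k u) x) + (\<Sum>k\<in>UNIV. \<Sum>l\<in>UNIV. pd j (e l k) x * pd l (pd k u) x)"
        unfolding V_def by simp
      also have "\<dots> = (\<Sum>k\<in>UNIV. \<Sum>l\<in>UNIV. (pd j (e k l) x + pd j (e l k) x) * pd l (pd k u) x)"
        by (simp add: sum.distrib distrib_right)
      also have "\<dots> = 2 * \<i> * (\<Sum>k\<in>UNIV. \<Sum>l\<in>UNIV. pd j (symB c k l) x * pd l (pd k u) x)"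
        unfolding pe by (simp add: sum_distrib_left mult.assoc)
      finally have "V j x = \<i> * (\<Sum>k\<in>UNIV. \<Sum>l\<in>UNIV. pd j (symB c k l) x * pd l (pd k u) x)" by simp
      then show ?thesis using W(3) by (simp add: norm_mult)
    qed
    have split: "tform c j u = tform (symR c) j u + tform e j u" for j
    proof -
      have pc: "pd j (c k l) x = pd j (symR c k l) x + pd j (e k l) x" for k l x
        using pd_add[OF C1_differentiable[OF R[of k l]] C1_differentiable[OF E[of k l]], of j x]
        by (simp add: e_def[abs_def])
      have i: "integrable lborel (\<lambda>x. pd j (f k l) x * (pd k u x * cnj (pd j (pd l u) x)))" if "\<And>k l. C1 (f k l)" for f :: "'n \<Rightarrow> 'n \<Rightarrow> real^'n \<Rightarrow> complex" and k l
        by (intro C1_integrable C1_pd_continuous that Cc_inf_mult Cc_inf_cnj Cc_inf_pd u)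
      show ?thesis unfolding tform_def pc
        unfolding distrib_right sum.distrib[symmetric]
        by (intro sum.cong refl Bochner_Integration.integral_add i[of "symR c"] i[of e] R E)
    qed
    have T: "- (K * ?d * grad_sq u) - ((K + K) * ?d\<^sup>2 * grad_sq u) - (\<eta> * M * (LINT x|lborel. W x) + (l2_norm (pd j u))\<^sup>2 / (4 * \<eta>)) \<le> Re (tform c j u)" for j
    proof -
      have "\<bar>Re (tform (symR c) j u)\<bar> \<le> K * ?d * grad_sq u"
        by (rule tform_real_symmetric[OF reg_symR[OF c] _ _ u]) (auto simp: symR_def fun_eq_iff)
      moreover have "cmod (tform e j u) \<le> (K + K) * ?d\<^sup>2 * grad_sq u + (LINT x|lborel. cmod (V j x) * cmod (pd j u x))"
        unfolding V_def by (rule tform_bound[OF re u])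
      moreover have "(LINT x|lborel. cmod (V j x) * cmod (pd j u x)) \<le> \<eta> * M * (LINT x|lborel. W x) + (l2_norm (pd j u))\<^sup>2 / (4 * \<eta>)"
        by (rule young_integral[OF VL Cc_inf_L2[OF Cc_inf_pd[OF u]] W(1) Vb \<eta>(1)])
      ultimately show ?thesis
        using abs_Re_le_cmod[of "tform e j u"] unfolding split by simp
    qed
    let ?I = "LINT x|lborel. W x"
    have I: "?I \<ge> 0" using W(2) by simp
    have "(\<Sum>j\<in>(UNIV::'n set). - (K * ?d * grad_sq u) - ((K + K) * ?d\<^sup>2 * grad_sq u) - (\<eta> * M * ?I + (l2_norm (pd j u))\<^sup>2 / (4 * \<eta>)))
        \<le> (\<Sum>j\<in>UNIV. Re (tform c j u))"
      by (intro sum_mono T)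
    also have "(\<Sum>j\<in>(UNIV::'n set). - (K * ?d * grad_sq u) - ((K + K) * ?d\<^sup>2 * grad_sq u) - (\<eta> * M * ?I + (l2_norm (pd j u))\<^sup>2 / (4 * \<eta>)))
      = - (?d * (K * ?d) * grad_sq u) - ?d * ((K + K) * ?d\<^sup>2) * grad_sq u - ?d * \<eta> * M * ?I - grad_sq u / (4 * \<eta>)"
      unfolding grad_sq_def[of u] sum_divide_distrib by (simp add: sum_subtractf sum.distrib algebra_simps)
    finally have t: "- (?d * (K * ?d) * grad_sq u) - ?d * ((K + K) * ?d\<^sup>2) * grad_sq u - ?d * \<eta> * M * ?I - grad_sq u / (4 * \<eta>)
        \<le> (\<Sum>j\<in>UNIV. Re (tform c j u))" .
    have "?d * \<eta> * M * ?I \<le> h * ?I" using \<eta>(2) I by (rule mult_right_mono)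
    moreover have "Re (l2_inner (ell c u) (\<lambda>x. - lap u x)) = Re (\<Sum>j\<in>UNIV. aform c (pd j u) (pd j u)) + (\<Sum>j\<in>UNIV. Re (tform c j u))"
      unfolding energy_identity[OF C u] by (simp add: sum.distrib)
    moreover have "- \<kappa>' * grad_sq u = - (\<kappa> * grad_sq u) - (?d * (K * ?d) * grad_sq u) - ?d * ((K + K) * ?d\<^sup>2) * grad_sq u - grad_sq u / (4 * \<eta>)"
      by (simp add: \<kappa>'_def algebra_simps)
    ultimately show ?thesis using t W(4) by linarith
  qed
  ultimately show ?thesis by blast
qed

text \<open>The adjoint coefficients change the sign of \<open>B_s\<close> and conjugate the
  diagonal values of the form; moduli and real parts do not see either change, so the same
  \<open>W\<close> works.\<close>

lemma grad_coercive_adj: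
  assumes c: "\<And>k l. reg K (c k l)" and gc: "grad_coercive c"
  shows "grad_coercive (adj c)"
proof -
  have B: "C1 (symB c k l)" for k l by (rule regD(1)[OF reg_symB[OF c]])
  have "pd j (symB (adj c) k l) x = - pd j (symB c k l) x" for j k l x
  proof -
    have "symB (adj c) k l = (\<lambda>x. (-1) * symB c k l x)"
      by (simp add: symB_def adj_def fun_eq_iff field_simps)
    then show ?thesis using pd_cmult[OF C1_differentiable[OF B[of k l]], of j "-1" x] by simp
  qed
  then have 1: "cmod (\<Sum>k\<in>UNIV. \<Sum>l\<in>UNIV. pd j (symB (adj c) k l) x * pd l (pd k u) x)
      = cmod (\<Sum>k\<in>UNIV. \<Sum>l\<in>UNIV. pd j (symB c k l) x * pd l (pd k u) x)" for j x u
    by (simp add: sum_negf)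
  have 2: "Re (\<Sum>j\<in>UNIV. aform (adj c) (pd j u) (pd j u)) = Re (\<Sum>j\<in>UNIV. aform c (pd j u) (pd j u))" if "u \<in> Cc_inf" for u
    using aform_adj[OF Cc_inf_pd[OF that] Cc_inf_pd[OF that], of c] by simp
  show ?thesis using gc unfolding grad_coercive_def 1 by (simp only: 2 cong: ball_cong)
qed

section \<open>Sectors and the three hypotheses\<close>

lemma sector_cmod_le:
  assumes "z \<in> sector \<psi>" "0 \<le> \<psi>" "\<psi> < pi/2"
  shows "cmod z * cos \<psi> \<le> Re z"
proof -
  obtain r a where z: "z = of_real r * exp (\<i> * of_real a)" "r \<ge> 0" "\<bar>a\<bar> \<le> \<psi>"
    using assms(1) by (auto simp: sector_def)
  have "cos \<psi> \<le> cos \<bar>a\<bar>" using z assms by (intro cos_monotone_0_pi_le) auto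
  then have "r * cos \<psi> \<le> r * cos a" using z(2) by (simp add: mult_left_mono)
  moreover have "Re z = r * cos a" "cmod z = r"
    using z by (simp_all add: exp_Euler[symmetric] cis_conv_exp[symmetric] norm_mult)
  ultimately show ?thesis by simp
qed

lemma sector_mult: "z \<in> sector a \<Longrightarrow> w \<in> sector b \<Longrightarrow> z * w \<in> sector (a + b)"
proof -
  assume "z \<in> sector a" "w \<in> sector b"
  then obtain r s \<alpha> \<beta> where *: "z = of_real r * exp (\<i> * of_real \<alpha>)" "r \<ge> 0" "\<bar>\<alpha>\<bar> \<le> a"
    "w = of_real s * exp (\<i> * of_real \<beta>)" "s \<ge> 0" "\<bar>\<beta>\<bar> \<le> b" by (auto simp: sector_def)
  then have "z * w = of_real (r * s) * exp (\<i> * of_real (\<alpha> + \<beta>))"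
    by (simp add: exp_add[symmetric] algebra_simps)
  moreover have "r * s \<ge> 0" "\<bar>\<alpha> + \<beta>\<bar> \<le> a + b" using * by auto
  ultimately show ?thesis unfolding sector_def by blast
qed

text \<open>Sectoriality as domination of the modulus by the real part, with
  \<open>\<kappa> = 1 / cos \<psi>\<close> for the angle \<open>\<psi>\<close>. In this shape it
  passes to integrals and to the adjoint coefficients.\<close>

definition accretive :: "real \<Rightarrow> ('n::finite \<Rightarrow> 'n \<Rightarrow> real^'n \<Rightarrow> complex) \<Rightarrow> bool" where
  "accretive \<kappa> c \<longleftrightarrow> (\<forall>x \<xi>. cmod (cqf (\<lambda>k l. c k l x) \<xi>) \<le> \<kappa> * Re (cqf (\<lambda>k l. c k l x) \<xi>))"

lemma cqf_in_sector:
  assumes "takes_values_in_sector Q \<psi>"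
  shows "cqf (\<lambda>k l. Q x $ k $ l) \<xi> \<in> sector \<psi>"
proof -
  \<comment> \<open>\<open>cqf\<close> conjugates the variable of the column index, the inner
    product that of the row index; conjugating \<open>\<xi>\<close> reconciles the two.\<close>
  have "cinner_vec (Q x *v (\<chi> k. cnj (\<xi> k))) (\<chi> k. cnj (\<xi> k)) = cqf (\<lambda>k l. Q x $ k $ l) \<xi>"
    by (simp add: cinner_vec_def cqf_def matrix_vector_mult_def sum_distrib_left sum_distrib_right ac_simps)
  then show ?thesis using assms unfolding takes_values_in_sector_def by metis
qed

lemma sector_accretive:
  assumes "takes_values_in_sector Q \<psi>" "0 \<le> \<psi>" "\<psi> < pi/2"
  shows "accretive (1 / cos \<psi>) (\<lambda>k l x. Q x $ k $ l)"
proof -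
  have c: "cos \<psi> > 0" using assms by (intro cos_gt_zero_pi) auto
  show ?thesis unfolding accretive_def
    using sector_cmod_le[OF cqf_in_sector[OF assms(1)] assms(2,3)] c by (simp add: pos_le_divide_eq)
qed

lemma accretive_Re_nonneg:
  assumes "accretive \<kappa> c" "\<kappa> > 0" shows "0 \<le> Re (cqf (\<lambda>k l. c k l x) \<xi>)"
proof -
  have "0 \<le> \<kappa> * Re (cqf (\<lambda>k l. c k l x) \<xi>)"
    using assms(1) order_trans[OF norm_ge_zero] unfolding accretive_def by blast
  then show ?thesis using assms(2) by (simp add: zero_le_mult_iff)
qed

lemma cqf_adj: "cqf (\<lambda>k l. adj c k l x) \<xi> = cnj (cqf (\<lambda>k l. c k l x) \<xi>)"
  unfolding cqf_def adj_def by (subst sum.swap) (simp add: ac_simps)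

lemma accretive_adj: "accretive \<kappa> c \<Longrightarrow> accretive \<kappa> (adj c)"
  by (simp add: accretive_def cqf_adj)

lemma
  assumes c: "\<And>k l. C1 (c k l)" and w: "w \<in> Cc_inf"
  shows aform_eq_cqf: "aform c w w = (LINT x|lborel. cqf (\<lambda>k l. c k l x) (\<lambda>k. pd k w x))"
    and cqf_integrable: "integrable lborel (\<lambda>x. cqf (\<lambda>k l. c k l x) (\<lambda>k. pd k w x))"
proof -
  have i: "integrable lborel (\<lambda>x. c k l x * pd k w x * cnj (pd l w x))" for k l
    unfolding mult.assoc by (intro C1_integrable C1_continuous c Cc_inf_mult Cc_inf_cnj Cc_inf_pd w)
  show "integrable lborel (\<lambda>x. cqf (\<lambda>k l. c k l x) (\<lambda>k. pd k w x))"
    unfolding cqf_def by (intro Bochner_Integration.integrable_sum i)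
  show "aform c w w = (LINT x|lborel. cqf (\<lambda>k l. c k l x) (\<lambda>k. pd k w x))"
    unfolding aform_alt[OF w] cqf_def by (simp add: i)
qed

lemma aform_accretive:
  assumes c: "\<And>k l. C1 (c k l)" and w: "w \<in> Cc_inf" and a: "accretive \<kappa> c" and k: "\<kappa> > 0"
  shows "cmod (aform c w w) \<le> \<kappa> * Re (aform c w w)" "0 \<le> Re (aform c w w)"
proof -
  let ?q = "\<lambda>x. cqf (\<lambda>k l. c k l x) (\<lambda>k. pd k w x)"
  note i = cqf_integrable[OF c w]
  have iR: "integrable lborel (\<lambda>x. Re (?q x))" by (rule integrable_Re[OF i])
  have Re: "Re (aform c w w) = (LINT x|lborel. Re (?q x))"
    unfolding aform_eq_cqf[OF c w] by (rule integral_Re[OF i, symmetric])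
  show "0 \<le> Re (aform c w w)" unfolding Re by (simp add: accretive_Re_nonneg[OF a k])
  have "cmod (aform c w w) \<le> (LINT x|lborel. cmod (?q x))"
    unfolding aform_eq_cqf[OF c w] by (rule integral_norm_bound)
  also have "\<dots> \<le> (LINT x|lborel. \<kappa> * Re (?q x))"
    using a by (intro integral_mono[OF integrable_norm[OF i] integrable_mult_right[OF iR]]) (simp add: accretive_def)
  finally show "cmod (aform c w w) \<le> \<kappa> * Re (aform c w w)" by (simp add: Re)
qed

section \<open>Quadratic forms of the symmetric parts\<close>

lemma rqf_transpose: "rqf (\<lambda>k l. r l k) \<xi> = rqf r \<xi>"
  unfolding rqf_def by (subst sum.swap) (simp add: ac_simps)

lemma rqf_average: "rqf (\<lambda>k l. (r k l + r l k) / 2) \<xi> = rqf r \<xi>"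
proof -
  have "rqf r \<xi> + rqf (\<lambda>k l. r l k) \<xi> = (\<Sum>k\<in>UNIV. \<Sum>l\<in>UNIV. r k l * \<xi> k * \<xi> l + r l k * \<xi> k * \<xi> l)"
    unfolding rqf_def by (simp only: sum.distrib)
  also have "\<dots> = (\<Sum>k\<in>UNIV. \<Sum>l\<in>UNIV. 2 * ((r k l + r l k) / 2 * \<xi> k * \<xi> l))"
    by (intro sum.cong refl) (simp add: field_simps)
  also have "\<dots> = 2 * rqf (\<lambda>k l. (r k l + r l k) / 2) \<xi>"
    by (simp only: rqf_def sum_distrib_left)
  finally show ?thesis using rqf_transpose[of r \<xi>] by linarith
qed

lemma cqf_real_arg:
  "Re (cqf c (\<lambda>k. complex_of_real (\<xi> k))) = rqf (\<lambda>k l. Re (c k l)) \<xi>"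
  "Im (cqf c (\<lambda>k. complex_of_real (\<xi> k))) = rqf (\<lambda>k l. Im (c k l)) \<xi>"
  by (simp_all add: cqf_def rqf_def)

text \<open>This is \<open>tr (U R_s cnj U)\<close> for the Hessian \<open>U\<close>, expanded over
  the rows of \<open>U\<close>; \<open>trace_symQ\<close> gives the matrix form.\<close>

definition symQ :: "('n::finite \<Rightarrow> 'n \<Rightarrow> real^'n \<Rightarrow> complex) \<Rightarrow> (real^'n \<Rightarrow> complex) \<Rightarrow> real^'n \<Rightarrow> real" where
  "symQ c u x = (\<Sum>j\<in>UNIV. Re (cqf (\<lambda>k l. symR c k l x) (\<lambda>k. pd k (pd j u) x)))"

lemma Re_cqf_symR:
  "Re (cqf (\<lambda>k l. symR c k l x) \<xi>) = rqf (\<lambda>k l. Re (c k l x)) (\<lambda>k. Re (\<xi> k)) + rqf (\<lambda>k l. Re (c k l x)) (\<lambda>k. Im (\<xi> k))"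
  unfolding symR_def Re_cqf_of_real rqf_average ..

text \<open>Oleinik's inequality enters with \<open>W = symQ c u\<close>. At a real vector the
  quadratic form of \<open>C\<close> has real part \<open>R_s\<close> and imaginary part
  \<open>B_s\<close>, so sectoriality yields the comparison of \<open>B_s\<close> with
  \<open>t R_s\<close> that it requires. What remains for a hypothesis to supply is a lower bound of
  the main term by the integral of \<open>symQ\<close>.\<close>

lemma grad_coercive_of_symQ:
  fixes c :: "'n::finite \<Rightarrow> 'n \<Rightarrow> real^'n \<Rightarrow> complex"
  assumes c: "\<And>k l. reg K (c k l)" and a: "accretive t c" and t: "t > 0"
    and h: "h > 0" and \<kappa>: "\<kappa> \<ge> 0"
    and le: "\<And>u. u \<in> Cc_inf \<Longrightarrow> h * (LINT x|lborel. symQ c u x) - \<kappa> * grad_sq u \<le> Re (\<Sum>j\<in>UNIV. aform c (pd j u) (pd j u))"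
  shows "grad_coercive c"
proof -
  define M where "M = 4 * real CARD('n) ^ 3 * K * (t + 1) * t"
  have K: "K \<ge> 0" using regD(8)[OF c] .
  have M: "M \<ge> 0" using K t by (simp add: M_def)
  have "\<exists>W. integrable lborel W \<and> (\<forall>x. 0 \<le> W x) \<and>
     (\<forall>j x. (cmod (\<Sum>k\<in>UNIV. \<Sum>l\<in>UNIV. pd j (symB c k l) x * pd l (pd k u) x))\<^sup>2 \<le> M * W x) \<and>
     h * (LINT x|lborel. W x) - \<kappa> * grad_sq u \<le> Re (\<Sum>j\<in>UNIV. aform c (pd j u) (pd j u))" if u: "u \<in> Cc_inf" for u
  proof (intro exI[of _ "symQ c u"] conjI allI le u)
    show "integrable lborel (symQ c u)"
      unfolding symQ_def[abs_def]
      by (intro Bochner_Integration.integrable_sum integrable_Re cqf_integrable regD(1)[OF reg_symR[OF c]] Cc_inf_pd u)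
    have nonneg: "0 \<le> rqf (\<lambda>k l. Re (c k l x)) \<xi>" for \<xi> x
      using accretive_Re_nonneg[OF a t, of x "\<lambda>k. complex_of_real (\<xi> k)"] by (simp add: cqf_real_arg)
    then show "0 \<le> symQ c u x" for x unfolding symQ_def Re_cqf_symR by (intro sum_nonneg add_nonneg_nonneg)
    fix j x
    have cond: "\<bar>rqf (\<lambda>k l. Re (symB c k l x)) \<xi>\<bar> \<le> t * rqf (\<lambda>k l. Re (symR c k l x)) \<xi>" for x \<xi>
    proof -
      let ?z = "cqf (\<lambda>k l. c k l x) (\<lambda>k. complex_of_real (\<xi> k))"
      have "\<bar>Im ?z\<bar> \<le> t * Re ?z" using a abs_Im_le_cmod[of ?z] unfolding accretive_def by (meson order_trans)
      then show ?thesis unfolding symB_def symR_def Re_complex_of_real rqf_average cqf_real_arg .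
    qed
    have real: "complex_of_real (Re (symR c k l x)) = symR c k l x" for k l by (simp add: symR_def)
    have realB: "complex_of_real (Re (pd j (symB c k l) x)) = pd j (symB c k l) x" for k l
    proof -
      have "cnj (pd j (symB c k l) x) = pd j (\<lambda>x. cnj (symB c k l x)) x"
        by (rule pd_cnj[symmetric, OF C1_differentiable[OF regD(1)[OF reg_symB[OF c]]]])
      also have "(\<lambda>x. cnj (symB c k l x)) = symB c k l" by (simp add: symB_def fun_eq_iff)
      finally have "Im (pd j (symB c k l) x) = 0" by (simp add: complex_eq_iff)
      then show ?thesis by (simp add: complex_eq_iff)
    qed
    have "(cmod (\<Sum>k\<in>UNIV. \<Sum>l\<in>UNIV. complex_of_real (Re (pd j (symB c k l) x)) * pd l (pd k u) x))\<^sup>2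
      \<le> 4 * real CARD('n) ^ 3 * K * (t + 1) * t *
        (\<Sum>m\<in>UNIV. Re (cqf (\<lambda>k l. complex_of_real (Re (symR c k l x))) (\<lambda>l. pd l (pd m u) x)))"
      by (rule oleinik[where U="\<lambda>k l. pd l (pd k u) x", OF reg_symR[OF c] reg_symB[OF c] less_imp_le[OF t] cond])
         (simp only: pd_commute[OF Cc_inf_smooth[OF u]])
    then show "(cmod (\<Sum>k\<in>UNIV. \<Sum>l\<in>UNIV. pd j (symB c k l) x * pd l (pd k u) x))\<^sup>2 \<le> M * symQ c u x"
      unfolding real realB M_def symQ_def .
  qed
  then show ?thesis unfolding grad_coercive_def using h M \<kappa> by blast
qed

text \<open>There is no dangerous term, so \<open>W = 0\<close> and \<open>M = 0\<close> do, and the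
  main term is nonnegative by sectoriality.\<close>

lemma grad_coercive_constB:
  assumes c: "\<And>k l. C1 (c k l)" and a: "accretive t c" and t: "t > 0"
    and const: "\<And>k l x y. symB c k l x = symB c k l y"
  shows "grad_coercive c"
proof -
  have "pd j (symB c k l) x = 0" for j k l x
  proof -
    have "symB c k l = (\<lambda>x. symB c k l 0)" using const by blast
    then show ?thesis using pd_const by metis
  qed
  moreover have "0 \<le> Re (\<Sum>j\<in>UNIV. aform c (pd j u) (pd j u))" if "u \<in> Cc_inf" for u
    unfolding Re_sum by (intro sum_nonneg aform_accretive[OF c _ a t] Cc_inf_pd that)
  ultimately have "(\<forall>j x. (cmod (\<Sum>k\<in>UNIV. \<Sum>l\<in>UNIV. pd j (symB c k l) x * pd l (pd k u) x))\<^sup>2 \<le> 0 * (0::real)) \<and>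
     1 * (LINT x|(lborel :: (real^'a) measure). 0) - 0 * grad_sq u \<le> Re (\<Sum>j\<in>UNIV. aform c (pd j u) (pd j u))"
    if "u \<in> Cc_inf" for u using that by simp
  then show ?thesis unfolding grad_coercive_def
    by (intro exI[of _ "1::real"] exI[of _ "0::real"] conjI ballI exI[of _ "\<lambda>x. 0"]) auto
qed

section \<open>From matrix traces to quadratic forms, and the three hypotheses\<close>

lemma trace_cqf:
  fixes U V :: "complex^'n::finite^'n"
  assumes sym: "\<And>k l. U $ k $ l = U $ l $ k"
  shows "trace (U ** V ** map_matrix cnj U) = (\<Sum>j\<in>UNIV. cqf (\<lambda>k l. V $ k $ l) (\<lambda>k. U $ j $ k))"
proof -
  have "trace (U ** V ** map_matrix cnj U) = (\<Sum>j\<in>UNIV. \<Sum>l\<in>UNIV. (\<Sum>k\<in>UNIV. U $ j $ k * V $ k $ l) * cnj (U $ l $ j))"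
    by (simp add: trace_def matrix_matrix_mult_def map_matrix_def)
  also have "\<dots> = (\<Sum>j\<in>UNIV. \<Sum>l\<in>UNIV. \<Sum>k\<in>UNIV. V $ k $ l * U $ j $ k * cnj (U $ j $ l))"
  proof (intro sum.cong refl)
    fix j l
    show "(\<Sum>k\<in>UNIV. U $ j $ k * V $ k $ l) * cnj (U $ l $ j) = (\<Sum>k\<in>UNIV. V $ k $ l * U $ j $ k * cnj (U $ j $ l))"
      unfolding sym[of l j] by (simp add: sum_distrib_right mult.commute[of "U $ j $ _"])
  qed
  also have "\<dots> = (\<Sum>j\<in>UNIV. cqf (\<lambda>k l. V $ k $ l) (\<lambda>k. U $ j $ k))"
    unfolding cqf_def by (rule sum.cong[OF refl sum.swap])
  finally show ?thesis .
qed

lemma trace_hessian: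
  assumes u: "u \<in> Cc_inf"
  shows "trace (hessian u x ** V ** map_matrix cnj (hessian u x)) = (\<Sum>j\<in>UNIV. cqf (\<lambda>k l. V $ k $ l) (\<lambda>k. pd k (pd j u) x))"
proof -
  have "hessian u x $ k $ l = hessian u x $ l $ k" for k l
    unfolding hessian_def by (simp only: vec_lambda_beta) (simp only: pd_commute[OF Cc_inf_smooth[OF u], of k l])
  from trace_cqf[OF this] show ?thesis by (simp add: hessian_def)
qed

lemma Re_cqf_hermitian: "Re (cqf (\<lambda>k l. hermitian_part V $ k $ l) \<xi>) = Re (cqf (\<lambda>k l. V $ k $ l) \<xi>)"
proof -
  have 1: "cqf (\<lambda>k l. cnj (V $ l $ k)) \<xi> = cnj (cqf (\<lambda>k l. V $ k $ l) \<xi>)"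
    unfolding cqf_def by (subst sum.swap) (simp add: ac_simps)
  have "cqf (\<lambda>k l. V $ k $ l) \<xi> + cqf (\<lambda>k l. cnj (V $ l $ k)) \<xi> = (\<Sum>k\<in>UNIV. \<Sum>l\<in>UNIV. V $ k $ l * \<xi> k * cnj (\<xi> l) + cnj (V $ l $ k) * \<xi> k * cnj (\<xi> l))"
    unfolding cqf_def by (simp only: sum.distrib)
  also have "\<dots> = (\<Sum>k\<in>UNIV. \<Sum>l\<in>UNIV. 2 * (hermitian_part V $ k $ l * \<xi> k * cnj (\<xi> l)))"
    by (intro sum.cong refl)
       (simp add: hermitian_part_def conj_transpose_def map_matrix_def transpose_def scaleR_conv_of_real[where 'a=complex] distrib_right)
  also have "\<dots> = 2 * cqf (\<lambda>k l. hermitian_part V $ k $ l) \<xi>"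
    by (simp only: cqf_def sum_distrib_left)
  finally have "2 * cqf (\<lambda>k l. hermitian_part V $ k $ l) \<xi> = cqf (\<lambda>k l. V $ k $ l) \<xi> + cnj (cqf (\<lambda>k l. V $ k $ l) \<xi>)"
    by (simp only: 1)
  then have "Re (2 * cqf (\<lambda>k l. hermitian_part V $ k $ l) \<xi>) = Re (cqf (\<lambda>k l. V $ k $ l) \<xi> + cnj (cqf (\<lambda>k l. V $ k $ l) \<xi>))"
    by (rule arg_cong)
  then show ?thesis by simp
qed

lemma symR_matrix:
  "map_matrix complex_of_real (sym_part (map_matrix Re (C x))) $ k $ l = symR (\<lambda>k l x. C x $ k $ l) k l x"
  by (simp add: map_matrix_def sym_part_def transpose_def symR_def)

lemma trace_symQ:
  assumes "u \<in> Cc_inf"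
  shows "Re (trace (hessian u x ** map_matrix of_real (sym_part (map_matrix Re (C x))) ** map_matrix cnj (hessian u x)))
    = symQ (\<lambda>k l x. C x $ k $ l) u x"
  unfolding trace_hessian[OF assms] symR_matrix symQ_def by simp

lemma hyp_i_grad_coercive:
  assumes c: "\<And>k l. C1 (\<lambda>x. C x $ k $ l)" and a: "accretive t (\<lambda>k l x. C x $ k $ l)" "t > 0" and h: "hyp_i C"
  shows "grad_coercive (\<lambda>k l x. C x $ k $ l)"
proof (rule grad_coercive_constB[OF c a])
  obtain B where B: "\<And>x. sym_part (map_matrix Im (C x)) = B" using h by (auto simp: hyp_i_def)
  have "symB (\<lambda>k l x. C x $ k $ l) k l x = complex_of_real (sym_part (map_matrix Im (C x)) $ k $ l)" for k l x
    by (simp add: symB_def sym_part_def map_matrix_def transpose_def)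
  then show "symB (\<lambda>k l x. C x $ k $ l) k l x = symB (\<lambda>k l x. C x $ k $ l) k l y" for k l x y
    by (simp add: B)
qed

lemma integral_sum_aform:
  assumes c: "\<And>k l. C1 (c k l)" and u: "u \<in> Cc_inf"
  shows "(\<Sum>j\<in>UNIV. aform c (pd j u) (pd j u)) = (LINT x|lborel. (\<Sum>j\<in>UNIV. cqf (\<lambda>k l. c k l x) (\<lambda>k. pd k (pd j u) x)))"
    and "integrable lborel (\<lambda>x. \<Sum>j\<in>UNIV. cqf (\<lambda>k l. c k l x) (\<lambda>k. pd k (pd j u) x))"
  using cqf_integrable[OF c Cc_inf_pd[OF u]] by (simp_all add: aform_eq_cqf[OF c Cc_inf_pd[OF u]])

lemma symQ_integrable:
  assumes c: "\<And>k l. reg K (c k l)" and u: "u \<in> Cc_inf"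
  shows "integrable lborel (symQ c u)"
  unfolding symQ_def[abs_def]
  by (intro Bochner_Integration.integrable_sum integrable_Re cqf_integrable regD(1)[OF reg_symR[OF c]] Cc_inf_pd u)

text \<open>Each row of the Hessian gives a value \<open>z\<close> of the form of \<open>Ct\<close>,
  and \<open>\<phi> * z\<close> lies in the sector of angle \<open>\<theta>\<close>, so its real
  part is at least \<open>cos \<theta> * cmod \<phi> * cmod z\<close>. Moduli can be summed over the
  rows and compared with the assumed lower bound for \<open>Ct\<close>; the weight
  \<open>cmod \<phi>\<close> is turned back into \<open>C\<close> by comparing the symmetric real
  parts of \<open>C\<close> and \<open>Ct\<close>.\<close>

lemma hyp_ii_grad_coercive:
  fixes C :: "real^'n::finite \<Rightarrow> complex^'n^'n"
  assumes c: "\<And>k l. reg K (\<lambda>x. C x $ k $ l)" and a: "accretive t (\<lambda>k l x. C x $ k $ l)" "t > 0"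
    and \<theta>: "0 \<le> \<theta>" "\<theta> < pi/2" and hyp: "hyp_ii C \<theta>"
  shows "grad_coercive (\<lambda>k l x. C x $ k $ l)"
proof -
  let ?c = "\<lambda>k l x. C x $ k $ l"
  obtain \<theta>1 \<theta>2 \<phi> Ct h where t2: "0 \<le> \<theta>2" "\<theta>2 < pi/2" and th: "\<theta> = \<theta>1 + \<theta>2"
    and ph: "\<And>x. \<phi> x \<in> sector \<theta>1" and Ct: "takes_values_in_sector Ct \<theta>2"
    and CC: "\<And>x k l. C x $ k $ l = \<phi> x * Ct x $ k $ l" and h: "h > 0"
    and H: "\<And>u x. u \<in> Cc_inf \<Longrightarrow> Re (trace (hessian u x ** hermitian_part (Ct x) ** map_matrix cnj (hessian u x))) \<ge>
        h * Re (trace (hessian u x ** map_matrix of_real (sym_part (map_matrix Re (Ct x))) ** map_matrix cnj (hessian u x)))"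
    using hyp unfolding hyp_ii_def Let_def by blast
  have cos: "cos \<theta> > 0" "cos \<theta>2 > 0" using \<theta> t2 by (auto intro!: cos_gt_zero_pi)
  have cC: "cqf (\<lambda>k l. C x $ k $ l) \<xi> = \<phi> x * cqf (\<lambda>k l. Ct x $ k $ l) \<xi>" for x \<xi>
    unfolding cqf_def CC by (simp add: sum_distrib_left mult.assoc)
  \<comment> \<open>One cosine from the sector of \<open>C\<close>, the constant \<open>h\<close> of
    the hypothesis, and one cosine from comparing the symmetric real parts of \<open>C\<close> and
    \<open>Ct\<close>.\<close>
  define g where "g = cos \<theta> * h * cos \<theta>2"
  have g: "g > 0" using cos h by (simp add: g_def)
  have le: "g * symQ ?c u x \<le> Re (\<Sum>j\<in>UNIV. cqf (\<lambda>k l. C x $ k $ l) (\<lambda>k. pd k (pd j u) x))" if u: "u \<in> Cc_inf" for u x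
  proof -
    let ?\<xi> = "\<lambda>j k. pd k (pd j u) x"
    let ?z = "\<lambda>j. cqf (\<lambda>k l. Ct x $ k $ l) (?\<xi> j)"
    let ?T = "symQ (\<lambda>k l x. Ct x $ k $ l) u x"
    have "h * ?T \<le> (\<Sum>j\<in>UNIV. Re (?z j))"
      using H[OF u, of x] unfolding trace_symQ[OF u] unfolding trace_hessian[OF u] Re_sum Re_cqf_hermitian .
    also have "\<dots> \<le> (\<Sum>j\<in>UNIV. cmod (?z j))" by (intro sum_mono complex_Re_le_cmod)
    finally have 1: "h * ?T \<le> (\<Sum>j\<in>UNIV. cmod (?z j))" .
    have "(cos \<theta> * cmod (\<phi> x)) * (h * ?T) \<le> (cos \<theta> * cmod (\<phi> x)) * (\<Sum>j\<in>UNIV. cmod (?z j))"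
      using 1 cos by (intro mult_left_mono) auto
    also have "\<dots> = (\<Sum>j\<in>UNIV. cmod (\<phi> x * ?z j) * cos \<theta>)" by (simp add: sum_distrib_left norm_mult ac_simps)
    also have "\<dots> \<le> (\<Sum>j\<in>UNIV. Re (\<phi> x * ?z j))"
      unfolding th by (intro sum_mono sector_cmod_le sector_mult ph cqf_in_sector[OF Ct] \<theta>[unfolded th])
    also have "\<dots> = Re (\<Sum>j\<in>UNIV. cqf (\<lambda>k l. C x $ k $ l) (?\<xi> j))" by (simp add: cC)
    finally have 2: "(cos \<theta> * cmod (\<phi> x)) * (h * ?T) \<le> Re (\<Sum>j\<in>UNIV. cqf (\<lambda>k l. C x $ k $ l) (?\<xi> j))" .
    \<comment> \<open>Since \<open>\<phi>\<close> may vanish, the forms are compared with the weight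
      \<open>cmod (\<phi> x)\<close> instead of dividing by it.\<close>
    have rq: "cos \<theta>2 * rqf (\<lambda>k l. Re (C x $ k $ l)) \<eta> \<le> cmod (\<phi> x) * rqf (\<lambda>k l. Re (Ct x $ k $ l)) \<eta>" for \<eta>
    proof -
      let ?w = "cqf (\<lambda>k l. Ct x $ k $ l) (\<lambda>k. complex_of_real (\<eta> k))"
      have "rqf (\<lambda>k l. Re (C x $ k $ l)) \<eta> = Re (\<phi> x * ?w)" by (simp only: cqf_real_arg(1)[symmetric] cC)
      also have "\<dots> \<le> cmod (\<phi> x) * cmod ?w" by (metis complex_Re_le_cmod norm_mult)
      finally have "cos \<theta>2 * rqf (\<lambda>k l. Re (C x $ k $ l)) \<eta> \<le> cos \<theta>2 * (cmod (\<phi> x) * cmod ?w)"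
        using cos by (intro mult_left_mono) auto
      also have "\<dots> = cmod (\<phi> x) * (cmod ?w * cos \<theta>2)" by simp
      also have "\<dots> \<le> cmod (\<phi> x) * Re ?w"
        by (intro mult_left_mono sector_cmod_le cqf_in_sector[OF Ct] t2) auto
      finally show ?thesis by (simp only: cqf_real_arg)
    qed
    have "cos \<theta>2 * symQ ?c u x \<le> cmod (\<phi> x) * ?T"
      unfolding symQ_def Re_cqf_symR sum_distrib_left distrib_left by (intro sum_mono add_mono rq)
    then have "(cos \<theta> * h) * (cos \<theta>2 * symQ ?c u x) \<le> (cos \<theta> * h) * (cmod (\<phi> x) * ?T)"
      using cos h by (intro mult_left_mono) auto
    with 2 show ?thesis by (simp add: g_def ac_simps)
  qed
  show ?thesis
  proof (rule grad_coercive_of_symQ[OF c a g order_refl])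
    fix u :: "real^'n \<Rightarrow> complex" assume u: "u \<in> Cc_inf"
    note C1 = regD(1)[OF c]
    have "g * (LINT x|lborel. symQ ?c u x) = (LINT x|lborel. g * symQ ?c u x)" by simp
    also have "\<dots> \<le> (LINT x|lborel. Re (\<Sum>j\<in>UNIV. cqf (\<lambda>k l. C x $ k $ l) (\<lambda>k. pd k (pd j u) x)))"
      using le[OF u] by (intro integral_mono integrable_mult_right symQ_integrable[OF c u] integrable_Re integral_sum_aform(2)[OF C1 u])
    also have "\<dots> = Re (\<Sum>j\<in>UNIV. aform ?c (pd j u) (pd j u))"
      unfolding integral_sum_aform(1)[OF C1 u] by (rule integral_Re[OF integral_sum_aform(2)[OF C1 u]])
    finally show "g * (LINT x|lborel. symQ ?c u x) - 0 * grad_sq u \<le> Re (\<Sum>j\<in>UNIV. aform ?c (pd j u) (pd j u))" by simp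
  qed
qed

text \<open>The entries of \<open>B_a\<close>; the sum with a negated term matches the shape of
  \<open>reg_average\<close>.\<close>

definition skewB :: "('n::finite \<Rightarrow> 'n \<Rightarrow> real^'n \<Rightarrow> complex) \<Rightarrow> 'n \<Rightarrow> 'n \<Rightarrow> real^'n \<Rightarrow> complex" where
  "skewB c k l x = complex_of_real ((Im (c k l x) + - Im (c l k x)) / 2)"

lemma reg_skewB:
  assumes "\<And>k l. reg K (c k l)" shows "reg K (skewB c k l)"
proof -
  have "reg (cmod (-1) * K) (\<lambda>x. (-1) * complex_of_real (Im (c l k x)))"
    by (intro reg_cmult reg_Im assms)
  then have "reg K (\<lambda>x. complex_of_real (- Im (c l k x)))" by simp
  then show ?thesis unfolding skewB_def[abs_def] by (intro reg_average reg_Im assms)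
qed

text \<open>Of the four parts of \<open>C\<close> only \<open>R_s\<close> and
  \<open>\<i> B_a\<close> are Hermitian; the other two contribute imaginary values. The sign comes
  from \<open>Re (\<i> * z) = - Im z\<close>.\<close>

lemma Re_cqf_split:
  "Re (cqf (\<lambda>k l. c k l x) \<xi>) = Re (cqf (\<lambda>k l. symR c k l x) \<xi>) - Im (cqf (\<lambda>k l. skewB c k l x) \<xi>)"
proof -
  have swap: "(\<Sum>k\<in>UNIV. \<Sum>l\<in>UNIV. f k l) = (\<Sum>k\<in>UNIV. \<Sum>l\<in>UNIV. (f k l + f l k) / 2)" for f :: "'a \<Rightarrow> 'a \<Rightarrow> real"
  proof -
    have "(\<Sum>k\<in>UNIV. \<Sum>l\<in>UNIV. (f k l + f l k) / 2) = ((\<Sum>k\<in>UNIV. \<Sum>l\<in>UNIV. f k l) + (\<Sum>k\<in>UNIV. \<Sum>l\<in>UNIV. f l k)) / 2"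
      by (simp only: sum.distrib sum_divide_distrib[symmetric])
    then show ?thesis using sum.swap[of "\<lambda>k l. f l k" UNIV UNIV] by simp
  qed
  have "Re (cqf (\<lambda>k l. c k l x) \<xi>) = (\<Sum>k\<in>UNIV. \<Sum>l\<in>UNIV. Re (c k l x * \<xi> k * cnj (\<xi> l)))"
    unfolding cqf_def Re_sum ..
  also have "\<dots> = (\<Sum>k\<in>UNIV. \<Sum>l\<in>UNIV. (Re (c k l x * \<xi> k * cnj (\<xi> l)) + Re (c l k x * \<xi> l * cnj (\<xi> k))) / 2)"
    by (rule swap)
  also have "\<dots> = (\<Sum>k\<in>UNIV. \<Sum>l\<in>UNIV. Re (symR c k l x * \<xi> k * cnj (\<xi> l)) - Im (skewB c k l x * \<xi> k * cnj (\<xi> l)))"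
    by (intro sum.cong refl) (simp add: symR_def skewB_def field_simps)
  also have "\<dots> = Re (cqf (\<lambda>k l. symR c k l x) \<xi>) - Im (cqf (\<lambda>k l. skewB c k l x) \<xi>)"
    unfolding cqf_def Re_sum Im_sum sum_subtractf ..
  finally show ?thesis .
qed

lemma hs_norm_sq: "(hs_norm V)\<^sup>2 = (\<Sum>j\<in>UNIV. \<Sum>i\<in>UNIV. (cmod (V $ i $ j))\<^sup>2)"
proof -
  have "Re (trace (conj_transpose V ** V)) = (\<Sum>j\<in>UNIV. \<Sum>i\<in>UNIV. Re (cnj (V $ i $ j) * V $ i $ j))"
    by (simp only: trace_def matrix_matrix_mult_def conj_transpose_def map_matrix_def transpose_def vec_lambda_beta Re_sum)
  also have "\<dots> = (\<Sum>j\<in>UNIV. \<Sum>i\<in>UNIV. (cmod (V $ i $ j))\<^sup>2)"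
    unfolding cmod_power2 by (simp add: power2_eq_square)
  finally have "Re (trace (conj_transpose V ** V)) = (\<Sum>j\<in>UNIV. \<Sum>i\<in>UNIV. (cmod (V $ i $ j))\<^sup>2)" .
  moreover have "0 \<le> (\<Sum>j\<in>UNIV. \<Sum>i\<in>UNIV. (cmod (V $ i $ j))\<^sup>2)" by (intro sum_nonneg) auto
  ultimately show ?thesis by (simp add: hs_norm_def)
qed

text \<open>The real part of the form at \<open>pd j u\<close> differs from its \<open>R_s\<close>
  part by the form of \<open>B_a\<close>. As \<open>B_a\<close> is antisymmetric, its operator has
  no second-order term: it multiplies derivatives of \<open>B_a\<close> by first derivatives of
  \<open>pd j u\<close>, that is by the Hessian of \<open>u\<close>. The hypothesis bounds these
  products by \<open>symQ\<close>, and Young's inequality lets half of the main term absorb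
  them.\<close>

lemma hyp_iii_grad_coercive:
  fixes C :: "real^'n::finite \<Rightarrow> complex^'n^'n"
  assumes c: "\<And>k l. reg K (\<lambda>x. C x $ k $ l)" and a: "accretive t (\<lambda>k l x. C x $ k $ l)" "t > 0" and hyp: "hyp_iii C"
  shows "grad_coercive (\<lambda>k l x. C x $ k $ l)"
proof -
  let ?c = "\<lambda>k l x. C x $ k $ l" and ?d = "real CARD('n)"
  let ?A = "skewB ?c"
  have C1: "C1 (?c k l)" and A1: "C1 (?A k l)" for k l by (rule regD(1)[OF c], rule regD(1)[OF reg_skewB[OF c]])
  obtain M where M: "M > 0" and H: "\<And>l u x. u \<in> Cc_inf \<Longrightarrow>
     (hs_norm (map_matrix of_real (pd_matrix l (\<lambda>y. skew_part (map_matrix Im (C y))) x) ** hessian u x))\<^sup>2 \<le> M * symQ ?c u x"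
    using hyp unfolding hyp_iii_def Let_def by (auto simp: trace_symQ)
  have pdA: "complex_of_real (pd_matrix l (\<lambda>y. skew_part (map_matrix Im (C y))) x $ i $ j) = pd l (?A i j) x" for l i j x
  proof -
    let ?f = "\<lambda>x. (Im (C x $ i $ j) - Im (C x $ j $ i)) / 2"
    have d: "?f differentiable (at x)"
      by (intro differentiable_divide differentiable_diff differentiable_bounded_linear[OF bounded_linear_Im] C1_differentiable[OF C1] differentiable_const) simp
    have "pd l (\<lambda>x. complex_of_real (?f x)) x = complex_of_real (pd l ?f x)"
      by (rule pd_bounded_linear[OF bounded_linear_of_real d])
    then show ?thesis
      by (simp add: pd_matrix_def skew_part_def map_matrix_def transpose_def skewB_def[abs_def])
  qed
  \<comment> \<open>Aims at the factor \<open>1/2\<close> in the equation below: there are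
    \<open>?d\<close> values of \<open>j\<close>, and \<open>?d\<^sup>2 * M\<close> comes from
    summing over \<open>l\<close> with Cauchy-Schwarz.\<close>
  define \<eta> where "\<eta> = 1 / (2 * ?d ^ 3 * M)"
  have d: "?d > 0" by simp
  have \<eta>: "\<eta> > 0" "?d * (\<eta> * (?d\<^sup>2 * M)) = 1/2" using M d by (auto simp: \<eta>_def power2_eq_square power3_eq_cube)
  have bound: "cmod (aform ?A (pd j u) (pd j u)) \<le> \<eta> * (?d\<^sup>2 * M) * (LINT x|lborel. symQ ?c u x) + (l2_norm (pd j u))\<^sup>2 / (4 * \<eta>)"
    if u: "u \<in> Cc_inf" for u j
  proof -
    let ?w = "pd j u"
    have w: "?w \<in> Cc_inf" by (rule Cc_inf_pd[OF u])
    define Z where "Z x = (\<Sum>l\<in>UNIV. \<Sum>k\<in>UNIV. pd l (?A l k) x * hessian u x $ k $ j)" for x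
    have hess: "hessian u x $ k $ j = pd k ?w x" for x k
      unfolding hessian_def by (simp only: vec_lambda_beta pd_commute[OF Cc_inf_smooth[OF u], of j k])
    have skew: "?A l k x = - ?A k l x" for k l x by (simp add: skewB_def field_simps)
    have pskew: "pd i (?A l k) x = - pd i (?A k l) x" for i k l x
    proof -
      have "?A l k = (\<lambda>x. (-1) * ?A k l x)" using skew[of l k] by (auto simp: fun_eq_iff)
      then show ?thesis using pd_cmult[OF C1_differentiable[OF A1[of k l]], of i "-1" x] by simp
    qed
    have anti: "(\<Sum>k\<in>UNIV. \<Sum>l\<in>UNIV. ?A k l x * pd l (pd k ?w) x) = 0" for x
    proof -
      let ?S = "\<Sum>k\<in>UNIV. \<Sum>l\<in>UNIV. ?A k l x * pd l (pd k ?w) x"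
      have "?S = (\<Sum>l\<in>UNIV. \<Sum>k\<in>UNIV. ?A k l x * pd l (pd k ?w) x)" by (rule sum.swap)
      also have "\<dots> = (\<Sum>l\<in>UNIV. \<Sum>k\<in>UNIV. - (?A l k x * pd k (pd l ?w) x))"
      proof (intro sum.cong refl)
        fix k l
        show "?A k l x * pd l (pd k ?w) x = - (?A l k x * pd k (pd l ?w) x)"
          unfolding skew[of l k] pd_commute[OF Cc_inf_smooth[OF w], of k l] by simp
      qed
      also have "\<dots> = - ?S" by (simp add: sum_negf)
      finally show ?thesis by simp
    qed
    have ell: "ell ?A ?w x = Z x" for x
    proof -
      have "ell ?A ?w x = - (\<Sum>k\<in>UNIV. \<Sum>l\<in>UNIV. pd l (?A k l) x * pd k ?w x)"
        unfolding ell_expand[OF A1 w] sum.distrib anti by simp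
      also have "\<dots> = - (\<Sum>l\<in>UNIV. \<Sum>k\<in>UNIV. pd l (?A k l) x * pd k ?w x)" by (subst sum.swap) (rule refl)
      also have "\<dots> = Z x"
        unfolding Z_def hess sum_negf[symmetric]
      proof (intro sum.cong refl)
        fix l k
        show "- (pd l (?A k l) x * pd k ?w x) = pd l (?A l k) x * pd k ?w x"
          unfolding pskew[of l l k] by simp
      qed
      finally show ?thesis .
    qed
    have ZL: "Z \<in> L2" using ell_L2[of ?A ?w, OF A1 w] ext[of "ell ?A ?w" Z, OF ell] by simp
    have Zb: "(cmod (Z x))\<^sup>2 \<le> (?d\<^sup>2 * M) * symQ ?c u x" for x
    proof -
      let ?v = "\<lambda>l. \<Sum>k\<in>UNIV. pd l (?A l k) x * hessian u x $ k $ j"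
      have v: "(cmod (?v l))\<^sup>2 \<le> M * symQ ?c u x" for l
      proof -
        let ?V = "map_matrix complex_of_real (pd_matrix l (\<lambda>y. skew_part (map_matrix Im (C y))) x) ** hessian u x"
        \<comment> \<open>Of each matrix \<open>(\<partial>_l B_a) U\<close> only the entry
          \<open>(l, j)\<close> enters \<open>Z\<close>; its square is at most the squared
          Hilbert-Schmidt norm.\<close>
        have "?V $ l $ j = ?v l" by (simp only: matrix_matrix_mult_def map_matrix_def[of complex_of_real] vec_lambda_beta pdA)
        then have "(cmod (?v l))\<^sup>2 = (cmod (?V $ l $ j))\<^sup>2" by simp
        also have "\<dots> \<le> (\<Sum>i\<in>UNIV. (cmod (?V $ i $ j))\<^sup>2)" by (rule member_le_sum) auto
        also have "\<dots> \<le> (\<Sum>j\<in>UNIV. \<Sum>i\<in>UNIV. (cmod (?V $ i $ j))\<^sup>2)" by (rule member_le_sum) (auto intro: sum_nonneg)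
        finally show ?thesis using H[OF u, of l x] by (simp only: hs_norm_sq)
      qed
      have "cmod (Z x) \<le> (\<Sum>l\<in>UNIV. cmod (?v l))" unfolding Z_def by (rule norm_sum)
      then have "(cmod (Z x))\<^sup>2 \<le> (\<Sum>l\<in>UNIV. cmod (?v l))\<^sup>2" by (intro power_mono) auto
      also have "\<dots> \<le> (\<Sum>l\<in>UNIV. (cmod (?v l))\<^sup>2) * ?d" by (rule sum_squared_le_sum_of_squares)
      also have "\<dots> \<le> (\<Sum>l\<in>(UNIV::'n set). M * symQ ?c u x) * ?d" by (intro mult_right_mono sum_mono v) simp
      finally show ?thesis by (simp add: power2_eq_square ac_simps)
    qed
    have "aform ?A ?w ?w = l2_inner (ell ?A ?w) ?w" by (rule ell_inner[OF A1 w w, symmetric])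
    also have "\<dots> = l2_inner Z ?w" by (simp add: l2_inner_def ell)
    also have "cmod \<dots> \<le> (LINT x|lborel. cmod (Z x) * cmod (?w x))"
      unfolding l2_inner_def using integral_norm_bound[of lborel "\<lambda>x. Z x * cnj (?w x)"] by (simp add: norm_mult)
    also have "\<dots> \<le> \<eta> * (?d\<^sup>2 * M) * (LINT x|lborel. symQ ?c u x) + (l2_norm ?w)\<^sup>2 / (4 * \<eta>)"
      by (rule young_integral[OF ZL Cc_inf_L2[OF w] symQ_integrable[OF c u] Zb \<eta>(1)])
    finally show ?thesis .
  qed
  show ?thesis
  proof (rule grad_coercive_of_symQ[OF c a, of "1/2" "1 / (4 * \<eta>)"])
    fix u :: "real^'n \<Rightarrow> complex" assume u: "u \<in> Cc_inf"
    let ?I = "LINT x|lborel. symQ ?c u x"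
    let ?qA = "\<lambda>x. \<Sum>j\<in>UNIV. cqf (\<lambda>k l. ?A k l x) (\<lambda>k. pd k (pd j u) x)"
    have iA: "integrable lborel ?qA" by (rule integral_sum_aform(2)[of ?A u, OF A1 u])
    have "Re (\<Sum>j\<in>UNIV. aform ?c (pd j u) (pd j u)) = (LINT x|lborel. Re (\<Sum>j\<in>UNIV. cqf (\<lambda>k l. C x $ k $ l) (\<lambda>k. pd k (pd j u) x)))"
      unfolding integral_sum_aform(1)[OF C1 u] by (rule integral_Re[symmetric, OF integral_sum_aform(2)[OF C1 u]])
    also have "\<dots> = (LINT x|lborel. symQ ?c u x - Im (?qA x))"
      unfolding Re_sum Im_sum symQ_def sum_subtractf[symmetric] Re_cqf_split[of ?c] ..
    also have "\<dots> = ?I - (LINT x|lborel. Im (?qA x))"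
      by (rule Bochner_Integration.integral_diff[OF symQ_integrable[OF c u] integrable_Im[OF iA]])
    also have "(LINT x|lborel. Im (?qA x)) = Im (\<Sum>j\<in>UNIV. aform ?A (pd j u) (pd j u))"
      unfolding integral_sum_aform(1)[of ?A u, OF A1 u] by (rule integral_Im[OF iA])
    finally have eq: "Re (\<Sum>j\<in>UNIV. aform ?c (pd j u) (pd j u)) = ?I - Im (\<Sum>j\<in>UNIV. aform ?A (pd j u) (pd j u))" .
    have "Im (\<Sum>j\<in>UNIV. aform ?A (pd j u) (pd j u)) \<le> cmod (\<Sum>j\<in>UNIV. aform ?A (pd j u) (pd j u))"
      using abs_Im_le_cmod abs_le_D1 by blast
    also have "\<dots> \<le> (\<Sum>j\<in>UNIV. \<eta> * (?d\<^sup>2 * M) * ?I + (l2_norm (pd j u))\<^sup>2 / (4 * \<eta>))"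
      by (rule order_trans[OF norm_sum]) (intro sum_mono bound u)
    also have "\<dots> = (?d * (\<eta> * (?d\<^sup>2 * M))) * ?I + 1 / (4 * \<eta>) * grad_sq u"
      by (simp add: sum.distrib grad_sq_def sum_divide_distrib)
    also have "\<dots> = 1/2 * ?I + 1 / (4 * \<eta>) * grad_sq u" by (simp only: \<eta>(2))
    finally show "1/2 * ?I - 1 / (4 * \<eta>) * grad_sq u \<le> Re (\<Sum>j\<in>UNIV. aform ?c (pd j u) (pd j u))"
      unfolding eq by linarith
  qed (use \<eta> in auto)
qed

section \<open>Density of the range\<close>

lemma pd_lincomb:
  assumes "u \<in> Cc_inf" "w \<in> Cc_inf"
  shows "pd k (\<lambda>x. u x + s * w x) = (\<lambda>x. pd k u x + s * pd k w x)"
proof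
  fix x
  have "pd k (\<lambda>x. u x + s * w x) x = pd k u x + pd k (\<lambda>x. s * w x) x"
    by (intro pd_add Cc_inf_differentiable Cc_inf_cmult assms)
  also have "pd k (\<lambda>x. s * w x) x = s * pd k w x"
    by (intro pd_cmult Cc_inf_differentiable assms)
  finally show "pd k (\<lambda>x. u x + s * w x) x = pd k u x + s * pd k w x" .
qed

lemma Cc_inf_lincomb: "u \<in> Cc_inf \<Longrightarrow> w \<in> Cc_inf \<Longrightarrow> (\<lambda>x. u x + s * w x) \<in> Cc_inf"
  by (intro Cc_inf_add Cc_inf_cmult)

lemma ell_lincomb:
  assumes c: "\<And>k l. C1 (c k l)" and u: "u \<in> Cc_inf" and w: "w \<in> Cc_inf"
  shows "ell c (\<lambda>x. u x + s * w x) = (\<lambda>x. ell c u x + s * ell c w x)"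
proof
  fix x
  show "ell c (\<lambda>x. u x + s * w x) x = ell c u x + s * ell c w x"
    unfolding ell_expand[OF c Cc_inf_lincomb[OF u w]] ell_expand[OF c u] ell_expand[OF c w]
    by (simp add: pd_lincomb u w Cc_inf_pd distrib_left sum.distrib sum_distrib_left algebra_simps)
qed

lemma aform_lincomb_left:
  assumes c: "\<And>k l. C1 (c k l)" and u: "u \<in> Cc_inf" and w: "w \<in> Cc_inf" and v: "v \<in> Cc_inf"
  shows "aform c (\<lambda>x. u x + s * w x) v = aform c u v + s * aform c w v"
  using u w v
  by (simp add: ell_inner[symmetric, OF c] ell_lincomb[OF c] Cc_inf_lincomb l2_inner_add_left l2_inner_cmult_left
      ell_L2[OF c] L2_cmult Cc_inf_L2)

lemma aform_lincomb_right:
  assumes c: "\<And>k l. C1 (c k l)" and u: "u \<in> Cc_inf" and w: "w \<in> Cc_inf" and v: "v \<in> Cc_inf"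
  shows "aform c v (\<lambda>x. u x + s * w x) = aform c v u + cnj s * aform c v w"
  using u w v
  by (simp add: ell_inner[symmetric, OF c] Cc_inf_lincomb l2_inner_add_right l2_inner_cmult_right
      ell_L2[OF c] L2_cmult Cc_inf_L2)

lemma lap_symmetric:
  assumes "w \<in> Cc_inf" "v \<in> Cc_inf"
  shows "l2_inner (lap w) v = l2_inner w (lap v)"
proof -
  have "l2_inner (lap w) v = (\<Sum>k\<in>UNIV. l2_inner (pd k (pd k w)) v)"
    unfolding lap_def[abs_def] by (intro l2_inner_sum_left Cc_inf_L2 Cc_inf_pd assms)
  also have "\<dots> = (\<Sum>k\<in>UNIV. l2_inner w (pd k (pd k v)))"
    using assms by (simp add: l2_inner_pd Cc_inf_pd)
  also have "\<dots> = l2_inner w (lap v)"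
    unfolding lap_def[abs_def] by (intro l2_inner_sum_right[symmetric] Cc_inf_L2 Cc_inf_pd assms)
  finally show ?thesis .
qed

lemma Re_l2_inner_le: "f \<in> L2 \<Longrightarrow> g \<in> L2 \<Longrightarrow> Re (l2_inner f g) \<le> l2_norm f * l2_norm g"
  using l2_cauchy_schwarz complex_Re_le_cmod order_trans by blast

definition shifted :: "real \<Rightarrow> ('n::finite \<Rightarrow> 'n \<Rightarrow> real^'n \<Rightarrow> complex) \<Rightarrow> (real^'n \<Rightarrow> complex) \<Rightarrow> real^'n \<Rightarrow> complex" where
  "shifted \<mu> c u x = complex_of_real \<mu> * u x + ell c u x"

lemma shifted_L2: "(\<And>k l. C1 (c k l)) \<Longrightarrow> u \<in> Cc_inf \<Longrightarrow> shifted \<mu> c u \<in> L2"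
  unfolding shifted_def[abs_def] by (intro L2_add L2_cmult ell_L2 Cc_inf_L2)

lemma shifted_lincomb:
  assumes c: "\<And>k l. C1 (c k l)" and u: "u \<in> Cc_inf" and w: "w \<in> Cc_inf"
  shows "shifted \<mu> c (\<lambda>x. u x + s * w x) x = shifted \<mu> c u x + s * shifted \<mu> c w x"
  unfolding shifted_def ell_lincomb[OF c u w] by (simp add: algebra_simps)

lemma shifted_accretive:
  assumes c: "\<And>k l. C1 (c k l)" and u: "u \<in> Cc_inf" and a: "accretive t c" "t > 0" and l: "\<mu> > 0"
  shows "\<mu> * l2_norm u \<le> l2_norm (shifted \<mu> c u)"
proof (cases "l2_norm u = 0")
  case False
  have L: "u \<in> L2" "ell c u \<in> L2" "shifted \<mu> c u \<in> L2" using c u by (auto intro: Cc_inf_L2 ell_L2 shifted_L2)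
  have "l2_inner (shifted \<mu> c u) u = complex_of_real \<mu> * l2_inner u u + aform c u u"
    using L by (simp add: shifted_def[abs_def] l2_inner_add_left L2_cmult l2_inner_cmult_left ell_inner[OF c u u])
  then have "Re (l2_inner (shifted \<mu> c u) u) = \<mu> * (l2_norm u)\<^sup>2 + Re (aform c u u)"
    by (simp add: l2_inner_self del: of_real_power)
  then have "\<mu> * (l2_norm u)\<^sup>2 \<le> Re (l2_inner (shifted \<mu> c u) u)"
    using aform_accretive(2)[OF c u a] by simp
  also have "\<dots> \<le> l2_norm (shifted \<mu> c u) * l2_norm u" by (rule Re_l2_inner_le[OF L(3,1)])
  finally have "(\<mu> * l2_norm u) * l2_norm u \<le> l2_norm (shifted \<mu> c u) * l2_norm u" by (simp add: power2_eq_square)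
  moreover have "l2_norm u > 0" using False l2_norm_nonneg[of u] by linarith
  ultimately show ?thesis by simp
qed simp

text \<open>In the inner product of the first-order Sobolev space the shift contributes
  \<open>\<mu> * grad_sq u\<close>, which compensates the loss \<open>\<kappa> * grad_sq u\<close>;
  hence the requirement \<open>\<mu> \<ge> \<kappa>\<close>.\<close>

lemma shifted_inner_one_minus_lap:
  assumes c: "\<And>k l. C1 (c k l)" and u: "u \<in> Cc_inf" and a: "accretive t c" "t > 0"
    and \<kappa>: "- \<kappa> * grad_sq u \<le> Re (l2_inner (ell c u) (\<lambda>x. - lap u x))" and l: "\<mu> \<ge> \<kappa>"
  shows "\<mu> * (l2_norm u)\<^sup>2 \<le> Re (l2_inner (shifted \<mu> c u) (\<lambda>x. u x - lap u x))"
proof -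
  have L: "u \<in> L2" "lap u \<in> L2" "ell c u \<in> L2" using c u by (auto intro: Cc_inf_L2 ell_L2 lap_Cc_inf)
  have "l2_inner (shifted \<mu> c u) (\<lambda>x. u x - lap u x)
      = complex_of_real \<mu> * (l2_inner u u - l2_inner u (lap u)) + (aform c u u - l2_inner (ell c u) (lap u))"
    using L by (simp add: shifted_def[abs_def] l2_inner_add_left L2_cmult l2_inner_cmult_left l2_inner_diff_right
        L2_diff ell_inner[OF c u u])
  then have "Re (l2_inner (shifted \<mu> c u) (\<lambda>x. u x - lap u x))
      = \<mu> * ((l2_norm u)\<^sup>2 + grad_sq u) + Re (aform c u u) - Re (l2_inner (ell c u) (lap u))"
    by (simp add: l2_inner_self inner_lap[OF u] del: of_real_power)
  moreover have "l2_inner (ell c u) (\<lambda>x. - lap u x) = - l2_inner (ell c u) (lap u)"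
    using l2_inner_cmult_right[of "ell c u" "-1" "lap u"] by simp
  moreover have "\<kappa> * grad_sq u \<le> \<mu> * grad_sq u" using l grad_sq_nonneg by (rule mult_right_mono)
  ultimately show ?thesis using \<kappa> aform_accretive(2)[OF c u a] by (simp add: distrib_left)
qed

text \<open>The residual \<open>r\<close> of a near-minimiser of the distance from \<open>f\<close> to the range is nearly orthogonal
  to the range.  Testing with \<open>w\<close> such that \<open>w - lap w\<close> is close to \<open>r\<close> shows that \<open>w\<close> is small, hence
  \<open>r\<close> is small in the weak sense, which forces the distance to vanish.  Completeness of the
  Hilbert space is not needed.\<close>

theorem shifted_range_dense:
  fixes c :: "'n::finite \<Rightarrow> 'n \<Rightarrow> real^'n \<Rightarrow> complex"
  assumes rc: "\<And>k l. reg K (c k l)" and a: "accretive t c" "t > 0" 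
    and \<kappa>: "\<And>u. u \<in> Cc_inf \<Longrightarrow> - \<kappa> * grad_sq u \<le> Re (l2_inner (ell c u) (\<lambda>x. - lap u x))"
    and l: "\<mu> \<ge> \<kappa>" "\<mu> \<ge> 1" and f: "f \<in> L2" and e: "\<epsilon> > 0"
  shows "\<exists>u\<in>Cc_inf. l2_norm (\<lambda>x. f x - shifted \<mu> c u x) < \<epsilon>"
proof -
  have c: "C1 (c k l)" for k l by (rule regD(1)[OF rc])
  let ?T = "shifted \<mu> c"
  have TL: "?T u \<in> L2" if "u \<in> Cc_inf" for u by (rule shifted_L2[OF c that])
  define \<Lambda> where "\<Lambda> = \<mu> + 2 * K * (real CARD('n))\<^sup>2"
  have \<Lambda>: "\<Lambda> \<ge> 0" using l regD(8)[OF rc] by (simp add: \<Lambda>_def)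
  have Tb: "l2_norm (?T u) \<le> \<Lambda> * l2_norm (\<lambda>x. u x - lap u x)" if u: "u \<in> Cc_inf" for u
  proof -
    have "l2_norm (?T u) \<le> l2_norm (\<lambda>x. complex_of_real \<mu> * u x) + l2_norm (ell c u)"
      unfolding shifted_def[abs_def] by (intro l2_norm_triangle L2_cmult ell_L2 c Cc_inf_L2 u)
    also have "l2_norm (\<lambda>x. complex_of_real \<mu> * u x) = \<mu> * l2_norm u" using l by (simp add: l2_norm_cmult)
    also have "\<mu> * l2_norm u \<le> \<mu> * l2_norm (\<lambda>x. u x - lap u x)"
      using l by (intro mult_left_mono norm_le_one_minus_lap u) auto
    also have "l2_norm (ell c u) \<le> 2 * K * (real CARD('n))\<^sup>2 * l2_norm (\<lambda>x. u x - lap u x)"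
      by (rule ell_norm_bound[OF rc u])
    finally show ?thesis by (simp add: \<Lambda>_def algebra_simps)
  qed
  let ?S = "(\<lambda>u. l2_norm (\<lambda>x. f x - ?T u x)) ` Cc_inf"
  define D where "D = Inf ?S"
  have ne: "?S \<noteq> {}" using Cc_inf_0 by blast
  have bdd: "bdd_below ?S" by (rule bdd_belowI[of _ 0]) auto
  have D0: "D \<ge> 0" unfolding D_def by (rule cInf_greatest[OF ne]) auto
  have Dle: "D \<le> l2_norm (\<lambda>x. f x - ?T u x)" if "u \<in> Cc_inf" for u
    unfolding D_def by (rule cInf_lower[OF _ bdd]) (use that in blast)
  have "D = 0"
  proof (rule ccontr)
    assume "D \<noteq> 0"
    then have D: "D > 0" using D0 by simp
    \<comment> \<open>Replacing \<open>f\<close> by a test function \<open>\<phi>\<close> up to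
      \<open>\<delta>\<close> costs at most \<open>(D + 1) * \<delta>\<close>, which this choice
      keeps below \<open>D\<^sup>2\<close>.\<close>
    define \<delta> where "\<delta> = D\<^sup>2 / (4 * (D + 1))"
    have D4: "(D + 1) * \<delta> = D\<^sup>2 / 4" using D by (simp add: \<delta>_def divide_simps)
    have \<delta>: "\<delta> > 0" "(D + 1) * \<delta> < D\<^sup>2"
      using D by (simp add: \<delta>_def) (use D in \<open>simp add: D4\<close>)
    obtain \<phi> where \<phi>: "\<phi> \<in> Cc_inf" "l2_norm (\<lambda>x. f x - \<phi> x) < \<delta>" using Cc_inf_dense_L2[OF f \<delta>(1)] .
    define P where "P = l2_norm (\<lambda>x. \<phi> x - lap \<phi> x)"
    \<comment> \<open>Collects the errors for a near-minimiser of quality \<open>\<eta>\<close>. As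
      \<open>\<eta>\<close> tends to zero, \<open>g \<eta>\<close> tends to
      \<open>(D + 1) * \<delta>\<close>, which is less than \<open>D\<^sup>2\<close>: a
      contradiction to the bound shown next.\<close>
    define g where "g \<eta> = (D + 1) * \<delta> + \<eta> * l2_norm \<phi> + sqrt (2 * \<eta> * \<Lambda> * (D + 2)) * P + \<eta> * (l2_norm f + D + 1)" for \<eta>
    have le: "D\<^sup>2 \<le> g \<eta>" if \<eta>: "0 < \<eta>" "\<eta> \<le> 1" for \<eta>
    proof -
      \<comment> \<open>Near-minimality is measured on squares: the squared distance exceeds
        \<open>D\<^sup>2\<close> by at most \<open>\<eta>\<^sup>2\<close>, so that the first
        variation is of order \<open>\<eta>\<close>.\<close>
      have "D < sqrt (D\<^sup>2 + \<eta>\<^sup>2)" using D \<eta> by (intro real_less_rsqrt) simp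
      then obtain u where u: "u \<in> Cc_inf" "l2_norm (\<lambda>x. f x - ?T u x) < sqrt (D\<^sup>2 + \<eta>\<^sup>2)"
        using cInf_lessD[OF ne] unfolding D_def by blast
      define r where "r x = f x - ?T u x" for x
      have rL: "r \<in> L2" unfolding r_def[abs_def] by (intro L2_diff f TL u)
      have "(l2_norm r)\<^sup>2 \<le> (sqrt (D\<^sup>2 + \<eta>\<^sup>2))\<^sup>2" using u(2) unfolding r_def[abs_def] by (intro power_mono) auto
      then have r2: "(l2_norm r)\<^sup>2 \<le> D\<^sup>2 + \<eta>\<^sup>2" by simp
      also have "\<dots> \<le> (D + 1)\<^sup>2" using D \<eta> power_le_one[of \<eta> 2] by (simp add: power2_sum)
      finally have r1: "l2_norm r \<le> D + 1" by (rule power2_le_imp_le) (use D in simp)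
      \<comment> \<open>For all real \<open>s\<close> the squared distance at
        \<open>u - s * w\<close> is at least \<open>D\<^sup>2\<close>: a quadratic inequality in
        \<open>s\<close> whose discriminant expresses near-orthogonality.\<close>
      have near: "\<bar>Re (l2_inner r (?T w))\<bar> \<le> \<eta> * l2_norm (?T w)" if w: "w \<in> Cc_inf" for w
      proof -
        have "(2 * Re (l2_inner r (?T w)))\<^sup>2 \<le> 4 * (l2_norm (?T w))\<^sup>2 * \<eta>\<^sup>2"
        proof (rule nonneg_quadratic_discriminant)
          fix s :: real
          have "D \<le> l2_norm (\<lambda>x. f x - ?T (\<lambda>x. u x + complex_of_real (- s) * w x) x)"
            by (rule Dle[OF Cc_inf_lincomb[OF u(1) w]])
          also have "(\<lambda>x. f x - ?T (\<lambda>x. u x + complex_of_real (- s) * w x) x) = (\<lambda>x. r x + complex_of_real s * ?T w x)"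
            unfolding shifted_lincomb[OF c u(1) w] r_def by (simp add: fun_eq_iff)
          finally have "D\<^sup>2 \<le> (l2_norm (\<lambda>x. r x + complex_of_real s * ?T w x))\<^sup>2" using D by (intro power_mono) auto
          also have "\<dots> = (l2_norm r)\<^sup>2 + 2 * (s * Re (l2_inner r (?T w))) + (\<bar>s\<bar> * l2_norm (?T w))\<^sup>2"
            by (simp add: l2_norm_add_sq[OF rL L2_cmult[OF TL[OF w]]] l2_inner_cmult_right l2_norm_cmult)
          finally show "0 \<le> \<eta>\<^sup>2 + s * (2 * Re (l2_inner r (?T w))) + (l2_norm (?T w))\<^sup>2 * s\<^sup>2"
            using r2 by (simp add: power_mult_distrib algebra_simps)
        qed simp
        then have "\<bar>Re (l2_inner r (?T w))\<bar>\<^sup>2 \<le> (\<eta> * l2_norm (?T w))\<^sup>2" by (simp add: power_mult_distrib mult.commute)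
        then show ?thesis by (rule power2_le_imp_le) (use \<eta> in simp)
      qed
      obtain w where w: "w \<in> Cc_inf" "l2_norm (\<lambda>x. r x - (w x - lap w x)) < \<eta>"
        using one_minus_lap_dense[OF rL \<eta>(1)] .
      define m where "m x = w x - lap w x" for x
      have mC: "m \<in> Cc_inf" unfolding m_def[abs_def] by (intro Cc_inf_diff w lap_Cc_inf)
      have mL: "m \<in> L2" by (rule Cc_inf_L2[OF mC])
      define z where "z x = r x - m x" for x
      have zL: "z \<in> L2" unfolding z_def[abs_def] by (intro L2_diff rL mL)
      have z: "l2_norm z \<le> \<eta>" using w(2) unfolding z_def[abs_def] m_def by simp
      have m1: "l2_norm m \<le> D + 2" using l2_norm_triangle_sub[OF mL rL] r1 z \<eta>
        by (simp add: z_def[abs_def] l2_norm_diff_commute[of m])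
      have "l2_inner (?T w) m = l2_inner (?T w) r - l2_inner (?T w) z"
        unfolding z_def[abs_def] by (simp add: l2_inner_diff_right TL w rL mL)
      then have "Re (l2_inner (?T w) m) = Re (l2_inner r (?T w)) - Re (l2_inner (?T w) z)"
        using l2_inner_cnj[of "?T w" r] by simp
      also have "\<dots> \<le> \<eta> * l2_norm (?T w) + l2_norm (?T w) * \<eta>"
      proof -
        have "\<bar>Re (l2_inner (?T w) z)\<bar> \<le> l2_norm (?T w) * l2_norm z"
          using abs_Re_le_cmod l2_cauchy_schwarz[OF TL[OF w(1)] zL] order_trans by blast
        also have "\<dots> \<le> l2_norm (?T w) * \<eta>" by (intro mult_left_mono z) simp
        finally show ?thesis using near[OF w(1)] by linarith
      qed
      also have "\<dots> = 2 * \<eta> * l2_norm (?T w)" by simp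
      also have "\<dots> \<le> 2 * \<eta> * (\<Lambda> * (D + 2))"
      proof -
        have "l2_norm (?T w) \<le> \<Lambda> * l2_norm m" using Tb[OF w(1)] unfolding m_def .
        also have "\<dots> \<le> \<Lambda> * (D + 2)" by (intro mult_left_mono m1 \<Lambda>)
        finally show ?thesis using \<eta> by (intro mult_left_mono) auto
      qed
      finally have "Re (l2_inner (?T w) m) \<le> 2 * \<eta> * \<Lambda> * (D + 2)" by (simp add: mult.assoc)
      moreover have "1 * (l2_norm w)\<^sup>2 \<le> \<mu> * (l2_norm w)\<^sup>2" using l by (intro mult_right_mono) auto
      moreover have "\<mu> * (l2_norm w)\<^sup>2 \<le> Re (l2_inner (?T w) m)"
        unfolding m_def[abs_def] by (rule shifted_inner_one_minus_lap[OF c w(1) a \<kappa>[OF w(1)] l(1)])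
      ultimately have "(l2_norm w)\<^sup>2 \<le> 2 * \<eta> * \<Lambda> * (D + 2)" by linarith
      then have w0: "l2_norm w \<le> sqrt (2 * \<eta> * \<Lambda> * (D + 2))" by (rule real_le_rsqrt)
      have fL: "(\<lambda>x. f x - \<phi> x) \<in> L2" "\<phi> \<in> L2" "(\<lambda>x. \<phi> x - lap \<phi> x) \<in> L2"
        using f \<phi> by (auto intro: L2_diff Cc_inf_L2 lap_Cc_inf)
      \<comment> \<open>\<open>1 - lap\<close> is symmetric and passes from \<open>w\<close> to
        \<open>\<phi>\<close>, so smallness of \<open>w\<close> in norm, without control of its
        derivatives, makes the pairing small.\<close>
      have "l2_inner m \<phi> = l2_inner w (\<lambda>x. \<phi> x - lap \<phi> x)"
        unfolding m_def[abs_def] using w(1) \<phi>(1)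
        by (simp add: l2_inner_diff_left l2_inner_diff_right Cc_inf_L2 lap_Cc_inf lap_symmetric)
      then have "l2_inner r f = l2_inner r (\<lambda>x. f x - \<phi> x) + l2_inner z \<phi> + l2_inner w (\<lambda>x. \<phi> x - lap \<phi> x)"
        unfolding z_def[abs_def] by (simp add: l2_inner_diff_left l2_inner_diff_right rL mL f fL)
      then have "Re (l2_inner r f) \<le> l2_norm r * l2_norm (\<lambda>x. f x - \<phi> x) + l2_norm z * l2_norm \<phi> + l2_norm w * P"
        using Re_l2_inner_le[OF rL fL(1)] Re_l2_inner_le[OF zL fL(2)] Re_l2_inner_le[OF Cc_inf_L2[OF w(1)] fL(3)]
        by (simp add: P_def)
      also have "\<dots> \<le> (D + 1) * \<delta> + \<eta> * l2_norm \<phi> + sqrt (2 * \<eta> * \<Lambda> * (D + 2)) * P"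
        using r1 \<phi>(2) z w0 D \<eta> \<Lambda> by (intro add_mono mult_mono) (auto simp: P_def)
      finally have rf: "Re (l2_inner r f) \<le> (D + 1) * \<delta> + \<eta> * l2_norm \<phi> + sqrt (2 * \<eta> * \<Lambda> * (D + 2)) * P" .
      have "l2_norm (?T u) \<le> l2_norm f + l2_norm r"
        using l2_norm_triangle_diff[OF f rL] by (simp add: r_def)
      then have Tu: "\<eta> * l2_norm (?T u) \<le> \<eta> * (l2_norm f + D + 1)" using r1 \<eta> by (intro mult_left_mono) auto
      have "l2_inner r r = l2_inner r f - l2_inner r (?T u)"
        using l2_inner_diff_right[OF f TL[OF u(1)] rL] by (simp add: r_def[symmetric])
      then have "(l2_norm r)\<^sup>2 = Re (l2_inner r f) - Re (l2_inner r (?T u))"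
        by (simp add: l2_inner_self complex_eq_iff del: of_real_power)
      moreover have "D\<^sup>2 \<le> (l2_norm r)\<^sup>2" using Dle[OF u(1)] D by (intro power_mono) (auto simp: r_def[abs_def])
      ultimately show ?thesis using rf Tu near[OF u(1)] unfolding g_def by linarith
    qed
    have "(g \<longlongrightarrow> (D + 1) * \<delta> + 0 * l2_norm \<phi> + sqrt (2 * 0 * \<Lambda> * (D + 2)) * P + 0 * (l2_norm f + D + 1)) (at_right 0)"
      unfolding g_def[abs_def] by (intro tendsto_intros)
    moreover have "\<forall>\<^sub>F \<eta> in at_right 0. D\<^sup>2 \<le> g \<eta>"
      using le by (intro eventually_at_rightI[of 0 1]) auto
    ultimately have "D\<^sup>2 \<le> (D + 1) * \<delta> + 0 * l2_norm \<phi> + sqrt (2 * 0 * \<Lambda> * (D + 2)) * P + 0 * (l2_norm f + D + 1)"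
      by (rule tendsto_lowerbound) simp
    then show False using \<delta> by simp
  qed
  then have "Inf ?S < \<epsilon>" using e unfolding D_def by simp
  from cInf_lessD[OF ne this] show ?thesis by (simp only: bex_simps)
qed

section \<open>The closure of the form\<close>

definition fq :: "('n::finite \<Rightarrow> 'n \<Rightarrow> real^'n \<Rightarrow> complex) \<Rightarrow> (real^'n \<Rightarrow> complex) \<Rightarrow> real" where
  "fq c u = Re (aform c u u)"

context
  fixes c :: "'n::finite \<Rightarrow> 'n \<Rightarrow> real^'n \<Rightarrow> complex" and t :: real
  assumes c: "\<And>k l. C1 (c k l)" and acc: "accretive t c" "t > 0"
begin

lemma fq_nonneg: "u \<in> Cc_inf \<Longrightarrow> 0 \<le> fq c u"
  unfolding fq_def by (rule aform_accretive(2)[OF c _ acc])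

lemma cmod_aform_le_fq: "u \<in> Cc_inf \<Longrightarrow> cmod (aform c u u) \<le> t * fq c u"
  unfolding fq_def by (rule aform_accretive(1)[OF c _ acc])

lemma aform_diff:
  assumes "u \<in> Cc_inf" "w \<in> Cc_inf" "v \<in> Cc_inf"
  shows "aform c (\<lambda>x. u x - w x) v = aform c u v - aform c w v"
    and "aform c v (\<lambda>x. u x - w x) = aform c v u - aform c v w"
proof -
  have "aform c (\<lambda>x. u x + (-1) * w x) v = aform c u v + (-1) * aform c w v"
    by (rule aform_lincomb_left[OF c assms])
  then show "aform c (\<lambda>x. u x - w x) v = aform c u v - aform c w v" by simp
  have "aform c v (\<lambda>x. u x + (-1) * w x) = aform c v u + cnj (-1) * aform c v w"
    by (rule aform_lincomb_right[OF c assms])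
  then show "aform c v (\<lambda>x. u x - w x) = aform c v u - aform c v w" by simp
qed

lemma aform_scale:
  assumes "w \<in> Cc_inf" "z \<in> Cc_inf"
  shows "aform c (\<lambda>x. a * w x) z = a * aform c w z" "aform c z (\<lambda>x. a * w x) = cnj a * aform c z w"
proof -
  have 0: "aform c (\<lambda>x. 0) z = 0" "aform c z (\<lambda>x. 0) = 0"
    using aform_diff[OF assms(1) assms(1,2)] by simp_all
  have "aform c (\<lambda>x. 0 + a * w x) z = aform c (\<lambda>x. 0) z + a * aform c w z"
    by (rule aform_lincomb_left[OF c Cc_inf_0 assms])
  then show "aform c (\<lambda>x. a * w x) z = a * aform c w z" using 0 by simp
  have "aform c z (\<lambda>x. 0 + a * w x) = aform c z (\<lambda>x. 0) + cnj a * aform c z w"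
    by (rule aform_lincomb_right[OF c Cc_inf_0 assms])
  then show "aform c z (\<lambda>x. a * w x) = cnj a * aform c z w" using 0 by simp
qed

lemma aform_expand_square:
  assumes u: "u \<in> Cc_inf" and v: "v \<in> Cc_inf"
  shows "aform c (\<lambda>x. u x + s * v x) (\<lambda>x. u x + s * v x)
    = aform c u u + cnj s * aform c u v + s * aform c v u + s * cnj s * aform c v v"
  using u v by (simp add: aform_lincomb_left[OF c] aform_lincomb_right[OF c] Cc_inf_lincomb algebra_simps)

text \<open>The cross terms cancel for every unimodular \<open>s\<close>; polarisation uses it with
  \<open>s = 1\<close> and \<open>s = \<i>\<close>.\<close>

lemma fq_parallelogram:
  assumes u: "u \<in> Cc_inf" and v: "v \<in> Cc_inf" and s: "cmod s = 1"
  shows "fq c (\<lambda>x. u x + s * v x) + fq c (\<lambda>x. u x + (- s) * v x) = 2 * fq c u + 2 * fq c v"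
proof -
  have "s * cnj s = 1" using s by (simp add: complex_norm_square[symmetric])
  then show ?thesis unfolding fq_def aform_expand_square[OF u v] by simp
qed

lemma fq_diff_le:
  assumes u: "u \<in> Cc_inf" and v: "v \<in> Cc_inf"
  shows "fq c (\<lambda>x. u x - v x) \<le> 2 * fq c u + 2 * fq c v" "fq c u \<le> 2 * fq c (\<lambda>x. u x - v x) + 2 * fq c v"
proof -
  have *: "fq c (\<lambda>x. u x - v x) \<le> 2 * fq c u + 2 * fq c v" "fq c (\<lambda>x. u x + v x) \<le> 2 * fq c u + 2 * fq c v"
    if "u \<in> Cc_inf" "v \<in> Cc_inf" for u v
    using fq_parallelogram[OF that, of 1] fq_nonneg[OF Cc_inf_diff[OF that]] fq_nonneg[OF Cc_inf_add[OF that]] by simp_all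
  show "fq c (\<lambda>x. u x - v x) \<le> 2 * fq c u + 2 * fq c v" by (rule *[OF u v])
  show "fq c u \<le> 2 * fq c (\<lambda>x. u x - v x) + 2 * fq c v" using *(2)[OF Cc_inf_diff[OF u v] v] by simp
qed

text \<open>The form need not be Hermitian, so it is polarised: the four diagonal values are bounded
  by sectoriality and summed by the parallelogram law. Scaling \<open>u\<close> and \<open>v\<close>
  by reciprocal factors and optimising turns the resulting sum into a product.\<close>

lemma aform_cauchy_schwarz:
  assumes u: "u \<in> Cc_inf" and v: "v \<in> Cc_inf"
  shows "cmod (aform c u v) \<le> 2 * t * sqrt (fq c u) * sqrt (fq c v)"
proof -
  have weak: "cmod (aform c u v) \<le> t * (fq c u + fq c v)" if u: "u \<in> Cc_inf" and v: "v \<in> Cc_inf" for u v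
  proof -
    let ?a = "\<lambda>s. aform c (\<lambda>x. u x + s * v x) (\<lambda>x. u x + s * v x)"
    have "4 * aform c u v = ?a 1 - ?a (- 1) + \<i> * ?a \<i> - \<i> * ?a (- \<i>)"
      unfolding aform_expand_square[OF u v] by (simp add: algebra_simps)
    then have "4 * cmod (aform c u v) = cmod (?a 1 - ?a (- 1) + \<i> * ?a \<i> - \<i> * ?a (- \<i>))"
      by (metis norm_mult norm_numeral)
    also have "\<dots> \<le> cmod (?a 1) + cmod (?a (- 1)) + cmod (?a \<i>) + cmod (?a (- \<i>))"
      using norm_triangle_ineq4[of "?a 1 - ?a (- 1) + \<i> * ?a \<i>" "\<i> * ?a (- \<i>)"]
        norm_triangle_ineq[of "?a 1 - ?a (- 1)" "\<i> * ?a \<i>"] norm_triangle_ineq4[of "?a 1" "?a (- 1)"]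
      by (simp add: norm_mult del: mult_minus_left mult_1)
    also have "\<dots> \<le> t * fq c (\<lambda>x. u x + 1 * v x) + t * fq c (\<lambda>x. u x + (- 1) * v x)
        + t * fq c (\<lambda>x. u x + \<i> * v x) + t * fq c (\<lambda>x. u x + (- \<i>) * v x)"
      by (intro add_mono cmod_aform_le_fq Cc_inf_lincomb u v)
    also have "\<dots> = t * (2 * fq c u + 2 * fq c v) + t * (2 * fq c u + 2 * fq c v)"
      using fq_parallelogram[OF u v, of 1] fq_parallelogram[OF u v, of \<i>]
      by (simp only: distrib_left[symmetric] add.assoc norm_one norm_ii)
    finally show ?thesis by (simp add: algebra_simps)
  qed
  have "cmod (aform c u v) \<le> sqrt (2 * t * fq c u) * sqrt (2 * t * fq c v)"
  proof (rule le_mult_of_scaled_am_gm)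
    fix s :: real assume s: "s > 0"
    let ?r = "complex_of_real (sqrt s)"
    have r: "?r \<noteq> 0" "?r * ?r = complex_of_real s" using s by (simp_all flip: of_real_mult)
    note lin = aform_scale
    have "cmod (aform c u v) = cmod (aform c (\<lambda>x. ?r * u x) (\<lambda>x. (1 / ?r) * v x))"
      using r u v by (simp only: lin Cc_inf_cmult) (simp add: norm_mult norm_divide)
    also have "\<dots> \<le> t * (fq c (\<lambda>x. ?r * u x) + fq c (\<lambda>x. (1 / ?r) * v x))"
      by (intro weak Cc_inf_cmult u v)
    also have "fq c (\<lambda>x. ?r * u x) = s * fq c u"
      using u r s by (simp add: fq_def lin Cc_inf_cmult mult.assoc[symmetric])
    also have "fq c (\<lambda>x. (1 / ?r) * v x) = fq c v / s"
      using v r s by (simp only: fq_def lin Cc_inf_cmult) (simp add: field_simps flip: of_real_mult)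
    finally show "cmod (aform c u v) \<le> (s * (sqrt (2 * t * fq c u))\<^sup>2 + (sqrt (2 * t * fq c v))\<^sup>2 / s) / 2"
      using acc(2) fq_nonneg[OF u] fq_nonneg[OF v] s by (simp add: field_simps)
  qed (use acc(2) fq_nonneg[OF u] fq_nonneg[OF v] in auto)
  also have "\<dots> = (sqrt (2 * t) * sqrt (2 * t)) * sqrt (fq c u) * sqrt (fq c v)"
    unfolding real_sqrt_mult[of "2 * t"] by (simp only: ac_simps)
  also have "sqrt (2 * t) * sqrt (2 * t) = 2 * t" using acc(2) by simp
  finally show ?thesis .
qed

section \<open>Closability and the values of the closed form\<close>

lemma form_tendstoD:
  assumes "form_tendsto Cc_inf (aform c) U u"
  shows "U n \<in> Cc_inf" "l2_tendsto U u" "u \<in> L2"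
    "\<epsilon> > 0 \<Longrightarrow> \<exists>N. \<forall>m\<ge>N. \<forall>n\<ge>N. fq c (\<lambda>x. U m x - U n x) < \<epsilon>"
proof -
  show U: "U n \<in> Cc_inf" "l2_tendsto U u" for n using assms by (auto simp: form_tendsto_def)
  then show "u \<in> L2" by (simp add: l2_tendsto_def)
  assume "\<epsilon> > 0"
  then obtain N where "\<forall>m\<ge>N. \<forall>n\<ge>N. cmod (aform c (\<lambda>x. U m x - U n x) (\<lambda>x. U m x - U n x)) < \<epsilon>"
    using assms unfolding form_tendsto_def by blast
  then show "\<exists>N. \<forall>m\<ge>N. \<forall>n\<ge>N. fq c (\<lambda>x. U m x - U n x) < \<epsilon>"
    unfolding fq_def using complex_Re_le_cmod le_less_trans by blast
qed

lemma fq_bounded: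
  assumes U: "form_tendsto Cc_inf (aform c) U u"
  shows "\<exists>Q. \<forall>n. fq c (U n) \<le> Q"
proof -
  note C = form_tendstoD(1)[OF U]
  obtain N where N: "\<And>m n. m \<ge> N \<Longrightarrow> n \<ge> N \<Longrightarrow> fq c (\<lambda>x. U m x - U n x) < 1"
    using form_tendstoD(4)[OF U, of 1] by auto
  have "fq c (U n) \<le> (\<Sum>i<N. fq c (U i)) + (2 + 2 * fq c (U N))" for n
  proof (cases "n < N")
    case True
    then have "fq c (U n) \<le> (\<Sum>i<N. fq c (U i))" by (intro member_le_sum) (auto intro: fq_nonneg C)
    then show ?thesis using fq_nonneg[OF C, of N] by linarith
  next
    case False
    then have "fq c (U n) \<le> 2 + 2 * fq c (U N)" using fq_diff_le(2)[OF C C, of n N] N[of n N] by simp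
    moreover have "0 \<le> (\<Sum>i<N. fq c (U i))" by (intro sum_nonneg fq_nonneg C)
    ultimately show ?thesis by linarith
  qed
  then show ?thesis by blast
qed

text \<open>The difference \<open>W\<close> is Cauchy for the form and null in \<open>L2\<close>.
  For fixed \<open>m\<close>, \<open>aform c (W n) (W m)\<close> tends to zero because all
  derivatives can be moved onto \<open>W m\<close>; the rest, with \<open>W n - W m\<close> in the
  second place, is small by Cauchy-Schwarz. This is the classical argument for forms that come from
  an operator.\<close>

lemma form_closable:
  assumes U: "form_tendsto Cc_inf (aform c) U u" and V: "form_tendsto Cc_inf (aform c) V u"
  shows "(\<lambda>n. fq c (\<lambda>x. U n x - V n x)) \<longlonglongrightarrow> 0"
proof -
  note C = form_tendstoD(1)[OF U] form_tendstoD(1)[OF V]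
  define W where "W n x = U n x - V n x" for n x
  have WC: "W n \<in> Cc_inf" for n unfolding W_def[abs_def] by (intro Cc_inf_diff C)
  have W0: "l2_tendsto W (\<lambda>x. 0)"
  proof -
    have "l2_norm (W n) \<le> l2_norm (\<lambda>x. U n x - u x) + l2_norm (\<lambda>x. V n x - u x)" for n
      using l2_norm_triangle_via[OF Cc_inf_L2[OF C(1)] form_tendstoD(3)[OF U] Cc_inf_L2[OF C(2)], of n n]
      by (simp add: W_def[abs_def] l2_norm_diff_commute[of u])
    moreover have "(\<lambda>n. l2_norm (\<lambda>x. U n x - u x) + l2_norm (\<lambda>x. V n x - u x)) \<longlonglongrightarrow> 0"
      using form_tendstoD(2)[OF U] form_tendstoD(2)[OF V] unfolding l2_tendsto_def by (auto intro: tendsto_add_zero)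
    ultimately have "(\<lambda>n. l2_norm (W n)) \<longlonglongrightarrow> 0"
      by (intro Lim_null_comparison[of "\<lambda>n. l2_norm (W n)"]) (auto intro: always_eventually)
    then show ?thesis using WC by (simp add: l2_tendsto_def Cc_inf_L2 L2_0)
  qed
  have "\<exists>N. \<forall>n\<ge>N. fq c (W n) < \<epsilon>" if e: "\<epsilon> > 0" for \<epsilon>
  proof -
    have e4: "\<epsilon> / 4 > 0" using e by simp
    obtain Q where Q: "\<And>n. fq c (W n) \<le> Q"
    proof -
      obtain Q1 Q2 where "\<forall>n. fq c (U n) \<le> Q1" "\<forall>n. fq c (V n) \<le> Q2" using fq_bounded[OF U] fq_bounded[OF V] by blast
      then have "fq c (W n) \<le> 2 * Q1 + 2 * Q2" for n
        unfolding W_def[abs_def] using fq_diff_le(1)[OF C(1) C(2), of n n] by (smt (verit))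
      then show ?thesis using that by blast
    qed
    have Q0: "Q \<ge> 0" using Q[of 0] fq_nonneg[OF WC, of 0] by linarith
    \<comment> \<open>Arranged so that the Cauchy-Schwarz term is at most
      \<open>\<epsilon> / 2\<close>; the added \<open>1\<close> covers \<open>Q = 0\<close>.\<close>
    define d where "d = (\<epsilon> / (4 * t * (sqrt Q + 1)))\<^sup>2"
    have d: "d > 0" "2 * t * sqrt d * sqrt Q \<le> \<epsilon> / 2"
    proof -
      have p: "4 * t * (sqrt Q + 1) > 0" using acc(2) Q0 by (simp add: add_nonneg_pos)
      then have "\<epsilon> / (4 * t * (sqrt Q + 1)) > 0" using e by (intro divide_pos_pos)
      then show "d > 0" unfolding d_def by (rule zero_less_power)
      have "sqrt d = \<epsilon> / (4 * t * (sqrt Q + 1))" using e p by (simp add: d_def)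
      moreover have "2 * t * (\<epsilon> / (4 * t * S)) * sqrt Q = (\<epsilon> / 2) * (sqrt Q / S)" for S
        using acc(2) by simp
      ultimately have "2 * t * sqrt d * sqrt Q = (\<epsilon> / 2) * (sqrt Q / (sqrt Q + 1))" by (simp only:)
      also have "\<dots> \<le> (\<epsilon> / 2) * 1" 
      proof (rule mult_left_mono)
        have "sqrt Q + 1 > 0" using real_sqrt_ge_zero[OF Q0] by linarith
        then show "sqrt Q / (sqrt Q + 1) \<le> 1" by (simp add: pos_divide_le_eq)
      qed (use e in simp)
      finally show "2 * t * sqrt d * sqrt Q \<le> \<epsilon> / 2" by simp
    qed
    have "d / 4 > 0" using d by simp
    then obtain N1 N2 where N1: "\<And>m n. m \<ge> N1 \<Longrightarrow> n \<ge> N1 \<Longrightarrow> fq c (\<lambda>x. U m x - U n x) < d / 4"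
      and N2: "\<And>m n. m \<ge> N2 \<Longrightarrow> n \<ge> N2 \<Longrightarrow> fq c (\<lambda>x. V m x - V n x) < d / 4"
      using form_tendstoD(4)[OF U] form_tendstoD(4)[OF V] by metis
    define m where "m = max N1 N2"
    have close: "fq c (\<lambda>x. W n x - W m x) < d" if "n \<ge> m" for n
    proof -
      have "(\<lambda>x. W n x - W m x) = (\<lambda>x. (U n x - U m x) - (V n x - V m x))" by (simp add: W_def fun_eq_iff)
      then have "fq c (\<lambda>x. W n x - W m x) \<le> 2 * fq c (\<lambda>x. U n x - U m x) + 2 * fq c (\<lambda>x. V n x - V m x)"
        using fq_diff_le(1)[OF Cc_inf_diff[OF C(1) C(1)] Cc_inf_diff[OF C(2) C(2)], of n m n m] by simp
      then show ?thesis using N1[of n m] N2[of n m] that by (simp add: m_def)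
    qed
    have "(\<lambda>n. l2_inner (W n) (ell (adj c) (W m))) \<longlonglongrightarrow> l2_inner (\<lambda>x. 0) (ell (adj c) (W m))"
    proof (rule l2_tendsto_inner[OF W0 ell_L2[OF _ WC]])
      show "C1 (adj c k l)" for k l unfolding adj_def[abs_def] by (intro C1_cnj c)
    qed
    moreover have "l2_inner (W n) (ell (adj c) (W m)) = aform c (W n) (W m)" for n by (rule inner_ell_adj[OF c WC WC])
    moreover have "l2_inner (\<lambda>x. 0) (ell (adj c) (W m)) = 0" by (simp add: l2_inner_def)
    ultimately have "(\<lambda>n. aform c (W n) (W m)) \<longlonglongrightarrow> 0" by simp
    then obtain N3 where N3: "\<And>n. n \<ge> N3 \<Longrightarrow> cmod (aform c (W n) (W m)) < \<epsilon> / 2"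
      using LIMSEQ_D[of _ 0 "\<epsilon>/2"] e by auto
    have "fq c (W n) < \<epsilon>" if n: "n \<ge> max m N3" for n
    proof -
      have "aform c (W n) (W n) = aform c (W n) (W m) + aform c (W n) (\<lambda>x. W n x - W m x)"
        by (simp add: aform_diff WC)
      then have "fq c (W n) \<le> cmod (aform c (W n) (W m)) + cmod (aform c (W n) (\<lambda>x. W n x - W m x))"
        unfolding fq_def using complex_Re_le_cmod norm_triangle_ineq order_trans by metis
      also have "cmod (aform c (W n) (\<lambda>x. W n x - W m x)) \<le> 2 * t * sqrt (fq c (W n)) * sqrt (fq c (\<lambda>x. W n x - W m x))"
        by (intro aform_cauchy_schwarz WC Cc_inf_diff)
      also have "\<dots> \<le> 2 * t * sqrt Q * sqrt d"
        using acc(2) Q0 n close[of n] fq_nonneg[OF Cc_inf_diff[OF WC WC]] fq_nonneg[OF WC] by (intro mult_mono real_sqrt_le_mono Q) (auto intro: less_imp_le)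
      also have "\<dots> \<le> \<epsilon> / 2" using d(2) by (simp add: ac_simps)
      finally show ?thesis using N3[of n] n by simp
    qed
    then show ?thesis by blast
  qed
  then have "W' \<longlonglongrightarrow> 0" if "W' = (\<lambda>n. fq c (W n))" for W'
    unfolding that using fq_nonneg[OF WC] by (intro LIMSEQ_I) (auto simp: abs_of_nonneg)
  then show ?thesis by (simp add: W_def[abs_def])
qed

text \<open>Justifies the definite description in \<open>form_closure\<close>: two choices of
  approximating sequences differ by sequences on which \<open>fq c\<close> tends to zero, while the
  values of \<open>fq c\<close> stay bounded, so one convergent pair determines the limit for
  all.\<close>

lemma form_closure_eqI:
  assumes U: "form_tendsto Cc_inf (aform c) U u" and V: "form_tendsto Cc_inf (aform c) V v"
    and z: "(\<lambda>n. aform c (U n) (V n)) \<longlonglongrightarrow> z"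
  shows "form_closure Cc_inf (aform c) u v = z"
  unfolding form_closure_def
proof (rule the_equality)
  show "\<forall>U V. form_tendsto Cc_inf (aform c) U u \<longrightarrow> form_tendsto Cc_inf (aform c) V v \<longrightarrow> (\<lambda>n. aform c (U n) (V n)) \<longlonglongrightarrow> z"
  proof (intro allI impI)
    fix U' V' assume U': "form_tendsto Cc_inf (aform c) U' u" and V': "form_tendsto Cc_inf (aform c) V' v"
    note C = form_tendstoD(1)[OF U] form_tendstoD(1)[OF V] form_tendstoD(1)[OF U'] form_tendstoD(1)[OF V']
    obtain Q1 where Q1: "\<And>n. fq c (U n) \<le> Q1" using fq_bounded[OF U] by blast
    obtain Q2 where Q2: "\<And>n. fq c (V' n) \<le> Q2" using fq_bounded[OF V'] by blast
    let ?b = "\<lambda>n. 2 * t * sqrt (fq c (\<lambda>x. U' n x - U n x)) * sqrt Q2 + 2 * t * sqrt Q1 * sqrt (fq c (\<lambda>x. V' n x - V n x))"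
    have le: "cmod (aform c (U' n) (V' n) - aform c (U n) (V n)) \<le> ?b n" for n
    proof -
      have "aform c (U' n) (V' n) - aform c (U n) (V n) = aform c (\<lambda>x. U' n x - U n x) (V' n) + aform c (U n) (\<lambda>x. V' n x - V n x)"
        by (simp add: aform_diff C)
      then have "cmod (aform c (U' n) (V' n) - aform c (U n) (V n)) \<le> cmod (aform c (\<lambda>x. U' n x - U n x) (V' n)) + cmod (aform c (U n) (\<lambda>x. V' n x - V n x))"
        by (simp add: norm_triangle_ineq)
      also have "\<dots> \<le> 2 * t * sqrt (fq c (\<lambda>x. U' n x - U n x)) * sqrt (fq c (V' n)) + 2 * t * sqrt (fq c (U n)) * sqrt (fq c (\<lambda>x. V' n x - V n x))"
        by (intro add_mono aform_cauchy_schwarz Cc_inf_diff C)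
      also have "\<dots> \<le> ?b n"
        using acc(2) fq_nonneg[OF Cc_inf_diff[OF C(3) C(1)]] fq_nonneg[OF Cc_inf_diff[OF C(4) C(2)]]
        by (intro add_mono mult_left_mono mult_right_mono real_sqrt_le_mono Q1 Q2) auto
      finally show ?thesis .
    qed
    have "?b \<longlonglongrightarrow> 2 * t * sqrt 0 * sqrt Q2 + 2 * t * sqrt Q1 * sqrt 0"
      by (intro tendsto_intros form_closable[OF U' U] form_closable[OF V' V])
    then have b0: "?b \<longlonglongrightarrow> 0" by simp
    have "(\<lambda>n. aform c (U' n) (V' n) - aform c (U n) (V n)) \<longlonglongrightarrow> 0"
      by (rule Lim_null_comparison[OF always_eventually[OF allI[OF le]] b0])
    from tendsto_add[OF this z] show "(\<lambda>n. aform c (U' n) (V' n)) \<longlonglongrightarrow> z" by simp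
  qed
  fix z' assume "\<forall>U V. form_tendsto Cc_inf (aform c) U u \<longrightarrow> form_tendsto Cc_inf (aform c) V v \<longrightarrow> (\<lambda>n. aform c (U n) (V n)) \<longlonglongrightarrow> z'"
  with U V have "(\<lambda>n. aform c (U n) (V n)) \<longlonglongrightarrow> z'" by (simp only:)
  then show "z' = z" using z by (rule LIMSEQ_unique)
qed

lemma form_tendsto_const:
  assumes "v \<in> Cc_inf" shows "form_tendsto Cc_inf (aform c) (\<lambda>n. v) v"
proof -
  have "aform c (\<lambda>x. v x - v x) (\<lambda>x. v x - v x) = 0" by (simp add: aform_def)
  then show ?thesis using assms by (simp add: form_tendsto_def l2_tendsto_def Cc_inf_L2)
qed

end

section \<open>The operators\<close>

abbreviation (input) entry :: "(real^'n::finite \<Rightarrow> complex^'n^'n) \<Rightarrow> 'n \<Rightarrow> 'n \<Rightarrow> real^'n \<Rightarrow> complex" where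
  "entry C k l x \<equiv> C x $ k $ l"

lemma form_a0_eq_aform: "form_a0 C = aform (entry C)"
  by (simp add: fun_eq_iff form_a0_def aform_def)

lemma op_H2_eq: "op_H2 C = {(u, ell (adj (entry C)) u) |u. u \<in> Cc_inf}"
proof -
  have "(\<lambda>x. - (\<Sum>k\<in>UNIV. \<Sum>l\<in>UNIV. pd k (\<lambda>y. cnj (C y $ k $ l) * pd l u y) x)) = ell (adj (entry C)) u" for u
    unfolding ell_def[abs_def] adj_def by (rule ext) (subst sum.swap, rule refl)
  then show ?thesis unfolding op_H2_def by simp
qed

lemma op_B2_iff: "(v, w) \<in> op_B2 C \<longleftrightarrow>
    v \<in> L2 \<and> w \<in> L2 \<and> (\<forall>u\<in>Cc_inf. l2_inner (ell (adj (entry C)) u) v = l2_inner u w)"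
  unfolding op_B2_def l2_adjoint_def op_H2_eq by blast

lemma op_B2_L2: "(v, w) \<in> op_B2 C \<Longrightarrow> v \<in> L2" "(v, w) \<in> op_B2 C \<Longrightarrow> w \<in> L2"
  by (simp_all add: op_B2_iff)

lemma op_B2_diff:
  assumes c: "\<And>k l. C1 (entry C k l)" and 1: "(v, w) \<in> op_B2 C" and 2: "(v', w') \<in> op_B2 C"
  shows "(\<lambda>x. v x - v' x, \<lambda>x. w x - w' x) \<in> op_B2 C"
proof -
  have c': "C1 (adj (entry C) k l)" for k l unfolding adj_def[abs_def] by (intro C1_cnj c)
  show ?thesis
    using 1 2 by (simp add: op_B2_iff L2_diff l2_inner_diff_right Cc_inf_L2 ell_L2[OF c'])
qed

text \<open>On test functions the adjoint of \<open>H_2\<close> acts as a differential operator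
  again, since taking the adjoint coefficients twice returns those of \<open>C\<close>.\<close>

lemma op_B2_test_function:
  assumes c: "\<And>k l. C1 (entry C k l)" and u: "u \<in> Cc_inf"
  shows "(u, ell (entry C) u) \<in> op_B2 C"
  unfolding op_B2_iff
proof (intro conjI ballI)
  show "u \<in> L2" "ell (entry C) u \<in> L2" by (rule Cc_inf_L2[OF u], rule ell_L2[OF c u])
  fix w :: "real^'a \<Rightarrow> complex" assume w: "w \<in> Cc_inf"
  have c': "C1 (adj (entry C) k l)" for k l unfolding adj_def[abs_def] by (intro C1_cnj c)
  show "l2_inner (ell (adj (entry C)) w) u = l2_inner w (ell (entry C) u)"
    using inner_ell_adj[of "adj (entry C)", OF c' w u] ell_inner[OF c' w u] by (simp add: adj_adj)
qed

section \<open>Equality of the three operators from the dense ranges\<close>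

context
  fixes C :: "real^'n::finite \<Rightarrow> complex^'n^'n" and t \<mu> :: real
  assumes c: "\<And>k l. C1 (entry C k l)" and acc: "accretive t (entry C)" "t > 0" and \<mu>: "\<mu> > 0"
    and dense: "\<And>f \<epsilon>. f \<in> L2 \<Longrightarrow> \<epsilon> > 0 \<Longrightarrow> \<exists>u\<in>Cc_inf. l2_norm (\<lambda>x. f x - shifted \<mu> (entry C) u x) < \<epsilon>"
    and dense_adj: "\<And>f \<epsilon>. f \<in> L2 \<Longrightarrow> \<epsilon> > 0 \<Longrightarrow> \<exists>u\<in>Cc_inf. l2_norm (\<lambda>x. f x - shifted \<mu> (adj (entry C)) u x) < \<epsilon>"
begin

lemma C1_adj_coeff: "C1 (adj (entry C) k l)"
  unfolding adj_def[abs_def] by (intro C1_cnj c)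

text \<open>Approximate \<open>z\<close> by \<open>(\<mu> + H_2) p\<close>. By definition of the
  adjoint the inner product of \<open>z\<close> with itself is nearly that of \<open>p\<close> with
  \<open>(\<mu> + B_2) z\<close>, and accretivity on test functions bounds
  \<open>\<mu> * l2_norm p\<close> by nearly \<open>l2_norm z\<close>.\<close>

lemma op_B2_estimate:
  assumes zy: "(z, y) \<in> op_B2 C"
  shows "\<mu> * l2_norm z \<le> l2_norm (\<lambda>x. complex_of_real \<mu> * z x + y x)"
proof -
  let ?G = "\<lambda>x. complex_of_real \<mu> * z x + y x"
  have L: "z \<in> L2" "y \<in> L2" "?G \<in> L2" using zy by (auto simp: op_B2_iff intro: L2_add L2_cmult)
  have step: "\<mu> * (l2_norm z)\<^sup>2 \<le> \<epsilon> * (\<mu> * l2_norm z + l2_norm ?G) + l2_norm z * l2_norm ?G" if e: "\<epsilon> > 0" for \<epsilon>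
  proof -
    obtain p where p: "p \<in> Cc_inf" "l2_norm (\<lambda>x. z x - shifted \<mu> (adj (entry C)) p x) < \<epsilon>"
      using dense_adj[OF L(1) e] by blast
    let ?T = "shifted \<mu> (adj (entry C)) p"
    have TL: "?T \<in> L2" by (rule shifted_L2[OF C1_adj_coeff p(1)])
    have pL: "p \<in> L2" by (rule Cc_inf_L2[OF p(1)])
    have "\<mu> * l2_norm p \<le> l2_norm ?T"
      by (rule shifted_accretive[OF C1_adj_coeff p(1) accretive_adj[OF acc(1)] acc(2) \<mu>])
    also have "\<dots> \<le> l2_norm z + \<epsilon>"
      using l2_norm_triangle_sub[OF TL L(1)] p(2) by (simp add: l2_norm_diff_commute[of z])
    finally have pb: "\<mu> * l2_norm p \<le> l2_norm z + \<epsilon>" .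
    have "l2_inner ?T z = complex_of_real \<mu> * l2_inner p z + l2_inner (ell (adj (entry C)) p) z"
      unfolding shifted_def[abs_def]
      by (simp add: l2_inner_add_left L2_cmult pL ell_L2[OF C1_adj_coeff p(1)] L l2_inner_cmult_left)
    also have "l2_inner (ell (adj (entry C)) p) z = l2_inner p y" using zy p(1) by (simp add: op_B2_iff)
    also have "complex_of_real \<mu> * l2_inner p z + l2_inner p y = l2_inner p ?G"
      by (simp add: l2_inner_add_right L2_cmult L pL l2_inner_cmult_right)
    finally have T: "l2_inner ?T z = l2_inner p ?G" .
    have "l2_inner z z = l2_inner (\<lambda>x. z x - ?T x) z + l2_inner p ?G"
      by (simp add: l2_inner_diff_left L TL T)
    then have "(l2_norm z)\<^sup>2 = Re (l2_inner (\<lambda>x. z x - ?T x) z) + Re (l2_inner p ?G)"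
      by (simp add: l2_inner_self complex_eq_iff del: of_real_power)
    also have "\<dots> \<le> l2_norm (\<lambda>x. z x - ?T x) * l2_norm z + l2_norm p * l2_norm ?G"
      by (intro add_mono Re_l2_inner_le L2_diff L TL pL)
    also have "\<dots> \<le> \<epsilon> * l2_norm z + l2_norm p * l2_norm ?G" using p(2) by (intro add_mono mult_right_mono) auto
    finally have "\<mu> * (l2_norm z)\<^sup>2 \<le> \<mu> * (\<epsilon> * l2_norm z + l2_norm p * l2_norm ?G)" using \<mu> by (intro mult_left_mono) auto
    also have "\<dots> = \<epsilon> * (\<mu> * l2_norm z) + (\<mu> * l2_norm p) * l2_norm ?G" by (simp add: algebra_simps)
    also have "\<dots> \<le> \<epsilon> * (\<mu> * l2_norm z) + (l2_norm z + \<epsilon>) * l2_norm ?G" 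
      using pb by (intro add_mono order_refl mult_right_mono) auto
    finally show ?thesis by (simp add: algebra_simps)
  qed
  have "((\<lambda>\<epsilon>. \<epsilon> * (\<mu> * l2_norm z + l2_norm ?G) + l2_norm z * l2_norm ?G) \<longlongrightarrow> 0 * (\<mu> * l2_norm z + l2_norm ?G) + l2_norm z * l2_norm ?G) (at_right 0)"
    by (intro tendsto_intros)
  moreover have "\<forall>\<^sub>F \<epsilon> in at_right 0. \<mu> * (l2_norm z)\<^sup>2 \<le> \<epsilon> * (\<mu> * l2_norm z + l2_norm ?G) + l2_norm z * l2_norm ?G"
    using step by (intro eventually_at_rightI[of 0 1]) auto
  ultimately have "\<mu> * (l2_norm z)\<^sup>2 \<le> 0 * (\<mu> * l2_norm z + l2_norm ?G) + l2_norm z * l2_norm ?G"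
    by (rule tendsto_lowerbound) simp
  then have "l2_norm z * (\<mu> * l2_norm z) \<le> l2_norm z * l2_norm ?G" by (simp add: power2_eq_square algebra_simps)
  then show ?thesis
    using l2_norm_nonneg[of z] by (cases "l2_norm z = 0") (auto simp: mult_le_cancel_left)
qed

text \<open>Approximation in the graph norm, from which both the inclusion in \<open>op_Z\<close>
  and the core property are read off.\<close>

lemma op_B2_approx:
  assumes vw: "(v, w) \<in> op_B2 C" and e: "\<epsilon> > 0"
  shows "\<exists>u\<in>Cc_inf. l2_norm (\<lambda>x. v x - u x) < \<epsilon> \<and> l2_norm (\<lambda>x. w x - ell (entry C) u x) < \<epsilon>"
proof -
  have L: "v \<in> L2" "w \<in> L2" using op_B2_L2[OF vw] .
  \<comment> \<open>The approximation error bounds \<open>\<mu> * l2_norm z\<close>, and twice the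
    error bounds \<open>l2_norm y\<close>; the minimum with \<open>1\<close> serves both.\<close>
  define d where "d = \<epsilon> * min \<mu> 1 / 2"
  have d: "d > 0" "d \<le> \<epsilon> / 2" "d / \<mu> \<le> \<epsilon> / 2"
    using e \<mu> by (auto simp: d_def divide_le_eq min_def mult_left_le)
  obtain u where u: "u \<in> Cc_inf" "l2_norm (\<lambda>x. (complex_of_real \<mu> * v x + w x) - shifted \<mu> (entry C) u x) < d"
    using dense[OF L2_add[OF L2_cmult[OF L(1)] L(2)] d(1)] by blast
  define z where "z x = v x - u x" for x
  define y where "y x = w x - ell (entry C) u x" for x
  have zy: "(z, y) \<in> op_B2 C"
    unfolding z_def[abs_def] y_def[abs_def] by (rule op_B2_diff[OF c vw op_B2_test_function[OF c u(1)]])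
  have yL: "z \<in> L2" "y \<in> L2" using op_B2_L2[OF zy] .
  have "(\<lambda>x. (complex_of_real \<mu> * v x + w x) - shifted \<mu> (entry C) u x) = (\<lambda>x. complex_of_real \<mu> * z x + y x)"
    by (simp add: shifted_def z_def y_def fun_eq_iff algebra_simps)
  then have G: "l2_norm (\<lambda>x. complex_of_real \<mu> * z x + y x) < d" using u(2) by simp
  then have mz: "\<mu> * l2_norm z < d" using op_B2_estimate[OF zy] by simp
  then have "l2_norm z < d / \<mu>" using \<mu> by (simp add: field_simps)
  then have 1: "l2_norm z < \<epsilon>" using d e by linarith
  have "l2_norm y \<le> l2_norm (\<lambda>x. complex_of_real \<mu> * z x + y x) + l2_norm (\<lambda>x. complex_of_real \<mu> * z x)"
    using l2_norm_triangle_diff[OF L2_add[OF L2_cmult[OF yL(1)] yL(2)] L2_cmult[OF yL(1)], of "complex_of_real \<mu>" "complex_of_real \<mu>"] by simp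
  also have "l2_norm (\<lambda>x. complex_of_real \<mu> * z x) = \<mu> * l2_norm z" using \<mu> by (simp add: l2_norm_cmult)
  finally have 2: "l2_norm y < \<epsilon>" using G mz d by linarith
  show ?thesis using 1 2 u(1) unfolding z_def[abs_def] y_def[abs_def] by blast
qed

lemma op_B2_subset_op_Z: "op_B2 C \<subseteq> op_Z C"
proof (rule subrelI)
  fix v w assume vw: "(v, w) \<in> op_B2 C"
  have L: "v \<in> L2" "w \<in> L2" using op_B2_L2[OF vw] .
  have "\<forall>n. \<exists>u\<in>Cc_inf. l2_norm (\<lambda>x. v x - u x) < inverse (real (Suc n)) \<and> l2_norm (\<lambda>x. w x - ell (entry C) u x) < inverse (real (Suc n))"
    by (intro allI op_B2_approx[OF vw]) simp
  then have "\<forall>n. \<exists>u. u \<in> Cc_inf \<and> l2_norm (\<lambda>x. v x - u x) < inverse (real (Suc n)) \<and> l2_norm (\<lambda>x. w x - ell (entry C) u x) < inverse (real (Suc n))"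
    by (simp only: Bex_def simp_thms)
  from choice[OF this] obtain U where U: "\<And>n. U n \<in> Cc_inf" "\<And>n. l2_norm (\<lambda>x. v x - U n x) < inverse (real (Suc n))"
    "\<And>n. l2_norm (\<lambda>x. w x - ell (entry C) (U n) x) < inverse (real (Suc n))" by blast
  have "l2_tendsto U v"
    unfolding l2_tendsto_def
  proof (intro conjI allI L Cc_inf_L2 U)
    show "(\<lambda>n. l2_norm (\<lambda>x. U n x - v x)) \<longlonglongrightarrow> 0"
      by (rule tendsto_sandwich[OF _ _ tendsto_const LIMSEQ_inverse_real_of_nat])
         (use U(2) in \<open>auto simp: l2_norm_diff_commute[of _ v] intro!: always_eventually less_imp_le\<close>)
  qed
  moreover have "l2_tendsto (\<lambda>n. ell (entry C) (U n)) w"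
    unfolding l2_tendsto_def
  proof (intro conjI allI L ell_L2 c U)
    show "(\<lambda>n. l2_norm (\<lambda>x. ell (entry C) (U n) x - w x)) \<longlonglongrightarrow> 0"
      by (rule tendsto_sandwich[OF _ _ tendsto_const LIMSEQ_inverse_real_of_nat])
         (use U(3) in \<open>auto simp: l2_norm_diff_commute[of _ w] intro!: always_eventually less_imp_le\<close>)
  qed
  moreover have "(U n, ell (entry C) (U n)) \<in> l2_restrict (op_B2 C) Cc_inf" for n
    using op_B2_test_function[OF c U(1)] U(1) by (simp add: l2_restrict_def)
  ultimately show "(v, w) \<in> op_Z C" unfolding op_Z_def l2_closure_def
    by (intro CollectI case_prodI exI[of _ U] exI[of _ "\<lambda>n. ell (entry C) (U n)"] conjI allI)
qed

text \<open>Convergence of the graphs implies convergence for the form, because the form at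
  \<open>U m - U n\<close> is the inner product of \<open>F m - F n\<close> with that difference.
  The identity defining \<open>op_A\<close> then passes to the limit.\<close>

lemma op_Z_subset_op_A: "op_Z C \<subseteq> op_A C"
proof (rule subrelI)
  fix u f assume "(u, f) \<in> op_Z C"
  then obtain U F where UF: "\<And>n. (U n, F n) \<in> op_B2 C" "\<And>n. U n \<in> Cc_inf" and U: "l2_tendsto U u" and F: "l2_tendsto F f"
    unfolding op_Z_def l2_closure_def l2_restrict_def by auto
  have FL: "F n \<in> L2" "f \<in> L2" for n using F by (auto simp: l2_tendsto_def)
  have uL: "u \<in> L2" using U by (simp add: l2_tendsto_def)
  have F_inner: "l2_inner (F n) v = aform (entry C) (U n) v" if v: "v \<in> Cc_inf" for n v
  proof -
    have "l2_inner v (F n) = l2_inner (ell (adj (entry C)) v) (U n)" using UF(1)[of n] v by (simp add: op_B2_iff)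
    also have "\<dots> = cnj (l2_inner (U n) (ell (adj (entry C)) v))" by (rule l2_inner_cnj)
    also have "\<dots> = cnj (aform (entry C) (U n) v)" by (simp add: inner_ell_adj[OF c UF(2) v])
    finally show ?thesis using l2_inner_cnj[of "F n" v] by simp
  qed
  have T: "form_tendsto Cc_inf (aform (entry C)) U u"
    unfolding form_tendsto_def
  proof (intro conjI allI impI UF(2) U)
    fix \<epsilon> :: real assume e: "\<epsilon> > 0"
    obtain N1 where N1: "\<And>n. n \<ge> N1 \<Longrightarrow> l2_norm (\<lambda>x. U n x - u x) < 1"
      using U LIMSEQ_D[of "\<lambda>n. l2_norm (\<lambda>x. U n x - u x)" 0 1] by (auto simp: l2_tendsto_def)
    obtain N2 where N2: "\<And>n. n \<ge> N2 \<Longrightarrow> l2_norm (\<lambda>x. F n x - f x) < \<epsilon> / 8"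
      using F e LIMSEQ_D[of "\<lambda>n. l2_norm (\<lambda>x. F n x - f x)" 0 "\<epsilon> / 8"] by (auto simp: l2_tendsto_def)
    have "cmod (aform (entry C) (\<lambda>x. U m x - U n x) (\<lambda>x. U m x - U n x)) < \<epsilon>"
      if m: "m \<ge> max N1 N2" and n: "n \<ge> max N1 N2" for m n
    proof -
      let ?W = "\<lambda>x. U m x - U n x"
      have W: "?W \<in> Cc_inf" by (intro Cc_inf_diff UF)
      have "aform (entry C) ?W ?W = l2_inner (F m) ?W - l2_inner (F n) ?W"
        by (simp only: aform_diff(1)[OF c acc UF(2) UF(2) W] F_inner[OF W])
      also have "\<dots> = l2_inner (\<lambda>x. F m x - F n x) ?W" by (intro l2_inner_diff_left[symmetric] FL Cc_inf_L2 W)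
      finally have "cmod (aform (entry C) ?W ?W) \<le> l2_norm (\<lambda>x. F m x - F n x) * l2_norm ?W"
        by (simp only:) (intro l2_cauchy_schwarz L2_diff FL Cc_inf_L2 W)
      also have "\<dots> \<le> (\<epsilon> / 4) * 2"
      proof (rule mult_mono)
        show "l2_norm (\<lambda>x. F m x - F n x) \<le> \<epsilon> / 4"
          using l2_norm_triangle_via[OF FL(1) FL(2) FL(1), of m n] N2[of m] N2[of n] m n by (simp add: l2_norm_diff_commute[of f])
        show "l2_norm ?W \<le> 2"
          using l2_norm_triangle_via[OF Cc_inf_L2[OF UF(2)] uL Cc_inf_L2[OF UF(2)], of m n] N1[of m] N1[of n] m n by (simp add: l2_norm_diff_commute[of u])
      qed (use e in auto)
      also have "\<dots> < \<epsilon>" using e by simp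
      finally show ?thesis .
    qed
    then show "\<exists>N. \<forall>m\<ge>N. \<forall>n\<ge>N. cmod (aform (entry C) (\<lambda>x. U m x - U n x) (\<lambda>x. U m x - U n x)) < \<epsilon>" by blast
  qed
  have "form_closure Cc_inf (aform (entry C)) u v = l2_inner f v" if v: "v \<in> form_closure_dom Cc_inf (aform (entry C))" for v
  proof -
    obtain V where V: "form_tendsto Cc_inf (aform (entry C)) V v" using v by (auto simp: form_closure_dom_def)
    have VC: "V n \<in> Cc_inf" "l2_tendsto V v" for n using V by (auto simp: form_tendsto_def)
    have "(\<lambda>n. l2_inner (F n) (V n)) \<longlonglongrightarrow> l2_inner f v" by (rule l2_tendsto_inner2[OF F VC(2)])
    then have "(\<lambda>n. aform (entry C) (U n) (V n)) \<longlonglongrightarrow> l2_inner f v" by (simp only: F_inner[OF VC(1)])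
    then show ?thesis by (rule form_closure_eqI[OF c acc T V])
  qed
  then show "(u, f) \<in> op_A C"
    unfolding op_A_def form_operator_def form_a0_eq_aform using T FL(2) by (auto simp: form_closure_dom_def)
qed

text \<open>Test functions belong to the domain of the closed form through constant sequences.
  Against such a \<open>v\<close> the form is an inner product with
  \<open>ell (adj (entry C)) v\<close>, and its limit in \<open>L2\<close> is the defining identity
  of the adjoint.\<close>

lemma op_A_subset_op_B2: "op_A C \<subseteq> op_B2 C"
proof (rule subrelI)
  fix u f assume "(u, f) \<in> op_A C"
  then have u: "u \<in> form_closure_dom Cc_inf (aform (entry C))" and f: "f \<in> L2"
    and H: "\<And>v. v \<in> form_closure_dom Cc_inf (aform (entry C)) \<Longrightarrow> form_closure Cc_inf (aform (entry C)) u v = l2_inner f v"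
    by (auto simp: op_A_def form_operator_def form_a0_eq_aform)
  obtain U where U: "form_tendsto Cc_inf (aform (entry C)) U u" using u by (auto simp: form_closure_dom_def)
  have UC: "U n \<in> Cc_inf" "l2_tendsto U u" for n using U by (auto simp: form_tendsto_def)
  have "l2_inner (ell (adj (entry C)) v) u = l2_inner v f" if v: "v \<in> Cc_inf" for v
  proof -
    note V = form_tendsto_const[OF c acc v]
    have "(\<lambda>n. l2_inner (U n) (ell (adj (entry C)) v)) \<longlonglongrightarrow> l2_inner u (ell (adj (entry C)) v)"
      by (rule l2_tendsto_inner[OF UC(2) ell_L2[OF C1_adj_coeff v]])
    then have "(\<lambda>n. aform (entry C) (U n) v) \<longlonglongrightarrow> l2_inner u (ell (adj (entry C)) v)"
      by (simp only: inner_ell_adj[OF c UC(1) v])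
    then have "form_closure Cc_inf (aform (entry C)) u v = l2_inner u (ell (adj (entry C)) v)"
      by (rule form_closure_eqI[OF c acc U V])
    moreover have "form_closure Cc_inf (aform (entry C)) u v = l2_inner f v"
      using V by (intro H) (auto simp: form_closure_dom_def)
    ultimately show ?thesis
      using l2_inner_cnj[of "ell (adj (entry C)) v" u] l2_inner_cnj[of v f] by simp
  qed
  then show "(u, f) \<in> op_B2 C" using UC(2) f by (simp add: op_B2_iff l2_tendsto_def)
qed

lemma operators_equal: "op_A C = op_B2 C" "op_B2 C = op_Z C"
  using op_B2_subset_op_Z op_Z_subset_op_A op_A_subset_op_B2 by blast+

lemma Cc_inf_is_core: "is_core Cc_inf (op_A C)"
  unfolding is_core_def operators_equal(1)
proof (intro conjI ballI allI impI)
  show "Cc_inf \<subseteq> Domain (op_B2 C)" using op_B2_test_function[OF c] by blast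
  show "Cc_inf \<noteq> ({} :: (real^'n \<Rightarrow> complex) set)" using Cc_inf_0 by blast
  show "(\<lambda>x. a * u x + v x) \<in> Cc_inf" if "u \<in> Cc_inf" "v \<in> Cc_inf" for u v :: "real^'n \<Rightarrow> complex" and a
    using that by (intro Cc_inf_add Cc_inf_cmult)
  fix p assume p: "p \<in> op_B2 C"
  obtain v w where vw: "p = (v, w)" by (cases p)
  have "\<exists>(v', g)\<in>op_B2 C. v' \<in> Cc_inf \<and> l2_norm (\<lambda>x. v x - v' x) + l2_norm (\<lambda>x. w x - g x) < \<epsilon>" if e: "\<epsilon> > 0" for \<epsilon>
  proof -
    obtain u where u: "u \<in> Cc_inf" "l2_norm (\<lambda>x. v x - u x) < \<epsilon> / 2" "l2_norm (\<lambda>x. w x - ell (entry C) u x) < \<epsilon> / 2"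
      using op_B2_approx[of v w "\<epsilon> / 2"] p e unfolding vw by auto
    then show ?thesis
      by (intro bexI[of _ "(u, ell (entry C) u)"] op_B2_test_function c) auto
  qed
  then show "case p of (u, f) \<Rightarrow> \<forall>\<epsilon>>0. \<exists>(v, g)\<in>op_B2 C. v \<in> Cc_inf \<and> l2_norm (\<lambda>x. u x - v x) + l2_norm (\<lambda>x. f x - g x) < \<epsilon>"
    unfolding vw by simp
qed

end

theorem theorem6p8:
  fixes C :: "real^'n::finite \<Rightarrow> complex^'n^'n" and \<theta> :: real
  assumes "0 \<le> \<theta>" and "\<theta> < pi/2"
    and "\<And>k l. (\<lambda>x. C x $ k $ l) \<in> W2inf"
    and "takes_values_in_sector C \<theta>"
    and "hyp_i C \<or> hyp_ii C \<theta> \<or> hyp_iii C"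
  shows "op_A C = op_B2 C \<and> op_B2 C = op_Z C \<and> is_core Cc_inf (op_A C)"
proof -
  have "\<forall>k l. \<exists>K. reg K (entry C k l)" using W2inf_reg[OF assms(3)] by blast
  then obtain Kf where Kf: "\<And>k l. reg (Kf k l) (entry C k l)" by metis
  \<comment> \<open>One constant for all entries: the individual ones are nonnegative, so each is at
    most their sum.\<close>
  define K where "K = (\<Sum>k\<in>UNIV. \<Sum>l\<in>UNIV. Kf k l)"
  have reg: "reg K (entry C k l)" for k l
  proof (rule reg_mono[OF Kf])
    have nn: "0 \<le> Kf k l" for k l by (rule regD(8)[OF Kf])
    have "Kf k l \<le> (\<Sum>l\<in>UNIV. Kf k l)" by (rule member_le_sum) (auto intro: nn)
    also have "\<dots> \<le> K" unfolding K_def by (rule member_le_sum) (auto intro: nn sum_nonneg)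
    finally show "Kf k l \<le> K" .
  qed
  have c: "C1 (entry C k l)" for k l by (rule regD(1)[OF reg])
  have reg': "reg K (adj (entry C) k l)" for k l by (rule reg_adj[OF reg])
  define t where "t = 1 / cos \<theta>"
  have t: "t > 0" using assms(1,2) by (simp add: t_def cos_gt_zero_pi)
  have acc: "accretive t (entry C)" unfolding t_def by (rule sector_accretive[OF assms(4,1,2)])
  have gc: "grad_coercive (entry C)"
    using assms(5) hyp_i_grad_coercive[OF c acc t] hyp_ii_grad_coercive[OF reg acc t assms(1,2)] hyp_iii_grad_coercive[OF reg acc t]
    by blast
  obtain \<kappa> where \<kappa>: "\<And>u. u \<in> Cc_inf \<Longrightarrow> - \<kappa> * grad_sq u \<le> Re (l2_inner (ell (entry C) u) (\<lambda>x. - lap u x))"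
    using gradient_accretive[OF reg gc] by blast
  obtain \<kappa>' where \<kappa>': "\<And>u. u \<in> Cc_inf \<Longrightarrow> - \<kappa>' * grad_sq u \<le> Re (l2_inner (ell (adj (entry C)) u) (\<lambda>x. - lap u x))"
    using gradient_accretive[OF reg' grad_coercive_adj[OF reg gc]] by blast
  \<comment> \<open>Large enough for the operator and its adjoint at once; the lower bound
    \<open>1\<close> lets the density argument pass from \<open>\<mu>\<close> times a squared norm
    to the squared norm itself.\<close>
  define \<mu> where "\<mu> = max 1 (max \<kappa> \<kappa>')"
  have \<mu>: "\<mu> \<ge> \<kappa>" "\<mu> \<ge> \<kappa>'" "\<mu> \<ge> 1" "\<mu> > 0" by (auto simp: \<mu>_def)
  note dense = shifted_range_dense[OF reg acc t \<kappa> \<mu>(1,3)]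
    shifted_range_dense[OF reg' accretive_adj[OF acc] t \<kappa>' \<mu>(2,3)]
  show ?thesis
    using operators_equal[OF c acc t \<mu>(4) dense] Cc_inf_is_core[OF c acc t \<mu>(4) dense] by simp
qed

end
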